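(* Let $\mu$ be a symmetric Lévy measure on $\mathbb{R}$ and $m:\mathbb{R}\times\mathbb{R}\to\mathbb{R}$ a Borel measurable function such that: (A1) there exists $\beta>1$ such that $q^U(\xi)\le \beta q^L(\xi)$ for all sufficiently large $|\xi|$; (A2) $m(x,u)\ge 0$ and $m(x,-u)=m(x,u)$ for all $x,u\in\mathbb{R}$; (A3) there exist $c,\epsilon>0$ such that $\sup_x m(x,u)\le c(1\wedge|u|^\epsilon)$ for all $u$, where $\epsilon$ is small enough that $\int_{\mathbb{R}}(|u|^\epsilon\wedge 1)\,\mu(du)=\infty$. Let $p_t(x,y)=p_t^0(x,y)+(p^0\star\Psi)_t(x,y)$ be the function given by the parametrix construction. Then: 1. There exist constants $c_1,c_2>0$ such that $$c_1\rho_t\le p_t(x,x)\le c_2\rho_t,\qquad t\in(0,1],\ x\in\mathbb{R}.$$ 2. There exist constants $d_3,d_4>0$ such that, with $f_{low}(x)=d_3(1-d_4|x|)_+$, $$p_t(x,y)\ge\rho_tf_{low}((x-y)\rho_t),\qquad t\in(0,1],\ x,y\in\mathbb{R}.$$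
   Context: A Lévy measure $\mu$ on $\mathbb{R}$ satisfies $\mu(\{0\})=0$ and $\int_{\mathbb{R}}(1\wedge u^2)\,\mu(du)<\infty$; symmetric means invariant under $u\mapsto -u$. Notation: $a\wedge b=\min(a,b)$, $a_+=\max(a,0)$. $q(\xi)=\int_{\mathbb{R}}(1-\cos(\xi u))\,\mu(du)$, $\quad q^U(\xi)=\int_{\mathbb{R}}((\xi u)^2\wedge1)\,\mu(du)$, $\quad q^L(\xi)=\int_{|u\xi|\le1}(\xi u)^2\,\mu(du)$. The function $q^U$ is continuous and nondecreasing on $[0,\infty)$, and under (A1) it is strictly increasing on some $[a,\infty)$ and unbounded. Put $\rho_t=(q^U)^{-1}(1/t)$, $t\in(0,1]$, i.e. $\rho_t>0$ solves $q^U(\rho_t)=1/t$ (the largest solution, should there be several). Under (A1), $p_t(x)=\frac1{2\pi}\int_{\mathbb{R}}e^{-ix\xi-tq(\xi)}\,d\xi$ is the transition density of the Lévy process with characteristic exponent $q$, and $p_t^0(x,y):=p_t(y-x)$ (the one-argument function $p_t(\cdot)$ is distinct from $p_t(x,y)$). Perturbation operator: $\mathfrak{L}(x,D)f(x)=\int_{\mathbb{R}}(f(x+u)-f(x))\,m(x,u)\,\mu(du)$; integrals of this kind against kernels symmetric in $u$ are understood in the symmetric (principal value) sense, i.e. as $\frac12\int(f(x+u)+f(x-u)-2f(x))\,m(x,u)\,\mu(du)$. Put $\Phi_t(x,y)=\mathfrak{L}(x,D)p_t^0(x,y)$ (acting in $x$). Space-time convolution: $(f\star g)_t(x,y)=\int_0^t\int_{\mathbb{R}}f_{t-\tau}(x,z)\,g_\tau(z,y)\,dz\,d\tau$;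 $\Phi^{\star1}=\Phi$, $\Phi^{\star(k+1)}=\Phi^{\star k}\star\Phi$; $\Psi_t(x,y)=\sum_{k\ge1}\Phi_t^{\star k}(x,y)$; the convolutions are well defined and the series converges under (A1)-(A3). *)

theory Defs
  imports "HOL-Analysis.Analysis"
begin

definition symmetric_levy_measure :: "real measure \<Rightarrow> bool" where
  "symmetric_levy_measure \<mu> \<longleftrightarrow>
     sets \<mu> = sets borel \<and>
     emeasure \<mu> {0} = 0 \<and>
     (\<integral>\<^sup>+u. ennreal (min 1 (u\<^sup>2)) \<partial>\<mu>) < \<infinity> \<and>
     distr \<mu> borel uminus = \<mu>"

definition levy_q :: "real measure \<Rightarrow> real \<Rightarrow> real" where
  "levy_q \<mu> \<xi> = (\<integral>u. 1 - cos (\<xi> * u) \<partial>\<mu>)"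

definition levy_qU :: "real measure \<Rightarrow> real \<Rightarrow> real" where
  "levy_qU \<mu> \<xi> = (\<integral>u. min ((\<xi> * u)\<^sup>2) 1 \<partial>\<mu>)"

definition levy_qL :: "real measure \<Rightarrow> real \<Rightarrow> real" where
  "levy_qL \<mu> \<xi> = set_lebesgue_integral \<mu> {u. \<bar>u * \<xi>\<bar> \<le> 1} (\<lambda>u. (\<xi> * u)\<^sup>2)"

definition levy_rho :: "real measure \<Rightarrow> real \<Rightarrow> real" where
  "levy_rho \<mu> t = (GREATEST r. r > 0 \<and> levy_qU \<mu> r = 1 / t)"

text \<open>The Fourier integral is real because \<^const>\<open>levy_q\<close> is even; \<^const>\<open>Re\<close> only adjusts the type.\<close>

definition levy_density :: "real measure \<Rightarrow> real \<Rightarrow> real \<Rightarrow> real" where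
  "levy_density \<mu> t x =
     Re (1 / (2 * of_real pi) *
         (\<integral>\<xi>. exp (- \<i> * of_real (x * \<xi>) - of_real (t * levy_q \<mu> \<xi>)) \<partial>lborel))"

text \<open>Kernels \<open>f\<^sub>t(x, y)\<close> are functions \<open>f t x y\<close>.\<close>

type_synonym kernel = "real \<Rightarrow> real \<Rightarrow> real \<Rightarrow> real"

definition p0 :: "real measure \<Rightarrow> kernel" where
  "p0 \<mu> t x y = levy_density \<mu> t (y - x)"

text \<open>The operator \<open>f \<mapsto> \<integral> (f (x + u) - f x) m(x, u) \<mu>(du)\<close> in the symmetric (principal value) sense,
  for \<open>m(x, \<cdot>)\<close> and \<open>\<mu>\<close> symmetric.\<close>

definition perturb_op :: "real measure \<Rightarrow> (real \<Rightarrow> real \<Rightarrow> real) \<Rightarrow> (real \<Rightarrow> real) \<Rightarrow> real \<Rightarrow> real" where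
  "perturb_op \<mu> m f x = 1 / 2 * (\<integral>u. (f (x + u) + f (x - u) - 2 * f x) * m x u \<partial>\<mu>)"

definition Phi :: "real measure \<Rightarrow> (real \<Rightarrow> real \<Rightarrow> real) \<Rightarrow> kernel" where
  "Phi \<mu> m t x y = perturb_op \<mu> m (\<lambda>x'. p0 \<mu> t x' y) x"

definition star :: "kernel \<Rightarrow> kernel \<Rightarrow> kernel" where
  "star f g t x y =
     set_lebesgue_integral lborel {0<..<t} (\<lambda>\<tau>. \<integral>z. f (t - \<tau>) x z * g \<tau> z y \<partial>lborel)"

text \<open>The index is shifted: \<open>star_iter F k\<close> is the \<open>(k + 1)\<close>-fold convolution power of \<open>F\<close>.\<close>

primrec star_iter :: "kernel \<Rightarrow> nat \<Rightarrow> kernel" where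
  "star_iter F 0 = F"
| "star_iter F (Suc k) = star (star_iter F k) F"

definition Psi :: "real measure \<Rightarrow> (real \<Rightarrow> real \<Rightarrow> real) \<Rightarrow> kernel" where
  "Psi \<mu> m t x y = (\<Sum>k. star_iter (Phi \<mu> m) k t x y)"

definition parametrix :: "real measure \<Rightarrow> (real \<Rightarrow> real \<Rightarrow> real) \<Rightarrow> kernel" where
  "parametrix \<mu> m t x y = p0 \<mu> t x y + star (p0 \<mu>) (Psi \<mu> m) t x y"

definition f_low :: "real \<Rightarrow> real \<Rightarrow> real \<Rightarrow> real" where
  "f_low d\<^sub>3 d\<^sub>4 x = d\<^sub>3 * max (1 - d\<^sub>4 * \<bar>x\<bar>) 0"

end

theory Submission
  imports Defs "HOL-Probability.Probability"
begin

text \<open>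
The function \<open>P = parametrix \<mu> m\<close> solves the integral equation \<open>P = p\<^sup>0 + P \<star> \<Phi>\<close>, and both estimates
say that the perturbation term cannot destroy what is true of \<open>p\<^sup>0\<close> on the spatial scale \<open>1 / \<rho>\<^sub>t\<close>.

\<^emph>\<open>The unperturbed density.\<close> Comparability of \<open>q\<^sup>U\<close> and \<open>q\<^sup>L\<close> makes \<open>q\<^sup>U\<close> grow at least like a power, so that
\<open>exp (- t q(\<xi>))\<close> decays in \<open>\<xi> / \<rho>\<^sub>t\<close> faster than any power, uniformly in \<open>t\<close>. Hence \<open>p\<^sub>t\<close> is bounded by a
multiple of \<open>\<rho>\<^sub>t\<close>, is at least a multiple of \<open>\<rho>\<^sub>t\<close> near the origin, and its second difference with step \<open>u\<close>
is of order \<open>\<rho>\<^sub>t min ((\<rho>\<^sub>t u)\<^sup>2) 1\<close>. The same gain is needed in \<open>L\<^sup>1\<close>, where the large jumps are an obstacle: they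
make the symbol too rough for integration by parts. Splitting \<open>\<mu>\<close> at \<open>\<bar>u\<bar> = 1 / \<rho>\<^sub>t\<close> removes it. The small jumps
have a symbol with controlled second differences (\<open>small_jumps_transform\<close>), and the large jumps contribute a compound
Poisson factor, which never increases an \<open>L\<^sup>1\<close> norm (\<open>cos_transform_compound_L1\<close>).

\<^emph>\<open>Upper bound.\<close> Integrated against \<open>m(x, u) \<le> c min 1 \<bar>u\<bar>\<^sup>\<epsilon>\<close>, these bounds show that \<open>\<Phi>\<^sub>t\<close> is at most
\<open>\<rho>\<^sub>t\<close> times an integrable power \<open>t\<^sup>\<delta>\<^sup>-\<^sup>1\<close>, with \<open>L\<^sup>1\<close> norms in each variable of order \<open>t\<^sup>\<delta>\<^sup>-\<^sup>1\<close>
(\<open>jump_moment_bound\<close>, \<open>Phi_bounds\<close>). Kernels with such a pair of bounds are closed under \<open>\<star>\<close>, because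
\<open>\<rho>\<^sub>t\<^sub>/\<^sub>2\<close> is comparable with \<open>\<rho>\<^sub>t\<close>. With the weight \<open>exp (k t)\<close> and \<open>k\<close> large, \<open>f \<mapsto> f \<star> \<Phi>\<close> is a
contraction (\<open>star_contraction\<close>). This gives convergence of the series \<open>\<Psi>\<close>, the integral equation
(\<open>perturbation_equation\<close>), and the bound of \<open>P\<close> by a multiple of \<open>\<rho>\<^sub>t\<close>.

\<^emph>\<open>Lower bound.\<close> The contraction also shows \<open>\<bar>P - p\<^sup>0\<bar> \<le> K c \<rho>\<^sub>t\<close>, linearly in the size \<open>c\<close> of the jump rate
(\<open>parametrix_near_p0\<close>). For a small rate the lower bound of \<open>p\<^sup>0\<close> is therefore inherited for all \<open>t \<le> 1\<close>, not only
for short times. A general rate becomes small after restriction to \<open>\<bar>u\<bar> \<le> s\<close>, at the cost of half of the exponent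
\<open>\<epsilon>\<close> (\<open>jump_rate_small\<close>). The jumps longer than \<open>s\<close> have a bounded total rate \<open>L\<close>, and restoring them lowers the
density at most by the factor \<open>exp (- L t)\<close>: multiplication of a solution by \<open>exp (L t)\<close> turns \<open>\<Phi>\<close> into
\<open>\<Phi> + L p\<^sup>0\<close> (\<open>exponential_tilting\<close>, a consequence of Chapman-Kolmogorov), which is nonnegative once \<open>L\<close>
dominates the total rate, and for nonnegative kernels a larger kernel has a larger solution (\<open>comparison\<close>). The
tilting asks for a finite total rate, so the jumps shorter than \<open>1 / n\<close> are left out first;
\<open>n \<rightarrow> \<infinity>\<close> is possible because the solution depends continuously on the rate (\<open>parametrix_continuity\<close>).
\<close>

section \<open>Absolute integrability and elementary inequalities\<close>

lemma ennreal_norm_integral_le: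
  fixes f :: "'a \<Rightarrow> real"
  shows "ennreal \<bar>integral\<^sup>L M f\<bar> \<le> (\<integral>\<^sup>+x. ennreal \<bar>f x\<bar> \<partial>M)"
proof (cases "integrable M f")
  case True
  then show ?thesis using integral_norm_bound_ennreal[OF True] by simp
next
  case False
  then show ?thesis by (simp add: not_integrable_integral_eq)
qed

lemma fubini_absolute:
  fixes f :: "'a \<Rightarrow> 'b \<Rightarrow> real"
  assumes "sigma_finite_measure M" "sigma_finite_measure N"
    and meas[measurable]: "(\<lambda>(x, y). f x y) \<in> borel_measurable (M \<Otimes>\<^sub>M N)"
    and fin: "(\<integral>\<^sup>+x. \<integral>\<^sup>+y. ennreal \<bar>f x y\<bar> \<partial>N \<partial>M) < \<infinity>"
  shows "integrable (M \<Otimes>\<^sub>M N) (\<lambda>(x, y). f x y)"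
    and "(\<integral>x. \<integral>y. f x y \<partial>N \<partial>M) = (\<integral>(x, y). f x y \<partial>(M \<Otimes>\<^sub>M N))"
    and "(\<integral>x. \<integral>y. f x y \<partial>N \<partial>M) = (\<integral>y. \<integral>x. f x y \<partial>M \<partial>N)"
    and "integrable M (\<lambda>x. \<integral>y. f x y \<partial>N)"
    and "integrable N (\<lambda>y. \<integral>x. f x y \<partial>M)"
    and "AE x in M. integrable N (\<lambda>y. f x y)"
proof -
  interpret M: sigma_finite_measure M by fact
  interpret N: sigma_finite_measure N by fact
  interpret pair_sigma_finite M N ..
  have "(\<integral>\<^sup>+p. ennreal (norm (case p of (x, y) \<Rightarrow> f x y)) \<partial>(M \<Otimes>\<^sub>M N))
      = (\<integral>\<^sup>+x. \<integral>\<^sup>+y. ennreal \<bar>f x y\<bar> \<partial>N \<partial>M)"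
    by (subst N.nn_integral_fst[symmetric]) (auto simp: case_prod_beta)
  then show I: "integrable (M \<Otimes>\<^sub>M N) (\<lambda>(x, y). f x y)"
    using fin by (intro integrableI_bounded) auto
  show E: "(\<integral>x. \<integral>y. f x y \<partial>N \<partial>M) = (\<integral>(x, y). f x y \<partial>(M \<Otimes>\<^sub>M N))"
    using integral_fst'[OF I] by simp
  show "(\<integral>x. \<integral>y. f x y \<partial>N \<partial>M) = (\<integral>y. \<integral>x. f x y \<partial>M \<partial>N)"
    using Fubini_integral[OF I] by simp
  show "integrable M (\<lambda>x. \<integral>y. f x y \<partial>N)"
    using integrable_fst'[OF I] by simp
  show "integrable N (\<lambda>y. \<integral>x. f x y \<partial>M)"
    using integrable_snd[OF I] by simp
  show "AE x in M. integrable N (\<lambda>y. f x y)"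
    using AE_integrable_fst'[OF I] by simp
qed

lemma one_minus_cos_le: "1 - cos (y::real) \<le> y\<^sup>2 / 2"
proof -
  have "1 - cos y = 2 * (sin (y / 2))\<^sup>2" using cos_double_sin[of "y / 2"] by simp
  also have "\<dots> \<le> 2 * (y / 2)\<^sup>2"
    using abs_sin_x_le_abs_x[of "y / 2"] by (intro mult_left_mono) (auto simp: abs_le_square_iff[symmetric])
  finally show ?thesis by (simp add: power_divide)
qed

lemma one_minus_cos_le_min: "1 - cos (y::real) \<le> 2 * min (y\<^sup>2) 1"
proof (cases "y\<^sup>2 \<le> 1")
  case True
  then show ?thesis using one_minus_cos_le[of y] zero_le_power2[of y] by (simp only: min_absorb1)
next
  case False
  then show ?thesis using cos_ge_minus_one[of y] by (simp add: min_absorb2)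
qed

lemma abs_one_minus_cos: "\<bar>1 - cos (y::real)\<bar> = 1 - cos y"
  by (simp add: abs_of_nonneg)

lemma one_minus_cos_ge: "\<bar>y\<bar> \<le> 1 \<Longrightarrow> y\<^sup>2 / 4 \<le> 1 - cos (y::real)"
proof -
  assume "\<bar>y\<bar> \<le> 1"
  then have y2: "y\<^sup>2 \<le> 1" by (simp add: abs_square_le_1)
  obtain s where "cos y = (\<Sum>m<4. cos_coeff m * y ^ m) + cos (s + 1/2 * real 4 * pi) / fact 4 * y ^ 4"
    using Maclaurin_cos_expansion[of y 4] by auto
  moreover have "(\<Sum>m<4. cos_coeff m * y ^ m) = 1 - y\<^sup>2 / 2"
  proof -
    have "{..<4} = {0, 1, 2, 3::nat}" by auto
    then show ?thesis by (simp add: cos_coeff_def)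
  qed
  moreover have "cos (s + 1/2 * real 4 * pi) / fact 4 * y ^ 4 \<le> 1 / fact 4 * y ^ 4"
    by (intro mult_right_mono divide_right_mono) auto
  moreover have "1 / fact 4 * y ^ 4 \<le> y\<^sup>2 / 24"
  proof -
    have "y ^ 4 = y\<^sup>2 * y\<^sup>2" by (simp add: power2_eq_square power4_eq_xxxx)
    also have "\<dots> \<le> 1 * y\<^sup>2" using y2 by (intro mult_right_mono) auto
    finally show ?thesis by (simp add: fact_numeral)
  qed
  moreover have "0 \<le> y\<^sup>2" by simp
  ultimately show ?thesis by linarith
qed

section \<open>Symmetric Levy measures and their truncated second moments\<close>

locale symmetric_levy =
  fixes \<mu> :: "real measure"
  assumes levy: "symmetric_levy_measure \<mu>"
begin

lemma sets_mu [measurable_cong, simp]: "sets \<mu> = sets borel"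
  using levy by (simp add: symmetric_levy_measure_def)

lemma space_mu [simp]: "space \<mu> = UNIV"
  using sets_eq_imp_space_eq[OF sets_mu] by simp

lemma integrable_min_square: "integrable \<mu> (\<lambda>u. min 1 (u\<^sup>2))"
  using levy by (intro integrableI_bounded) (auto simp: symmetric_levy_measure_def)

lemma integrable_by_min_square:
  assumes [measurable]: "f \<in> borel_measurable borel" and "\<And>u. \<bar>f u\<bar> \<le> C * min 1 (u\<^sup>2)"
  shows "integrable \<mu> (f :: real \<Rightarrow> real)"
proof (rule Bochner_Integration.integrable_bound[where f = "\<lambda>u. C * min 1 (u\<^sup>2)"])
  show "integrable \<mu> (\<lambda>u. C * min 1 (u\<^sup>2))" using integrable_min_square by simp
  show "f \<in> borel_measurable \<mu>" by measurable
  have "\<bar>f u\<bar> \<le> \<bar>C * min 1 (u\<^sup>2)\<bar>" for u using assms(2)[of u] by linarith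
  then show "AE u in \<mu>. norm (f u) \<le> norm (C * min 1 (u\<^sup>2))" by simp
qed

lemma emeasure_away_finite:
  assumes "r > 0" shows "emeasure \<mu> {u. r \<le> \<bar>u\<bar>} < \<infinity>"
proof -
  have "integrable \<mu> (indicator {u. r \<le> \<bar>u\<bar>} :: real \<Rightarrow> real)"
  proof (rule integrable_by_min_square[where C = "1 / min 1 (r\<^sup>2)"])
    fix u :: real
    have "r\<^sup>2 \<le> u\<^sup>2" if "r \<le> \<bar>u\<bar>" using that assms by (metis abs_le_square_iff abs_of_pos)
    then show "\<bar>indicator {u. r \<le> \<bar>u\<bar>} u :: real\<bar> \<le> 1 / min 1 (r\<^sup>2) * min 1 (u\<^sup>2)"
      using assms by (auto simp: indicator_def field_simps min_def)
  qed simp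
  then show ?thesis by (simp add: integrable_indicator_iff)
qed

lemma sigma_finite_mu: "sigma_finite_measure \<mu>"
proof
  let ?A = "insert {0} (range (\<lambda>n::nat. {u::real. 1 / real (Suc n) \<le> \<bar>u\<bar>}))"
  have "u \<in> \<Union>?A" for u :: real
  proof (cases "u = 0")
    case False
    then obtain n where "1 / real (Suc n) < \<bar>u\<bar>"
      using reals_Archimedean[of "\<bar>u\<bar>"] by (auto simp: inverse_eq_divide)
    then show ?thesis by (auto intro!: exI[of _ n])
  qed simp
  moreover have "emeasure \<mu> {0} = 0" using levy by (simp add: symmetric_levy_measure_def)
  ultimately show "\<exists>A. countable A \<and> A \<subseteq> sets \<mu> \<and> \<Union>A = space \<mu> \<and> (\<forall>a\<in>A. emeasure \<mu> a \<noteq> \<infinity>)"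
    using emeasure_away_finite by (intro exI[of _ ?A]) (auto simp: less_top intro: less_imp_neq)
qed

lemma min_scale_le: "min ((\<xi> * u)\<^sup>2) 1 \<le> max 1 (\<xi>\<^sup>2) * min 1 ((u::real)\<^sup>2)"
proof (cases "u\<^sup>2 \<le> 1")
  case True
  have "(\<xi> * u)\<^sup>2 \<le> max 1 (\<xi>\<^sup>2) * u\<^sup>2"
    by (auto simp: power_mult_distrib intro!: mult_right_mono)
  then show ?thesis using True by (auto simp: min_def)
qed (auto simp: min_def)

lemma integrable_qU: "integrable \<mu> (\<lambda>u. min ((\<xi> * u)\<^sup>2) 1)"
  by (rule integrable_by_min_square[where C = "max 1 (\<xi>\<^sup>2)"]) (use min_scale_le in auto)

lemma integrable_q: "integrable \<mu> (\<lambda>u. 1 - cos (\<xi> * u))"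
proof (rule integrable_by_min_square[where C = "2 * max 1 (\<xi>\<^sup>2)"])
  show "\<bar>1 - cos (\<xi> * u)\<bar> \<le> 2 * max 1 (\<xi>\<^sup>2) * min 1 (u\<^sup>2)" for u
    using one_minus_cos_le_min[of "\<xi> * u"] min_scale_le[of \<xi> u] unfolding abs_one_minus_cos by linarith
qed simp

lemma continuous_parameter_integral:
  fixes f :: "real \<Rightarrow> real \<Rightarrow> real"
  assumes [measurable]: "\<And>\<xi>. f \<xi> \<in> borel_measurable borel"
    and cont: "\<And>u. continuous_on UNIV (\<lambda>\<xi>. f \<xi> u)"
    and bound: "\<And>\<xi> u. \<bar>f \<xi> u\<bar> \<le> C * (max 1 (\<xi>\<^sup>2) * min 1 (u\<^sup>2))" and "C \<ge> 0"
  shows "continuous_on UNIV (\<lambda>\<xi>. \<integral>u. f \<xi> u \<partial>\<mu>)"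
proof (rule continuous_on_sequentiallyI)
  fix X :: "nat \<Rightarrow> real" and a assume X: "X \<longlonglongrightarrow> a"
  then obtain K where K: "\<And>n. \<bar>X n\<bar> \<le> K"
    by (metis Bseq_def convergentI convergent_imp_Bseq real_norm_def)
  have sq: "(X n)\<^sup>2 \<le> K\<^sup>2" for n using K[of n] by (metis abs_ge_zero abs_le_square_iff abs_of_nonneg order_trans)
  show "(\<lambda>n. \<integral>u. f (X n) u \<partial>\<mu>) \<longlonglongrightarrow> (\<integral>u. f a u \<partial>\<mu>)"
  proof (rule integral_dominated_convergence[where w = "\<lambda>u. C * (max 1 (K\<^sup>2) * min 1 (u\<^sup>2))"])
    show "integrable \<mu> (\<lambda>u. C * (max 1 (K\<^sup>2) * min 1 (u\<^sup>2)))"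
      using integrable_min_square by simp
    have "(\<lambda>n. f (X n) u) \<longlonglongrightarrow> f a u" for u
      using cont[of u] X by (auto simp: continuous_on_eq_continuous_at intro: isCont_tendsto_compose)
    then show "AE u in \<mu>. (\<lambda>n. f (X n) u) \<longlonglongrightarrow> f a u" by simp
    have "\<bar>f (X n) u\<bar> \<le> C * (max 1 (K\<^sup>2) * min 1 (u\<^sup>2))" for n u
    proof -
      have "C * (max 1 ((X n)\<^sup>2) * min 1 (u\<^sup>2)) \<le> C * (max 1 (K\<^sup>2) * min 1 (u\<^sup>2))"
        using sq[of n] \<open>C \<ge> 0\<close> by (intro mult_left_mono mult_right_mono) auto
      then show ?thesis using bound[of "X n" u] by linarith
    qed
    then show "AE u in \<mu>. norm (f (X n) u) \<le> C * (max 1 (K\<^sup>2) * min 1 (u\<^sup>2))" for n by simp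
  qed measurable
qed

lemma continuous_qU: "continuous_on UNIV (levy_qU \<mu>)"
  unfolding levy_qU_def
  by (rule continuous_parameter_integral[where C = 1]) (use min_scale_le in \<open>auto intro!: continuous_intros\<close>)

lemma continuous_q: "continuous_on UNIV (levy_q \<mu>)"
  unfolding levy_q_def
proof (rule continuous_parameter_integral[where C = 2])
  show "\<bar>1 - cos (\<xi> * u)\<bar> \<le> 2 * (max 1 (\<xi>\<^sup>2) * min 1 (u\<^sup>2))" for \<xi> u :: real
    using one_minus_cos_le_min[of "\<xi> * u"] min_scale_le[of \<xi> u] unfolding abs_one_minus_cos by linarith
qed (auto intro!: continuous_intros)

lemma measurable_q [measurable]: "levy_q \<mu> \<in> borel_measurable borel"
  using continuous_q by (rule borel_measurable_continuous_onI)

lemma qU_mono_abs: "\<bar>a\<bar> \<le> \<bar>b\<bar> \<Longrightarrow> levy_qU \<mu> a \<le> levy_qU \<mu> b"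
  unfolding levy_qU_def
proof (rule integral_mono[OF integrable_qU integrable_qU])
  fix u assume "\<bar>a\<bar> \<le> \<bar>b\<bar>"
  then have "(a * u)\<^sup>2 \<le> (b * u)\<^sup>2"
    by (simp add: abs_le_square_iff[symmetric] abs_mult mult_right_mono)
  then show "min ((a * u)\<^sup>2) 1 \<le> min ((b * u)\<^sup>2) 1" by auto
qed

lemma qU_scale_le: "\<bar>k\<bar> \<ge> 1 \<Longrightarrow> levy_qU \<mu> (k * \<xi>) \<le> k\<^sup>2 * levy_qU \<mu> \<xi>"
  unfolding levy_qU_def
proof (subst integral_mult_right_zero[symmetric], rule integral_mono)
  show "integrable \<mu> (\<lambda>u. min ((k * \<xi> * u)\<^sup>2) 1)" by (rule integrable_qU)
  show "integrable \<mu> (\<lambda>u. k\<^sup>2 * min ((\<xi> * u)\<^sup>2) 1)" using integrable_qU by simp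
  fix u assume "\<bar>k\<bar> \<ge> 1"
  then have "1 \<le> k\<^sup>2" by (metis abs_square_le_1 abs_le_square_iff abs_one one_power2)
  then show "min ((k * \<xi> * u)\<^sup>2) 1 \<le> k\<^sup>2 * min ((\<xi> * u)\<^sup>2) 1"
    by (auto simp: min_def power_mult_distrib mult.assoc)
qed

lemma qU_nonneg: "0 \<le> levy_qU \<mu> \<xi>"
  unfolding levy_qU_def by (rule integral_nonneg_AE) auto

lemma q_nonneg: "0 \<le> levy_q \<mu> \<xi>"
  unfolding levy_q_def by (rule integral_nonneg_AE) auto

lemma q_even: "levy_q \<mu> (- \<xi>) = levy_q \<mu> \<xi>"
  unfolding levy_q_def by simp

lemma q_le_qU: "levy_q \<mu> \<xi> \<le> 2 * levy_qU \<mu> \<xi>"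
  unfolding levy_q_def levy_qU_def
  by (subst integral_mult_right_zero[symmetric], rule integral_mono)
     (use one_minus_cos_le_min integrable_q integrable_qU in auto)

lemma integrable_qL: "integrable \<mu> (\<lambda>u. indicator {u. \<bar>u * \<xi>\<bar> \<le> 1} u * (\<xi> * u)\<^sup>2)"
proof (rule Bochner_Integration.integrable_bound[OF integrable_qU[of \<xi>]])
  have "indicator {u. \<bar>u * \<xi>\<bar> \<le> 1} u * (\<xi> * u)\<^sup>2 \<le> min ((\<xi> * u)\<^sup>2) 1" for u
    by (auto simp: indicator_def abs_square_le_1 mult.commute)
  then show "AE u in \<mu>. norm (indicator {u. \<bar>u * \<xi>\<bar> \<le> 1} u * (\<xi> * u)\<^sup>2) \<le> norm (min ((\<xi> * u)\<^sup>2) 1)"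
    by simp
qed measurable

lemma qL_eq: "levy_qL \<mu> \<xi> = (\<integral>u. indicator {u. \<bar>u * \<xi>\<bar> \<le> 1} u * (\<xi> * u)\<^sup>2 \<partial>\<mu>)"
  unfolding levy_qL_def set_lebesgue_integral_def by simp

lemma qL_le_q: "levy_qL \<mu> \<xi> \<le> 4 * levy_q \<mu> \<xi>"
  unfolding qL_eq levy_q_def
proof (subst integral_mult_right_zero[symmetric], rule integral_mono[OF integrable_qL])
  show "integrable \<mu> (\<lambda>u. 4 * (1 - cos (\<xi> * u)))" by (intro integrable_mult_right integrable_q)
  show "indicator {u. \<bar>u * \<xi>\<bar> \<le> 1} u * (\<xi> * u)\<^sup>2 \<le> 4 * (1 - cos (\<xi> * u))" for u
    using one_minus_cos_ge[of "\<xi> * u"] by (auto simp: indicator_def mult.commute)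
qed

text \<open>Where \<open>\<bar>2 \<xi> u\<bar> \<le> 1\<close> the truncation at \<open>1\<close> is inactive for both arguments and the integrand quadruples; three
quarters of \<open>q\<^sup>L(2 \<xi>)\<close> is thus pure increase.\<close>

lemma qU_double_ge_qL: "levy_qU \<mu> \<xi> + 3 / 4 * levy_qL \<mu> (2 * \<xi>) \<le> levy_qU \<mu> (2 * \<xi>)"
proof -
  have "levy_qU \<mu> \<xi> + 3 / 4 * levy_qL \<mu> (2 * \<xi>)
      = (\<integral>u. min ((\<xi> * u)\<^sup>2) 1 + 3 / 4 * (indicator {u. \<bar>u * (2 * \<xi>)\<bar> \<le> 1} u * (2 * \<xi> * u)\<^sup>2) \<partial>\<mu>)"
    unfolding levy_qU_def qL_eq using integrable_qU integrable_qL by simp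
  also have "\<dots> \<le> levy_qU \<mu> (2 * \<xi>)"
    unfolding levy_qU_def
  proof (rule integral_mono)
    show "integrable \<mu> (\<lambda>u. min ((\<xi> * u)\<^sup>2) 1 + 3 / 4 * (indicator {u. \<bar>u * (2 * \<xi>)\<bar> \<le> 1} u * (2 * \<xi> * u)\<^sup>2))"
      using integrable_qU integrable_qL by simp
    show "integrable \<mu> (\<lambda>u. min ((2 * \<xi> * u)\<^sup>2) 1)" by (rule integrable_qU)
    fix u
    have e: "(2 * \<xi> * u)\<^sup>2 = 4 * (\<xi> * u)\<^sup>2" by (simp add: power_mult_distrib)
    have "\<bar>u * (2 * \<xi>)\<bar> \<le> 1 \<longleftrightarrow> (2 * \<xi> * u)\<^sup>2 \<le> 1" by (simp add: abs_square_le_1 mult.commute)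
    then show "min ((\<xi> * u)\<^sup>2) 1 + 3 / 4 * (indicator {u. \<bar>u * (2 * \<xi>)\<bar> \<le> 1} u * (2 * \<xi> * u)\<^sup>2)
        \<le> min ((2 * \<xi> * u)\<^sup>2) 1"
      unfolding e by (auto simp: indicator_def min_def)
  qed
  finally show ?thesis .
qed

end

section \<open>Growth of the truncated moment and the scale \<open>\<rho>\<close>\<close>

text \<open>Infinite total mass makes \<open>q\<^sup>U\<close> unbounded, so that \<open>\<rho>\<^sub>t\<close> exists for every \<open>t > 0\<close>.\<close>

locale growing_levy = symmetric_levy +
  assumes comparable: "\<exists>\<beta>>1. \<forall>\<^sub>F \<xi> in at_infinity. levy_qU \<mu> \<xi> \<le> \<beta> * levy_qL \<mu> \<xi>"
    and infinite_mass: "emeasure \<mu> UNIV = \<infinity>"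
begin

lemma comparable_pos: "\<exists>\<beta>>1. \<exists>\<xi>\<^sub>0>0. \<forall>\<xi>. \<bar>\<xi>\<bar> \<ge> \<xi>\<^sub>0 \<longrightarrow> levy_qU \<mu> \<xi> \<le> \<beta> * levy_qL \<mu> \<xi>"
proof -
  obtain \<beta> where b: "\<beta> > 1" "\<forall>\<^sub>F \<xi> in at_infinity. levy_qU \<mu> \<xi> \<le> \<beta> * levy_qL \<mu> \<xi>"
    using comparable by blast
  then obtain b0 where "\<forall>\<xi>. b0 \<le> \<bar>\<xi>\<bar> \<longrightarrow> levy_qU \<mu> \<xi> \<le> \<beta> * levy_qL \<mu> \<xi>"
    by (auto simp: eventually_at_infinity)
  then show ?thesis using b(1)
    by (intro exI[of _ \<beta>] conjI exI[of _ "max b0 1"]) auto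
qed

lemma measure_away_le_qU:
  assumes "r > 0" shows "emeasure \<mu> {u. r \<le> \<bar>u\<bar>} \<le> ennreal (levy_qU \<mu> (1 / r))"
proof -
  have "emeasure \<mu> {u. r \<le> \<bar>u\<bar>} = (\<integral>\<^sup>+u. indicator {u. r \<le> \<bar>u\<bar>} u \<partial>\<mu>)" by simp
  also have "\<dots> \<le> (\<integral>\<^sup>+u. ennreal (min ((1 / r * u)\<^sup>2) 1) \<partial>\<mu>)"
  proof (rule nn_integral_mono)
    fix u :: real
    have "1 \<le> (1 / r * u)\<^sup>2" if "r \<le> \<bar>u\<bar>"
    proof -
      have "1 \<le> \<bar>1 / r * u\<bar>" using that assms by (simp add: abs_mult)
      then show ?thesis by (metis abs_le_square_iff abs_one one_power2)
    qed
    then show "indicator {u. r \<le> \<bar>u\<bar>} u \<le> ennreal (min ((1 / r * u)\<^sup>2) 1)"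
      by (auto simp: indicator_def min_def)
  qed
  also have "\<dots> = ennreal (levy_qU \<mu> (1 / r))"
    unfolding levy_qU_def by (rule nn_integral_eq_integral[OF integrable_qU]) auto
  finally show ?thesis .
qed

lemma qU_unbounded: "\<exists>\<xi>>0. B \<le> levy_qU \<mu> \<xi>"
proof (rule ccontr)
  assume "\<not> ?thesis"
  then have B: "levy_qU \<mu> \<xi> < B" if "\<xi> > 0" for \<xi> using that by (auto simp: not_le)
  let ?A = "\<lambda>n::nat. {u::real. 1 / real (Suc n) \<le> \<bar>u\<bar>}"
  have inc: "incseq ?A"
    by (rule incseq_SucI) (auto simp: field_simps intro: order_trans[rotated])
  have "emeasure \<mu> (?A n) \<le> ennreal B" for n
  proof -
    have "emeasure \<mu> (?A n) \<le> ennreal (levy_qU \<mu> (1 / (1 / real (Suc n))))"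
      by (rule measure_away_le_qU) simp
    also have "\<dots> \<le> ennreal B" using B[of "real (Suc n)"] by (intro ennreal_leI) simp
    finally show ?thesis .
  qed
  then have "(SUP n. emeasure \<mu> (?A n)) \<le> ennreal B" by (intro SUP_least)
  moreover have "(SUP n. emeasure \<mu> (?A n)) = emeasure \<mu> (\<Union>n. ?A n)"
    by (rule SUP_emeasure_incseq[OF _ inc]) auto
  moreover have "(\<Union>n. ?A n) = UNIV - {0}"
  proof -
    have "u \<in> (\<Union>n. ?A n)" if "u \<noteq> 0" for u
      using reals_Archimedean[of "\<bar>u\<bar>"] that by (auto simp: inverse_eq_divide intro: less_imp_le)
    then show ?thesis by auto
  qed
  moreover have "emeasure \<mu> (UNIV - {0}) = \<infinity>"
    using levy infinite_mass by (subst emeasure_Diff) (auto simp: symmetric_levy_measure_def)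
  ultimately show False by (simp add: top_unique)
qed

lemma qU_zero: "levy_qU \<mu> 0 = 0" by (simp add: levy_qU_def)

text \<open>By continuity \<open>q\<^sup>U\<close> takes the value \<open>1 / t\<close>, and by monotonicity its level set lies in a compact interval;
the set therefore has a largest element.\<close>

lemma rho_greatest:
  assumes "t > 0"
  shows "levy_rho \<mu> t > 0" "levy_qU \<mu> (levy_rho \<mu> t) = 1 / t"
    and "\<And>r. r > 0 \<Longrightarrow> levy_qU \<mu> r = 1 / t \<Longrightarrow> r \<le> levy_rho \<mu> t"
proof -
  obtain b where b: "b > 0" "1 / t + 1 \<le> levy_qU \<mu> b" using qU_unbounded by blast
  let ?S = "{0..b} \<inter> levy_qU \<mu> -` {1 / t}"
  have "closed (levy_qU \<mu> -` {1 / t})"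
    using continuous_closed_vimage[of "{1 / t}" "levy_qU \<mu>"] continuous_qU
    by (auto simp: continuous_on_eq_continuous_at)
  then have "compact ?S" by (intro compact_Int_closed) auto
  moreover have "?S \<noteq> {}"
  proof -
    have "\<exists>x. 0 \<le> x \<and> x \<le> b \<and> levy_qU \<mu> x = 1 / t"
      using assms b qU_zero continuous_qU
      by (intro IVT') (auto intro: continuous_on_subset)
    then show ?thesis by auto
  qed
  ultimately obtain s where s: "s \<in> ?S" "\<And>x. x \<in> ?S \<Longrightarrow> x \<le> s"
    using compact_attains_sup[of ?S] by (meson that)
  have s0: "s > 0" using s(1) assms qU_zero by (cases "s = 0") auto
  have max: "r \<le> s" if "r > 0 \<and> levy_qU \<mu> r = 1 / t" for r
  proof -
    have "r \<le> b"
    proof (rule ccontr)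
      assume "\<not> r \<le> b"
      then have "levy_qU \<mu> b \<le> levy_qU \<mu> r" using b by (intro qU_mono_abs) auto
      then show False using b that by auto
    qed
    then show ?thesis using that by (intro s(2)) auto
  qed
  have "levy_rho \<mu> t = s" unfolding levy_rho_def
    by (rule Greatest_equality) (use s(1) s0 max in auto)
  then show "levy_rho \<mu> t > 0" "levy_qU \<mu> (levy_rho \<mu> t) = 1 / t"
    "\<And>r. r > 0 \<Longrightarrow> levy_qU \<mu> r = 1 / t \<Longrightarrow> r \<le> levy_rho \<mu> t"
    using s(1) s0 max by auto
qed

lemma rho_antimono: "0 < t \<Longrightarrow> t \<le> s \<Longrightarrow> levy_rho \<mu> s \<le> levy_rho \<mu> t"
proof (cases "t = s")
  case False
  assume a: "0 < t" "t \<le> s"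
  show ?thesis
  proof (rule ccontr)
    assume "\<not> ?thesis"
    then have "levy_qU \<mu> (levy_rho \<mu> t) \<le> levy_qU \<mu> (levy_rho \<mu> s)"
      using rho_greatest(1)[OF a(1)] by (intro qU_mono_abs) auto
    then show False using a False by (simp add: rho_greatest field_simps)
  qed
qed simp

text \<open>Comparability makes \<open>q\<^sup>L(2 \<xi>)\<close> a fixed fraction of \<open>q\<^sup>U(2 \<xi>)\<close>, so doubling the argument adds at least a fixed
fraction of the new value.\<close>

lemma qU_doubling: "\<exists>\<gamma>>1. \<exists>\<xi>\<^sub>0>0. \<forall>\<xi>\<ge>\<xi>\<^sub>0. \<gamma> * levy_qU \<mu> \<xi> \<le> levy_qU \<mu> (2 * \<xi>)"
proof -
  obtain \<beta> \<xi>\<^sub>0 where b: "\<beta> > 1" "\<xi>\<^sub>0 > 0" "\<And>\<xi>. \<bar>\<xi>\<bar> \<ge> \<xi>\<^sub>0 \<Longrightarrow> levy_qU \<mu> \<xi> \<le> \<beta> * levy_qL \<mu> \<xi>"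
    using comparable_pos by blast
  have th: "0 < 1 - 3 / (4 * \<beta>)" "1 - 3 / (4 * \<beta>) < 1" using b(1) by (auto simp: field_simps)
  have "1 / (1 - 3 / (4 * \<beta>)) * levy_qU \<mu> \<xi> \<le> levy_qU \<mu> (2 * \<xi>)" if "\<xi> \<ge> \<xi>\<^sub>0" for \<xi>
  proof -
    have "levy_qU \<mu> (2 * \<xi>) \<le> \<beta> * levy_qL \<mu> (2 * \<xi>)" using b(2) that by (intro b(3)) auto
    then have "3 / (4 * \<beta>) * levy_qU \<mu> (2 * \<xi>) \<le> 3 / 4 * levy_qL \<mu> (2 * \<xi>)"
      using b(1) by (simp add: field_simps)
    then have "levy_qU \<mu> \<xi> \<le> (1 - 3 / (4 * \<beta>)) * levy_qU \<mu> (2 * \<xi>)"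
      using qU_double_ge_qL[of \<xi>] by (simp add: left_diff_distrib)
    then show ?thesis using th by (simp add: pos_divide_le_eq mult.commute)
  qed
  moreover have "1 / (1 - 3 / (4 * \<beta>)) > 1" using th by simp
  ultimately show ?thesis using b(2) by blast
qed

text \<open>Iterated doubling; the exponent is \<open>log 2 \<gamma>\<close>, and the factor \<open>1 / \<gamma>\<close> pays for rounding \<open>log 2 k\<close> down.\<close>

lemma qU_power_growth:
  "\<exists>\<alpha>>0. \<exists>c>0. \<exists>\<xi>\<^sub>0>0. \<forall>\<xi>\<ge>\<xi>\<^sub>0. \<forall>k\<ge>1. c * k powr \<alpha> * levy_qU \<mu> \<xi> \<le> levy_qU \<mu> (k * \<xi>)"
proof -
  obtain \<gamma> \<xi>\<^sub>0 where g: "\<gamma> > 1" "\<xi>\<^sub>0 > 0" "\<And>\<xi>. \<xi> \<ge> \<xi>\<^sub>0 \<Longrightarrow> \<gamma> * levy_qU \<mu> \<xi> \<le> levy_qU \<mu> (2 * \<xi>)"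
    using qU_doubling by blast
  define \<alpha> where "\<alpha> = log 2 \<gamma>"
  have a0: "\<alpha> > 0" using g(1) by (simp add: \<alpha>_def)
  have pw: "\<gamma> ^ n * levy_qU \<mu> \<xi> \<le> levy_qU \<mu> (2 ^ n * \<xi>)" if "\<xi> \<ge> \<xi>\<^sub>0" for n \<xi>
  proof (induction n)
    case (Suc n)
    have "1 * \<xi>\<^sub>0 \<le> 2 ^ n * \<xi>" using that g(2) by (intro mult_mono) auto
    then have "\<gamma> * levy_qU \<mu> (2 ^ n * \<xi>) \<le> levy_qU \<mu> (2 ^ Suc n * \<xi>)"
      using g(3)[of "2 ^ n * \<xi>"] by (simp add: mult.assoc)
    moreover have "\<gamma> * (\<gamma> ^ n * levy_qU \<mu> \<xi>) \<le> \<gamma> * levy_qU \<mu> (2 ^ n * \<xi>)"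
      using Suc g(1) by (intro mult_left_mono) auto
    ultimately show ?case by (simp add: mult.assoc)
  qed simp
  have "1 / \<gamma> * k powr \<alpha> * levy_qU \<mu> \<xi> \<le> levy_qU \<mu> (k * \<xi>)" if xi: "\<xi> \<ge> \<xi>\<^sub>0" and k: "k \<ge> 1" for \<xi> k
  proof -
    define n where "n = nat \<lfloor>log 2 k\<rfloor>"
    have lk: "0 \<le> log 2 k" using k by simp
    have n1: "real n \<le> log 2 k" using lk by (simp add: n_def)
    have n2: "log 2 k \<le> real (Suc n)" using lk unfolding n_def by linarith
    have "2 ^ n \<le> k" using n1 k by (simp add: le_log_iff powr_realpow)
    have "k powr \<alpha> = \<gamma> powr (log 2 k)"
      using k g(1) by (simp add: \<alpha>_def powr_def log_def)
    also have "\<dots> \<le> \<gamma> powr real (Suc n)" using n2 g(1) by (intro powr_mono) auto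
    also have "\<dots> = \<gamma> * \<gamma> ^ n" using g(1) by (subst powr_realpow) auto
    finally have "1 / \<gamma> * k powr \<alpha> \<le> \<gamma> ^ n" using g(1) by (simp add: field_simps)
    then have "1 / \<gamma> * k powr \<alpha> * levy_qU \<mu> \<xi> \<le> \<gamma> ^ n * levy_qU \<mu> \<xi>"
      by (intro mult_right_mono qU_nonneg)
    also have "\<dots> \<le> levy_qU \<mu> (2 ^ n * \<xi>)" by (rule pw[OF xi])
    also have "\<dots> \<le> levy_qU \<mu> (k * \<xi>)"
      using \<open>2 ^ n \<le> k\<close> xi g(2) k by (intro qU_mono_abs) (auto simp: abs_mult intro!: mult_right_mono)
    finally show ?thesis .
  qed
  then show ?thesis using a0 g(1,2) by (intro exI[of _ \<alpha>] conjI exI[of _ "1 / \<gamma>"] exI[of _ \<xi>\<^sub>0]) auto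
qed

text \<open>The starting point of the growth can be moved down to any \<open>r > 0\<close>, because below \<open>\<xi>\<^sub>0\<close> monotonicity alone loses only
a factor depending on \<open>r / \<xi>\<^sub>0\<close>. With \<open>r = \<rho>\<^sub>1\<close> the estimate applies at every \<open>\<rho>\<^sub>t\<close>.\<close>

lemma qU_power_growth_from:
  assumes "r > 0"
  shows "\<exists>\<alpha>>0. \<exists>c>0. \<forall>\<xi>\<ge>r. \<forall>k\<ge>1. c * k powr \<alpha> * levy_qU \<mu> \<xi> \<le> levy_qU \<mu> (k * \<xi>)"
proof -
  obtain \<alpha> c \<xi>\<^sub>0 where g: "\<alpha> > 0" "c > 0" "\<xi>\<^sub>0 > 0"
    "\<And>\<xi> k. \<xi> \<ge> \<xi>\<^sub>0 \<Longrightarrow> k \<ge> 1 \<Longrightarrow> c * k powr \<alpha> * levy_qU \<mu> \<xi> \<le> levy_qU \<mu> (k * \<xi>)"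
    using qU_power_growth by blast
  define d where "d = min c 1 * min ((r / \<xi>\<^sub>0) powr \<alpha>) 1"
  have d0: "d > 0" using g assms by (simp add: d_def)
  have "d * k powr \<alpha> * levy_qU \<mu> \<xi> \<le> levy_qU \<mu> (k * \<xi>)" if xi: "\<xi> \<ge> r" and k: "k \<ge> 1" for \<xi> k
  proof -
    consider "\<xi> \<ge> \<xi>\<^sub>0" | "k * \<xi> \<le> \<xi>\<^sub>0" | "\<xi> < \<xi>\<^sub>0" "\<xi>\<^sub>0 < k * \<xi>" by linarith
    then show ?thesis
    proof cases
      case 1
      have "d \<le> c * 1" unfolding d_def using g by (intro mult_mono) auto
      then have "d * k powr \<alpha> * levy_qU \<mu> \<xi> \<le> c * k powr \<alpha> * levy_qU \<mu> \<xi>"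
        by (intro mult_right_mono qU_nonneg) auto
      then show ?thesis using g(4)[OF 1 k] by linarith
    next
      case 2
      have "k * r \<le> k * \<xi>" using xi k by (intro mult_left_mono) auto
      then have "k \<le> \<xi>\<^sub>0 / r" using 2 assms by (simp add: field_simps)
      then have "k powr \<alpha> \<le> (\<xi>\<^sub>0 / r) powr \<alpha>" using k g by (intro powr_mono2) auto
      moreover have "d \<le> 1 * (r / \<xi>\<^sub>0) powr \<alpha>" unfolding d_def using g by (intro mult_mono) auto
      ultimately have "d * k powr \<alpha> \<le> (r / \<xi>\<^sub>0) powr \<alpha> * (\<xi>\<^sub>0 / r) powr \<alpha>"
        using d0 by (intro mult_mono) auto
      also have "\<dots> = 1" using assms g by (simp add: powr_mult[symmetric])
      finally have "d * k powr \<alpha> * levy_qU \<mu> \<xi> \<le> 1 * levy_qU \<mu> \<xi>" by (intro mult_right_mono qU_nonneg)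
      also have "\<dots> \<le> levy_qU \<mu> (k * \<xi>)" using k by (auto intro!: qU_mono_abs simp: abs_mult mult_le_cancel_right1)
      finally show ?thesis .
    next
      case 3
      have k2: "k * \<xi> / \<xi>\<^sub>0 \<ge> 1" using 3 g by simp
      have "r / \<xi>\<^sub>0 * k \<le> k * \<xi> / \<xi>\<^sub>0" using xi k g by (simp add: field_simps)
      then have "(r / \<xi>\<^sub>0) powr \<alpha> * k powr \<alpha> \<le> (k * \<xi> / \<xi>\<^sub>0) powr \<alpha>"
        using assms g k by (subst powr_mult[symmetric]) (auto intro!: powr_mono2)
      moreover have "d \<le> c * (r / \<xi>\<^sub>0) powr \<alpha>" unfolding d_def using g by (intro mult_mono) auto
      then have "d * k powr \<alpha> \<le> c * (r / \<xi>\<^sub>0) powr \<alpha> * k powr \<alpha>" by (intro mult_right_mono) auto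
      ultimately have "d * k powr \<alpha> \<le> c * (k * \<xi> / \<xi>\<^sub>0) powr \<alpha>"
        using g by (smt (verit) mult.assoc mult_left_mono)
      moreover have "levy_qU \<mu> \<xi> \<le> levy_qU \<mu> \<xi>\<^sub>0" using 3 xi assms by (intro qU_mono_abs) auto
      ultimately have "d * k powr \<alpha> * levy_qU \<mu> \<xi> \<le> c * (k * \<xi> / \<xi>\<^sub>0) powr \<alpha> * levy_qU \<mu> \<xi>\<^sub>0"
        using g(2) by (intro mult_mono[OF _ _ _ qU_nonneg]) auto
      also have "\<dots> \<le> levy_qU \<mu> (k * \<xi> / \<xi>\<^sub>0 * \<xi>\<^sub>0)" by (rule g(4)[OF order_refl k2])
      finally show ?thesis using g by simp
    qed
  qed
  then show ?thesis using d0 g(1) by blast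
qed

definition rmin where "rmin = levy_rho \<mu> 1"

lemma rmin_pos: "rmin > 0" unfolding rmin_def by (rule rho_greatest) simp

lemma rho_ge_rmin: "0 < t \<Longrightarrow> t \<le> 1 \<Longrightarrow> rmin \<le> levy_rho \<mu> t"
  unfolding rmin_def by (rule rho_antimono)

lemma qU_rmin: "levy_qU \<mu> rmin = 1" unfolding rmin_def by (simp add: rho_greatest)

text \<open>Since \<open>q\<^sup>U\<close> grows at most quadratically, \<open>\<rho>\<^sub>t\<close> is at least of order \<open>t\<close> to the power \<open>-1/2\<close>. This converts
negative powers of \<open>\<rho>\<^sub>t\<close> into positive powers of \<open>t\<close>.\<close>

lemma inverse_rho_le:
  assumes "0 < t" "t \<le> 1" shows "1 / levy_rho \<mu> t \<le> sqrt t / rmin"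
proof -
  let ?r = "levy_rho \<mu> t"
  have r: "rmin \<le> ?r" "0 < ?r" using rho_ge_rmin assms rho_greatest by auto
  have "levy_qU \<mu> (?r / rmin * rmin) \<le> (?r / rmin)\<^sup>2 * levy_qU \<mu> rmin"
    using r rmin_pos by (intro qU_scale_le) auto
  then have "1 / t \<le> (?r / rmin)\<^sup>2" using r rmin_pos assms by (simp add: rho_greatest qU_rmin)
  then have "(rmin / ?r)\<^sup>2 \<le> t"
    using r rmin_pos assms by (simp add: field_simps power2_eq_square)
  then have "rmin / ?r \<le> sqrt t" by (rule real_le_rsqrt)
  then show ?thesis using r rmin_pos by (simp add: field_simps)
qed

text \<open>The values of \<open>q\<^sup>U\<close> at \<open>\<rho>\<^sub>t\<close> and \<open>\<rho>\<^sub>t\<^sub>/\<^sub>2\<close> differ by the factor \<open>2\<close>, and power growth turns a bounded ratio of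
values into a bounded ratio of arguments.\<close>

lemma rho_half: "\<exists>D\<ge>1. \<forall>t. 0 < t \<longrightarrow> t \<le> 1 \<longrightarrow> levy_rho \<mu> (t / 2) \<le> D * levy_rho \<mu> t"
proof -
  obtain \<alpha> c where g: "\<alpha> > 0" "c > 0"
    "\<And>\<xi> k. \<xi> \<ge> rmin \<Longrightarrow> k \<ge> 1 \<Longrightarrow> c * k powr \<alpha> * levy_qU \<mu> \<xi> \<le> levy_qU \<mu> (k * \<xi>)"
    using qU_power_growth_from[OF rmin_pos] by blast
  have "levy_rho \<mu> (t / 2) \<le> max 1 ((2 / c) powr (1 / \<alpha>)) * levy_rho \<mu> t" if t: "0 < t" "t \<le> 1" for t
  proof -
    let ?k = "levy_rho \<mu> (t / 2) / levy_rho \<mu> t"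
    have r: "levy_rho \<mu> t > 0" "levy_rho \<mu> t \<le> levy_rho \<mu> (t / 2)" "rmin \<le> levy_rho \<mu> t"
      using t rho_greatest(1) rho_antimono[of "t / 2" t] rho_ge_rmin by auto
    have k: "?k \<ge> 1" using r by simp
    have "c * ?k powr \<alpha> * levy_qU \<mu> (levy_rho \<mu> t) \<le> levy_qU \<mu> (?k * levy_rho \<mu> t)"
      by (rule g(3)[OF r(3) k])
    also have "?k * levy_rho \<mu> t = levy_rho \<mu> (t / 2)" using r by simp
    finally have "?k powr \<alpha> \<le> 2 / c" using t g(2) by (simp add: rho_greatest field_simps)
    then have "(?k powr \<alpha>) powr (1 / \<alpha>) \<le> (2 / c) powr (1 / \<alpha>)" using g by (intro powr_mono2) auto
    moreover have "(?k powr \<alpha>) powr (1 / \<alpha>) = ?k" using k g(1) r(1,2) by (simp add: powr_powr)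
    ultimately have "?k \<le> (2 / c) powr (1 / \<alpha>)" by simp
    then have "?k \<le> max 1 ((2 / c) powr (1 / \<alpha>))" by simp
    then show ?thesis using r(1) by (simp only: pos_divide_le_eq)
  qed
  then show ?thesis by (intro exI[of _ "max 1 ((2 / c) powr (1 / \<alpha>))"]) auto
qed

text \<open>At \<open>\<rho>\<^sub>t\<close> the product \<open>t q\<^sup>U\<close> equals \<open>1\<close>; power growth takes over from there, and \<open>q \<ge> q\<^sup>L / 4\<close> with comparability
passes from \<open>q\<^sup>U\<close> to \<open>q\<close>. The constant \<open>C\<close> covers the bounded range of \<open>\<xi> / \<rho>\<^sub>t\<close> where one of these tools
fails.\<close>

lemma tq_lower:
  "\<exists>\<alpha>>0. \<exists>c>0. \<exists>C. \<forall>t. 0 < t \<longrightarrow> t \<le> 1 \<longrightarrow> (\<forall>\<xi>. c * (\<bar>\<xi>\<bar> / levy_rho \<mu> t) powr \<alpha> - C \<le> t * levy_q \<mu> \<xi>)"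
proof -
  obtain \<alpha> c where g: "\<alpha> > 0" "c > 0"
    "\<And>\<xi> k. \<xi> \<ge> rmin \<Longrightarrow> k \<ge> 1 \<Longrightarrow> c * k powr \<alpha> * levy_qU \<mu> \<xi> \<le> levy_qU \<mu> (k * \<xi>)"
    using qU_power_growth_from[OF rmin_pos] by blast
  obtain \<beta> \<xi>\<^sub>0 where b: "\<beta> > 1" "\<xi>\<^sub>0 > 0" "\<And>\<xi>. \<bar>\<xi>\<bar> \<ge> \<xi>\<^sub>0 \<Longrightarrow> levy_qU \<mu> \<xi> \<le> \<beta> * levy_qL \<mu> \<xi>"
    using comparable_pos by blast
  define d where "d = c / (4 * \<beta>)"
  have d0: "d > 0" using b g by (simp add: d_def)
  define C where "C = d * max 1 (\<xi>\<^sub>0 / rmin) powr \<alpha>"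
  have "d * (\<bar>\<xi>\<bar> / levy_rho \<mu> t) powr \<alpha> - C \<le> t * levy_q \<mu> \<xi>" if t: "0 < t" "t \<le> 1" for t \<xi>
  proof -
    let ?r = "levy_rho \<mu> t"
    have r: "?r > 0" "rmin \<le> ?r" using t rho_greatest(1) rho_ge_rmin by auto
    show ?thesis
    proof (cases "\<bar>\<xi>\<bar> \<ge> \<xi>\<^sub>0 \<and> \<bar>\<xi>\<bar> \<ge> ?r")
      case True
      have "c * (\<bar>\<xi>\<bar> / ?r) powr \<alpha> * levy_qU \<mu> ?r \<le> levy_qU \<mu> (\<bar>\<xi>\<bar> / ?r * ?r)"
        using True r by (intro g(3)) auto
      also have "\<bar>\<xi>\<bar> / ?r * ?r = \<bar>\<xi>\<bar>" using r by simp
      also have "levy_qU \<mu> \<bar>\<xi>\<bar> \<le> levy_qU \<mu> \<xi>" by (intro qU_mono_abs) auto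
      also have "\<dots> \<le> \<beta> * levy_qL \<mu> \<xi>" using True b(3) by auto
      also have "\<dots> \<le> \<beta> * (4 * levy_q \<mu> \<xi>)" using b(1) by (intro mult_left_mono qL_le_q) auto
      finally have "d * (\<bar>\<xi>\<bar> / ?r) powr \<alpha> \<le> t * levy_q \<mu> \<xi>"
        using t b(1) by (simp add: rho_greatest d_def field_simps)
      moreover have "C \<ge> 0" using d0 by (simp add: C_def)
      ultimately show ?thesis by linarith
    next
      case False
      have "\<bar>\<xi>\<bar> / ?r \<le> max 1 (\<xi>\<^sub>0 / rmin)"
      proof (cases "\<bar>\<xi>\<bar> \<ge> ?r")
        case True
        then have "\<bar>\<xi>\<bar> / ?r \<le> \<xi>\<^sub>0 / rmin" using False r rmin_pos b(2) by (intro frac_le) auto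
        then show ?thesis by simp
      next
        case False
        then have "\<bar>\<xi>\<bar> / ?r \<le> 1" using r by simp
        then show ?thesis by simp
      qed
      then have "(\<bar>\<xi>\<bar> / ?r) powr \<alpha> \<le> max 1 (\<xi>\<^sub>0 / rmin) powr \<alpha>"
        using g(1) r by (intro powr_mono2) auto
      then have "d * (\<bar>\<xi>\<bar> / ?r) powr \<alpha> \<le> C" unfolding C_def using d0 by simp
      moreover have "0 \<le> t * levy_q \<mu> \<xi>" using t q_nonneg by simp
      ultimately show ?thesis by linarith
    qed
  qed
  then show ?thesis using g(1) d0 by blast
qed

lemma exp_powr_decay:
  assumes "\<alpha> > 0" "c > 0"
  shows "\<exists>K. \<forall>\<eta>\<ge>0. exp (- (c * \<eta> powr \<alpha>)) * (1 + \<eta>\<^sup>2) ^ N \<le> (K::real)"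
proof -
  let ?f = "\<lambda>\<eta>::real. exp (- (c * \<eta> powr \<alpha>)) * (1 + \<eta>\<^sup>2) ^ N"
  have "(?f \<longlongrightarrow> 0) at_top" using assms by real_asymp
  then have "\<forall>\<^sub>F \<eta> in at_top. ?f \<eta> < 1" by (rule order_tendstoD) simp
  then obtain M where M: "\<And>\<eta>. \<eta> \<ge> M \<Longrightarrow> ?f \<eta> < 1" by (auto simp: eventually_at_top_linorder)
  have "?f \<eta> \<le> max 1 ((1 + M\<^sup>2) ^ N)" if "\<eta> \<ge> 0" for \<eta>
  proof (cases "\<eta> \<ge> M")
    case True then show ?thesis using M[OF True] by linarith
  next
    case False
    then have "\<eta>\<^sup>2 \<le> M\<^sup>2" using that by (intro power_mono) auto
    then have "?f \<eta> \<le> 1 * (1 + M\<^sup>2) ^ N" using assms by (intro mult_mono power_mono) auto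
    then show ?thesis by simp
  qed
  then show ?thesis by blast
qed

lemma exp_tq_decay:
  "\<exists>K>0. \<forall>t. 0 < t \<longrightarrow> t \<le> 1 \<longrightarrow> (\<forall>\<xi>. exp (- (t * levy_q \<mu> \<xi>)) \<le> K / (1 + (\<xi> / levy_rho \<mu> t)\<^sup>2) ^ N)"
proof -
  obtain \<alpha> c C where g: "\<alpha> > 0" "c > 0"
    "\<And>t \<xi>. 0 < t \<Longrightarrow> t \<le> 1 \<Longrightarrow> c * (\<bar>\<xi>\<bar> / levy_rho \<mu> t) powr \<alpha> - C \<le> t * levy_q \<mu> \<xi>"
    using tq_lower by blast
  obtain K where K: "\<And>\<eta>. \<eta> \<ge> 0 \<Longrightarrow> exp (- (c * \<eta> powr \<alpha>)) * (1 + \<eta>\<^sup>2) ^ N \<le> K"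
    using exp_powr_decay[OF g(1,2)] by blast
  have "exp (- (t * levy_q \<mu> \<xi>)) \<le> exp C * max K 1 / (1 + (\<xi> / levy_rho \<mu> t)\<^sup>2) ^ N" if t: "0 < t" "t \<le> 1" for t \<xi>
  proof -
    let ?e = "\<bar>\<xi>\<bar> / levy_rho \<mu> t"
    have r: "levy_rho \<mu> t > 0" using t rho_greatest(1) by auto
    have p: "(1 + (\<xi> / levy_rho \<mu> t)\<^sup>2) ^ N > 0" by (intro zero_less_power add_pos_nonneg) auto
    have "exp (- (t * levy_q \<mu> \<xi>)) \<le> exp (C - c * ?e powr \<alpha>)" using g(3)[OF t, of \<xi>] by simp
    also have "\<dots> = exp C * exp (- (c * ?e powr \<alpha>))" by (simp add: exp_diff exp_minus field_simps)
    finally have "exp (- (t * levy_q \<mu> \<xi>)) * (1 + (\<xi> / levy_rho \<mu> t)\<^sup>2) ^ N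
        \<le> exp C * exp (- (c * ?e powr \<alpha>)) * (1 + (\<xi> / levy_rho \<mu> t)\<^sup>2) ^ N"
      using p by (intro mult_right_mono) auto
    also have "\<dots> = exp C * (exp (- (c * ?e powr \<alpha>)) * (1 + ?e\<^sup>2) ^ N)"
      by (simp add: power_divide)
    also have "\<dots> \<le> exp C * max K 1"
      using K[of ?e] r by (intro mult_left_mono) (auto simp: le_max_iff_disj)
    finally show ?thesis using p by (simp add: pos_le_divide_eq)
  qed
  then show ?thesis by (intro exI[of _ "exp C * max K 1"]) auto
qed

end

section \<open>Translations, reflections and the Cauchy kernel\<close>

lemma nn_integral_shift:
  assumes [measurable]: "f \<in> borel_measurable borel"
  shows "(\<integral>\<^sup>+x. f (x + c) \<partial>lborel) = (\<integral>\<^sup>+x. f (x::real) \<partial>lborel)"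
  using nn_integral_real_affine[of f 1 c] assms by (simp add: add.commute)

lemma nn_integral_reflect:
  assumes [measurable]: "f \<in> borel_measurable borel"
  shows "(\<integral>\<^sup>+x. f (c - x) \<partial>lborel) = (\<integral>\<^sup>+x. f (x::real) \<partial>lborel)"
  using nn_integral_real_affine[of f "-1" c] assms by simp

lemma integral_shift: "(\<integral>x. f (x + c) \<partial>lborel) = (\<integral>x. f (x::real) \<partial>lborel)" for f :: "real \<Rightarrow> real"
  using lborel_integral_real_affine[of 1 f c] by (simp add: add.commute)

lemma integral_reflect: "(\<integral>x. f (c - x) \<partial>lborel) = (\<integral>x. f (x::real) \<partial>lborel)" for f :: "real \<Rightarrow> real"
  using lborel_integral_real_affine[of "-1" f c] by simp

lemma integrable_shift: "integrable lborel f \<Longrightarrow> integrable lborel (\<lambda>x. f (x + c))" for f :: "real \<Rightarrow> real"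
  using lborel_integrable_real_affine[of f 1 c] by (simp add: add.commute)

lemma integrable_reflect: "integrable lborel f \<Longrightarrow> integrable lborel (\<lambda>x. f (c - x))" for f :: "real \<Rightarrow> real"
  using lborel_integrable_real_affine[of f "-1" c] by simp

lemma nn_integral_cauchy_kernel: "(\<integral>\<^sup>+x. ennreal (1 / (1 + x\<^sup>2)) \<partial>lborel) = ennreal pi"
proof -
  let ?f = "\<lambda>x::real. 1 / (1 + x\<^sup>2)"
  have half: "(\<integral>\<^sup>+x. ennreal (?f x) * indicator {0..} x \<partial>lborel) = ennreal (pi / 2 - arctan 0)"
    by (rule nn_integral_FTC_atLeast)
       (auto intro!: derivative_eq_intros tendsto_arctan_at_top simp: inverse_eq_divide add_nonneg_eq_0_iff)
  have "(\<integral>\<^sup>+x. ennreal (?f x) * indicator {..<0} x \<partial>lborel) = (\<integral>\<^sup>+x. ennreal (?f x) * indicator {0<..} x \<partial>lborel)"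
    by (subst nn_integral_reflect[symmetric, where c = 0]) (auto intro!: nn_integral_cong simp: indicator_def)
  also have "\<dots> = (\<integral>\<^sup>+x. ennreal (?f x) * indicator {0..} x \<partial>lborel)"
    using AE_lborel_singleton[of "0::real"] by (intro nn_integral_cong_AE) (auto simp: indicator_def)
  finally have "(\<integral>\<^sup>+x. ennreal (?f x) * indicator {..<0} x + ennreal (?f x) * indicator {0..} x \<partial>lborel) = ennreal pi"
    by (subst nn_integral_add) (auto simp: half ennreal_plus[symmetric] simp del: ennreal_plus)
  also have "(\<integral>\<^sup>+x. ennreal (?f x) * indicator {..<0} x + ennreal (?f x) * indicator {0..} x \<partial>lborel)
      = (\<integral>\<^sup>+x. ennreal (?f x) \<partial>lborel)"
    by (intro nn_integral_cong) (auto simp: indicator_def)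
  finally show ?thesis .
qed

lemma nn_integral_scaled_cauchy_kernel:
  assumes "r > 0" shows "(\<integral>\<^sup>+x. ennreal (1 / (1 + (x / r)\<^sup>2)) \<partial>lborel) = ennreal (pi * r)"
  using nn_integral_real_affine[of "\<lambda>x. ennreal (1 / (1 + (x / r)\<^sup>2))" r 0] assms
  by (simp add: nn_integral_cauchy_kernel ennreal_mult[symmetric] mult.commute)

lemma scaled_cauchy_kernel:
  assumes "r > 0"
  shows "integrable lborel (\<lambda>x. 1 / (1 + (x / r)\<^sup>2))" "(\<integral>x. 1 / (1 + (x / r)\<^sup>2) \<partial>lborel) = pi * r"
proof -
  show "integrable lborel (\<lambda>x. 1 / (1 + (x / r)\<^sup>2))"
    by (rule integrableI_bounded) (use nn_integral_scaled_cauchy_kernel[OF assms] in simp_all)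
  show "(\<integral>x. 1 / (1 + (x / r)\<^sup>2) \<partial>lborel) = pi * r"
    by (rule integral_eq_nn_integral[THEN trans]) (use nn_integral_scaled_cauchy_kernel[OF assms] assms in auto)
qed

lemma integrable_dominated:
  fixes f g :: "'a \<Rightarrow> real"
  assumes "integrable M g" "f \<in> borel_measurable M" "\<And>x. \<bar>f x\<bar> \<le> g x"
  shows "integrable M f"
proof (rule Bochner_Integration.integrable_bound[OF assms(1,2)])
  have "norm (f x) \<le> norm (g x)" for x using assms(3)[of x] by simp
  then show "AE x in M. norm (f x) \<le> norm (g x)" by simp
qed

section \<open>The cosine transform\<close>

text \<open>Fourier inversion for an even function: the densities below are the transforms of their symbols.\<close>

definition cos_transform :: "(real \<Rightarrow> real) \<Rightarrow> real \<Rightarrow> real" where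
  "cos_transform g x = (\<integral>\<xi>. cos (x * \<xi>) * g \<xi> \<partial>lborel) / (2 * pi)"

lemma integrable_cos_mult: "integrable lborel g \<Longrightarrow> integrable lborel (\<lambda>\<xi>. cos (x * \<xi>) * g \<xi> :: real)"
  by (rule Bochner_Integration.integrable_bound[of _ g]) (auto simp: abs_mult mult_left_le_one_le)

lemma integrable_bounded_mult:
  fixes f g :: "'a \<Rightarrow> real"
  assumes "integrable M g" "f \<in> borel_measurable M" "\<And>x. \<bar>f x\<bar> \<le> B"
  shows "integrable M (\<lambda>x. f x * g x)"
proof (rule integrable_dominated[where g = "\<lambda>x. B * \<bar>g x\<bar>"])
  show "integrable M (\<lambda>x. B * \<bar>g x\<bar>)" using assms by (intro integrable_mult_right integrable_abs)
  show "\<bar>f x * g x\<bar> \<le> B * \<bar>g x\<bar>" for x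
    using assms(3)[of x] by (simp add: abs_mult mult_right_mono)
qed (use assms in measurable)

lemma cos_transform_abs_le: "integrable lborel g \<Longrightarrow> \<bar>cos_transform g x\<bar> \<le> (\<integral>\<xi>. \<bar>g \<xi>\<bar> \<partial>lborel) / (2 * pi)"
proof -
  assume g: "integrable lborel g"
  have "\<bar>\<integral>\<xi>. cos (x * \<xi>) * g \<xi> \<partial>lborel\<bar> \<le> (\<integral>\<xi>. \<bar>cos (x * \<xi>) * g \<xi>\<bar> \<partial>lborel)"
    by (rule integral_abs_bound)
  also have "\<dots> \<le> (\<integral>\<xi>. \<bar>g \<xi>\<bar> \<partial>lborel)"
    by (intro integral_mono integrable_abs g integrable_cos_mult) (simp add: abs_mult mult_left_le_one_le)
  finally show ?thesis by (simp add: cos_transform_def divide_right_mono)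
qed

lemma cos_transform_even: "cos_transform g (- x) = cos_transform g x"
  by (simp add: cos_transform_def)

lemma measurable_cos_transform [measurable]:
  assumes [measurable]: "g \<in> borel_measurable borel"
  shows "cos_transform g \<in> borel_measurable borel"
  unfolding cos_transform_def[abs_def] by measurable

lemma cos_transform_cmult: "cos_transform (\<lambda>\<xi>. c * g \<xi>) x = c * cos_transform g x"
proof -
  have "(\<lambda>\<xi>. cos (x * \<xi>) * (c * g \<xi>)) = (\<lambda>\<xi>. c * (cos (x * \<xi>) * g \<xi>))" by (auto simp: ac_simps)
  then show ?thesis by (simp add: cos_transform_def)
qed

lemma cos_transform_diff:
  assumes "integrable lborel g" "integrable lborel h"
  shows "cos_transform (\<lambda>\<xi>. g \<xi> - h \<xi>) x = cos_transform g x - cos_transform h x"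
proof -
  have "(\<integral>\<xi>. cos (x * \<xi>) * (g \<xi> - h \<xi>) \<partial>lborel) = (\<integral>\<xi>. cos (x * \<xi>) * g \<xi> - cos (x * \<xi>) * h \<xi> \<partial>lborel)"
    by (simp add: right_diff_distrib)
  also have "\<dots> = (\<integral>\<xi>. cos (x * \<xi>) * g \<xi> \<partial>lborel) - (\<integral>\<xi>. cos (x * \<xi>) * h \<xi> \<partial>lborel)"
    using assms by (intro Bochner_Integration.integral_diff integrable_cos_mult)
  finally show ?thesis by (simp add: cos_transform_def diff_divide_distrib)
qed

lemma cos_transform_translates:
  assumes g: "integrable lborel g"
  shows "cos_transform g (x + u) + cos_transform g (x - u) = 2 * cos_transform (\<lambda>\<xi>. cos (u * \<xi>) * g \<xi>) x"
proof -
  have "(\<integral>\<xi>. cos ((x + u) * \<xi>) * g \<xi> \<partial>lborel) + (\<integral>\<xi>. cos ((x - u) * \<xi>) * g \<xi> \<partial>lborel)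
      = (\<integral>\<xi>. cos ((x + u) * \<xi>) * g \<xi> + cos ((x - u) * \<xi>) * g \<xi> \<partial>lborel)"
    using g by (intro Bochner_Integration.integral_add[symmetric] integrable_cos_mult)
  also have "\<dots> = (\<integral>\<xi>. 2 * (cos (x * \<xi>) * (cos (u * \<xi>) * g \<xi>)) \<partial>lborel)"
    by (intro Bochner_Integration.integral_cong) (auto simp: algebra_simps cos_add cos_diff)
  finally show ?thesis by (simp add: cos_transform_def add_divide_distrib[symmetric])
qed

lemma cos_transform_second_difference:
  assumes g: "integrable lborel g"
  shows "cos_transform g (x + u) + cos_transform g (x - u) - 2 * cos_transform g x
    = - cos_transform (\<lambda>\<xi>. 2 * (1 - cos (u * \<xi>)) * g \<xi>) x"
proof -
  have "cos_transform (\<lambda>\<xi>. 2 * (1 - cos (u * \<xi>)) * g \<xi>) x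
      = cos_transform (\<lambda>\<xi>. 2 * g \<xi> - 2 * (cos (u * \<xi>) * g \<xi>)) x"
    by (simp add: algebra_simps)
  also have "\<dots> = 2 * cos_transform g x - 2 * cos_transform (\<lambda>\<xi>. cos (u * \<xi>) * g \<xi>) x"
    using g integrable_cos_mult[OF g, of u] by (subst cos_transform_diff) (auto simp: cos_transform_cmult)
  finally show ?thesis using cos_transform_translates[OF g, of x u] by simp
qed

lemma cos_transform_of_second_difference:
  assumes h: "integrable lborel h"
  shows "cos_transform (\<lambda>\<xi>. h (\<xi> + v) + h (\<xi> - v) - 2 * h \<xi>) x = - (2 * (1 - cos (v * x)) * cos_transform h x)"
proof -
  have i: "integrable lborel (\<lambda>\<xi>. cos (x * (\<xi> - v)) * h \<xi>)" "integrable lborel (\<lambda>\<xi>. cos (x * (\<xi> + v)) * h \<xi>)"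
    "integrable lborel (\<lambda>\<xi>. cos (x * \<xi>) * h \<xi>)"
    by (intro integrable_bounded_mult[OF h, where B = 1], simp, simp)+
  have e: "(\<integral>\<xi>. cos (x * \<xi>) * h (\<xi> + v) \<partial>lborel) = (\<integral>\<xi>. cos (x * (\<xi> - v)) * h \<xi> \<partial>lborel)"
    "(\<integral>\<xi>. cos (x * \<xi>) * h (\<xi> - v) \<partial>lborel) = (\<integral>\<xi>. cos (x * (\<xi> + v)) * h \<xi> \<partial>lborel)"
    using integral_shift[of "\<lambda>\<xi>. cos (x * (\<xi> - v)) * h \<xi>" v] integral_shift[of "\<lambda>\<xi>. cos (x * (\<xi> + v)) * h \<xi>" "- v"]
    by simp_all
  have j: "integrable lborel (\<lambda>\<xi>. h (\<xi> + v))" "integrable lborel (\<lambda>\<xi>. h (\<xi> - v))"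
    using integrable_shift[OF h, of v] integrable_shift[OF h, of "- v"] by simp_all
  have "(\<integral>\<xi>. cos (x * \<xi>) * (h (\<xi> + v) + h (\<xi> - v) - 2 * h \<xi>) \<partial>lborel)
     = (\<integral>\<xi>. cos (x * \<xi>) * h (\<xi> + v) + cos (x * \<xi>) * h (\<xi> - v) - 2 * (cos (x * \<xi>) * h \<xi>) \<partial>lborel)"
    by (simp add: algebra_simps)
  also have "\<dots> = (\<integral>\<xi>. cos (x * \<xi>) * h (\<xi> + v) \<partial>lborel) + (\<integral>\<xi>. cos (x * \<xi>) * h (\<xi> - v) \<partial>lborel) - 2 * (\<integral>\<xi>. cos (x * \<xi>) * h \<xi> \<partial>lborel)"
    using integrable_cos_mult[OF j(1), of x] integrable_cos_mult[OF j(2), of x] i(3) by simp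
  also have "\<dots> = (\<integral>\<xi>. cos (x * (\<xi> - v)) * h \<xi> + cos (x * (\<xi> + v)) * h \<xi> - 2 * (cos (x * \<xi>) * h \<xi>) \<partial>lborel)"
    unfolding e using i by simp
  also have "\<dots> = (\<integral>\<xi>. - (2 * (1 - cos (v * x))) * (cos (x * \<xi>) * h \<xi>) \<partial>lborel)"
    by (intro Bochner_Integration.integral_cong) (auto simp: algebra_simps cos_add cos_diff)
  also have "\<dots> = - (2 * (1 - cos (v * x))) * (\<integral>\<xi>. cos (x * \<xi>) * h \<xi> \<partial>lborel)"
    by (rule integral_mult_right_zero)
  finally have eq: "(\<integral>\<xi>. cos (x * \<xi>) * (h (\<xi> + v) + h (\<xi> - v) - 2 * h \<xi>) \<partial>lborel)
      = - (2 * (1 - cos (v * x))) * (\<integral>\<xi>. cos (x * \<xi>) * h \<xi> \<partial>lborel)" .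
  show ?thesis unfolding cos_transform_def eq
    by (simp only: times_divide_eq_right mult_minus_left minus_divide_left)
qed

text \<open>Two integrations by parts in discrete form. A second difference of \<open>h\<close> with step \<open>v\<close> multiplies the transform at
\<open>x\<close> by \<open>- 2 (1 - cos (v x))\<close>, so quadratic control of second differences yields quadratic decay of the transform
without any derivative of \<open>h\<close>.\<close>

lemma cos_transform_decay:
  assumes [measurable]: "h \<in> borel_measurable borel" and r: "r > 0" and M: "M \<ge> 0"
    and b0: "\<And>\<xi>. \<bar>h \<xi>\<bar> \<le> M / (1 + (\<xi> / r)\<^sup>2)"
    and b2: "\<And>\<xi> v. \<bar>v\<bar> \<le> pi * r \<Longrightarrow> \<bar>h (\<xi> + v) + h (\<xi> - v) - 2 * h \<xi>\<bar> \<le> M * (v / r)\<^sup>2 / (1 + (\<xi> / r)\<^sup>2)"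
  shows "integrable lborel h" and "\<bar>cos_transform h x\<bar> \<le> 4 * M * r / (1 + (r * x)\<^sup>2)"
proof -
  note ck = scaled_cauchy_kernel[OF r]
  have ckM: "integrable lborel (\<lambda>\<xi>. K / (1 + (\<xi> / r)\<^sup>2))" "(\<integral>\<xi>. K / (1 + (\<xi> / r)\<^sup>2) \<partial>lborel) = K * (pi * r)" for K :: real
    using integrable_mult_right[OF ck(1), of K] integral_mult_right_zero[of lborel K "\<lambda>x. 1 / (1 + (x / r)\<^sup>2)"] ck(2)
    by simp_all
  show h: "integrable lborel h"
    by (rule integrable_dominated[OF ckM(1)[of M]]) (use b0 in auto)
  show "\<bar>cos_transform h x\<bar> \<le> 4 * M * r / (1 + (r * x)\<^sup>2)"
  proof (cases "\<bar>r * x\<bar> < 1")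
    case True
    then have lt: "(r * x)\<^sup>2 \<le> 1" by (simp add: abs_square_le_1)
    have "\<bar>cos_transform h x\<bar> \<le> (\<integral>\<xi>. \<bar>h \<xi>\<bar> \<partial>lborel) / (2 * pi)" by (rule cos_transform_abs_le[OF h])
    also have "\<dots> \<le> M * (pi * r) / (2 * pi)"
      unfolding ckM(2)[of M, symmetric]
      by (intro divide_right_mono integral_mono) (use h ckM(1) b0 in auto)
    also have "\<dots> = M * r / 2" by simp
    also have "\<dots> \<le> 4 * M * r / (1 + (r * x)\<^sup>2)"
    proof -
      have "M * r * (1 + (r * x)\<^sup>2) \<le> M * r * 2" using lt M r by (intro mult_left_mono) auto
      moreover have "0 \<le> M * r" using M r by simp
      moreover have "0 < 1 + (r * x)\<^sup>2" by (rule add_pos_nonneg) auto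
      ultimately show ?thesis by (simp add: pos_le_divide_eq)
    qed
    finally show ?thesis .
  next
    case False
    then have x: "x \<noteq> 0" by auto
    have gt: "(r * x)\<^sup>2 \<ge> 1" using False by (metis abs_le_square_iff abs_one not_less one_power2)
    \<comment> \<open>This step makes \<open>1 - cos (v x)\<close> maximal, and \<open>\<bar>r x\<bar> \<ge> 1\<close> puts it into the range where \<open>b2\<close> holds.\<close>
    define v where "v = pi / x"
    have v: "\<bar>v\<bar> \<le> pi * r" using False r x by (simp add: v_def abs_mult field_simps)
    have cosv: "cos (v * x) = -1" using x by (simp add: v_def)
    let ?D = "\<lambda>\<xi>. h (\<xi> + v) + h (\<xi> - v) - 2 * h \<xi>"
    have D: "integrable lborel ?D"
      using h integrable_shift[OF h, of v] integrable_shift[OF h, of "- v"] by simp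
    have "4 * \<bar>cos_transform h x\<bar> = \<bar>cos_transform ?D x\<bar>"
      unfolding cos_transform_of_second_difference[OF h] cosv by (simp add: abs_mult)
    also have "\<dots> \<le> (\<integral>\<xi>. \<bar>?D \<xi>\<bar> \<partial>lborel) / (2 * pi)" by (rule cos_transform_abs_le[OF D])
    also have "\<dots> \<le> M * (v / r)\<^sup>2 * (pi * r) / (2 * pi)"
      unfolding ckM(2)[symmetric]
      by (intro divide_right_mono integral_mono integrable_abs D ckM(1) b2[OF v]) auto
    also have "\<dots> = M * r * pi\<^sup>2 / (2 * (r * x)\<^sup>2)"
      using r x by (simp add: v_def power_divide power_mult_distrib field_simps)
    also have "\<dots> \<le> M * r * 16 / (2 * (r * x)\<^sup>2)"
    proof -
      have "pi\<^sup>2 \<le> 4\<^sup>2" using pi_less_4 by (intro power_mono) auto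
      then show ?thesis using M r by (intro divide_right_mono mult_left_mono) auto
    qed
    also have "\<dots> = 4 * (2 * M * r / (r * x)\<^sup>2)" by simp
    finally have "\<bar>cos_transform h x\<bar> \<le> 2 * M * r / (r * x)\<^sup>2" by linarith
    also have "\<dots> \<le> 4 * M * r / (1 + (r * x)\<^sup>2)"
    proof -
      have "2 * M * r * (1 + (r * x)\<^sup>2) \<le> 2 * M * r * (2 * (r * x)\<^sup>2)" using gt M r by (intro mult_left_mono) auto
      moreover have "0 < 1 + (r * x)\<^sup>2" by (rule add_pos_nonneg) auto
      ultimately show ?thesis using gt by (simp add: field_simps)
    qed
    finally show ?thesis .
  qed
qed

lemma cos_transform_decay_L1:
  assumes [measurable]: "f \<in> borel_measurable borel" and r: "r > 0" and "M \<ge> 0"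
    and b: "\<And>x::real. \<bar>f x\<bar> \<le> 4 * M * r / (1 + (r * x)\<^sup>2)"
  shows "(\<integral>\<^sup>+x. ennreal \<bar>f x\<bar> \<partial>lborel) \<le> ennreal (4 * pi * M)"
proof -
  have "(\<integral>\<^sup>+x. ennreal \<bar>f x\<bar> \<partial>lborel) \<le> (\<integral>\<^sup>+x. ennreal (4 * M * r) * ennreal (1 / (1 + (x / (1 / r))\<^sup>2)) \<partial>lborel)"
    using b assms by (intro nn_integral_mono) (auto simp: ennreal_mult[symmetric] mult.commute intro!: ennreal_leI)
  also have "\<dots> = ennreal (4 * M * r) * ennreal (pi * (1 / r))"
    using r nn_integral_scaled_cauchy_kernel[of "1 / r"] by (subst nn_integral_cmult) auto
  also have "\<dots> = ennreal (4 * pi * M)"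
    using r assms by (subst ennreal_mult[symmetric]) (auto simp: field_simps)
  finally show ?thesis .
qed

section \<open>Mixtures of translates and compound Poisson factors\<close>

text \<open>For a symmetric measure this is its characteristic function; in general it is that of the symmetrised measure.\<close>

definition cos_char :: "real measure \<Rightarrow> real \<Rightarrow> real" where
  "cos_char \<nu> \<xi> = (\<integral>u. cos (u * \<xi>) \<partial>\<nu>)"

context
  fixes \<nu> :: "real measure"
  assumes fin: "finite_measure \<nu>" and sets_nu [measurable_cong, simp]: "sets \<nu> = sets borel"
begin

interpretation finite_measure \<nu> by (rule fin)

lemma space_nu [simp]: "space \<nu> = UNIV"
  using sets_eq_imp_space_eq[OF sets_nu] by simp

lemma measurable_cos_char [measurable]: "cos_char \<nu> \<in> borel_measurable borel"
  unfolding cos_char_def[abs_def] by measurable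

lemma cos_char_abs_le: "\<bar>cos_char \<nu> \<xi>\<bar> \<le> measure \<nu> UNIV"
proof -
  have "\<bar>cos_char \<nu> \<xi>\<bar> \<le> (\<integral>u. 1 \<partial>\<nu>)"
    unfolding cos_char_def
    by (rule order_trans[OF integral_abs_bound], rule integral_mono) (auto intro!: integrable_const_bound[where B = 1])
  then show ?thesis by simp
qed

text \<open>A factor \<open>cos (u \<xi>)\<close> averages the translates by \<open>u\<close> and \<open>- u\<close>; Fubini integrates this over \<open>u\<close>. Positivity and
\<open>L\<^sup>1\<close> norms are therefore inherited, which is what the large jumps are controlled by.\<close>

lemma cos_transform_mixture:
  assumes g: "integrable lborel g"
  shows "cos_transform (\<lambda>\<xi>. cos_char \<nu> \<xi> * g \<xi>) x
    = (\<integral>u. (cos_transform g (x + u) + cos_transform g (x - u)) / 2 \<partial>\<nu>)"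
proof -
  have [measurable]: "g \<in> borel_measurable borel" using borel_measurable_integrable[OF g] by simp
  have "(\<integral>\<^sup>+u. \<integral>\<^sup>+\<xi>. ennreal \<bar>cos (x * \<xi>) * (cos (u * \<xi>) * g \<xi>)\<bar> \<partial>lborel \<partial>\<nu>)
      \<le> (\<integral>\<^sup>+u. \<integral>\<^sup>+\<xi>. ennreal \<bar>g \<xi>\<bar> \<partial>lborel \<partial>\<nu>)"
  proof (intro nn_integral_mono ennreal_leI)
    fix u \<xi>
    have "\<bar>cos (x * \<xi>)\<bar> * (\<bar>cos (u * \<xi>)\<bar> * \<bar>g \<xi>\<bar>) \<le> 1 * (1 * \<bar>g \<xi>\<bar>)" by (intro mult_mono) auto
    then show "\<bar>cos (x * \<xi>) * (cos (u * \<xi>) * g \<xi>)\<bar> \<le> \<bar>g \<xi>\<bar>" by (simp add: abs_mult)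
  qed
  also have "\<dots> = (\<integral>\<^sup>+\<xi>. ennreal \<bar>g \<xi>\<bar> \<partial>lborel) * emeasure \<nu> UNIV" by simp
  also have "\<dots> < \<infinity>"
  proof -
    have "(\<integral>\<^sup>+\<xi>. ennreal \<bar>g \<xi>\<bar> \<partial>lborel) < \<top>" using g by (simp add: integrable_iff_bounded)
    moreover have "emeasure \<nu> UNIV < \<top>" using emeasure_finite[of UNIV] by (simp add: less_top[symmetric])
    ultimately show ?thesis by (simp add: ennreal_mult_less_top)
  qed
  finally have F: "(\<integral>\<^sup>+u. \<integral>\<^sup>+\<xi>. ennreal \<bar>cos (x * \<xi>) * (cos (u * \<xi>) * g \<xi>)\<bar> \<partial>lborel \<partial>\<nu>) < \<infinity>" .
  have "(\<integral>u. (cos_transform g (x + u) + cos_transform g (x - u)) / 2 \<partial>\<nu>)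
     = (\<integral>u. (\<integral>\<xi>. cos (x * \<xi>) * (cos (u * \<xi>) * g \<xi>) \<partial>lborel) / (2 * pi) \<partial>\<nu>)"
    unfolding cos_transform_translates[OF g] by (simp add: cos_transform_def)
  also have "\<dots> = (\<integral>u. (\<integral>\<xi>. cos (x * \<xi>) * (cos (u * \<xi>) * g \<xi>) \<partial>lborel) \<partial>\<nu>) / (2 * pi)" by simp
  also have "(\<integral>u. (\<integral>\<xi>. cos (x * \<xi>) * (cos (u * \<xi>) * g \<xi>) \<partial>lborel) \<partial>\<nu>)
     = (\<integral>\<xi>. (\<integral>u. cos (x * \<xi>) * (cos (u * \<xi>) * g \<xi>) \<partial>\<nu>) \<partial>lborel)"
    by (rule fubini_absolute(3)[OF sigma_finite_measure_axioms sigma_finite_lborel _ F]) measurable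
  also have "\<dots> = (\<integral>\<xi>. cos (x * \<xi>) * (cos_char \<nu> \<xi> * g \<xi>) \<partial>lborel)"
    by (simp add: cos_char_def)
  finally show ?thesis by (simp add: cos_transform_def)
qed

lemma integrable_cos_char_mult: "integrable lborel g \<Longrightarrow> integrable lborel (\<lambda>\<xi>. cos_char \<nu> \<xi> * g \<xi>)"
  by (rule integrable_bounded_mult[where B = "measure \<nu> UNIV"]) (use cos_char_abs_le in auto)

lemma cos_transform_mixture_L1:
  assumes g: "integrable lborel g"
  shows "(\<integral>\<^sup>+x. ennreal \<bar>cos_transform (\<lambda>\<xi>. cos_char \<nu> \<xi> * g \<xi>) x\<bar> \<partial>lborel)
    \<le> ennreal (measure \<nu> UNIV) * (\<integral>\<^sup>+x. ennreal \<bar>cos_transform g x\<bar> \<partial>lborel)"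
proof -
  let ?f = "cos_transform g"
  have [measurable]: "g \<in> borel_measurable borel" using borel_measurable_integrable[OF g] by simp
  have sf: "sigma_finite_measure \<nu>" ..
  interpret P: pair_sigma_finite "lborel :: real measure" \<nu> by (intro pair_sigma_finite.intro sigma_finite_lborel sf)
  have "(\<integral>\<^sup>+x. ennreal \<bar>cos_transform (\<lambda>\<xi>. cos_char \<nu> \<xi> * g \<xi>) x\<bar> \<partial>lborel)
     \<le> (\<integral>\<^sup>+x. \<integral>\<^sup>+u. ennreal (\<bar>?f (x + u)\<bar> / 2) + ennreal (\<bar>?f (x - u)\<bar> / 2) \<partial>\<nu> \<partial>lborel)"
    unfolding cos_transform_mixture[OF g]
  proof (intro nn_integral_mono order_trans[OF ennreal_norm_integral_le])
    fix x u
    have "\<bar>(?f (x + u) + ?f (x - u)) / 2\<bar> \<le> \<bar>?f (x + u)\<bar> / 2 + \<bar>?f (x - u)\<bar> / 2"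
      by simp
    from ennreal_leI[OF this]
    show "ennreal \<bar>(?f (x + u) + ?f (x - u)) / 2\<bar> \<le> ennreal (\<bar>?f (x + u)\<bar> / 2) + ennreal (\<bar>?f (x - u)\<bar> / 2)"
      by (subst ennreal_plus[symmetric]) auto
  qed
  also have "\<dots> = (\<integral>\<^sup>+u. \<integral>\<^sup>+x. ennreal (\<bar>?f (x + u)\<bar> / 2) + ennreal (\<bar>?f (x - u)\<bar> / 2) \<partial>lborel \<partial>\<nu>)"
    by (rule P.Fubini'[symmetric]) measurable
  also have "\<dots> = (\<integral>\<^sup>+u. (\<integral>\<^sup>+x. ennreal \<bar>?f x\<bar> \<partial>lborel) \<partial>\<nu>)"
  proof (rule nn_integral_cong)
    fix u
    have "(\<integral>\<^sup>+x. ennreal (\<bar>?f (x + u)\<bar> / 2) + ennreal (\<bar>?f (x - u)\<bar> / 2) \<partial>lborel)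
       = (\<integral>\<^sup>+x. ennreal (\<bar>?f (x + u)\<bar> / 2) \<partial>lborel) + (\<integral>\<^sup>+x. ennreal (\<bar>?f (x + - u)\<bar> / 2) \<partial>lborel)"
      by (subst nn_integral_add) auto
    also have "\<dots> = (\<integral>\<^sup>+x. ennreal (\<bar>?f x\<bar> / 2) \<partial>lborel) + (\<integral>\<^sup>+x. ennreal (\<bar>?f x\<bar> / 2) \<partial>lborel)"
      by (subst (1 2) nn_integral_shift) auto
    also have "\<dots> = (\<integral>\<^sup>+x. ennreal \<bar>?f x\<bar> \<partial>lborel)"
      by (subst nn_integral_add[symmetric]) (auto simp: ennreal_plus[symmetric] simp del: ennreal_plus)
    finally show "(\<integral>\<^sup>+x. ennreal (\<bar>?f (x + u)\<bar> / 2) + ennreal (\<bar>?f (x - u)\<bar> / 2) \<partial>lborel) = (\<integral>\<^sup>+x. ennreal \<bar>?f x\<bar> \<partial>lborel)" .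
  qed
  also have "\<dots> = ennreal (measure \<nu> UNIV) * (\<integral>\<^sup>+x. ennreal \<bar>?f x\<bar> \<partial>lborel)"
    using emeasure_eq_measure[of UNIV] by (simp add: mult.commute)
  finally show ?thesis .
qed

lemma integrable_cos_char_power: "integrable lborel g \<Longrightarrow> integrable lborel (\<lambda>\<xi>. cos_char \<nu> \<xi> ^ k * g \<xi>)"
  by (induction k) (auto simp: mult.assoc dest: integrable_cos_char_mult)

lemma cos_transform_power_L1:
  assumes g: "integrable lborel g"
  shows "(\<integral>\<^sup>+x. ennreal \<bar>cos_transform (\<lambda>\<xi>. cos_char \<nu> \<xi> ^ k * g \<xi>) x\<bar> \<partial>lborel)
    \<le> ennreal (measure \<nu> UNIV ^ k) * (\<integral>\<^sup>+x. ennreal \<bar>cos_transform g x\<bar> \<partial>lborel)"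
proof (induction k)
  case (Suc k)
  have "(\<integral>\<^sup>+x. ennreal \<bar>cos_transform (\<lambda>\<xi>. cos_char \<nu> \<xi> ^ Suc k * g \<xi>) x\<bar> \<partial>lborel)
      = (\<integral>\<^sup>+x. ennreal \<bar>cos_transform (\<lambda>\<xi>. cos_char \<nu> \<xi> * (cos_char \<nu> \<xi> ^ k * g \<xi>)) x\<bar> \<partial>lborel)"
    by (simp add: mult.assoc)
  also have "\<dots> \<le> ennreal (measure \<nu> UNIV) * (\<integral>\<^sup>+x. ennreal \<bar>cos_transform (\<lambda>\<xi>. cos_char \<nu> \<xi> ^ k * g \<xi>) x\<bar> \<partial>lborel)"
    by (rule cos_transform_mixture_L1[OF integrable_cos_char_power[OF g]])
  also have "\<dots> \<le> ennreal (measure \<nu> UNIV) * (ennreal (measure \<nu> UNIV ^ k) * (\<integral>\<^sup>+x. ennreal \<bar>cos_transform g x\<bar> \<partial>lborel))"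
    by (intro mult_left_mono Suc) auto
  finally show ?case by (simp add: ennreal_mult mult.assoc)
qed simp

lemma cos_transform_power_nonneg:
  assumes g: "integrable lborel g" and pos: "\<And>x. 0 \<le> cos_transform g x"
  shows "0 \<le> cos_transform (\<lambda>\<xi>. cos_char \<nu> \<xi> ^ k * g \<xi>) x"
proof (induction k arbitrary: x)
  case (Suc k)
  have "cos_transform (\<lambda>\<xi>. cos_char \<nu> \<xi> ^ Suc k * g \<xi>) x
     = cos_transform (\<lambda>\<xi>. cos_char \<nu> \<xi> * (cos_char \<nu> \<xi> ^ k * g \<xi>)) x" by (simp add: mult.assoc)
  also have "\<dots> \<ge> 0"
    unfolding cos_transform_mixture[OF integrable_cos_char_power[OF g]]
    by (intro integral_nonneg_AE AE_I2 divide_nonneg_nonneg add_nonneg_nonneg Suc) auto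
  finally show ?case .
qed (simp add: pos)

text \<open>The exponential series of the factor \<open>exp (- t (N - cos_char \<nu> \<xi>))\<close>, with \<open>N\<close> the mass of \<open>\<nu>\<close>: a Poisson average
of iterated mixtures of translates.\<close>

lemma cos_transform_compound:
  assumes g: "integrable lborel g" and t: "t \<ge> 0"
  shows "(\<lambda>k. exp (- (t * measure \<nu> UNIV)) * (t ^ k / fact k) * cos_transform (\<lambda>\<xi>. cos_char \<nu> \<xi> ^ k * g \<xi>) x)
    sums cos_transform (\<lambda>\<xi>. exp (- (t * (measure \<nu> UNIV - cos_char \<nu> \<xi>))) * g \<xi>) x"
proof -
  let ?N = "measure \<nu> UNIV"
  let ?e = "exp (- (t * ?N))"
  let ?F = "\<lambda>k \<xi>. ?e * ((t * cos_char \<nu> \<xi>) ^ k /\<^sub>R fact k) * (cos (x * \<xi>) * g \<xi>)"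
  have G: "integrable lborel (\<lambda>\<xi>. cos (x * \<xi>) * g \<xi>)" by (rule integrable_cos_mult[OF g])
  have F_le: "\<bar>?F k \<xi>\<bar> \<le> ((t * ?N) ^ k /\<^sub>R fact k) * (?e * \<bar>cos (x * \<xi>) * g \<xi>\<bar>)" for k \<xi>
  proof -
    have "\<bar>t * cos_char \<nu> \<xi>\<bar> ^ k \<le> (t * ?N) ^ k"
      using t cos_char_abs_le[of \<xi>] by (intro power_mono) (auto simp: abs_mult intro!: mult_left_mono)
    then have "(\<bar>t * cos_char \<nu> \<xi>\<bar> ^ k /\<^sub>R fact k) * (?e * \<bar>cos (x * \<xi>) * g \<xi>\<bar>)
        \<le> ((t * ?N) ^ k /\<^sub>R fact k) * (?e * \<bar>cos (x * \<xi>) * g \<xi>\<bar>)"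
      by (intro mult_right_mono scaleR_left_mono) auto
    moreover have "\<bar>?F k \<xi>\<bar> = (\<bar>t * cos_char \<nu> \<xi>\<bar> ^ k /\<^sub>R fact k) * (?e * \<bar>cos (x * \<xi>) * g \<xi>\<bar>)"
      by (simp add: abs_mult power_abs)
    ultimately show ?thesis by simp
  qed
  have Fi: "integrable lborel (?F k)" for k
  proof (rule integrable_dominated[OF _ _ F_le])
    show "integrable lborel (\<lambda>\<xi>. ((t * ?N) ^ k /\<^sub>R fact k) * (?e * \<bar>cos (x * \<xi>) * g \<xi>\<bar>))"
      using G by (intro integrable_mult_right integrable_abs)
    show "?F k \<in> borel_measurable lborel" using borel_measurable_integrable[OF g] by measurable
  qed
  have S: "(\<lambda>k. integral\<^sup>L lborel (?F k)) sums (\<integral>\<xi>. (\<Sum>k. ?F k \<xi>) \<partial>lborel)"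
  proof (rule sums_integral[OF Fi])
    show "AE \<xi> in lborel. summable (\<lambda>k. norm (?F k \<xi>))"
    proof (rule AE_I2)
      fix \<xi>
      show "summable (\<lambda>k. norm (?F k \<xi>))"
      proof (rule summable_comparison_test'[where N = 0])
        show "summable (\<lambda>k. ((t * ?N) ^ k /\<^sub>R fact k) * (?e * \<bar>cos (x * \<xi>) * g \<xi>\<bar>))"
          by (intro summable_mult2 summable_exp_generic)
        show "norm (norm (?F k \<xi>)) \<le> ((t * ?N) ^ k /\<^sub>R fact k) * (?e * \<bar>cos (x * \<xi>) * g \<xi>\<bar>)" for k
          unfolding real_norm_def abs_idempotent by (rule F_le)
      qed
    qed
    show "summable (\<lambda>k. \<integral>\<xi>. norm (?F k \<xi>) \<partial>lborel)"
    proof (rule summable_comparison_test'[where N = 0])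
      show "summable (\<lambda>k. ((t * ?N) ^ k /\<^sub>R fact k) * (\<integral>\<xi>. ?e * \<bar>cos (x * \<xi>) * g \<xi>\<bar> \<partial>lborel))"
        by (intro summable_mult2 summable_exp_generic)
      fix k
      have Fn: "integrable lborel (\<lambda>\<xi>. norm (?F k \<xi>))" by (rule integrable_norm[OF Fi])
      have Gk: "integrable lborel (\<lambda>\<xi>. ((t * ?N) ^ k /\<^sub>R fact k) * (?e * \<bar>cos (x * \<xi>) * g \<xi>\<bar>))"
        using G by (intro integrable_mult_right integrable_abs)
      have "(\<integral>\<xi>. norm (?F k \<xi>) \<partial>lborel) \<le> (\<integral>\<xi>. ((t * ?N) ^ k /\<^sub>R fact k) * (?e * \<bar>cos (x * \<xi>) * g \<xi>\<bar>) \<partial>lborel)"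
        by (rule integral_mono[OF Fn Gk]) (unfold real_norm_def, rule F_le)
      also have "\<dots> = ((t * ?N) ^ k /\<^sub>R fact k) * (\<integral>\<xi>. ?e * \<bar>cos (x * \<xi>) * g \<xi>\<bar> \<partial>lborel)"
        by (rule integral_mult_right_zero)
      finally show "norm (\<integral>\<xi>. norm (?F k \<xi>) \<partial>lborel) \<le> ((t * ?N) ^ k /\<^sub>R fact k) * (\<integral>\<xi>. ?e * \<bar>cos (x * \<xi>) * g \<xi>\<bar> \<partial>lborel)"
        by (simp only: real_norm_def abs_of_nonneg integral_nonneg_AE) (simp add: integral_nonneg_AE)
    qed
  qed
  have E1: "(\<Sum>k. ?F k \<xi>) = cos (x * \<xi>) * (exp (- (t * (?N - cos_char \<nu> \<xi>))) * g \<xi>)" for \<xi>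
  proof -
    have "(\<lambda>k. ?F k \<xi>) sums (?e * exp (t * cos_char \<nu> \<xi>) * (cos (x * \<xi>) * g \<xi>))"
      by (intro sums_mult2 sums_mult exp_converges)
    then have "(\<Sum>k. ?F k \<xi>) = ?e * exp (t * cos_char \<nu> \<xi>) * (cos (x * \<xi>) * g \<xi>)"
      by (rule sums_unique[symmetric])
    also have "?e * exp (t * cos_char \<nu> \<xi>) = exp (- (t * (?N - cos_char \<nu> \<xi>)))"
      by (simp only: mult_exp_exp) (simp add: algebra_simps)
    finally show ?thesis by (simp only: mult.left_commute)
  qed
  have E2: "integral\<^sup>L lborel (?F k)
      = ?e * (t ^ k / fact k) * (\<integral>\<xi>. cos (x * \<xi>) * (cos_char \<nu> \<xi> ^ k * g \<xi>) \<partial>lborel)" for k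
  proof -
    have "?F k \<xi> = ?e * (t ^ k / fact k) * (cos (x * \<xi>) * (cos_char \<nu> \<xi> ^ k * g \<xi>))" for \<xi>
      by (simp add: power_mult_distrib divide_inverse)
    then show ?thesis by (simp only: integral_mult_right_zero)
  qed
  have "(\<lambda>k. ?e * (t ^ k / fact k) * (\<integral>\<xi>. cos (x * \<xi>) * (cos_char \<nu> \<xi> ^ k * g \<xi>) \<partial>lborel))
      sums (\<integral>\<xi>. cos (x * \<xi>) * (exp (- (t * (?N - cos_char \<nu> \<xi>))) * g \<xi>) \<partial>lborel)"
    using S unfolding E1 E2 .
  from sums_divide[OF this, of "2 * pi"] show ?thesis
    unfolding cos_transform_def by (simp only: times_divide_eq_right)
qed

lemma cos_transform_compound_nonneg:
  assumes g: "integrable lborel g" and t: "t \<ge> 0" and pos: "\<And>x. 0 \<le> cos_transform g x"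
  shows "0 \<le> cos_transform (\<lambda>\<xi>. exp (- (t * (measure \<nu> UNIV - cos_char \<nu> \<xi>))) * g \<xi>) x"
  by (rule sums_le[OF _ sums_zero cos_transform_compound[OF g t]])
     (intro mult_nonneg_nonneg divide_nonneg_nonneg cos_transform_power_nonneg[OF g pos], use t in simp_all)

text \<open>The \<open>k\<close>-th mixture multiplies the \<open>L\<^sup>1\<close> norm by at most \<open>N ^ k\<close>, and these factors sum to \<open>1\<close> against the weights
\<open>exp (- t N) t ^ k / fact k\<close>.\<close>

lemma cos_transform_compound_L1:
  assumes g: "integrable lborel g" and t: "t \<ge> 0"
  shows "(\<integral>\<^sup>+x. ennreal \<bar>cos_transform (\<lambda>\<xi>. exp (- (t * (measure \<nu> UNIV - cos_char \<nu> \<xi>))) * g \<xi>) x\<bar> \<partial>lborel)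
     \<le> (\<integral>\<^sup>+x. ennreal \<bar>cos_transform g x\<bar> \<partial>lborel)"
proof -
  let ?N = "measure \<nu> UNIV"
  let ?a = "\<lambda>k. exp (- (t * ?N)) * (t ^ k / fact k)"
  let ?f = "\<lambda>k. cos_transform (\<lambda>\<xi>. cos_char \<nu> \<xi> ^ k * g \<xi>)"
  let ?I = "\<integral>\<^sup>+x. ennreal \<bar>cos_transform g x\<bar> \<partial>lborel"
  have [measurable]: "g \<in> borel_measurable borel" using borel_measurable_integrable[OF g] by simp
  have a0: "?a k \<ge> 0" for k using t by simp
  have sums_le_nn: "ennreal \<bar>S\<bar> \<le> (\<Sum>k. ennreal \<bar>f k\<bar>)" if "f sums S" for f :: "nat \<Rightarrow> real" and S
  proof (rule LIMSEQ_le_const2)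
    show "(\<lambda>n. ennreal \<bar>\<Sum>k<n. f k\<bar>) \<longlonglongrightarrow> ennreal \<bar>S\<bar>"
      using that by (intro tendsto_ennrealI tendsto_rabs) (simp add: sums_def)
    have "ennreal \<bar>\<Sum>k<n. f k\<bar> \<le> (\<Sum>k. ennreal \<bar>f k\<bar>)" for n
    proof -
      have "ennreal \<bar>\<Sum>k<n. f k\<bar> \<le> ennreal (\<Sum>k<n. \<bar>f k\<bar>)" by (intro ennreal_leI sum_abs)
      also have "\<dots> = (\<Sum>k<n. ennreal \<bar>f k\<bar>)" by (simp add: sum_ennreal)
      also have "\<dots> \<le> (\<Sum>k. ennreal \<bar>f k\<bar>)" by (intro sum_le_suminf) auto
      finally show ?thesis .
    qed
    then show "\<exists>N. \<forall>n\<ge>N. ennreal \<bar>\<Sum>k<n. f k\<bar> \<le> (\<Sum>k. ennreal \<bar>f k\<bar>)" by blast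
  qed
  have "(\<integral>\<^sup>+x. ennreal \<bar>cos_transform (\<lambda>\<xi>. exp (- (t * (?N - cos_char \<nu> \<xi>))) * g \<xi>) x\<bar> \<partial>lborel)
      \<le> (\<integral>\<^sup>+x. (\<Sum>k. ennreal (?a k) * ennreal \<bar>?f k x\<bar>) \<partial>lborel)"
  proof (rule nn_integral_mono)
    fix x
    have "ennreal \<bar>?a k * ?f k x\<bar> = ennreal (?a k) * ennreal \<bar>?f k x\<bar>" for k
      by (simp only: abs_mult[of "?a k" "?f k x"] abs_of_nonneg[OF a0] ennreal_mult[OF a0 abs_ge_zero])
    then show "ennreal \<bar>cos_transform (\<lambda>\<xi>. exp (- (t * (?N - cos_char \<nu> \<xi>))) * g \<xi>) x\<bar>
       \<le> (\<Sum>k. ennreal (?a k) * ennreal \<bar>?f k x\<bar>)"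
      using sums_le_nn[OF cos_transform_compound[OF g t, of x]] by simp
  qed
  also have "\<dots> = (\<Sum>k. \<integral>\<^sup>+x. ennreal (?a k) * ennreal \<bar>?f k x\<bar> \<partial>lborel)"
    by (rule nn_integral_suminf) measurable
  also have "\<dots> = (\<Sum>k. ennreal (?a k) * (\<integral>\<^sup>+x. ennreal \<bar>?f k x\<bar> \<partial>lborel))"
    by (subst nn_integral_cmult) auto
  also have "\<dots> \<le> (\<Sum>k. ennreal (?a k) * (ennreal (?N ^ k) * ?I))"
    by (intro suminf_le mult_left_mono cos_transform_power_L1 g) auto
  also have "\<dots> = (\<Sum>k. ennreal (?a k * ?N ^ k) * ?I)"
    by (simp only: ennreal_mult[OF a0 zero_le_power[OF measure_nonneg]]) (simp only: mult.assoc)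
  also have "\<dots> = (\<Sum>k. ennreal (?a k * ?N ^ k)) * ?I" by simp
  finally have le: "(\<integral>\<^sup>+x. ennreal \<bar>cos_transform (\<lambda>\<xi>. exp (- (t * (?N - cos_char \<nu> \<xi>))) * g \<xi>) x\<bar> \<partial>lborel)
      \<le> (\<Sum>k. ennreal (?a k * ?N ^ k)) * ?I" .
  have "(\<Sum>k. ennreal (?a k * ?N ^ k)) = ennreal 1"
  proof (rule suminf_ennreal_eq)
    have "(\<lambda>k. exp (- (t * ?N)) * ((t * ?N) ^ k /\<^sub>R fact k)) sums (exp (- (t * ?N)) * exp (t * ?N))"
      by (intro sums_mult exp_converges)
    moreover have "exp (- (t * ?N)) * exp (t * ?N) = 1" by (simp add: exp_minus)
    moreover have "exp (- (t * ?N)) * ((t * ?N) ^ k /\<^sub>R fact k) = ?a k * ?N ^ k" for k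
      by (simp add: power_mult_distrib divide_inverse)
    ultimately show "(\<lambda>k. ?a k * ?N ^ k) sums 1" by simp
  qed (use t in auto)
  then show ?thesis using le by simp
qed

end

section \<open>Gaussian regularisation and Fourier inversion\<close>

lemma cos_std_normal: "(\<integral>x. cos (t * x) * std_normal_density x \<partial>lborel) = exp (- t\<^sup>2 / 2)"
proof -
  interpret real_distribution std_normal_distribution by (rule real_dist_normal_dist)
  have "exp (- t\<^sup>2 / 2) = Re (char std_normal_distribution t)"
    by (simp add: char_std_normal_distribution)
  also have "\<dots> = (\<integral>x. Re (iexp (t * x)) \<partial>std_normal_distribution)"
    unfolding char_def by (rule integral_Re[symmetric]) (rule integrable_iexp, simp_all)
  also have "\<dots> = (\<integral>x. std_normal_density x *\<^sub>R cos (t * x) \<partial>lborel)"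
    by (subst integral_density) (auto simp: Re_exp)
  finally show ?thesis by (simp add: mult.commute)
qed

definition gauss :: "real \<Rightarrow> real \<Rightarrow> real" where "gauss s \<xi> = exp (- (s * \<xi>)\<^sup>2 / 2)"

lemma gauss_bounds: "0 \<le> gauss s \<xi>" "gauss s \<xi> \<le> 1"
  by (auto simp: gauss_def)

lemma measurable_gauss [measurable]: "gauss s \<in> borel_measurable borel"
  unfolding gauss_def[abs_def] by measurable

lemma gauss_density: "gauss s \<xi> = sqrt (2 * pi) * std_normal_density (s * \<xi>)"
  by (simp add: gauss_def std_normal_density_def)

lemma integrable_std_normal: "integrable lborel std_normal_density"
  using normal_density_pos by (simp add: integrable_normal_density)

lemma integrable_gauss: "s > 0 \<Longrightarrow> integrable lborel (gauss s)"
  unfolding gauss_density[abs_def]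
  using lborel_integrable_real_affine[OF integrable_std_normal, of s 0]
  by (intro integrable_mult_right) simp

lemma cos_transform_gauss:
  assumes "s > 0" shows "cos_transform (gauss s) x = std_normal_density (x / s) / s"
proof -
  have "(\<integral>\<xi>. cos (x / s * \<xi>) * std_normal_density \<xi> \<partial>lborel)
     = s * (\<integral>\<xi>. cos (x * \<xi>) * std_normal_density (s * \<xi>) \<partial>lborel)"
    using lborel_integral_real_affine[of s "\<lambda>\<xi>. cos (x / s * \<xi>) * std_normal_density \<xi>" 0] assms by simp
  then have e: "(\<integral>\<xi>. cos (x * \<xi>) * std_normal_density (s * \<xi>) \<partial>lborel) = exp (- (x / s)\<^sup>2 / 2) / s"
    unfolding cos_std_normal using assms by (metis nonzero_mult_div_cancel_left less_irrefl)
  have "cos_transform (gauss s) x = sqrt (2 * pi) * (exp (- (x / s)\<^sup>2 / 2) / s) / (2 * pi)"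
    unfolding gauss_density[abs_def] cos_transform_cmult by (simp add: cos_transform_def e)
  also have "\<dots> = sqrt (2 * pi) / (2 * pi) * (exp (- (x / s)\<^sup>2 / 2) / s)" by (simp only: divide_inverse ac_simps)
  also have "sqrt (2 * pi) / (2 * pi) = 1 / sqrt (2 * pi)"
  proof -
    have "sqrt (2 * pi) * sqrt (2 * pi) = 2 * pi" by simp
    then show ?thesis by (metis nonzero_divide_mult_cancel_left pi_neq_zero real_sqrt_eq_zero_cancel_iff mult_eq_0_iff zero_neq_numeral)
  qed
  also have "1 / sqrt (2 * pi) * (exp (- (x / s)\<^sup>2 / 2) / s) = std_normal_density (x / s) / s"
    unfolding std_normal_density_def by (simp only: divide_inverse ac_simps)
  finally show ?thesis .
qed

lemma gauss_tendsto: "(\<lambda>n. gauss (1 / real (Suc n)) \<xi>) \<longlonglongrightarrow> 1"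
proof -
  have "(\<lambda>n. 1 / real (Suc n)) \<longlonglongrightarrow> 0"
    using LIMSEQ_inverse_real_of_nat by (simp add: inverse_eq_divide)
  then have "(\<lambda>n. exp (- (1 / real (Suc n) * \<xi>)\<^sup>2 / 2)) \<longlonglongrightarrow> exp (- (0 * \<xi>)\<^sup>2 / 2)"
    by (intro tendsto_intros) simp_all
  then show ?thesis by (simp add: gauss_def)
qed

text \<open>The factor \<open>gauss s z\<close> makes the double integral absolutely convergent, and Fubini turns the left-hand side into
an average of \<open>g\<close> around \<open>\<xi>\<close> over the width \<open>s\<close>. As \<open>s\<close> tends to \<open>0\<close> both sides converge by domination.\<close>

lemma fourier_inversion:
  assumes g: "integrable lborel g" and cont: "continuous_on UNIV g" and even: "\<And>\<xi>. g (- \<xi>) = g \<xi>"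
    and B: "\<And>\<xi>. \<bar>g \<xi>\<bar> \<le> B" and f: "integrable lborel (cos_transform g)"
  shows "(\<integral>z. cos (\<xi> * z) * cos_transform g z \<partial>lborel) = g \<xi>"
proof -
  have [measurable]: "g \<in> borel_measurable borel" using borel_measurable_integrable[OF g] by simp
  have regular: "(\<integral>z. cos (\<xi> * z) * cos_transform g z * gauss s z \<partial>lborel)
      = (\<integral>y. g (\<xi> + s * y) * std_normal_density y \<partial>lborel)" if s: "s > 0" for s
  proof -
    let ?F = "\<lambda>z \<eta>. cos (\<xi> * z) * gauss s z * (cos (z * \<eta>) * g \<eta>)"
    have "(\<integral>\<^sup>+z. \<integral>\<^sup>+\<eta>. ennreal \<bar>?F z \<eta>\<bar> \<partial>lborel \<partial>lborel)
        \<le> (\<integral>\<^sup>+z. \<integral>\<^sup>+\<eta>. ennreal (gauss s z) * ennreal \<bar>g \<eta>\<bar> \<partial>lborel \<partial>lborel)"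
    proof (intro nn_integral_mono)
      fix z \<eta>
      have "\<bar>cos (\<xi> * z)\<bar> * gauss s z * (\<bar>cos (z * \<eta>)\<bar> * \<bar>g \<eta>\<bar>) \<le> 1 * gauss s z * (1 * \<bar>g \<eta>\<bar>)"
        by (intro mult_mono) (auto simp: gauss_bounds)
      then show "ennreal \<bar>?F z \<eta>\<bar> \<le> ennreal (gauss s z) * ennreal \<bar>g \<eta>\<bar>"
        by (subst ennreal_mult[symmetric]) (auto simp: gauss_bounds abs_mult intro!: ennreal_leI)
    qed
    also have "\<dots> = (\<integral>\<^sup>+z. ennreal (gauss s z) \<partial>lborel) * (\<integral>\<^sup>+\<eta>. ennreal \<bar>g \<eta>\<bar> \<partial>lborel)"
      by (simp add: nn_integral_cmult nn_integral_multc)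
    also have "\<dots> < \<infinity>"
    proof -
      have "(\<integral>\<^sup>+\<eta>. ennreal \<bar>g \<eta>\<bar> \<partial>lborel) < \<top>" using g by (simp add: integrable_iff_bounded)
      moreover have "(\<integral>\<^sup>+z. ennreal (gauss s z) \<partial>lborel) < \<top>"
        using integrable_gauss[OF s] gauss_bounds(1) by (simp add: integrable_iff_bounded)
      ultimately show ?thesis by (simp add: ennreal_mult_less_top)
    qed
    finally have fin: "(\<integral>\<^sup>+z. \<integral>\<^sup>+\<eta>. ennreal \<bar>?F z \<eta>\<bar> \<partial>lborel \<partial>lborel) < \<infinity>" .
    have "(\<integral>z. cos (\<xi> * z) * cos_transform g z * gauss s z \<partial>lborel)
       = (\<integral>z. (\<integral>\<eta>. ?F z \<eta> \<partial>lborel) / (2 * pi) \<partial>lborel)"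
      by (intro Bochner_Integration.integral_cong) (simp_all add: cos_transform_def)
    also have "\<dots> = (\<integral>z. (\<integral>\<eta>. ?F z \<eta> \<partial>lborel) \<partial>lborel) / (2 * pi)" by simp
    also have "(\<integral>z. (\<integral>\<eta>. ?F z \<eta> \<partial>lborel) \<partial>lborel) = (\<integral>\<eta>. (\<integral>z. ?F z \<eta> \<partial>lborel) \<partial>lborel)"
      by (rule fubini_absolute(3)[OF sigma_finite_lborel sigma_finite_lborel _ fin]) measurable
    also have "(\<integral>\<eta>. (\<integral>z. ?F z \<eta> \<partial>lborel) \<partial>lborel) / (2 * pi)
       = (\<integral>\<eta>. g \<eta> * cos_transform (\<lambda>z. cos (\<xi> * z) * gauss s z) \<eta> \<partial>lborel)"
    proof -
      have "(\<integral>z. ?F z \<eta> \<partial>lborel) = g \<eta> * (\<integral>z. cos (\<eta> * z) * (cos (\<xi> * z) * gauss s z) \<partial>lborel)" for \<eta>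
        by (subst integral_mult_right_zero[symmetric], intro Bochner_Integration.integral_cong) (auto simp: ac_simps)
      then show ?thesis by (simp add: cos_transform_def)
    qed
    also have "\<dots> = (\<integral>\<eta>. g \<eta> * cos_transform (gauss s) (\<eta> + \<xi>) / 2 + g \<eta> * cos_transform (gauss s) (\<eta> - \<xi>) / 2 \<partial>lborel)"
    proof (intro Bochner_Integration.integral_cong refl)
      fix \<eta>
      show "g \<eta> * cos_transform (\<lambda>z. cos (\<xi> * z) * gauss s z) \<eta>
         = g \<eta> * cos_transform (gauss s) (\<eta> + \<xi>) / 2 + g \<eta> * cos_transform (gauss s) (\<eta> - \<xi>) / 2"
        using cos_transform_translates[OF integrable_gauss[OF s], of \<eta> \<xi>]
        by (simp add: add_divide_distrib[symmetric] distrib_left[symmetric])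
    qed
    also have "\<dots> = (\<integral>\<eta>. g \<eta> * cos_transform (gauss s) (\<eta> + \<xi>) / 2 \<partial>lborel) + (\<integral>\<eta>. g \<eta> * cos_transform (gauss s) (\<eta> - \<xi>) / 2 \<partial>lborel)"
    proof -
      have "integrable lborel (\<lambda>\<eta>. g \<eta> * cos_transform (gauss s) (\<eta> + a) / 2)" for a
      proof -
        have "integrable lborel (\<lambda>\<eta>. cos_transform (gauss s) (\<eta> + a) * g \<eta>)"
          by (rule integrable_bounded_mult[OF g _ cos_transform_abs_le[OF integrable_gauss[OF s]]]) measurable
        then show ?thesis by (simp add: mult.commute)
      qed
      from this[of \<xi>] this[of "- \<xi>"] show ?thesis by (subst Bochner_Integration.integral_add) auto
    qed
    also have "(\<integral>\<eta>. g \<eta> * cos_transform (gauss s) (\<eta> + \<xi>) / 2 \<partial>lborel) = (\<integral>\<eta>. g \<eta> * cos_transform (gauss s) (\<eta> - \<xi>) / 2 \<partial>lborel)"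
    proof -
      have "cos_transform (gauss s) (\<xi> - \<eta>) = cos_transform (gauss s) (\<eta> - \<xi>)" for \<eta>
        using cos_transform_even[of "gauss s" "\<xi> - \<eta>"] by simp
      then show ?thesis
        using integral_reflect[of "\<lambda>\<eta>. g \<eta> * cos_transform (gauss s) (\<eta> + \<xi>) / 2" 0] by (simp add: even)
    qed
    also have "(\<integral>\<eta>. g \<eta> * cos_transform (gauss s) (\<eta> - \<xi>) / 2 \<partial>lborel) + (\<integral>\<eta>. g \<eta> * cos_transform (gauss s) (\<eta> - \<xi>) / 2 \<partial>lborel)
       = (\<integral>\<eta>. g \<eta> * cos_transform (gauss s) (\<eta> - \<xi>) \<partial>lborel)" by simp
    also have "\<dots> = s * (\<integral>y. g (\<xi> + s * y) * cos_transform (gauss s) (s * y) \<partial>lborel)"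
      using s lborel_integral_real_affine[of s "\<lambda>\<eta>. g \<eta> * cos_transform (gauss s) (\<eta> - \<xi>)" \<xi>] by simp
    also have "\<dots> = (\<integral>y. g (\<xi> + s * y) * std_normal_density y \<partial>lborel)"
      using s by (simp add: cos_transform_gauss)
    finally show ?thesis .
  qed
  let ?s = "\<lambda>n. 1 / real (Suc n)"
  have "(\<lambda>n. \<integral>z. cos (\<xi> * z) * cos_transform g z * gauss (?s n) z \<partial>lborel) \<longlonglongrightarrow> (\<integral>z. cos (\<xi> * z) * cos_transform g z \<partial>lborel)"
  proof (rule integral_dominated_convergence[where w = "\<lambda>z. \<bar>cos_transform g z\<bar>"])
    show "AE z in lborel. (\<lambda>n. cos (\<xi> * z) * cos_transform g z * gauss (?s n) z) \<longlonglongrightarrow> cos (\<xi> * z) * cos_transform g z"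
    proof (intro AE_I2)
      fix z show "(\<lambda>n. cos (\<xi> * z) * cos_transform g z * gauss (?s n) z) \<longlonglongrightarrow> cos (\<xi> * z) * cos_transform g z"
        using tendsto_mult_left[OF gauss_tendsto[of z], of "cos (\<xi> * z) * cos_transform g z"] by simp
    qed
    show "AE z in lborel. norm (cos (\<xi> * z) * cos_transform g z * gauss (?s n) z) \<le> \<bar>cos_transform g z\<bar>" for n
    proof (intro AE_I2)
      fix z
      have "\<bar>cos (\<xi> * z)\<bar> * \<bar>cos_transform g z\<bar> * gauss (?s n) z \<le> 1 * \<bar>cos_transform g z\<bar> * 1"
        by (intro mult_mono) (auto simp: gauss_bounds)
      then show "norm (cos (\<xi> * z) * cos_transform g z * gauss (?s n) z) \<le> \<bar>cos_transform g z\<bar>"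
        by (simp add: abs_mult gauss_bounds)
    qed
  qed (use f in \<open>auto intro: integrable_abs\<close>)
  moreover have "(\<lambda>n. \<integral>y. g (\<xi> + ?s n * y) * std_normal_density y \<partial>lborel) \<longlonglongrightarrow> (\<integral>y. g \<xi> * std_normal_density y \<partial>lborel)"
  proof (rule integral_dominated_convergence[where w = "\<lambda>y. B * std_normal_density y"])
    show "integrable lborel (\<lambda>y. B * std_normal_density y)" using integrable_std_normal by simp
    show "AE y in lborel. (\<lambda>n. g (\<xi> + ?s n * y) * std_normal_density y) \<longlonglongrightarrow> g \<xi> * std_normal_density y"
    proof (intro AE_I2 tendsto_mult tendsto_const)
      fix y
      have "(\<lambda>n. \<xi> + ?s n * y) \<longlonglongrightarrow> \<xi> + 0 * y"
        using LIMSEQ_inverse_real_of_nat by (intro tendsto_intros) (simp add: inverse_eq_divide)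
      then show "(\<lambda>n. g (\<xi> + ?s n * y)) \<longlonglongrightarrow> g \<xi>"
        using cont by (auto simp: continuous_on_eq_continuous_at intro: isCont_tendsto_compose)
    qed
    show "AE y in lborel. norm (g (\<xi> + ?s n * y) * std_normal_density y) \<le> B * std_normal_density y" for n
      using B by (intro AE_I2) (auto simp: abs_mult intro!: mult_right_mono)
  qed measurable
  moreover have "(\<integral>y. g \<xi> * std_normal_density y \<partial>lborel) = g \<xi>" by simp
  ultimately show ?thesis
    using regular by (intro LIMSEQ_unique) auto
qed

text \<open>Writing out the transform of \<open>h\<close> and integrating over \<open>z\<close> first leaves the inversion integral of \<open>g\<close>.\<close>

lemma cos_transform_convolution:
  assumes g: "integrable lborel g" and cont: "continuous_on UNIV g" and even: "\<And>\<xi>. g (- \<xi>) = g \<xi>"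
    and B: "\<And>\<xi>. \<bar>g \<xi>\<bar> \<le> B" and f: "integrable lborel (cos_transform g)" and h: "integrable lborel h"
  shows "(\<integral>z. cos_transform g (x - z) * cos_transform h (z - y) \<partial>lborel) = cos_transform (\<lambda>\<xi>. g \<xi> * h \<xi>) (x - y)"
proof -
  have [measurable]: "g \<in> borel_measurable borel" "h \<in> borel_measurable borel"
    using borel_measurable_integrable[OF g] borel_measurable_integrable[OF h] by simp_all
  have odd: "(\<integral>w. sin (\<xi> * w) * cos_transform g w \<partial>lborel) = 0" for \<xi>
    using integral_reflect[of "\<lambda>w. sin (\<xi> * w) * cos_transform g w" 0] by (simp add: cos_transform_even)
  have inner: "(\<integral>z. cos_transform g (x - z) * cos ((z - y) * \<xi>) \<partial>lborel) = cos ((x - y) * \<xi>) * g \<xi>" for \<xi>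
  proof -
    have i: "integrable lborel (\<lambda>w. cos (\<xi> * w) * cos_transform g w)"
      "integrable lborel (\<lambda>w. sin (\<xi> * w) * cos_transform g w)"
      by (intro integrable_bounded_mult[OF f, where B = 1], simp, simp)+
    have "(\<integral>z. cos_transform g (x - z) * cos ((z - y) * \<xi>) \<partial>lborel)
        = (\<integral>w. cos_transform g w * cos ((x - w - y) * \<xi>) \<partial>lborel)"
      using integral_reflect[of "\<lambda>z. cos_transform g (x - z) * cos ((z - y) * \<xi>)" x] by simp
    also have "\<dots> = (\<integral>w. cos ((x - y) * \<xi>) * (cos (\<xi> * w) * cos_transform g w)
          + sin ((x - y) * \<xi>) * (sin (\<xi> * w) * cos_transform g w) \<partial>lborel)"
    proof (intro Bochner_Integration.integral_cong refl)
      fix w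
      have "(x - w - y) * \<xi> = (x - y) * \<xi> - \<xi> * w" by (simp add: algebra_simps)
      then show "cos_transform g w * cos ((x - w - y) * \<xi>) = cos ((x - y) * \<xi>) * (cos (\<xi> * w) * cos_transform g w)
          + sin ((x - y) * \<xi>) * (sin (\<xi> * w) * cos_transform g w)"
        by (simp only: cos_diff) (simp add: algebra_simps)
    qed
    also have "\<dots> = cos ((x - y) * \<xi>) * g \<xi>"
      using i by (subst Bochner_Integration.integral_add)
        (simp_all add: odd fourier_inversion[OF g cont even B f] del: integral_mult_left_zero)
    finally show ?thesis .
  qed
  let ?F = "\<lambda>z \<xi>. cos_transform g (x - z) * (cos ((z - y) * \<xi>) * h \<xi>)"
  have fr: "integrable lborel (\<lambda>z. cos_transform g (x - z))" by (rule integrable_reflect[OF f])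
  have "(\<integral>\<^sup>+z. \<integral>\<^sup>+\<xi>. ennreal \<bar>?F z \<xi>\<bar> \<partial>lborel \<partial>lborel)
      \<le> (\<integral>\<^sup>+z. \<integral>\<^sup>+\<xi>. ennreal \<bar>cos_transform g (x - z)\<bar> * ennreal \<bar>h \<xi>\<bar> \<partial>lborel \<partial>lborel)"
  proof (intro nn_integral_mono)
    fix z \<xi>
    have "\<bar>cos_transform g (x - z)\<bar> * (\<bar>cos ((z - y) * \<xi>)\<bar> * \<bar>h \<xi>\<bar>) \<le> \<bar>cos_transform g (x - z)\<bar> * (1 * \<bar>h \<xi>\<bar>)"
      by (intro mult_left_mono mult_right_mono) auto
    then show "ennreal \<bar>?F z \<xi>\<bar> \<le> ennreal \<bar>cos_transform g (x - z)\<bar> * ennreal \<bar>h \<xi>\<bar>"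
      by (subst ennreal_mult[symmetric]) (auto simp: abs_mult intro!: ennreal_leI)
  qed
  also have "\<dots> = (\<integral>\<^sup>+z. ennreal \<bar>cos_transform g (x - z)\<bar> \<partial>lborel) * (\<integral>\<^sup>+\<xi>. ennreal \<bar>h \<xi>\<bar> \<partial>lborel)"
    by (simp add: nn_integral_cmult nn_integral_multc)
  also have "\<dots> < \<infinity>"
  proof -
    have "(\<integral>\<^sup>+z. ennreal \<bar>cos_transform g (x - z)\<bar> \<partial>lborel) < \<top>" "(\<integral>\<^sup>+\<xi>. ennreal \<bar>h \<xi>\<bar> \<partial>lborel) < \<top>"
      using fr h by (simp_all add: integrable_iff_bounded)
    then show ?thesis by (simp add: ennreal_mult_less_top)
  qed
  finally have fin: "(\<integral>\<^sup>+z. \<integral>\<^sup>+\<xi>. ennreal \<bar>?F z \<xi>\<bar> \<partial>lborel \<partial>lborel) < \<infinity>" .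
  have "(\<integral>z. cos_transform g (x - z) * cos_transform h (z - y) \<partial>lborel)
     = (\<integral>z. (\<integral>\<xi>. ?F z \<xi> \<partial>lborel) \<partial>lborel) / (2 * pi)"
    by (simp add: cos_transform_def[of h])
  also have "(\<integral>z. (\<integral>\<xi>. ?F z \<xi> \<partial>lborel) \<partial>lborel) = (\<integral>\<xi>. (\<integral>z. ?F z \<xi> \<partial>lborel) \<partial>lborel)"
    by (rule fubini_absolute(3)[OF sigma_finite_lborel sigma_finite_lborel _ fin]) measurable
  also have "\<dots> = (\<integral>\<xi>. cos ((x - y) * \<xi>) * (g \<xi> * h \<xi>) \<partial>lborel)"
  proof (intro Bochner_Integration.integral_cong refl)
    fix \<xi>
    have "(\<integral>z. ?F z \<xi> \<partial>lborel) = h \<xi> * (\<integral>z. cos_transform g (x - z) * cos ((z - y) * \<xi>) \<partial>lborel)"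
      by (subst integral_mult_right_zero[symmetric], intro Bochner_Integration.integral_cong) (auto simp: ac_simps)
    then show "(\<integral>z. ?F z \<xi> \<partial>lborel) = cos ((x - y) * \<xi>) * (g \<xi> * h \<xi>)" by (simp add: inner)
  qed
  finally show ?thesis by (simp add: cos_transform_def)
qed

section \<open>Second differences of exponentials and products\<close>

lemma exp_taylor_abs: "\<bar>exp (- d) - 1 + d\<bar> \<le> d\<^sup>2 * max 1 (exp (- d :: real))"
proof (cases "d \<ge> 0")
  case True
  have "exp (- d) \<ge> 1 - d" using exp_ge_add_one_self[of "- d"] by simp
  moreover have "exp (- d) \<le> 1 / (1 + d)"
    unfolding exp_minus inverse_eq_divide
    using exp_ge_add_one_self[of d] True by (intro frac_le) auto
  moreover have "1 / (1 + d) - 1 + d \<le> d\<^sup>2"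
  proof -
    have "1 / (1 + d) - 1 + d = d\<^sup>2 / (1 + d)" using True by (simp add: field_simps power2_eq_square)
    also have "\<dots> \<le> d\<^sup>2 / 1" using True by (intro divide_left_mono) auto
    finally show ?thesis by simp
  qed
  moreover have "max 1 (exp (- d)) = 1" using True by simp
  ultimately show ?thesis by simp
next
  case False
  define x where "x = - d"
  have x: "x > 0" using False by (simp add: x_def)
  have "exp x \<ge> 1 + x" by (rule exp_ge_add_one_self)
  moreover have "exp x - 1 - x \<le> x\<^sup>2 * exp x"
  proof -
    have "(1 - x) * (1 + x) \<le> exp (- x) * (1 + x)"
      using exp_ge_add_one_self[of "- x"] x by (intro mult_right_mono) auto
    then have "1 - exp (- x) * (1 + x) \<le> x\<^sup>2" by (simp add: power2_eq_square algebra_simps)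
    then have "exp x * (1 - exp (- x) * (1 + x)) \<le> exp x * x\<^sup>2"
      by (rule mult_left_mono) simp
    moreover have "exp x * (1 - exp (- x) * (1 + x)) = exp x - exp x * exp (- x) * (1 + x)"
      by (simp only: right_diff_distrib mult_1_right mult.assoc)
    moreover have "exp x * exp (- x) = 1" by (simp add: mult_exp_exp)
    ultimately have "exp x - 1 * (1 + x) \<le> exp x * x\<^sup>2" by metis
    then show ?thesis by (simp add: mult.commute)
  qed
  moreover have "max 1 (exp (- d)) = exp x" using x by (simp add: x_def)
  ultimately show ?thesis by (simp add: x_def)
qed

lemma exp_lipschitz_max:
  assumes "exp (- a) \<le> M" "exp (- b) \<le> M"
  shows "\<bar>exp (- a) - exp (- b)\<bar> \<le> M * \<bar>a - (b::real)\<bar>"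
proof -
  have *: "exp (- a) - exp (- b) \<le> M * \<bar>a - b\<bar>" if "exp (- a) \<le> M" for a b :: real
  proof -
    have "exp (- a) - exp (- b) = exp (- a) * (1 - exp (a - b))"
      by (simp add: right_diff_distrib mult_exp_exp)
    also have "\<dots> \<le> exp (- a) * \<bar>a - b\<bar>"
    proof (rule mult_left_mono)
      show "1 - exp (a - b) \<le> \<bar>a - b\<bar>" using exp_ge_add_one_self[of "a - b"] by linarith
    qed simp
    also have "\<dots> \<le> M * \<bar>a - b\<bar>" using that by (intro mult_right_mono) auto
    finally show ?thesis .
  qed
  show ?thesis using *[OF assms(1), of b] *[OF assms(2), of a] by (simp add: abs_le_iff abs_minus_commute)
qed

text \<open>The discrete chain rule: second-order Taylor expansion of \<open>exp\<close> at \<open>- c\<close>.\<close>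

lemma exp_second_difference:
  assumes "exp (- a) \<le> M" "exp (- b) \<le> M" "exp (- c) \<le> (M::real)"
  shows "\<bar>exp (- a) + exp (- b) - 2 * exp (- c)\<bar> \<le> M * (\<bar>a + b - 2 * c\<bar> + (a - c)\<^sup>2 + (b - c)\<^sup>2)"
proof -
  have *: "\<bar>exp (- a) - exp (- c) + exp (- c) * (a - c)\<bar> \<le> M * (a - c)\<^sup>2" if "exp (- a) \<le> M" for a
  proof -
    have "exp (- a) - exp (- c) + exp (- c) * (a - c) = exp (- c) * (exp (- (a - c)) - 1 + (a - c))"
      by (simp add: algebra_simps mult_exp_exp)
    then have "\<bar>exp (- a) - exp (- c) + exp (- c) * (a - c)\<bar> = exp (- c) * \<bar>exp (- (a - c)) - 1 + (a - c)\<bar>"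
      by (simp add: abs_mult)
    also have "\<dots> \<le> exp (- c) * ((a - c)\<^sup>2 * max 1 (exp (- (a - c))))"
      by (intro mult_left_mono exp_taylor_abs) auto
    also have "\<dots> = (a - c)\<^sup>2 * max (exp (- c)) (exp (- a))"
      by (simp add: max_def mult_exp_exp)
    also have "\<dots> \<le> (a - c)\<^sup>2 * M" using that assms(3) by (intro mult_left_mono) auto
    finally show ?thesis by (simp add: mult.commute)
  qed
  have "exp (- a) + exp (- b) - 2 * exp (- c)
     = (exp (- a) - exp (- c) + exp (- c) * (a - c)) + (exp (- b) - exp (- c) + exp (- c) * (b - c)) - exp (- c) * (a + b - 2 * c)"
    by (simp add: algebra_simps)
  moreover have "\<bar>exp (- c) * (a + b - 2 * c)\<bar> \<le> M * \<bar>a + b - 2 * c\<bar>"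
    using assms(3) by (simp add: abs_mult mult_right_mono)
  ultimately show ?thesis using *[OF assms(1)] *[OF assms(2)] by (simp add: distrib_left)
qed

text \<open>The discrete Leibniz rule, with \<open>l\<close> the common size of the first differences.\<close>

lemma second_difference_product:
  fixes g0 :: real
  assumes "\<bar>g0\<bar> \<le> A * w" "\<bar>g1 - g0\<bar> \<le> A * l" "\<bar>g2 - g0\<bar> \<le> A * l" "\<bar>g1 + g2 - 2 * g0\<bar> \<le> A * s"
    and "\<bar>e0\<bar> \<le> M" "\<bar>e1 - e0\<bar> \<le> M * l" "\<bar>e2 - e0\<bar> \<le> M * l" "\<bar>e1 + e2 - 2 * e0\<bar> \<le> M * k"
    and "0 \<le> A" "0 \<le> M" "0 \<le> l" "0 \<le> w" "0 \<le> s"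
  shows "\<bar>g1 * e1 + g2 * e2 - 2 * (g0 * e0)\<bar> \<le> A * M * (s + w * k + 2 * l\<^sup>2)"
proof -
  have "g1 * e1 + g2 * e2 - 2 * (g0 * e0)
     = (g1 + g2 - 2 * g0) * e0 + g0 * (e1 + e2 - 2 * e0) + (g1 - g0) * (e1 - e0) + (g2 - g0) * (e2 - e0)"
    by (simp only: left_diff_distrib right_diff_distrib distrib_left distrib_right mult_2)
  moreover have "\<bar>(g1 + g2 - 2 * g0) * e0\<bar> \<le> (A * s) * M"
    unfolding abs_mult by (rule mult_mono) (rule assms | intro mult_nonneg_nonneg assms abs_ge_zero)+
  moreover have "\<bar>g0 * (e1 + e2 - 2 * e0)\<bar> \<le> (A * w) * (M * k)"
    unfolding abs_mult by (rule mult_mono) (rule assms | intro mult_nonneg_nonneg assms abs_ge_zero)+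
  moreover have "\<bar>(g1 - g0) * (e1 - e0)\<bar> \<le> (A * l) * (M * l)"
    unfolding abs_mult by (rule mult_mono) (rule assms | intro mult_nonneg_nonneg assms abs_ge_zero)+
  moreover have "\<bar>(g2 - g0) * (e2 - e0)\<bar> \<le> (A * l) * (M * l)"
    unfolding abs_mult by (rule mult_mono) (rule assms | intro mult_nonneg_nonneg assms abs_ge_zero)+
  ultimately have "\<bar>g1 * e1 + g2 * e2 - 2 * (g0 * e0)\<bar> \<le> (A * s) * M + (A * w) * (M * k) + (A * l) * (M * l) + (A * l) * (M * l)"
    by linarith
  then show ?thesis by (simp add: algebra_simps power2_eq_square)
qed

lemma cos_difference_le: "\<bar>cos ((\<xi> + v) * u) - cos (\<xi> * u)\<bar> \<le> (v\<^sup>2 / 2 + \<bar>\<xi> * v\<bar>) * (u::real)\<^sup>2"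
proof -
  have "cos ((\<xi> + v) * u) - cos (\<xi> * u) = - (cos (\<xi> * u) * (1 - cos (v * u))) - sin (\<xi> * u) * sin (v * u)"
    by (simp add: distrib_right cos_add algebra_simps)
  moreover have "\<bar>cos (\<xi> * u) * (1 - cos (v * u))\<bar> \<le> 1 * ((v * u)\<^sup>2 / 2)"
    unfolding abs_mult abs_one_minus_cos using one_minus_cos_le[of "v * u"]
    by (intro mult_mono) auto
  moreover have "\<bar>sin (\<xi> * u) * sin (v * u)\<bar> \<le> \<bar>\<xi> * u\<bar> * \<bar>v * u\<bar>"
    unfolding abs_mult[of "sin (\<xi> * u)"] by (intro mult_mono abs_sin_x_le_abs_x) auto
  moreover have "\<bar>\<xi> * u\<bar> * \<bar>v * u\<bar> = \<bar>\<xi> * v\<bar> * u\<^sup>2"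
    by (simp add: abs_mult power2_eq_square mult.assoc mult.left_commute)
  moreover have "(v\<^sup>2 / 2 + \<bar>\<xi> * v\<bar>) * u\<^sup>2 = 1 * ((v * u)\<^sup>2 / 2) + \<bar>\<xi> * v\<bar> * u\<^sup>2"
    by (simp add: distrib_right power_mult_distrib)
  ultimately show ?thesis by linarith
qed

section \<open>Splitting the Levy measure at the scale of the density\<close>

context growing_levy
begin

text \<open>The part of \<open>q\<close> that comes from jumps shorter than \<open>1 / r\<close>. At \<open>r = \<rho>\<^sub>t\<close> the remaining jumps have total mass
at most \<open>1 / t\<close>, so that \<open>t q\<close> and \<open>t\<close> times this part differ by at most \<open>2\<close>.\<close>

definition small_jumps :: "real \<Rightarrow> real \<Rightarrow> real" where
  "small_jumps r \<xi> = (\<integral>u. indicator {u. \<bar>u\<bar> < 1 / r} u * (1 - cos (\<xi> * u)) \<partial>\<mu>)"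

definition large_jumps :: "real \<Rightarrow> real measure" where
  "large_jumps r = density \<mu> (\<lambda>u. ennreal (indicator {u. 1 / r \<le> \<bar>u\<bar>} u))"

lemma sets_large_jumps [simp, measurable_cong]: "sets (large_jumps r) = sets borel"
  by (simp add: large_jumps_def)

lemma emeasure_large_jumps: "emeasure (large_jumps r) UNIV = emeasure \<mu> {u. 1 / r \<le> \<bar>u\<bar>}"
  unfolding large_jumps_def by (subst emeasure_density) (auto simp: ennreal_indicator)

lemma finite_large_jumps: "r > 0 \<Longrightarrow> finite_measure (large_jumps r)"
  using emeasure_away_finite[of "1 / r"]
  by (intro finite_measureI) (auto simp: emeasure_large_jumps space_nu large_jumps_def less_top emeasure_density ennreal_indicator)

lemma large_jumps_mass: "r > 0 \<Longrightarrow> measure (large_jumps r) UNIV \<le> levy_qU \<mu> r"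
  using measure_away_le_qU[of "1 / r"] qU_nonneg
  by (simp add: measure_def emeasure_large_jumps enn2real_leI)

lemma integrable_indicator_mult:
  "integrable \<mu> f \<Longrightarrow> A \<in> sets borel \<Longrightarrow> integrable \<mu> (\<lambda>u. indicator A u * f u :: real)"
  by (rule integrable_bounded_mult[where B = 1]) (auto simp: indicator_def)

lemma q_split:
  assumes r: "r > 0"
  shows "levy_q \<mu> \<xi> = small_jumps r \<xi> + (measure (large_jumps r) UNIV - cos_char (large_jumps r) \<xi>)"
proof -
  let ?A = "{u. 1 / r \<le> \<bar>u\<bar>}"
  have iA: "integrable \<mu> (indicator ?A :: real \<Rightarrow> real)"
    using emeasure_away_finite[of "1 / r"] r by (intro integrable_real_indicator) auto
  have iAc: "integrable \<mu> (\<lambda>u. indicator ?A u * cos (u * \<xi>))"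
    using integrable_bounded_mult[OF iA, of "\<lambda>u. cos (u * \<xi>)" 1] by (simp add: mult.commute)
  have "measure (large_jumps r) UNIV = (\<integral>u. indicator ?A u \<partial>\<mu>)"
    by (simp add: measure_def emeasure_large_jumps)
  moreover have "cos_char (large_jumps r) \<xi> = (\<integral>u. indicator ?A u * cos (u * \<xi>) \<partial>\<mu>)"
    unfolding cos_char_def large_jumps_def by (subst integral_density) auto
  ultimately have "small_jumps r \<xi> + (measure (large_jumps r) UNIV - cos_char (large_jumps r) \<xi>)
     = (\<integral>u. indicator {u. \<bar>u\<bar> < 1 / r} u * (1 - cos (\<xi> * u)) + (indicator ?A u - indicator ?A u * cos (u * \<xi>)) \<partial>\<mu>)"
    unfolding small_jumps_def using iA iAc integrable_indicator_mult[OF integrable_q[of \<xi>]]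
    by (subst Bochner_Integration.integral_add) auto
  also have "\<dots> = levy_q \<mu> \<xi>"
    unfolding levy_q_def by (intro Bochner_Integration.integral_cong) (auto simp: indicator_def mult.commute)
  finally show ?thesis by simp
qed

lemma measurable_small_jumps [measurable]: "small_jumps r \<in> borel_measurable borel"
proof -
  interpret sigma_finite_measure \<mu> by (rule sigma_finite_mu)
  show ?thesis unfolding small_jumps_def[abs_def] by measurable
qed

definition small_moment :: "real \<Rightarrow> real" where
  "small_moment r = (\<integral>u. indicator {u. \<bar>u\<bar> < 1 / r} u * u\<^sup>2 \<partial>\<mu>)"

lemma small_square_le: "(r::real) > 0 \<Longrightarrow> indicator {u. \<bar>u\<bar> < 1 / r} u * u\<^sup>2 \<le> min ((r * u)\<^sup>2) 1 / r\<^sup>2"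
proof -
  assume r: "r > 0"
  have "(r * u)\<^sup>2 \<le> 1" if "\<bar>u\<bar> < 1 / r"
  proof -
    have "\<bar>r * u\<bar> \<le> 1" using that r by (simp add: abs_mult field_simps)
    then show ?thesis by (simp add: abs_square_le_1)
  qed
  then show ?thesis using r by (auto simp: indicator_def min_def field_simps power_mult_distrib)
qed

lemma integrable_small_square: "r > 0 \<Longrightarrow> integrable \<mu> (\<lambda>u. indicator {u. \<bar>u\<bar> < 1 / r} u * u\<^sup>2)"
  by (rule integrable_dominated[where g = "\<lambda>u. min ((r * u)\<^sup>2) 1 / r\<^sup>2"])
     (use integrable_qU small_square_le[of r] in auto)

text \<open>At \<open>r = \<rho>\<^sub>t\<close> this says that \<open>t\<close> times the second moment of the small jumps is at most \<open>1 / \<rho>\<^sub>t\<^sup>2\<close>. It is the only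
information on \<open>\<mu>\<close> that enters the first and second differences below.\<close>

lemma small_moment_le: "r > 0 \<Longrightarrow> small_moment r \<le> levy_qU \<mu> r / r\<^sup>2"
proof -
  assume r: "r > 0"
  have "small_moment r \<le> (\<integral>u. min ((r * u)\<^sup>2) 1 / r\<^sup>2 \<partial>\<mu>)"
    unfolding small_moment_def
    by (rule integral_mono) (use integrable_small_square integrable_qU small_square_le r in auto)
  then show ?thesis by (simp add: levy_qU_def)
qed

lemma small_jumps_difference:
  assumes r: "r > 0"
  shows "\<bar>small_jumps r (\<xi> + v) - small_jumps r \<xi>\<bar> \<le> (v\<^sup>2 / 2 + \<bar>\<xi> * v\<bar>) * small_moment r"
proof -
  let ?i = "indicator {u. \<bar>u\<bar> < 1 / r} :: real \<Rightarrow> real"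
  note I = integrable_indicator_mult[OF integrable_q, of "{u. \<bar>u\<bar> < 1 / r}"]
  have eq: "small_jumps r (\<xi> + v) - small_jumps r \<xi>
      = (\<integral>u. ?i u * (1 - cos ((\<xi> + v) * u)) - ?i u * (1 - cos (\<xi> * u)) \<partial>\<mu>)"
    unfolding small_jumps_def using I by (subst Bochner_Integration.integral_diff) auto
  have "\<bar>\<integral>u. ?i u * (1 - cos ((\<xi> + v) * u)) - ?i u * (1 - cos (\<xi> * u)) \<partial>\<mu>\<bar> \<le> (\<integral>u. (v\<^sup>2 / 2 + \<bar>\<xi> * v\<bar>) * (?i u * u\<^sup>2) \<partial>\<mu>)"
  proof (rule order_trans[OF integral_abs_bound], rule integral_mono)
    show "integrable \<mu> (\<lambda>u. \<bar>?i u * (1 - cos ((\<xi> + v) * u)) - ?i u * (1 - cos (\<xi> * u))\<bar>)"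
      by (intro integrable_abs Bochner_Integration.integrable_diff I) auto
    show "integrable \<mu> (\<lambda>u. (v\<^sup>2 / 2 + \<bar>\<xi> * v\<bar>) * (?i u * u\<^sup>2))"
      using integrable_small_square[OF r] by (intro integrable_mult_right)
    fix u
    have e: "?i u * (1 - cos ((\<xi> + v) * u)) - ?i u * (1 - cos (\<xi> * u)) = - (?i u * (cos ((\<xi> + v) * u) - cos (\<xi> * u)))"
      by (simp add: right_diff_distrib)
    have "?i u * \<bar>cos ((\<xi> + v) * u) - cos (\<xi> * u)\<bar> \<le> ?i u * ((v\<^sup>2 / 2 + \<bar>\<xi> * v\<bar>) * u\<^sup>2)"
      by (intro mult_left_mono cos_difference_le) auto
    then show "\<bar>?i u * (1 - cos ((\<xi> + v) * u)) - ?i u * (1 - cos (\<xi> * u))\<bar> \<le> (v\<^sup>2 / 2 + \<bar>\<xi> * v\<bar>) * (?i u * u\<^sup>2)"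
      unfolding e abs_minus_cancel abs_mult[of "?i u"] abs_of_nonneg[OF indicator_pos_le] by (simp only: ac_simps)
  qed
  also have "\<dots> = (v\<^sup>2 / 2 + \<bar>\<xi> * v\<bar>) * small_moment r"
    unfolding small_moment_def by (rule integral_mult_right_zero)
  finally show ?thesis unfolding eq .
qed

lemma small_jumps_second_difference:
  assumes r: "r > 0"
  shows "\<bar>small_jumps r (\<xi> + v) + small_jumps r (\<xi> - v) - 2 * small_jumps r \<xi>\<bar> \<le> v\<^sup>2 * small_moment r"
proof -
  let ?i = "indicator {u. \<bar>u\<bar> < 1 / r} :: real \<Rightarrow> real"
  let ?D = "\<lambda>u. ?i u * (1 - cos ((\<xi> + v) * u)) + ?i u * (1 - cos ((\<xi> - v) * u)) - 2 * (?i u * (1 - cos (\<xi> * u)))"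
  note I = integrable_indicator_mult[OF integrable_q, of "{u. \<bar>u\<bar> < 1 / r}"]
  have eq: "small_jumps r (\<xi> + v) + small_jumps r (\<xi> - v) - 2 * small_jumps r \<xi> = (\<integral>u. ?D u \<partial>\<mu>)"
  proof -
    have I1: "integrable \<mu> (\<lambda>u. ?i u * (1 - cos ((\<xi> + v) * u)))" "integrable \<mu> (\<lambda>u. ?i u * (1 - cos ((\<xi> - v) * u)))"
      "integrable \<mu> (\<lambda>u. 2 * (?i u * (1 - cos (\<xi> * u))))"
      by (intro integrable_mult_right I, simp)+
    show ?thesis
      unfolding small_jumps_def integral_mult_right_zero[symmetric]
        Bochner_Integration.integral_add[OF I1(1,2), symmetric]
      by (rule Bochner_Integration.integral_diff[OF Bochner_Integration.integrable_add[OF I1(1,2)] I1(3), symmetric])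
  qed
  have "\<bar>\<integral>u. ?D u \<partial>\<mu>\<bar> \<le> (\<integral>u. v\<^sup>2 * (?i u * u\<^sup>2) \<partial>\<mu>)"
  proof (rule order_trans[OF integral_abs_bound], rule integral_mono)
    show "integrable \<mu> (\<lambda>u. \<bar>?D u\<bar>)"
      by (intro integrable_abs Bochner_Integration.integrable_diff Bochner_Integration.integrable_add integrable_mult_right I) auto
    show "integrable \<mu> (\<lambda>u. v\<^sup>2 * (?i u * u\<^sup>2))"
      using integrable_small_square[OF r] by (intro integrable_mult_right)
    fix u
    have e: "?D u = ?i u * (2 * cos (\<xi> * u) * (1 - cos (v * u)))"
    proof -
      have "cos ((\<xi> + v) * u) = cos (\<xi> * u) * cos (v * u) - sin (\<xi> * u) * sin (v * u)"
        "cos ((\<xi> - v) * u) = cos (\<xi> * u) * cos (v * u) + sin (\<xi> * u) * sin (v * u)"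
        by (simp_all only: distrib_right left_diff_distrib cos_add cos_diff)
      then show ?thesis by (simp only:) (simp add: right_diff_distrib left_diff_distrib distrib_left)
    qed
    have "\<bar>cos (\<xi> * u)\<bar> * (1 - cos (v * u)) \<le> 1 * ((v * u)\<^sup>2 / 2)"
      using one_minus_cos_le[of "v * u"] by (intro mult_mono) auto
    then have "\<bar>2 * cos (\<xi> * u) * (1 - cos (v * u))\<bar> \<le> v\<^sup>2 * u\<^sup>2"
      by (simp add: abs_mult abs_one_minus_cos power_mult_distrib)
    then have "?i u * \<bar>2 * cos (\<xi> * u) * (1 - cos (v * u))\<bar> \<le> ?i u * (v\<^sup>2 * u\<^sup>2)"
      by (rule mult_left_mono) simp
    then show "\<bar>?D u\<bar> \<le> v\<^sup>2 * (?i u * u\<^sup>2)"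
      unfolding e abs_mult[of "?i u"] abs_of_nonneg[OF indicator_pos_le] by (simp only: ac_simps)
  qed
  also have "\<dots> = v\<^sup>2 * small_moment r"
    unfolding small_moment_def by (rule integral_mult_right_zero)
  finally show ?thesis unfolding eq .
qed

lemma shift_comparable:
  assumes "\<bar>s\<bar> \<le> pi" shows "1 + \<eta>\<^sup>2 \<le> 33 * (1 + (\<eta> + s :: real)\<^sup>2)"
proof -
  have "s\<^sup>2 \<le> 4\<^sup>2" using assms pi_less_4 by (intro abs_le_square_iff[THEN iffD1]) auto
  then have "s\<^sup>2 \<le> 16" by simp
  moreover have "\<eta>\<^sup>2 \<le> 2 * (\<eta> + s)\<^sup>2 + 2 * s\<^sup>2"
    using zero_le_power2[of "\<eta> + 2 * s"] by (simp add: power2_eq_square algebra_simps)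
  moreover have "0 \<le> (\<eta> + s)\<^sup>2" by simp
  ultimately show ?thesis by (simp only: distrib_left)
qed

text \<open>Collects the terms of the Leibniz rule, where \<open>a\<close> stands for \<open>(v / r)\<^sup>2\<close>, \<open>w\<close> for \<open>1 + (\<xi> / r)\<^sup>2\<close> and \<open>L\<close> for
the square of the first differences.\<close>

lemma second_difference_weight:
  assumes "1 \<le> w" "0 \<le> (a::real)" "L \<le> a * (8 * w)"
  shows "a + w * (a + 2 * L) + 2 * L \<le> 34 * a * (w * w)"
proof -
  have 1: "a * 1 \<le> a * w" using assms by (intro mult_left_mono)
  have 2: "a * w * 1 \<le> a * w * w" using assms by (intro mult_left_mono) auto
  have "w * L \<le> w * (a * (8 * w))" using assms by (intro mult_left_mono) auto
  then have 3: "w * L \<le> 8 * (a * w * w)" by (simp add: ac_simps)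
  have "a + w * (a + 2 * L) + 2 * L = a + a * w + 2 * (w * L) + 2 * L" by (simp add: algebra_simps)
  then show ?thesis using 1 2 3 assms(3) by simp
qed

text \<open>A multiplier that behaves at the frequency scale \<open>r\<close> like a quadratic polynomial with coefficients of size \<open>A\<close>.
The two instances are the constant \<open>1\<close> and \<open>2 (1 - cos (u \<xi>))\<close>, which produce the density and its second difference.
Steps up to \<open>pi r\<close> are those on which \<open>cos_transform_decay\<close> relies.\<close>

definition quadratic_symbol :: "real \<Rightarrow> real \<Rightarrow> (real \<Rightarrow> real) \<Rightarrow> bool" where
  "quadratic_symbol r A g \<longleftrightarrow> g \<in> borel_measurable borel \<and> 0 \<le> A \<and>
     (\<forall>\<xi>. \<bar>g \<xi>\<bar> \<le> A * (1 + (\<xi> / r)\<^sup>2)) \<and>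
     (\<forall>\<xi> v. \<bar>v\<bar> \<le> pi * r \<longrightarrow> \<bar>g (\<xi> + v) - g \<xi>\<bar> \<le> A * (\<bar>v / r\<bar> * (2 + \<bar>\<xi> / r\<bar>))) \<and>
     (\<forall>\<xi> v. \<bar>g (\<xi> + v) + g (\<xi> - v) - 2 * g \<xi>\<bar> \<le> A * (v / r)\<^sup>2)"

text \<open>The exponential decays like \<open>(1 + (\<xi> / r)\<^sup>2) ^ -3\<close>. One power of the weight is spent on the growth of \<open>g\<close>
and one on the squares of first differences; the last one is the decay that \<open>cos_transform_decay\<close> asks for.\<close>

lemma small_jumps_transform:
  "\<exists>C>0. \<forall>t. 0 < t \<longrightarrow> t \<le> 1 \<longrightarrow> (\<forall>g A. quadratic_symbol (levy_rho \<mu> t) A g \<longrightarrow>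
     integrable lborel (\<lambda>\<xi>. g \<xi> * exp (- (t * small_jumps (levy_rho \<mu> t) \<xi>))) \<and>
     (\<integral>\<^sup>+x. ennreal \<bar>cos_transform (\<lambda>\<xi>. g \<xi> * exp (- (t * small_jumps (levy_rho \<mu> t) \<xi>))) x\<bar> \<partial>lborel) \<le> ennreal (C * A))"
proof -
  from exp_tq_decay[of 3] obtain K where K: "K > 0" and
    K': "\<forall>t. 0 < t \<longrightarrow> t \<le> 1 \<longrightarrow> (\<forall>\<xi>. exp (- (t * levy_q \<mu> \<xi>)) \<le> K / (1 + (\<xi> / levy_rho \<mu> t)\<^sup>2) ^ 3)"
    by (elim exE conjE)
  define C0 where "C0 = exp 2 * K * 33 ^ 3"
  have C0: "C0 > 0" using K by (simp add: C0_def)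
  have "integrable lborel (\<lambda>\<xi>. g \<xi> * exp (- (t * small_jumps r \<xi>))) \<and>
     (\<integral>\<^sup>+x. ennreal \<bar>cos_transform (\<lambda>\<xi>. g \<xi> * exp (- (t * small_jumps r \<xi>))) x\<bar> \<partial>lborel) \<le> ennreal (4 * pi * (34 * C0) * A)"
    if t: "0 < t" "t \<le> 1" and r_def: "r = levy_rho \<mu> t" and sym: "quadratic_symbol r A g"
    for t r g A
  proof -
    from sym have [measurable]: "g \<in> borel_measurable borel" and A: "0 \<le> A"
      and g0: "\<And>\<xi>. \<bar>g \<xi>\<bar> \<le> A * (1 + (\<xi> / r)\<^sup>2)"
      and g1: "\<And>\<xi> v. \<bar>v\<bar> \<le> pi * r \<Longrightarrow> \<bar>g (\<xi> + v) - g \<xi>\<bar> \<le> A * (\<bar>v / r\<bar> * (2 + \<bar>\<xi> / r\<bar>))"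
      and g2: "\<And>\<xi> v. \<bar>g (\<xi> + v) + g (\<xi> - v) - 2 * g \<xi>\<bar> \<le> A * (v / r)\<^sup>2"
      by (simp_all add: quadratic_symbol_def)
    let ?e = "\<lambda>\<xi>. exp (- (t * small_jumps r \<xi>))"
    let ?w = "\<lambda>\<xi>. 1 + (\<xi> / r)\<^sup>2"
    let ?h = "\<lambda>\<xi>. g \<xi> * ?e \<xi>"
    have r: "r > 0" unfolding r_def using rho_greatest t by auto
    have w1: "?w \<xi> \<ge> 1" for \<xi> by simp
    have w0: "?w \<xi> > 0" for \<xi> using w1[of \<xi>] by linarith
    have mom: "t * small_moment r \<le> 1 / r\<^sup>2"
    proof -
      have "t * small_moment r \<le> t * (levy_qU \<mu> r / r\<^sup>2)" using t by (intro mult_left_mono small_moment_le r) auto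
      then show ?thesis using t by (simp add: r_def rho_greatest)
    qed
    have e_le: "?e \<xi> \<le> exp 2 * K / ?w \<xi> ^ 3" for \<xi>
    proof -
      interpret nu: finite_measure "large_jumps r" by (rule finite_large_jumps[OF r])
      have N: "measure (large_jumps r) UNIV \<le> 1 / t"
        using large_jumps_mass[OF r] t by (simp add: r_def rho_greatest)
      have "- cos_char (large_jumps r) \<xi> \<le> measure (large_jumps r) UNIV"
        using cos_char_abs_le[OF finite_large_jumps[OF r] sets_large_jumps, of \<xi>] by linarith
      then have "levy_q \<mu> \<xi> \<le> small_jumps r \<xi> + 2 / t" using q_split[OF r, of \<xi>] N by simp
      then have "t * levy_q \<mu> \<xi> \<le> t * (small_jumps r \<xi> + 2 / t)" using t by (intro mult_left_mono) auto
      also have "\<dots> = t * small_jumps r \<xi> + 2" using t by (simp add: distrib_left)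
      finally have "?e \<xi> \<le> exp (2 + - (t * levy_q \<mu> \<xi>))" by simp
      also have "\<dots> = exp 2 * exp (- (t * levy_q \<mu> \<xi>))" by (rule exp_add)
      also have "\<dots> \<le> exp 2 * (K / ?w \<xi> ^ 3)"
        unfolding r_def using K' t by (intro mult_left_mono) auto
      finally show ?thesis by simp
    qed
    \<comment> \<open>Shifts of length up to \<open>pi r\<close> change the weight by a factor of at most \<open>33\<close>.\<close>
    have e_shift: "?e (\<xi> + v) \<le> C0 / ?w \<xi> ^ 3" if v: "\<bar>v\<bar> \<le> pi * r" for \<xi> v
    proof -
      have "\<bar>v / r\<bar> \<le> pi" using v r by (simp add: field_simps)
      from shift_comparable[OF this, of "\<xi> / r"] have "?w \<xi> \<le> 33 * ?w (\<xi> + v)" by (simp add: add_divide_distrib)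
      then have "?w \<xi> ^ 3 \<le> (33 * ?w (\<xi> + v)) ^ 3" using w0[of \<xi>] by (intro power_mono) auto
      then have "?w \<xi> ^ 3 \<le> 33 ^ 3 * ?w (\<xi> + v) ^ 3" by (simp only: power_mult_distrib)
      then have "exp 2 * K * ?w \<xi> ^ 3 \<le> exp 2 * K * (33 ^ 3 * ?w (\<xi> + v) ^ 3)"
        using K by (intro mult_left_mono) auto
      then have "exp 2 * K / ?w (\<xi> + v) ^ 3 \<le> C0 / ?w \<xi> ^ 3"
        using zero_less_power[OF w0[of \<xi>], of 3] zero_less_power[OF w0[of "\<xi> + v"], of 3]
        by (simp only: C0_def pos_divide_le_eq times_divide_eq_left pos_le_divide_eq mult.assoc)
      then show ?thesis using e_le[of "\<xi> + v"] by linarith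
    qed
    have h0: "\<bar>?h \<xi>\<bar> \<le> (34 * C0 * A) / ?w \<xi>" for \<xi>
    proof -
      have "\<bar>?h \<xi>\<bar> \<le> (A * ?w \<xi>) * (C0 / ?w \<xi> ^ 3)"
        unfolding abs_mult using e_shift[of 0 \<xi>] r A w0[of \<xi>] by (intro mult_mono g0) auto
      also have "\<dots> = A * C0 / (?w \<xi> * ?w \<xi>)"
        using w0[of \<xi>] by (simp add: power3_eq_cube)
      also have "\<dots> \<le> A * C0 / ?w \<xi>"
      proof (rule divide_left_mono)
        show "?w \<xi> \<le> ?w \<xi> * ?w \<xi>" using mult_right_mono[OF w1[of \<xi>], of "?w \<xi>"] w0[of \<xi>] by simp
        show "0 \<le> A * C0" using A C0 by simp
        show "0 < ?w \<xi> * ?w \<xi> * ?w \<xi>" using w0[of \<xi>] by (intro mult_pos_pos)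
      qed
      also have "\<dots> \<le> (34 * C0 * A) / ?w \<xi>"
      proof -
        have "0 \<le> C0 * A" using A C0 by simp
        then have "A * C0 \<le> 34 * C0 * A" by (simp add: mult.commute)
        then show ?thesis using w0[of \<xi>] by (intro divide_right_mono) auto
      qed
      finally show ?thesis .
    qed
    have h2: "\<bar>?h (\<xi> + v) + ?h (\<xi> - v) - 2 * ?h \<xi>\<bar> \<le> (34 * C0 * A) * (v / r)\<^sup>2 / ?w \<xi>" if v: "\<bar>v\<bar> \<le> pi * r" for \<xi> v
    proof -
      let ?s = "v / r" and ?w' = "?w \<xi>" and ?M = "C0 / ?w \<xi> ^ 3"
      let ?l = "\<bar>?s\<bar> * (2 + \<bar>\<xi> / r\<bar>)"
      let ?f = "\<lambda>\<xi>. t * small_jumps r \<xi>"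
      have v': "\<bar>- v\<bar> \<le> pi * r" using v by simp
      have s: "\<bar>?s\<bar> \<le> 4" 
      proof -
        have "\<bar>?s\<bar> \<le> pi" using v r by (simp add: abs_divide pos_divide_le_eq)
        then show ?thesis using pi_less_4 by linarith
      qed
      have M0: "?M \<ge> 0" using C0 w0[of \<xi>] by (intro divide_nonneg_pos zero_less_power) auto
      have E: "?e \<xi> \<le> ?M" "?e (\<xi> + v) \<le> ?M" "?e (\<xi> - v) \<le> ?M"
        using e_shift[of 0 \<xi>] e_shift[OF v, of \<xi>] e_shift[OF v', of \<xi>] r by simp_all
      have d1: "\<bar>?f (\<xi> + a) - ?f \<xi>\<bar> \<le> ?l" if a: "\<bar>a\<bar> = \<bar>v\<bar>" for a
      proof -
        have "\<bar>?f (\<xi> + a) - ?f \<xi>\<bar> = t * \<bar>small_jumps r (\<xi> + a) - small_jumps r \<xi>\<bar>"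
          using t by (simp add: right_diff_distrib[symmetric] abs_mult)
        also have "\<dots> \<le> t * ((a\<^sup>2 / 2 + \<bar>\<xi> * a\<bar>) * small_moment r)"
          using t by (intro mult_left_mono small_jumps_difference r) auto
        also have "\<dots> = (a\<^sup>2 / 2 + \<bar>\<xi> * a\<bar>) * (t * small_moment r)" by simp
        also have "\<dots> \<le> (a\<^sup>2 / 2 + \<bar>\<xi> * a\<bar>) * (1 / r\<^sup>2)" by (intro mult_left_mono mom) auto
        also have "(a\<^sup>2 / 2 + \<bar>\<xi> * a\<bar>) * (1 / r\<^sup>2) = (v\<^sup>2 / 2 + \<bar>\<xi> * v\<bar>) * (1 / r\<^sup>2)"
        proof -
          have "a\<^sup>2 = v\<^sup>2" using a by (metis power2_abs)
          moreover have "\<bar>\<xi> * a\<bar> = \<bar>\<xi> * v\<bar>" using a by (simp only: abs_mult)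
          ultimately show ?thesis by (simp only:)
        qed
        also have "\<dots> = \<bar>?s\<bar> * (\<bar>?s\<bar> / 2 + \<bar>\<xi> / r\<bar>)"
          using r by (simp add: abs_mult abs_divide power2_eq_square field_simps)
        also have "\<dots> \<le> ?l" using s by (intro mult_left_mono) auto
        finally show ?thesis .
      qed
      have d1v: "\<bar>?f (\<xi> + v) - ?f \<xi>\<bar> \<le> ?l" "\<bar>?f (\<xi> - v) - ?f \<xi>\<bar> \<le> ?l"
        using d1[of v] d1[of "- v"] by (simp_all only: add_uminus_conv_diff abs_minus_cancel)
      have d2: "\<bar>?f (\<xi> + v) + ?f (\<xi> - v) - 2 * ?f \<xi>\<bar> \<le> ?s\<^sup>2"
      proof -
        have "?f (\<xi> + v) + ?f (\<xi> - v) - 2 * ?f \<xi> = t * (small_jumps r (\<xi> + v) + small_jumps r (\<xi> - v) - 2 * small_jumps r \<xi>)"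
          by (simp add: algebra_simps)
        then have "\<bar>?f (\<xi> + v) + ?f (\<xi> - v) - 2 * ?f \<xi>\<bar> = t * \<bar>small_jumps r (\<xi> + v) + small_jumps r (\<xi> - v) - 2 * small_jumps r \<xi>\<bar>"
          using t by (simp add: abs_mult)
        also have "\<dots> \<le> t * (v\<^sup>2 * small_moment r)"
          using t by (intro mult_left_mono small_jumps_second_difference r) auto
        also have "\<dots> = v\<^sup>2 * (t * small_moment r)" by simp
        also have "\<dots> \<le> v\<^sup>2 * (1 / r\<^sup>2)" by (intro mult_left_mono mom) auto
        finally show ?thesis by (simp add: power_divide)
      qed
      have l2: "?l\<^sup>2 \<le> ?s\<^sup>2 * (8 * ?w')"
      proof -
        have "(2 + z)\<^sup>2 \<le> 8 * (1 + z\<^sup>2)" for z :: real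
        proof -
          have "8 * (1 + z\<^sup>2) - (2 + z)\<^sup>2 = (z - 2)\<^sup>2 + 6 * z\<^sup>2" by (simp add: power2_eq_square algebra_simps)
          then show ?thesis using zero_le_power2[of "z - 2"] zero_le_power2[of z] by linarith
        qed
        from this[of "\<bar>\<xi> / r\<bar>"] have "(2 + \<bar>\<xi> / r\<bar>)\<^sup>2 \<le> 8 * ?w'" by (simp only: power2_abs)
        then have "?s\<^sup>2 * (2 + \<bar>\<xi> / r\<bar>)\<^sup>2 \<le> ?s\<^sup>2 * (8 * ?w')" by (rule mult_left_mono) simp
        then show ?thesis by (simp only: power_mult_distrib power2_abs)
      qed
      have ed: "\<bar>?e (\<xi> + v) - ?e \<xi>\<bar> \<le> ?M * ?l" "\<bar>?e (\<xi> - v) - ?e \<xi>\<bar> \<le> ?M * ?l"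
        using exp_lipschitz_max[OF E(2,1)] exp_lipschitz_max[OF E(3,1)] mult_left_mono[OF d1v(1) M0] mult_left_mono[OF d1v(2) M0]
        by linarith+
      have ed2: "\<bar>?e (\<xi> + v) + ?e (\<xi> - v) - 2 * ?e \<xi>\<bar> \<le> ?M * (?s\<^sup>2 + 2 * ?l\<^sup>2)"
      proof -
        have "(?f (\<xi> + v) - ?f \<xi>)\<^sup>2 \<le> ?l\<^sup>2" "(?f (\<xi> - v) - ?f \<xi>)\<^sup>2 \<le> ?l\<^sup>2"
          using d1v by (metis abs_ge_zero abs_le_square_iff abs_of_nonneg order_trans)+
        then have "?M * (\<bar>?f (\<xi> + v) + ?f (\<xi> - v) - 2 * ?f \<xi>\<bar> + (?f (\<xi> + v) - ?f \<xi>)\<^sup>2 + (?f (\<xi> - v) - ?f \<xi>)\<^sup>2)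
           \<le> ?M * (?s\<^sup>2 + 2 * ?l\<^sup>2)"
          using d2 by (intro mult_left_mono M0) linarith
        then show ?thesis using exp_second_difference[OF E(2,3,1)] by linarith
      qed
      have "\<bar>?h (\<xi> + v) + ?h (\<xi> - v) - 2 * ?h \<xi>\<bar> \<le> A * ?M * (?s\<^sup>2 + ?w' * (?s\<^sup>2 + 2 * ?l\<^sup>2) + 2 * ?l\<^sup>2)"
      proof -
        have gl: "\<bar>g (\<xi> + v) - g \<xi>\<bar> \<le> A * ?l" "\<bar>g (\<xi> - v) - g \<xi>\<bar> \<le> A * ?l"
          using g1[OF v, of \<xi>] g1[OF v', of \<xi>] by simp_all
        have e0: "\<bar>?e \<xi>\<bar> \<le> ?M" using E(1) by simp
        have l0: "0 \<le> ?l" by (intro mult_nonneg_nonneg) auto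
        show ?thesis
          by (rule second_difference_product[OF g0 gl g2 e0 ed ed2 A M0 l0 less_imp_le[OF w0] zero_le_power2])
      qed
      also have "\<dots> \<le> A * ?M * (34 * ?s\<^sup>2 * (?w' * ?w'))"
        by (rule mult_left_mono[OF second_difference_weight[OF w1 zero_le_power2 l2]]) (rule mult_nonneg_nonneg[OF A M0])
      also have "\<dots> = (34 * C0 * A) * ?s\<^sup>2 / ?w'"
        using w0[of \<xi>] by (simp add: power3_eq_cube)
      finally show ?thesis .
    qed
    have M: "0 \<le> 34 * C0 * A" using C0 A by simp
    have hm: "?h \<in> borel_measurable borel" by measurable
    note dec = cos_transform_decay[OF hm r M h0 h2]
    have "(\<integral>\<^sup>+x. ennreal \<bar>cos_transform ?h x\<bar> \<partial>lborel) \<le> ennreal (4 * pi * (34 * C0 * A))"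
      by (rule cos_transform_decay_L1[OF measurable_cos_transform[OF hm] r M dec(2)])
    then show ?thesis using dec(1) by (simp add: mult.assoc)
  qed
  then show ?thesis using C0 by (intro exI[of _ "4 * pi * (34 * C0)"]) auto
qed

section \<open>Bounds on the transition density\<close>

definition symbol :: "real \<Rightarrow> real \<Rightarrow> real" where
  "symbol t \<xi> = exp (- (t * levy_q \<mu> \<xi>))"

lemma symbol_pos: "0 < symbol t \<xi>" and symbol_even: "symbol t (- \<xi>) = symbol t \<xi>"
  by (simp_all add: symbol_def q_even)

lemma symbol_le_1: "t \<ge> 0 \<Longrightarrow> symbol t \<xi> \<le> 1"
  using q_nonneg by (simp add: symbol_def)

lemma measurable_symbol [measurable]: "symbol t \<in> borel_measurable borel"
  unfolding symbol_def[abs_def] by measurable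

lemma continuous_symbol: "continuous_on UNIV (symbol t)"
  unfolding symbol_def[abs_def] by (intro continuous_intros continuous_q)

lemma symbol_weighted:
  "\<exists>K>0. \<forall>t. 0 < t \<longrightarrow> t \<le> 1 \<longrightarrow> (\<forall>\<xi>. (1 + (\<xi> / levy_rho \<mu> t)\<^sup>2) * symbol t \<xi> \<le> K / (1 + (\<xi> / levy_rho \<mu> t)\<^sup>2))"
proof -
  from exp_tq_decay[of 2] obtain K where K: "K > 0" and
    K': "\<forall>t. 0 < t \<longrightarrow> t \<le> 1 \<longrightarrow> (\<forall>\<xi>. exp (- (t * levy_q \<mu> \<xi>)) \<le> K / (1 + (\<xi> / levy_rho \<mu> t)\<^sup>2) ^ 2)"
    by (elim exE conjE)
  have "(1 + (\<xi> / levy_rho \<mu> t)\<^sup>2) * symbol t \<xi> \<le> K / (1 + (\<xi> / levy_rho \<mu> t)\<^sup>2)" if t: "0 < t" "t \<le> 1" for t \<xi>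
  proof -
    let ?w = "1 + (\<xi> / levy_rho \<mu> t)\<^sup>2"
    have w: "?w > 0" by (rule add_pos_nonneg) auto
    have "?w * symbol t \<xi> \<le> ?w * (K / ?w ^ 2)"
      using K' t w unfolding symbol_def by (intro mult_left_mono) auto
    also have "\<dots> = K / ?w" using w by (simp add: power2_eq_square)
    finally show ?thesis .
  qed
  then show ?thesis using K by blast
qed

lemma symbol_moment:
  "\<exists>K>0. \<forall>t. 0 < t \<longrightarrow> t \<le> 1 \<longrightarrow> integrable lborel (\<lambda>\<xi>. (1 + (\<xi> / levy_rho \<mu> t)\<^sup>2) * symbol t \<xi>) \<and>
     (\<integral>\<xi>. (1 + (\<xi> / levy_rho \<mu> t)\<^sup>2) * symbol t \<xi> \<partial>lborel) \<le> K * levy_rho \<mu> t"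
proof -
  from symbol_weighted obtain K where K: "K > 0" and
    K': "\<forall>t. 0 < t \<longrightarrow> t \<le> 1 \<longrightarrow> (\<forall>\<xi>. (1 + (\<xi> / levy_rho \<mu> t)\<^sup>2) * symbol t \<xi> \<le> K / (1 + (\<xi> / levy_rho \<mu> t)\<^sup>2))"
    by (elim exE conjE)
  have "integrable lborel (\<lambda>\<xi>. (1 + (\<xi> / levy_rho \<mu> t)\<^sup>2) * symbol t \<xi>) \<and>
     (\<integral>\<xi>. (1 + (\<xi> / levy_rho \<mu> t)\<^sup>2) * symbol t \<xi> \<partial>lborel) \<le> (K * pi) * levy_rho \<mu> t" if t: "0 < t" "t \<le> 1" for t
  proof -
    let ?r = "levy_rho \<mu> t"
    let ?f = "\<lambda>\<xi>. (1 + (\<xi> / ?r)\<^sup>2) * symbol t \<xi>"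
    have r: "?r > 0" using rho_greatest t by auto
    have ck: "integrable lborel (\<lambda>\<xi>. K * (1 / (1 + (\<xi> / ?r)\<^sup>2)))"
      by (intro integrable_mult_right scaled_cauchy_kernel r)
    have le: "?f \<xi> \<le> K * (1 / (1 + (\<xi> / ?r)\<^sup>2))" for \<xi> using K' t by simp
    have nn: "0 \<le> ?f \<xi>" for \<xi> using symbol_pos[of t \<xi>] by (intro mult_nonneg_nonneg) auto
    have i: "integrable lborel ?f"
      by (rule integrable_dominated[OF ck]) (use le nn in \<open>auto simp del: times_divide_eq_right simp: abs_of_nonneg\<close>)
    have "(\<integral>\<xi>. ?f \<xi> \<partial>lborel) \<le> (\<integral>\<xi>. K * (1 / (1 + (\<xi> / ?r)\<^sup>2)) \<partial>lborel)"
      by (rule integral_mono[OF i ck le])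
    also have "\<dots> = K * (pi * ?r)"
      unfolding integral_mult_right_zero scaled_cauchy_kernel(2)[OF r] ..
    finally show ?thesis using i by simp
  qed
  then show ?thesis using K by (intro exI[of _ "K * pi"]) auto
qed

lemma integrable_symbol:
  assumes "0 < t" "t \<le> 1" shows "integrable lborel (symbol t)"
proof -
  from symbol_moment obtain K where
    K': "\<forall>t. 0 < t \<longrightarrow> t \<le> 1 \<longrightarrow> integrable lborel (\<lambda>\<xi>. (1 + (\<xi> / levy_rho \<mu> t)\<^sup>2) * symbol t \<xi>) \<and>
     (\<integral>\<xi>. (1 + (\<xi> / levy_rho \<mu> t)\<^sup>2) * symbol t \<xi> \<partial>lborel) \<le> K * levy_rho \<mu> t"
    by (elim exE conjE)
  show ?thesis
  proof (rule integrable_dominated)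
    show "integrable lborel (\<lambda>\<xi>. (1 + (\<xi> / levy_rho \<mu> t)\<^sup>2) * symbol t \<xi>)" using K' assms by blast
    show "\<bar>symbol t \<xi>\<bar> \<le> (1 + (\<xi> / levy_rho \<mu> t)\<^sup>2) * symbol t \<xi>" for \<xi>
      using symbol_pos[of t \<xi>] by (simp add: distrib_right)
  qed measurable
qed

lemma levy_density_eq:
  assumes t: "0 < t" "t \<le> 1"
  shows "levy_density \<mu> t = cos_transform (symbol t)"
proof
  fix x
  let ?f = "\<lambda>\<xi>. exp (- \<i> * complex_of_real (x * \<xi>) - complex_of_real (t * levy_q \<mu> \<xi>))"
  have i: "integrable lborel ?f"
  proof (rule Bochner_Integration.integrable_bound[OF integrable_symbol[OF t]])
    show "?f \<in> borel_measurable lborel" by measurable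
    show "AE \<xi> in lborel. norm (?f \<xi>) \<le> norm (symbol t \<xi>)"
      by (auto simp: symbol_def norm_exp_eq_Re)
  qed
  have "levy_density \<mu> t x = Re (of_real (1 / (2 * pi)) * (\<integral>\<xi>. ?f \<xi> \<partial>lborel))"
    unfolding levy_density_def by simp
  also have "\<dots> = 1 / (2 * pi) * Re (\<integral>\<xi>. ?f \<xi> \<partial>lborel)" by (simp only: times_complex.sel Re_complex_of_real Im_complex_of_real)
  also have "Re (\<integral>\<xi>. ?f \<xi> \<partial>lborel) = (\<integral>\<xi>. Re (?f \<xi>) \<partial>lborel)"
    by (rule integral_Re[symmetric, OF i])
  also have "(\<integral>\<xi>. Re (?f \<xi>) \<partial>lborel) = (\<integral>\<xi>. cos (x * \<xi>) * symbol t \<xi> \<partial>lborel)"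
    by (intro Bochner_Integration.integral_cong) (auto simp: Re_exp symbol_def)
  finally show "levy_density \<mu> t x = cos_transform (symbol t) x" by (simp add: cos_transform_def)
qed

lemma levy_density_even: "0 < t \<Longrightarrow> t \<le> 1 \<Longrightarrow> levy_density \<mu> t (- x) = levy_density \<mu> t x"
  by (simp add: levy_density_eq cos_transform_even)

text \<open>The second difference has the symbol \<open>2 (1 - cos (u \<xi>)) symbol t \<xi>\<close>, and \<open>1 - cos (u \<xi>)\<close> is bounded by
\<open>min ((\<rho>\<^sub>t u)\<^sup>2) 1\<close> times the weight \<open>1 + (\<xi> / \<rho>\<^sub>t)\<^sup>2\<close>, up to a factor.\<close>

lemma levy_density_second_difference_sup:
  "\<exists>C>0. \<forall>t. 0 < t \<longrightarrow> t \<le> 1 \<longrightarrow> (\<forall>x u.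
     \<bar>levy_density \<mu> t (x + u) + levy_density \<mu> t (x - u) - 2 * levy_density \<mu> t x\<bar>
       \<le> C * levy_rho \<mu> t * min ((levy_rho \<mu> t * u)\<^sup>2) 1)"
proof -
  from symbol_moment obtain K where K: "K > 0" and
    K': "\<forall>t. 0 < t \<longrightarrow> t \<le> 1 \<longrightarrow> integrable lborel (\<lambda>\<xi>. (1 + (\<xi> / levy_rho \<mu> t)\<^sup>2) * symbol t \<xi>) \<and>
     (\<integral>\<xi>. (1 + (\<xi> / levy_rho \<mu> t)\<^sup>2) * symbol t \<xi> \<partial>lborel) \<le> K * levy_rho \<mu> t"
    by (elim exE conjE)
  have "\<bar>levy_density \<mu> t (x + u) + levy_density \<mu> t (x - u) - 2 * levy_density \<mu> t x\<bar>
       \<le> (4 * K) * levy_rho \<mu> t * min ((levy_rho \<mu> t * u)\<^sup>2) 1" if t: "0 < t" "t \<le> 1" for t x u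
  proof -
    let ?r = "levy_rho \<mu> t"
    let ?m = "min ((?r * u)\<^sup>2) 1"
    let ?g = "\<lambda>\<xi>. 2 * (1 - cos (u * \<xi>)) * symbol t \<xi>"
    have r: "?r > 0" using rho_greatest t by auto
    have i: "integrable lborel (\<lambda>\<xi>. (4 * ?m) * ((1 + (\<xi> / ?r)\<^sup>2) * symbol t \<xi>))" using K' t by simp
    have le: "\<bar>?g \<xi>\<bar> \<le> (4 * ?m) * ((1 + (\<xi> / ?r)\<^sup>2) * symbol t \<xi>)" for \<xi>
    proof -
      have e: "(u * \<xi>)\<^sup>2 = (?r * u)\<^sup>2 * (\<xi> / ?r)\<^sup>2" using r by (simp add: power_mult_distrib power_divide)
      have "1 - cos (u * \<xi>) \<le> 2 * (?m * (1 + (\<xi> / ?r)\<^sup>2))"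
      proof (cases "(?r * u)\<^sup>2 \<le> 1")
        case True
        have "1 - cos (u * \<xi>) \<le> (?r * u)\<^sup>2 * (\<xi> / ?r)\<^sup>2 / 2" using one_minus_cos_le[of "u * \<xi>"] unfolding e .
        also have "\<dots> \<le> 2 * ((?r * u)\<^sup>2 * (1 + (\<xi> / ?r)\<^sup>2))" by (simp add: distrib_left)
        finally show ?thesis using True by (simp add: min_absorb1)
      next
        case False
        then have m: "?m = 1" by simp
        have "1 - cos (u * \<xi>) \<le> 2" using cos_ge_minus_one[of "u * \<xi>"] by linarith
        also have "2 \<le> 2 * (1 * (1 + (\<xi> / ?r)\<^sup>2))" by simp
        finally show ?thesis unfolding m .
      qed
      then have "2 * (1 - cos (u * \<xi>)) \<le> 4 * ?m * (1 + (\<xi> / ?r)\<^sup>2)" by simp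
      then have "2 * (1 - cos (u * \<xi>)) * symbol t \<xi> \<le> 4 * ?m * (1 + (\<xi> / ?r)\<^sup>2) * symbol t \<xi>"
        using symbol_pos[of t \<xi>] by (intro mult_right_mono) auto
      moreover have "\<bar>?g \<xi>\<bar> = ?g \<xi>" using symbol_pos[of t \<xi>] by (intro abs_of_nonneg mult_nonneg_nonneg) auto
      ultimately show ?thesis by (simp only: mult.assoc)
    qed
    have gi: "integrable lborel ?g" by (rule integrable_dominated[OF i _ le]) measurable
    have "\<bar>levy_density \<mu> t (x + u) + levy_density \<mu> t (x - u) - 2 * levy_density \<mu> t x\<bar> = \<bar>cos_transform ?g x\<bar>"
      unfolding levy_density_eq[OF t] cos_transform_second_difference[OF integrable_symbol[OF t]] by simp
    also have "\<dots> \<le> (\<integral>\<xi>. \<bar>?g \<xi>\<bar> \<partial>lborel) / (2 * pi)" by (rule cos_transform_abs_le[OF gi])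
    also have "\<dots> \<le> (\<integral>\<xi>. \<bar>?g \<xi>\<bar> \<partial>lborel) / 1"
      using pi_ge_two by (intro divide_left_mono) (auto intro: integral_nonneg_AE)
    also have "\<dots> \<le> (\<integral>\<xi>. (4 * ?m) * ((1 + (\<xi> / ?r)\<^sup>2) * symbol t \<xi>) \<partial>lborel)"
      unfolding div_by_1 by (rule integral_mono[OF integrable_abs[OF gi] i le])
    also have "\<dots> = (4 * ?m) * (\<integral>\<xi>. (1 + (\<xi> / ?r)\<^sup>2) * symbol t \<xi> \<partial>lborel)" by (rule integral_mult_right_zero)
    also have "\<dots> \<le> (4 * ?m) * (K * ?r)" using K' t by (intro mult_left_mono) auto
    finally show ?thesis by (simp only: ac_simps)
  qed
  then show ?thesis using K by (intro exI[of _ "4 * K"]) auto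
qed

lemma levy_density_sup: "\<exists>C>0. \<forall>t. 0 < t \<longrightarrow> t \<le> 1 \<longrightarrow> (\<forall>x. \<bar>levy_density \<mu> t x\<bar> \<le> C * levy_rho \<mu> t)"
proof -
  from symbol_moment obtain K where K: "K > 0" and
    K': "\<forall>t. 0 < t \<longrightarrow> t \<le> 1 \<longrightarrow> integrable lborel (\<lambda>\<xi>. (1 + (\<xi> / levy_rho \<mu> t)\<^sup>2) * symbol t \<xi>) \<and>
     (\<integral>\<xi>. (1 + (\<xi> / levy_rho \<mu> t)\<^sup>2) * symbol t \<xi> \<partial>lborel) \<le> K * levy_rho \<mu> t"
    by (elim exE conjE)
  have "\<bar>levy_density \<mu> t x\<bar> \<le> K * levy_rho \<mu> t" if t: "0 < t" "t \<le> 1" for t x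
  proof -
    have "\<bar>levy_density \<mu> t x\<bar> \<le> (\<integral>\<xi>. \<bar>symbol t \<xi>\<bar> \<partial>lborel) / (2 * pi)"
      unfolding levy_density_eq[OF t] by (rule cos_transform_abs_le[OF integrable_symbol[OF t]])
    also have "\<dots> \<le> (\<integral>\<xi>. \<bar>symbol t \<xi>\<bar> \<partial>lborel) / 1"
      using pi_ge_two by (intro divide_left_mono) (auto intro: integral_nonneg_AE)
    also have "\<dots> \<le> (\<integral>\<xi>. (1 + (\<xi> / levy_rho \<mu> t)\<^sup>2) * symbol t \<xi> \<partial>lborel)"
      unfolding div_by_1
    proof (rule integral_mono)
      show "integrable lborel (\<lambda>\<xi>. (1 + (\<xi> / levy_rho \<mu> t)\<^sup>2) * symbol t \<xi>)" using K' t by blast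
      show "\<bar>symbol t \<xi>\<bar> \<le> (1 + (\<xi> / levy_rho \<mu> t)\<^sup>2) * symbol t \<xi>" for \<xi>
        using symbol_pos[of t \<xi>] by (simp add: distrib_right)
    qed (rule integrable_abs[OF integrable_symbol[OF t]])
    also have "\<dots> \<le> K * levy_rho \<mu> t" using K' t by blast
    finally show ?thesis .
  qed
  then show ?thesis using K by blast
qed

text \<open>For \<open>\<bar>\<xi>\<bar> \<le> \<rho>\<^sub>t\<close> the exponent \<open>t q(\<xi>)\<close> is at most \<open>2\<close>, which bounds \<open>p\<^sub>t(0)\<close> from below by a multiple of
\<open>\<rho>\<^sub>t\<close>. Moving from \<open>0\<close> to \<open>x\<close> costs at most \<open>\<bar>x\<bar>\<close> times the first absolute moment of the symbol, which is of order
\<open>\<rho>\<^sub>t\<^sup>2\<close>.\<close>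

lemma levy_density_lower:
  "\<exists>c>0. \<exists>C>0. \<forall>t. 0 < t \<longrightarrow> t \<le> 1 \<longrightarrow> (\<forall>x. c * levy_rho \<mu> t - C * (levy_rho \<mu> t)\<^sup>2 * \<bar>x\<bar> \<le> levy_density \<mu> t x)"
proof -
  from symbol_moment obtain K where K: "K > 0" and
    K': "\<forall>t. 0 < t \<longrightarrow> t \<le> 1 \<longrightarrow> integrable lborel (\<lambda>\<xi>. (1 + (\<xi> / levy_rho \<mu> t)\<^sup>2) * symbol t \<xi>) \<and>
     (\<integral>\<xi>. (1 + (\<xi> / levy_rho \<mu> t)\<^sup>2) * symbol t \<xi> \<partial>lborel) \<le> K * levy_rho \<mu> t"
    by (elim exE conjE)
  have "exp (-2) / pi * levy_rho \<mu> t - K * (levy_rho \<mu> t)\<^sup>2 * \<bar>x\<bar> \<le> levy_density \<mu> t x" if t: "0 < t" "t \<le> 1" for t x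
  proof -
    let ?r = "levy_rho \<mu> t"
    have r: "?r > 0" using rho_greatest t by auto
    have i: "integrable lborel (\<lambda>\<xi>. (?r * \<bar>x\<bar>) * ((1 + (\<xi> / ?r)\<^sup>2) * symbol t \<xi>))" using K' t by simp
    note s = integrable_symbol[OF t]
    have ii: "integrable lborel (\<lambda>\<xi>. indicator {- ?r..?r} \<xi> * exp (-2 :: real))"
      by (intro integrable_mult_left integrable_real_indicator) (auto simp: emeasure_lborel_Icc_eq)
    have "2 * ?r * exp (-2) = (\<integral>\<xi>. indicator {- ?r..?r} \<xi> * exp (-2 :: real) \<partial>lborel)"
      using r by simp
    also have "\<dots> \<le> (\<integral>\<xi>. symbol t \<xi> \<partial>lborel)"
    proof (rule integral_mono[OF ii s])
      fix \<xi>
      show "indicator {- ?r..?r} \<xi> * exp (-2) \<le> symbol t \<xi>"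
      proof (cases "\<xi> \<in> {- ?r..?r}")
        case True
        then have "levy_qU \<mu> \<xi> \<le> levy_qU \<mu> ?r" by (intro qU_mono_abs) auto
        then have "levy_q \<mu> \<xi> \<le> 2 / t" using q_le_qU[of \<xi>] t by (simp add: rho_greatest)
        then have "t * levy_q \<mu> \<xi> \<le> 2" using t by (simp add: field_simps)
        then show ?thesis using True by (simp add: symbol_def)
      qed (use symbol_pos[of t \<xi>] in auto)
    qed
    finally have low: "2 * ?r * exp (-2) \<le> (\<integral>\<xi>. symbol t \<xi> \<partial>lborel)" .
    have "(\<integral>\<xi>. symbol t \<xi> \<partial>lborel) - (\<integral>\<xi>. cos (x * \<xi>) * symbol t \<xi> \<partial>lborel) = (\<integral>\<xi>. symbol t \<xi> - cos (x * \<xi>) * symbol t \<xi> \<partial>lborel)"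
      by (rule Bochner_Integration.integral_diff[symmetric, OF s integrable_cos_mult[OF s]])
    also have "\<dots> \<le> (\<integral>\<xi>. (?r * \<bar>x\<bar>) * ((1 + (\<xi> / ?r)\<^sup>2) * symbol t \<xi>) \<partial>lborel)"
    proof (rule integral_mono[OF Bochner_Integration.integrable_diff[OF s integrable_cos_mult[OF s]] i])
      fix \<xi>
      have "1 - cos (x * \<xi>) \<le> \<bar>x * \<xi>\<bar>"
      proof -
        have "1 - cos (x * \<xi>) = 2 * (sin (x * \<xi> / 2))\<^sup>2" using cos_double_sin[of "x * \<xi> / 2"] by simp
        also have "\<dots> = 2 * (\<bar>sin (x * \<xi> / 2)\<bar> * \<bar>sin (x * \<xi> / 2)\<bar>)" by (simp add: power2_eq_square)
        also have "\<dots> \<le> 2 * (1 * \<bar>x * \<xi> / 2\<bar>)" by (intro mult_left_mono mult_mono abs_sin_x_le_abs_x) auto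
        finally show ?thesis by simp
      qed
      also have "\<bar>x * \<xi>\<bar> = ?r * \<bar>x\<bar> * \<bar>\<xi> / ?r\<bar>" using r by (simp add: abs_mult)
      also have "\<dots> \<le> ?r * \<bar>x\<bar> * (1 + (\<xi> / ?r)\<^sup>2)"
      proof (rule mult_left_mono)
        have "z \<le> 1 + z\<^sup>2" for z :: real
        proof -
          have "1 + z\<^sup>2 - z = (z - 1 / 2)\<^sup>2 + 3 / 4" by (simp add: power2_eq_square algebra_simps)
          then show ?thesis using zero_le_power2[of "z - 1 / 2"] by linarith
        qed
        from this[of "\<bar>\<xi> / ?r\<bar>"] show "\<bar>\<xi> / ?r\<bar> \<le> 1 + (\<xi> / ?r)\<^sup>2" by (simp only: power2_abs)
      qed (use r in simp)
      finally have "(1 - cos (x * \<xi>)) * symbol t \<xi> \<le> (?r * \<bar>x\<bar> * (1 + (\<xi> / ?r)\<^sup>2)) * symbol t \<xi>"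
        using symbol_pos[of t \<xi>] by (intro mult_right_mono) auto
      then show "symbol t \<xi> - cos (x * \<xi>) * symbol t \<xi> \<le> (?r * \<bar>x\<bar>) * ((1 + (\<xi> / ?r)\<^sup>2) * symbol t \<xi>)"
        by (simp only: left_diff_distrib mult_1_left mult.assoc)
    qed
    also have "\<dots> = (?r * \<bar>x\<bar>) * (\<integral>\<xi>. (1 + (\<xi> / ?r)\<^sup>2) * symbol t \<xi> \<partial>lborel)" by (rule integral_mult_right_zero)
    also have "\<dots> \<le> (?r * \<bar>x\<bar>) * (K * ?r)" using K' t r by (intro mult_left_mono) auto
    finally have "2 * ?r * exp (-2) - (?r * \<bar>x\<bar>) * (K * ?r) \<le> (\<integral>\<xi>. cos (x * \<xi>) * symbol t \<xi> \<partial>lborel)"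
      using low by linarith
    then have "(2 * ?r * exp (-2) - (?r * \<bar>x\<bar>) * (K * ?r)) / (2 * pi) \<le> levy_density \<mu> t x"
      unfolding levy_density_eq[OF t] cos_transform_def by (intro divide_right_mono) auto
    moreover have "(2 * ?r * exp (-2) - (?r * \<bar>x\<bar>) * (K * ?r)) / (2 * pi)
        = exp (-2) / pi * ?r - (?r * \<bar>x\<bar>) * (K * ?r) / (2 * pi)"
      by (simp add: diff_divide_distrib)
    moreover have "(?r * \<bar>x\<bar>) * (K * ?r) / (2 * pi) \<le> (?r * \<bar>x\<bar>) * (K * ?r) / 1"
      using K r pi_ge_two by (intro divide_left_mono) auto
    ultimately show ?thesis by (simp add: power2_eq_square ac_simps)
  qed
  moreover have "exp (-2) / pi > (0 :: real)" by simp
  ultimately show ?thesis using K by blast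
qed

lemma symbol_factor:
  assumes "r > 0"
  shows "symbol t \<xi> = exp (- (t * (measure (large_jumps r) UNIV - cos_char (large_jumps r) \<xi>))) * exp (- (t * small_jumps r \<xi>))"
  unfolding symbol_def q_split[OF assms] by (simp add: mult_exp_exp algebra_simps)

text \<open>The symbol is a compound Poisson factor times the exponential of the small jumps.\<close>

lemma symbol_transform_L1:
  "\<exists>C>0. \<forall>t. 0 < t \<longrightarrow> t \<le> 1 \<longrightarrow> (\<forall>g A. quadratic_symbol (levy_rho \<mu> t) A g \<longrightarrow>
     (\<integral>\<^sup>+x. ennreal \<bar>cos_transform (\<lambda>\<xi>. g \<xi> * symbol t \<xi>) x\<bar> \<partial>lborel) \<le> ennreal (C * A))"
proof -
  from small_jumps_transform obtain C where C: "C > 0" and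
    C': "\<forall>t. 0 < t \<longrightarrow> t \<le> 1 \<longrightarrow> (\<forall>g A. quadratic_symbol (levy_rho \<mu> t) A g \<longrightarrow>
     integrable lborel (\<lambda>\<xi>. g \<xi> * exp (- (t * small_jumps (levy_rho \<mu> t) \<xi>))) \<and>
     (\<integral>\<^sup>+x. ennreal \<bar>cos_transform (\<lambda>\<xi>. g \<xi> * exp (- (t * small_jumps (levy_rho \<mu> t) \<xi>))) x\<bar> \<partial>lborel) \<le> ennreal (C * A))"
    by (elim exE conjE)
  have "(\<integral>\<^sup>+x. ennreal \<bar>cos_transform (\<lambda>\<xi>. g \<xi> * symbol t \<xi>) x\<bar> \<partial>lborel) \<le> ennreal (C * A)"
    if t: "0 < t" "t \<le> 1" and g: "quadratic_symbol (levy_rho \<mu> t) A g" for t g A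
  proof -
    let ?r = "levy_rho \<mu> t"
    let ?h = "\<lambda>\<xi>. g \<xi> * exp (- (t * small_jumps ?r \<xi>))"
    have r: "?r > 0" using rho_greatest t by auto
    have h: "integrable lborel ?h" "(\<integral>\<^sup>+x. ennreal \<bar>cos_transform ?h x\<bar> \<partial>lborel) \<le> ennreal (C * A)"
      using C' t g by blast+
    have "(\<lambda>\<xi>. g \<xi> * symbol t \<xi>)
      = (\<lambda>\<xi>. exp (- (t * (measure (large_jumps ?r) UNIV - cos_char (large_jumps ?r) \<xi>))) * ?h \<xi>)"
      unfolding symbol_factor[OF r] by (simp add: ac_simps)
    then show ?thesis
      using order_trans[OF cos_transform_compound_L1[OF finite_large_jumps[OF r] sets_large_jumps h(1) less_imp_le[OF t(1)]] h(2)]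
      by simp
  qed
  then show ?thesis using C by blast
qed

lemma levy_density_L1:
  "\<exists>C>0. \<forall>t. 0 < t \<longrightarrow> t \<le> 1 \<longrightarrow> (\<integral>\<^sup>+x. ennreal \<bar>levy_density \<mu> t x\<bar> \<partial>lborel) \<le> ennreal C"
proof -
  from symbol_transform_L1 obtain C where C: "C > 0" and
    C': "\<forall>t. 0 < t \<longrightarrow> t \<le> 1 \<longrightarrow> (\<forall>g A. quadratic_symbol (levy_rho \<mu> t) A g \<longrightarrow>
     (\<integral>\<^sup>+x. ennreal \<bar>cos_transform (\<lambda>\<xi>. g \<xi> * symbol t \<xi>) x\<bar> \<partial>lborel) \<le> ennreal (C * A))"
    by (elim exE conjE)
  have "(\<integral>\<^sup>+x. ennreal \<bar>levy_density \<mu> t x\<bar> \<partial>lborel) \<le> ennreal C" if t: "0 < t" "t \<le> 1" for t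
  proof -
    have "quadratic_symbol (levy_rho \<mu> t) 1 (\<lambda>_. 1)"
      by (auto simp: quadratic_symbol_def)
    then have "(\<integral>\<^sup>+x. ennreal \<bar>cos_transform (\<lambda>\<xi>. 1 * symbol t \<xi>) x\<bar> \<partial>lborel) \<le> ennreal (C * 1)"
      using C' t by blast
    then show ?thesis by (simp add: levy_density_eq[OF t])
  qed
  then show ?thesis using C by blast
qed

lemma quadratic_symbol_one_minus_cos:
  assumes r: "r > 0"
  shows "quadratic_symbol r (2 * (r * u)\<^sup>2) (\<lambda>\<xi>. 2 * (1 - cos (u * \<xi>)))"
  unfolding quadratic_symbol_def
proof (intro conjI allI impI)
  fix \<xi> v
  have s1: "(u * \<xi>)\<^sup>2 = (r * u)\<^sup>2 * (\<xi> / r)\<^sup>2" "u\<^sup>2 * v\<^sup>2 = (r * u)\<^sup>2 * (v / r)\<^sup>2"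
    using r by (simp_all add: power_mult_distrib power_divide)
  have "\<bar>2 * (1 - cos (u * \<xi>))\<bar> = 2 * (1 - cos (u * \<xi>))" by (simp add: abs_mult abs_one_minus_cos)
  also have "\<dots> \<le> (r * u)\<^sup>2 * (\<xi> / r)\<^sup>2" using one_minus_cos_le[of "u * \<xi>"] unfolding s1 by simp
  also have "\<dots> \<le> 2 * (r * u)\<^sup>2 * (1 + (\<xi> / r)\<^sup>2)" by (simp add: distrib_left)
  finally show "\<bar>2 * (1 - cos (u * \<xi>))\<bar> \<le> 2 * (r * u)\<^sup>2 * (1 + (\<xi> / r)\<^sup>2)" .
  show "\<bar>2 * (1 - cos (u * (\<xi> + v))) - 2 * (1 - cos (u * \<xi>))\<bar> \<le> 2 * (r * u)\<^sup>2 * (\<bar>v / r\<bar> * (2 + \<bar>\<xi> / r\<bar>))"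
    if v: "\<bar>v\<bar> \<le> pi * r"
  proof -
    have s: "\<bar>v / r\<bar> \<le> 4"
    proof -
      have "\<bar>v / r\<bar> \<le> pi" using v r by (simp add: abs_divide pos_divide_le_eq)
      then show ?thesis using pi_less_4 by linarith
    qed
    have "2 * (1 - cos (u * (\<xi> + v))) - 2 * (1 - cos (u * \<xi>)) = - (2 * (cos ((\<xi> + v) * u) - cos (\<xi> * u)))"
      by (simp add: mult.commute)
    then have "\<bar>2 * (1 - cos (u * (\<xi> + v))) - 2 * (1 - cos (u * \<xi>))\<bar> = 2 * \<bar>cos ((\<xi> + v) * u) - cos (\<xi> * u)\<bar>"
      by (simp only: abs_minus_cancel abs_mult abs_numeral)
    also have "\<dots> \<le> 2 * ((v\<^sup>2 / 2 + \<bar>\<xi> * v\<bar>) * u\<^sup>2)" by (intro mult_left_mono cos_difference_le) auto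
    also have "\<dots> = 2 * (r * u)\<^sup>2 * (\<bar>v / r\<bar> * (\<bar>v / r\<bar> / 2 + \<bar>\<xi> / r\<bar>))"
      using r by (simp add: abs_mult abs_divide power2_eq_square field_simps)
    also have "\<dots> \<le> 2 * (r * u)\<^sup>2 * (\<bar>v / r\<bar> * (2 + \<bar>\<xi> / r\<bar>))"
      using s by (intro mult_left_mono) auto
    finally show ?thesis .
  qed
  have "2 * (1 - cos (u * (\<xi> + v))) + 2 * (1 - cos (u * (\<xi> - v))) - 2 * (2 * (1 - cos (u * \<xi>)))
      = 4 * (cos (u * \<xi>) * (1 - cos (u * v)))"
    by (simp add: distrib_left right_diff_distrib cos_add cos_diff)
  then have "\<bar>2 * (1 - cos (u * (\<xi> + v))) + 2 * (1 - cos (u * (\<xi> - v))) - 2 * (2 * (1 - cos (u * \<xi>)))\<bar>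
      = 4 * (\<bar>cos (u * \<xi>)\<bar> * (1 - cos (u * v)))"
    by (simp only: abs_mult abs_numeral abs_one_minus_cos)
  also have "\<dots> \<le> 4 * (1 * ((u * v)\<^sup>2 / 2))"
    using one_minus_cos_le[of "u * v"] by (intro mult_left_mono mult_mono) auto
  also have "\<dots> = 2 * (r * u)\<^sup>2 * (v / r)\<^sup>2" by (simp add: s1 power_mult_distrib[of u v])
  finally show "\<bar>2 * (1 - cos (u * (\<xi> + v))) + 2 * (1 - cos (u * (\<xi> - v))) - 2 * (2 * (1 - cos (u * \<xi>)))\<bar>
      \<le> 2 * (r * u)\<^sup>2 * (v / r)\<^sup>2" .
qed simp_all

lemma measurable_levy_density2 [measurable]:
  "(\<lambda>p. levy_density \<mu> (fst p) (snd p)) \<in> borel_measurable (borel \<Otimes>\<^sub>M borel)"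
  unfolding levy_density_def by measurable

lemma measurable_levy_density: "levy_density \<mu> t \<in> borel_measurable borel"
  using measurable_compose[OF measurable_Pair1'[of t borel borel] measurable_levy_density2] by simp

text \<open>The quadratic multiplier \<open>2 (1 - cos (u \<xi>))\<close> serves for \<open>\<rho>\<^sub>t \<bar>u\<bar> \<le> 1\<close>, the triangle inequality for longer steps.\<close>

lemma levy_density_second_difference_L1:
  "\<exists>C>0. \<forall>t. 0 < t \<longrightarrow> t \<le> 1 \<longrightarrow> (\<forall>u.
    (\<integral>\<^sup>+x. ennreal \<bar>levy_density \<mu> t (x + u) + levy_density \<mu> t (x - u) - 2 * levy_density \<mu> t x\<bar> \<partial>lborel)
      \<le> ennreal (C * min ((levy_rho \<mu> t * u)\<^sup>2) 1))"
proof -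
  from symbol_transform_L1 obtain C where C: "C > 0" and
    C': "\<forall>t. 0 < t \<longrightarrow> t \<le> 1 \<longrightarrow> (\<forall>g A. quadratic_symbol (levy_rho \<mu> t) A g \<longrightarrow>
     (\<integral>\<^sup>+x. ennreal \<bar>cos_transform (\<lambda>\<xi>. g \<xi> * symbol t \<xi>) x\<bar> \<partial>lborel) \<le> ennreal (C * A))"
    by (elim exE conjE)
  from levy_density_L1 obtain B where B: "B > 0" and
    B': "\<forall>t. 0 < t \<longrightarrow> t \<le> 1 \<longrightarrow> (\<integral>\<^sup>+x. ennreal \<bar>levy_density \<mu> t x\<bar> \<partial>lborel) \<le> ennreal B"
    by (elim exE conjE)
  define M where "M = max (2 * C) (4 * B)"
  have "(\<integral>\<^sup>+x. ennreal \<bar>levy_density \<mu> t (x + u) + levy_density \<mu> t (x - u) - 2 * levy_density \<mu> t x\<bar> \<partial>lborel)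
      \<le> ennreal (M * min ((levy_rho \<mu> t * u)\<^sup>2) 1)" (is "?I \<le> _") if t: "0 < t" "t \<le> 1" for t u
  proof -
    let ?p = "levy_density \<mu> t"
    note [measurable] = measurable_levy_density[of t]
    let ?r = "levy_rho \<mu> t"
    have r: "?r > 0" using rho_greatest t by auto
    have "?I = (\<integral>\<^sup>+x. ennreal \<bar>cos_transform (\<lambda>\<xi>. 2 * (1 - cos (u * \<xi>)) * symbol t \<xi>) x\<bar> \<partial>lborel)"
      unfolding levy_density_eq[OF t] cos_transform_second_difference[OF integrable_symbol[OF t]] by simp
    also have "\<dots> \<le> ennreal (C * (2 * (?r * u)\<^sup>2))"
      using C' t quadratic_symbol_one_minus_cos[OF r, of u] by blast
    also have "\<dots> \<le> ennreal (M * (?r * u)\<^sup>2)"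
    proof (rule ennreal_leI)
      have "2 * C * (?r * u)\<^sup>2 \<le> M * (?r * u)\<^sup>2" by (intro mult_right_mono) (auto simp: M_def)
      then show "C * (2 * (?r * u)\<^sup>2) \<le> M * (?r * u)\<^sup>2" by (simp add: ac_simps)
    qed
    finally have 1: "?I \<le> ennreal (M * (?r * u)\<^sup>2)" .
    have "?I \<le> (\<integral>\<^sup>+x. ennreal \<bar>?p (x + u)\<bar> + (ennreal \<bar>?p (x + - u)\<bar> + ennreal 2 * ennreal \<bar>?p x\<bar>) \<partial>lborel)"
    proof (rule nn_integral_mono)
      fix x
      have "\<bar>?p (x + u) + ?p (x - u) - 2 * ?p x\<bar> \<le> \<bar>?p (x + u)\<bar> + (\<bar>?p (x + - u)\<bar> + 2 * \<bar>?p x\<bar>)" by simp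
      from ennreal_leI[OF this] show "ennreal \<bar>?p (x + u) + ?p (x - u) - 2 * ?p x\<bar>
        \<le> ennreal \<bar>?p (x + u)\<bar> + (ennreal \<bar>?p (x + - u)\<bar> + ennreal 2 * ennreal \<bar>?p x\<bar>)"
        by (subst ennreal_mult[symmetric], simp, simp, subst ennreal_plus[symmetric], simp, simp, subst ennreal_plus[symmetric]) simp_all
    qed
    also have "\<dots> = (\<integral>\<^sup>+x. ennreal \<bar>?p (x + u)\<bar> \<partial>lborel) + ((\<integral>\<^sup>+x. ennreal \<bar>?p (x + - u)\<bar> \<partial>lborel) + ennreal 2 * (\<integral>\<^sup>+x. ennreal \<bar>?p x\<bar> \<partial>lborel))"
      by (simp add: nn_integral_add nn_integral_cmult)
    also have "\<dots> = (\<integral>\<^sup>+x. ennreal \<bar>?p x\<bar> \<partial>lborel) + ((\<integral>\<^sup>+x. ennreal \<bar>?p x\<bar> \<partial>lborel) + ennreal 2 * (\<integral>\<^sup>+x. ennreal \<bar>?p x\<bar> \<partial>lborel))"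
    proof -
      have "(\<lambda>x. ennreal \<bar>?p x\<bar>) \<in> borel_measurable borel" by measurable
      from nn_integral_shift[OF this] show ?thesis by (simp only:)
    qed
    also have "\<dots> \<le> ennreal B + (ennreal B + ennreal 2 * ennreal B)"
      using B' t by (intro add_mono mult_left_mono) auto
    also have "\<dots> = ennreal (4 * B)"
    proof -
      have nn: "0 \<le> B" "0 \<le> 2 * B" "0 \<le> B + 2 * B" using B by auto
      have "4 * B = B + (B + 2 * B)" by simp
      then show ?thesis
        by (simp only: ennreal_plus[OF nn(1,3)] ennreal_plus[OF nn(1,2)] ennreal_mult[OF zero_le_numeral nn(1)])
    qed
    also have "\<dots> \<le> ennreal (M * 1)" by (intro ennreal_leI) (simp add: M_def)
    finally have 2: "?I \<le> ennreal (M * 1)" .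
    show ?thesis using 1 2 by (simp add: min_def)
  qed
  moreover have "M > 0" using C by (simp add: M_def)
  ultimately show ?thesis by blast
qed

lemma integrable_levy_density:
  assumes t: "0 < t" "t \<le> 1" shows "integrable lborel (levy_density \<mu> t)"
proof (rule integrableI_bounded)
  show "levy_density \<mu> t \<in> borel_measurable lborel" using measurable_levy_density by simp
  from levy_density_L1 obtain B where
    B': "\<forall>t. 0 < t \<longrightarrow> t \<le> 1 \<longrightarrow> (\<integral>\<^sup>+x. ennreal \<bar>levy_density \<mu> t x\<bar> \<partial>lborel) \<le> ennreal B"
    by (elim exE conjE)
  then have "(\<integral>\<^sup>+x. ennreal \<bar>levy_density \<mu> t x\<bar> \<partial>lborel) \<le> ennreal B" using t by blast
  also have "\<dots> < \<infinity>" by simp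
  finally show "(\<integral>\<^sup>+x. ennreal (norm (levy_density \<mu> t x)) \<partial>lborel) < \<infinity>" by simp
qed

lemma levy_density_semigroup:
  assumes s: "0 < s" and t: "0 < t" and st: "s + t \<le> 1"
  shows "(\<integral>z. levy_density \<mu> s (x - z) * levy_density \<mu> t (z - y) \<partial>lborel) = levy_density \<mu> (s + t) (x - y)"
proof -
  have le: "s \<le> 1" "t \<le> 1" using assms by auto
  have b: "\<bar>symbol s \<xi>\<bar> \<le> 1" for \<xi> using symbol_pos[of s \<xi>] symbol_le_1[of s \<xi>] s by simp
  have f: "integrable lborel (cos_transform (symbol s))"
    using integrable_levy_density[OF s le(1)] by (simp add: levy_density_eq[OF s le(1)])
  have "(\<lambda>\<xi>. symbol s \<xi> * symbol t \<xi>) = symbol (s + t)"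
    by (simp add: symbol_def fun_eq_iff mult_exp_exp distrib_right)
  then show ?thesis
    using cos_transform_convolution[OF integrable_symbol[OF s le(1)] continuous_symbol symbol_even b f integrable_symbol[OF t le(2)], of x y]
    using s t st by (simp add: levy_density_eq[OF s le(1)] levy_density_eq[OF t le(2)] levy_density_eq)
qed

lemma small_jumps_tendsto: "(\<lambda>n. small_jumps (real (Suc n)) \<xi>) \<longlonglongrightarrow> 0"
proof -
  have "(\<lambda>n. small_jumps (real (Suc n)) \<xi>) \<longlonglongrightarrow> (\<integral>u. 0 \<partial>\<mu>)"
    unfolding small_jumps_def
  proof (rule integral_dominated_convergence[where w = "\<lambda>u. 1 - cos (\<xi> * u)"])
    show "AE u in \<mu>. (\<lambda>n. indicator {u. \<bar>u\<bar> < 1 / real (Suc n)} u * (1 - cos (\<xi> * u))) \<longlonglongrightarrow> 0"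
    proof (intro AE_I2)
      fix u :: real
      show "(\<lambda>n. indicator {u. \<bar>u\<bar> < 1 / real (Suc n)} u * (1 - cos (\<xi> * u))) \<longlonglongrightarrow> 0"
      proof (cases "u = 0")
        case False
        then obtain N where "1 / real (Suc N) < \<bar>u\<bar>"
          using reals_Archimedean[of "\<bar>u\<bar>"] by (auto simp: inverse_eq_divide)
        moreover have "1 / real (Suc n) \<le> 1 / real (Suc N)" if "n \<ge> N" for n
          using that by (intro divide_left_mono) auto
        ultimately have "indicator {u. \<bar>u\<bar> < 1 / real (Suc n)} u * (1 - cos (\<xi> * u)) = 0" if "n \<ge> N" for n
          using that by (force simp: indicator_def)
        then show ?thesis by (intro tendsto_eventually) (auto simp: eventually_sequentially)
      qed simp
    qed
    show "AE u in \<mu>. norm (indicator {u. \<bar>u\<bar> < 1 / real (Suc n)} u * (1 - cos (\<xi> * u))) \<le> 1 - cos (\<xi> * u)" for n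
      by (intro AE_I2) (auto simp: indicator_def)
  qed (use integrable_q in \<open>simp_all add: indicator_def\<close>)
  then show ?thesis by simp
qed

text \<open>With the small jumps removed and a Gaussian factor added, the symbol is the characteristic function of a compound
Poisson variable plus an independent normal one. Both changes are undone by dominated convergence.\<close>

lemma levy_density_nonneg:
  assumes t: "0 < t" "t \<le> 1" shows "0 \<le> levy_density \<mu> t x"
proof -
  let ?N = "\<lambda>n. measure (large_jumps (real (Suc n))) UNIV"
  let ?c = "\<lambda>n. cos_char (large_jumps (real (Suc n)))"
  let ?e = "\<lambda>n \<xi>. exp (- (t * (?N n - ?c n \<xi>)))"
  note fin = finite_large_jumps[OF of_nat_0_less_iff[THEN iffD2, OF zero_less_Suc]]
  have e_bound: "0 \<le> ?e n \<xi>" "?e n \<xi> \<le> 1" for n \<xi>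
    using cos_char_abs_le[OF fin sets_large_jumps, of n \<xi>] t by (auto simp: abs_le_iff)
  have [measurable]: "?c n \<in> borel_measurable borel" for n
    by (rule measurable_cos_char[OF fin sets_large_jumps])
  have regular: "0 \<le> (\<integral>\<xi>. cos (x * \<xi>) * (symbol t \<xi> * gauss s \<xi>) \<partial>lborel)" if s: "s > 0" for s
  proof (rule LIMSEQ_le_const)
    show "(\<lambda>n. \<integral>\<xi>. cos (x * \<xi>) * (?e n \<xi> * gauss s \<xi>) \<partial>lborel) \<longlonglongrightarrow> (\<integral>\<xi>. cos (x * \<xi>) * (symbol t \<xi> * gauss s \<xi>) \<partial>lborel)"
    proof (rule integral_dominated_convergence[where w = "gauss s"])
      show "AE \<xi> in lborel. (\<lambda>n. cos (x * \<xi>) * (?e n \<xi> * gauss s \<xi>)) \<longlonglongrightarrow> cos (x * \<xi>) * (symbol t \<xi> * gauss s \<xi>)"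
      proof (intro AE_I2 tendsto_mult tendsto_const)
        fix \<xi>
        have "?N n - ?c n \<xi> = levy_q \<mu> \<xi> - small_jumps (real (Suc n)) \<xi>" for n
          using q_split[of "real (Suc n)" \<xi>] by simp
        moreover have "(\<lambda>n. exp (- (t * (levy_q \<mu> \<xi> - small_jumps (real (Suc n)) \<xi>)))) \<longlonglongrightarrow> exp (- (t * (levy_q \<mu> \<xi> - 0)))"
          by (intro tendsto_intros small_jumps_tendsto)
        ultimately show "(\<lambda>n. ?e n \<xi>) \<longlonglongrightarrow> symbol t \<xi>" by (simp only: symbol_def diff_zero)
      qed
      show "AE \<xi> in lborel. norm (cos (x * \<xi>) * (?e n \<xi> * gauss s \<xi>)) \<le> gauss s \<xi>" for n
      proof (intro AE_I2)
        fix \<xi>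
        have "\<bar>cos (x * \<xi>)\<bar> * (?e n \<xi> * gauss s \<xi>) \<le> 1 * (1 * gauss s \<xi>)"
          using e_bound gauss_bounds by (intro mult_mono) auto
        then show "norm (cos (x * \<xi>) * (?e n \<xi> * gauss s \<xi>)) \<le> gauss s \<xi>"
          using e_bound[of n \<xi>] gauss_bounds[of s \<xi>] by (simp add: abs_mult)
      qed
    qed (use integrable_gauss[OF s] in measurable)
    have "0 \<le> cos_transform (\<lambda>\<xi>. ?e n \<xi> * gauss s \<xi>) x" for n
    proof (rule cos_transform_compound_nonneg[OF fin sets_large_jumps integrable_gauss[OF s]])
      show "0 \<le> cos_transform (gauss s) x" for x using s by (simp add: cos_transform_gauss)
    qed (use t in simp)
    then have "0 \<le> cos_transform (\<lambda>\<xi>. ?e n \<xi> * gauss s \<xi>) x * (2 * pi)" for n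
      by (intro mult_nonneg_nonneg) auto
    then have "0 \<le> (\<integral>\<xi>. cos (x * \<xi>) * (?e n \<xi> * gauss s \<xi>) \<partial>lborel)" for n
      by (simp add: cos_transform_def)
    then show "\<exists>N. \<forall>n\<ge>N. 0 \<le> (\<integral>\<xi>. cos (x * \<xi>) * (?e n \<xi> * gauss s \<xi>) \<partial>lborel)" by blast
  qed
  have "0 \<le> (\<integral>\<xi>. cos (x * \<xi>) * symbol t \<xi> \<partial>lborel)"
  proof (rule LIMSEQ_le_const)
    show "(\<lambda>n. \<integral>\<xi>. cos (x * \<xi>) * (symbol t \<xi> * gauss (1 / real (Suc n)) \<xi>) \<partial>lborel) \<longlonglongrightarrow> (\<integral>\<xi>. cos (x * \<xi>) * symbol t \<xi> \<partial>lborel)"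
    proof (rule integral_dominated_convergence[where w = "symbol t"])
      show "AE \<xi> in lborel. (\<lambda>n. cos (x * \<xi>) * (symbol t \<xi> * gauss (1 / real (Suc n)) \<xi>)) \<longlonglongrightarrow> cos (x * \<xi>) * symbol t \<xi>"
      proof (intro AE_I2 tendsto_mult tendsto_const)
        fix \<xi> show "(\<lambda>n. symbol t \<xi> * gauss (1 / real (Suc n)) \<xi>) \<longlonglongrightarrow> symbol t \<xi>"
          using tendsto_mult_left[OF gauss_tendsto[of \<xi>], of "symbol t \<xi>"] by simp
      qed
      show "AE \<xi> in lborel. norm (cos (x * \<xi>) * (symbol t \<xi> * gauss (1 / real (Suc n)) \<xi>)) \<le> symbol t \<xi>" for n
      proof (intro AE_I2)
        fix \<xi>
        have "\<bar>cos (x * \<xi>)\<bar> * (symbol t \<xi> * gauss (1 / real (Suc n)) \<xi>) \<le> 1 * (symbol t \<xi> * 1)"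
          using symbol_pos[of t \<xi>] gauss_bounds by (intro mult_mono) auto
        then show "norm (cos (x * \<xi>) * (symbol t \<xi> * gauss (1 / real (Suc n)) \<xi>)) \<le> symbol t \<xi>"
          using symbol_pos[of t \<xi>] gauss_bounds by (simp add: abs_mult)
      qed
    qed (use integrable_symbol[OF t] in measurable)
    show "\<exists>N. \<forall>n\<ge>N. 0 \<le> (\<integral>\<xi>. cos (x * \<xi>) * (symbol t \<xi> * gauss (1 / real (Suc n)) \<xi>) \<partial>lborel)"
      using regular by auto
  qed
  then show ?thesis by (simp add: levy_density_eq[OF t] cos_transform_def)
qed

end

section \<open>Space-time convolution of bounded kernels\<close>

text \<open>Lets the measurability prover handle the integration domain of \<open>\<star>\<close>, whose end point is a variable.\<close>

lemma pred_in_greaterThanLessThan [measurable (raw)]: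
  fixes a b c :: "'a \<Rightarrow> real"
  assumes [measurable]: "a \<in> borel_measurable M" "b \<in> borel_measurable M" "c \<in> borel_measurable M"
  shows "Measurable.pred M (\<lambda>x. c x \<in> {a x<..<b x})"
  unfolding greaterThanLessThan_iff by measurable

definition measurable_kernel :: "kernel \<Rightarrow> bool" where
  "measurable_kernel f \<longleftrightarrow> (\<lambda>(t, x, y). f t x y) \<in> borel_measurable (borel \<Otimes>\<^sub>M borel \<Otimes>\<^sub>M borel)"

lemma measurable_kernelE:
  assumes "measurable_kernel f"
  obtains F where "F \<in> borel_measurable (borel \<Otimes>\<^sub>M borel \<Otimes>\<^sub>M borel)" "f = (\<lambda>t x y. F (t, x, y))"
  using assms by (intro that[of "\<lambda>(t, x, y). f t x y"]) (auto simp: measurable_kernel_def)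

lemma measurable_kernelI:
  "(\<lambda>p. f (fst p) (fst (snd p)) (snd (snd p))) \<in> borel_measurable (borel \<Otimes>\<^sub>M borel \<Otimes>\<^sub>M borel) \<Longrightarrow> measurable_kernel f"
  by (simp add: measurable_kernel_def case_prod_beta')

lemma measurable_kernel_compose:
  assumes "measurable_kernel f" and [measurable]: "a \<in> borel_measurable M" "b \<in> borel_measurable M" "c \<in> borel_measurable M"
  shows "(\<lambda>w. f (a w) (b w) (c w)) \<in> borel_measurable M"
proof -
  obtain F where [measurable]: "F \<in> borel_measurable (borel \<Otimes>\<^sub>M borel \<Otimes>\<^sub>M borel)" and f: "f = (\<lambda>t x y. F (t, x, y))"
    using assms(1) by (rule measurable_kernelE)
  show ?thesis unfolding f by measurable
qed

text \<open>The convolution of absolute values with values in \<open>ennreal\<close>: it needs no integrability to be meaningful, and its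
finiteness is the criterion for all manipulations of \<open>star\<close>.\<close>

definition abs_star :: "kernel \<Rightarrow> kernel \<Rightarrow> real \<Rightarrow> real \<Rightarrow> real \<Rightarrow> ennreal" where
  "abs_star f g t x y = (\<integral>\<^sup>+\<tau>. indicator {0<..<t} \<tau> * (\<integral>\<^sup>+z. ennreal \<bar>f (t - \<tau>) x z\<bar> * ennreal \<bar>g \<tau> z y\<bar> \<partial>lborel) \<partial>lborel)"

lemma measurable_abs_star:
  assumes "measurable_kernel f" "measurable_kernel g"
  shows "(\<lambda>p. abs_star f g (fst p) (fst (snd p)) (snd (snd p))) \<in> borel_measurable (borel \<Otimes>\<^sub>M borel \<Otimes>\<^sub>M borel)"
proof -
  obtain F where [measurable]: "F \<in> borel_measurable (borel \<Otimes>\<^sub>M borel \<Otimes>\<^sub>M borel)" and f: "f = (\<lambda>t x y. F (t, x, y))"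
    using assms(1) by (rule measurable_kernelE)
  obtain G where [measurable]: "G \<in> borel_measurable (borel \<Otimes>\<^sub>M borel \<Otimes>\<^sub>M borel)" and g: "g = (\<lambda>t x y. G (t, x, y))"
    using assms(2) by (rule measurable_kernelE)
  show ?thesis unfolding abs_star_def f g by measurable
qed

lemma measurable_star:
  assumes "measurable_kernel f" "measurable_kernel g"
  shows "measurable_kernel (star f g)"
proof (rule measurable_kernelI)
  obtain F where [measurable]: "F \<in> borel_measurable (borel \<Otimes>\<^sub>M borel \<Otimes>\<^sub>M borel)" and f: "f = (\<lambda>t x y. F (t, x, y))"
    using assms(1) by (rule measurable_kernelE)
  obtain G where [measurable]: "G \<in> borel_measurable (borel \<Otimes>\<^sub>M borel \<Otimes>\<^sub>M borel)" and g: "g = (\<lambda>t x y. G (t, x, y))"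
    using assms(2) by (rule measurable_kernelE)
  show "(\<lambda>p. star f g (fst p) (fst (snd p)) (snd (snd p))) \<in> borel_measurable (borel \<Otimes>\<^sub>M borel \<Otimes>\<^sub>M borel)"
    unfolding star_def set_lebesgue_integral_def f g by measurable
qed

text \<open>The convolution as a single integral over the plane, so that one application of Fubini covers time and space.\<close>

definition star_integrand :: "kernel \<Rightarrow> kernel \<Rightarrow> real \<Rightarrow> real \<Rightarrow> real \<Rightarrow> real \<times> real \<Rightarrow> real" where
  "star_integrand f g t x y = (\<lambda>(\<tau>, z). indicator {0<..<t} \<tau> * (f (t - \<tau>) x z * g \<tau> z y))"

abbreviation plane :: "(real \<times> real) measure" where "plane \<equiv> lborel \<Otimes>\<^sub>M lborel"

lemma measurable_star_integrand:
  assumes "measurable_kernel f" "measurable_kernel g"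
  shows "star_integrand f g t x y \<in> borel_measurable plane"
proof -
  obtain F where [measurable]: "F \<in> borel_measurable (borel \<Otimes>\<^sub>M borel \<Otimes>\<^sub>M borel)" and f: "f = (\<lambda>t x y. F (t, x, y))"
    using assms(1) by (rule measurable_kernelE)
  obtain G where [measurable]: "G \<in> borel_measurable (borel \<Otimes>\<^sub>M borel \<Otimes>\<^sub>M borel)" and g: "g = (\<lambda>t x y. G (t, x, y))"
    using assms(2) by (rule measurable_kernelE)
  show ?thesis unfolding star_integrand_def f g by measurable
qed

lemma abs_star_eq:
  assumes f: "measurable_kernel f" and g: "measurable_kernel g"
  shows "abs_star f g t x y = (\<integral>\<^sup>+\<tau>. \<integral>\<^sup>+z. ennreal \<bar>star_integrand f g t x y (\<tau>, z)\<bar> \<partial>lborel \<partial>lborel)"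
  unfolding abs_star_def
proof (rule nn_integral_cong)
  fix \<tau>
  have [measurable]: "(\<lambda>z. f a x z) \<in> borel_measurable borel" "(\<lambda>z. g a z y) \<in> borel_measurable borel" for a
    by (rule measurable_kernel_compose[OF f] measurable_kernel_compose[OF g]; simp)+
  show "indicator {0<..<t} \<tau> * (\<integral>\<^sup>+z. ennreal \<bar>f (t - \<tau>) x z\<bar> * ennreal \<bar>g \<tau> z y\<bar> \<partial>lborel)
    = (\<integral>\<^sup>+z. ennreal \<bar>star_integrand f g t x y (\<tau>, z)\<bar> \<partial>lborel)"
    by (auto simp: star_integrand_def indicator_def ennreal_mult[symmetric] abs_mult)
qed

lemma star_eq_plane_integral:
  assumes f: "measurable_kernel f" and g: "measurable_kernel g" and fin: "abs_star f g t x y < \<infinity>"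
  shows "integrable plane (star_integrand f g t x y)"
    and "star f g t x y = (\<integral>p. star_integrand f g t x y p \<partial>plane)"
proof -
  let ?K = "\<lambda>\<tau> z. star_integrand f g t x y (\<tau>, z)"
  have m: "(\<lambda>(\<tau>, z). ?K \<tau> z) \<in> borel_measurable plane"
    using measurable_star_integrand[OF f g, of t x y] by (simp add: case_prod_eta)
  note F = fubini_absolute[OF sigma_finite_lborel sigma_finite_lborel m fin[unfolded abs_star_eq[OF f g]]]
  show "integrable plane (star_integrand f g t x y)" using F(1) by (simp add: case_prod_eta)
  have "star f g t x y = (\<integral>\<tau>. \<integral>z. ?K \<tau> z \<partial>lborel \<partial>lborel)"
    unfolding star_def set_lebesgue_integral_def star_integrand_def by simp
  then show "star f g t x y = (\<integral>p. star_integrand f g t x y p \<partial>plane)"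
    using F(2) by (simp add: case_prod_eta)
qed

lemma abs_star_le:
  assumes f: "measurable_kernel f" and g: "measurable_kernel g"
  shows "ennreal \<bar>star f g t x y\<bar> \<le> abs_star f g t x y"
proof -
  let ?K = "\<lambda>\<tau> z. star_integrand f g t x y (\<tau>, z)"
  have "star f g t x y = (\<integral>\<tau>. \<integral>z. ?K \<tau> z \<partial>lborel \<partial>lborel)"
    unfolding star_def set_lebesgue_integral_def star_integrand_def by simp
  then have "ennreal \<bar>star f g t x y\<bar> \<le> (\<integral>\<^sup>+\<tau>. ennreal \<bar>\<integral>z. ?K \<tau> z \<partial>lborel\<bar> \<partial>lborel)"
    by (simp only: ennreal_norm_integral_le)
  also have "\<dots> \<le> (\<integral>\<^sup>+\<tau>. \<integral>\<^sup>+z. ennreal \<bar>?K \<tau> z\<bar> \<partial>lborel \<partial>lborel)"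
    by (intro nn_integral_mono ennreal_norm_integral_le)
  finally show ?thesis by (simp only: abs_star_eq[OF f g])
qed

lemma star_cong:
  assumes "\<And>\<tau> z. 0 < \<tau> \<Longrightarrow> \<tau> < t \<Longrightarrow> f \<tau> x z = f' \<tau> x z" "\<And>\<tau> z. 0 < \<tau> \<Longrightarrow> \<tau> < t \<Longrightarrow> g \<tau> z y = g' \<tau> z y"
  shows "star f g t x y = star f' g' t x y"
  unfolding star_def set_lebesgue_integral_def
  by (intro Bochner_Integration.integral_cong refl) (auto simp: indicator_def assms)

lemma measurable_kernel_add:
  assumes "measurable_kernel f" "measurable_kernel g"
  shows "measurable_kernel (\<lambda>t x y. f t x y + g t x y)"
  using assms unfolding measurable_kernel_def case_prod_beta' by (rule borel_measurable_add)

lemma measurable_kernel_diff: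
  assumes "measurable_kernel f" "measurable_kernel g"
  shows "measurable_kernel (\<lambda>t x y. f t x y - g t x y)"
  using assms unfolding measurable_kernel_def case_prod_beta' by (rule borel_measurable_diff)

lemma measurable_kernel_scale:
  assumes "measurable_kernel f" and [measurable]: "a \<in> borel_measurable borel"
  shows "measurable_kernel (\<lambda>t x y. a t * f t x y)"
  using assms(1) unfolding measurable_kernel_def case_prod_beta' by (intro borel_measurable_times) measurable

lemma star_add_left:
  assumes "measurable_kernel f" "measurable_kernel f'" "measurable_kernel g"
    and "abs_star f g t x y < \<infinity>" "abs_star f' g t x y < \<infinity>"
  shows "star (\<lambda>t x y. f t x y + f' t x y) g t x y = star f g t x y + star f' g t x y"
    and "abs_star (\<lambda>t x y. f t x y + f' t x y) g t x y < \<infinity>"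
proof -
  let ?s = "\<lambda>t x y. f t x y + f' t x y"
  have eq: "star_integrand ?s g t x y = (\<lambda>p. star_integrand f g t x y p + star_integrand f' g t x y p)"
    by (auto simp: star_integrand_def fun_eq_iff algebra_simps)
  note m = measurable_kernel_add[OF assms(1,2)]
  note I = star_eq_plane_integral(1)[OF assms(1,3,4)] star_eq_plane_integral(1)[OF assms(2,3,5)]
  have "abs_star ?s g t x y = (\<integral>\<^sup>+p. ennreal \<bar>star_integrand ?s g t x y p\<bar> \<partial>plane)"
    unfolding abs_star_eq[OF m assms(3)] using measurable_star_integrand[OF m assms(3), of t x y]
    by (subst lborel.nn_integral_fst[symmetric]) auto
  also have "\<dots> < \<infinity>"
    using Bochner_Integration.integrable_add[OF I] unfolding eq by (simp add: integrable_iff_bounded)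
  finally show fin: "abs_star ?s g t x y < \<infinity>" .
  show "star ?s g t x y = star f g t x y + star f' g t x y"
    unfolding star_eq_plane_integral(2)[OF m assms(3) fin] eq
      star_eq_plane_integral(2)[OF assms(1,3,4)] star_eq_plane_integral(2)[OF assms(2,3,5)]
    by (rule Bochner_Integration.integral_add[OF I])
qed

lemma star_add_right:
  assumes "measurable_kernel f" "measurable_kernel g" "measurable_kernel g'"
    and "abs_star f g t x y < \<infinity>" "abs_star f g' t x y < \<infinity>"
  shows "star f (\<lambda>t x y. g t x y + g' t x y) t x y = star f g t x y + star f g' t x y"
proof -
  let ?s = "\<lambda>t x y. g t x y + g' t x y"
  have eq: "star_integrand f ?s t x y = (\<lambda>p. star_integrand f g t x y p + star_integrand f g' t x y p)"
    by (auto simp: star_integrand_def fun_eq_iff algebra_simps)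
  note m = measurable_kernel_add[OF assms(2,3)]
  note I = star_eq_plane_integral(1)[OF assms(1,2,4)] star_eq_plane_integral(1)[OF assms(1,3,5)]
  have "abs_star f ?s t x y = (\<integral>\<^sup>+p. ennreal \<bar>star_integrand f ?s t x y p\<bar> \<partial>plane)"
    unfolding abs_star_eq[OF assms(1) m] using measurable_star_integrand[OF assms(1) m, of t x y]
    by (subst lborel.nn_integral_fst[symmetric]) auto
  also have "\<dots> < \<infinity>"
    using Bochner_Integration.integrable_add[OF I] unfolding eq by (simp add: integrable_iff_bounded)
  finally have fin: "abs_star f ?s t x y < \<infinity>" .
  show "star f ?s t x y = star f g t x y + star f g' t x y"
    unfolding star_eq_plane_integral(2)[OF assms(1) m fin] eq
      star_eq_plane_integral(2)[OF assms(1,2,4)] star_eq_plane_integral(2)[OF assms(1,3,5)]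
    by (rule Bochner_Integration.integral_add[OF I])
qed

lemma star_cmult_left: "star (\<lambda>t x y. c * f t x y) g t x y = c * star f g t x y"
proof -
  have "star (\<lambda>t x y. c * f t x y) g t x y = set_lebesgue_integral lborel {0<..<t} (\<lambda>\<tau>. c * (\<integral>z. f (t - \<tau>) x z * g \<tau> z y \<partial>lborel))"
    unfolding star_def mult.assoc integral_mult_right_zero ..
  then show ?thesis unfolding star_def by simp
qed

lemma star_cmult_right: "star f (\<lambda>t x y. c * g t x y) t x y = c * star f g t x y"
proof -
  have "star f (\<lambda>t x y. c * g t x y) t x y = set_lebesgue_integral lborel {0<..<t} (\<lambda>\<tau>. c * (\<integral>z. f (t - \<tau>) x z * g \<tau> z y \<partial>lborel))"
    unfolding star_def mult.left_commute[of _ c] integral_mult_right_zero ..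
  then show ?thesis unfolding star_def by simp
qed

section \<open>Kernels bounded on the scale \<open>\<rho>\<close>\<close>

text \<open>Of the scale \<open>\<rho>\<close> only monotonicity and doubling in \<open>t\<close> matter for convolutions. The exponent \<open>\<delta>\<close> is that of
the time singularity \<open>t powr (\<delta> - 1)\<close> of the perturbation.\<close>

locale kernel_scale =
  fixes \<rho> :: "real \<Rightarrow> real" and D \<delta> :: real
  assumes D: "1 \<le> D" and rho_pos: "\<And>t. 0 < t \<Longrightarrow> t \<le> 1 \<Longrightarrow> 0 < \<rho> t"
    and rho_anti: "\<And>s t. 0 < s \<Longrightarrow> s \<le> t \<Longrightarrow> t \<le> 1 \<Longrightarrow> \<rho> t \<le> \<rho> s"
    and rho_halving: "\<And>t. 0 < t \<Longrightarrow> t \<le> 1 \<Longrightarrow> \<rho> (t / 2) \<le> D * \<rho> t"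
    and \<delta>: "0 < \<delta>" "\<delta> \<le> 1"
begin

text \<open>A supremum bound alone is not stable under convolution over the whole line. Together with \<open>L\<^sup>1\<close> bounds in both
variables it is: the supremum of \<open>f \<star> g\<close> is estimated by that of one factor and an \<open>L\<^sup>1\<close> norm of the other.\<close>

definition bounded_kernel :: "(real \<Rightarrow> real) \<Rightarrow> kernel \<Rightarrow> bool" where
  "bounded_kernel w f \<longleftrightarrow> measurable_kernel f \<and> w \<in> borel_measurable borel \<and>
     (\<forall>t. 0 < t \<longrightarrow> t \<le> 1 \<longrightarrow> 0 \<le> w t \<and> (\<forall>x y. \<bar>f t x y\<bar> \<le> w t * \<rho> t) \<and>
       (\<forall>x. (\<integral>\<^sup>+y. ennreal \<bar>f t x y\<bar> \<partial>lborel) \<le> ennreal (w t)) \<and>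
       (\<forall>y. (\<integral>\<^sup>+x. ennreal \<bar>f t x y\<bar> \<partial>lborel) \<le> ennreal (w t)))"

lemma bounded_kernelD:
  assumes "bounded_kernel w f"
  shows "measurable_kernel f" "w \<in> borel_measurable borel"
    and "\<And>t. 0 < t \<Longrightarrow> t \<le> 1 \<Longrightarrow> 0 \<le> w t"
    and "\<And>t x y. 0 < t \<Longrightarrow> t \<le> 1 \<Longrightarrow> \<bar>f t x y\<bar> \<le> w t * \<rho> t"
    and "\<And>t x. 0 < t \<Longrightarrow> t \<le> 1 \<Longrightarrow> (\<integral>\<^sup>+y. ennreal \<bar>f t x y\<bar> \<partial>lborel) \<le> ennreal (w t)"
    and "\<And>t y. 0 < t \<Longrightarrow> t \<le> 1 \<Longrightarrow> (\<integral>\<^sup>+x. ennreal \<bar>f t x y\<bar> \<partial>lborel) \<le> ennreal (w t)"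
  using assms by (auto simp: bounded_kernel_def)

definition weights_convolve :: "(real \<Rightarrow> real) \<Rightarrow> (real \<Rightarrow> real) \<Rightarrow> (real \<Rightarrow> real) \<Rightarrow> bool" where
  "weights_convolve v w u \<longleftrightarrow> u \<in> borel_measurable borel \<and> (\<forall>t. 0 < t \<longrightarrow> t \<le> 1 \<longrightarrow> 0 \<le> u t \<and>
     (\<integral>\<^sup>+\<tau>. indicator {0<..<t} \<tau> * ennreal (v (t - \<tau>) * w \<tau>) \<partial>lborel) \<le> ennreal (u t))"

text \<open>At every time \<open>\<tau>\<close> one of \<open>t - \<tau>\<close> and \<open>\<tau>\<close> is at least \<open>t / 2\<close>. The factor living at that time is estimated
by its supremum, where \<open>\<rho>\<close> is at most \<open>D \<rho>\<^sub>t\<close>, and the other one in \<open>L\<^sup>1\<close>.\<close>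

lemma abs_star_sup:
  assumes f: "bounded_kernel v f" and g: "bounded_kernel w g" and c: "weights_convolve v w u" and t: "0 < t" "t \<le> 1"
  shows "abs_star f g t x y \<le> ennreal (D * u t * \<rho> t)"
proof -
  note F = bounded_kernelD[OF f] and G = bounded_kernelD[OF g]
  have [measurable]: "v \<in> borel_measurable borel" "w \<in> borel_measurable borel" by (fact F(2) G(2))+
  have [measurable]: "(\<lambda>z. f a x z) \<in> borel_measurable borel" "(\<lambda>z. g a z y) \<in> borel_measurable borel" for a
    by (rule measurable_kernel_compose[OF F(1)] measurable_kernel_compose[OF G(1)]; simp)+
  have Dr: "0 \<le> D * \<rho> t" using D rho_pos[OF t] by simp
  have inner: "(\<integral>\<^sup>+z. ennreal \<bar>f (t - \<tau>) x z\<bar> * ennreal \<bar>g \<tau> z y\<bar> \<partial>lborel)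
      \<le> ennreal (v (t - \<tau>) * w \<tau>) * ennreal (D * \<rho> t)" if \<tau>: "0 < \<tau>" "\<tau> < t" for \<tau>
  proof -
    have r1: "0 < t - \<tau>" "t - \<tau> \<le> 1" and r2: "\<tau> \<le> 1" using \<tau> t by auto
    have half: "\<rho> a \<le> D * \<rho> t" if "t / 2 \<le> a" "a \<le> 1" for a
      using rho_anti[of "t / 2" a] rho_halving[OF t] that t by linarith
    show ?thesis
    proof (cases "\<tau> \<le> t / 2")
      case True
      have "v (t - \<tau>) * \<rho> (t - \<tau>) \<le> v (t - \<tau>) * (D * \<rho> t)"
        using True t r1 by (intro mult_left_mono half F(3)) auto
      then have "(\<integral>\<^sup>+z. ennreal \<bar>f (t - \<tau>) x z\<bar> * ennreal \<bar>g \<tau> z y\<bar> \<partial>lborel)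
         \<le> (\<integral>\<^sup>+z. ennreal (v (t - \<tau>) * (D * \<rho> t)) * ennreal \<bar>g \<tau> z y\<bar> \<partial>lborel)"
        using F(4)[OF r1, of x] by (intro nn_integral_mono mult_right_mono ennreal_leI) (auto intro: order_trans)
      also have "\<dots> = ennreal (v (t - \<tau>) * (D * \<rho> t)) * (\<integral>\<^sup>+z. ennreal \<bar>g \<tau> z y\<bar> \<partial>lborel)"
        by (rule nn_integral_cmult) measurable
      also have "\<dots> \<le> ennreal (v (t - \<tau>) * (D * \<rho> t)) * ennreal (w \<tau>)"
        by (intro mult_left_mono G(6)[OF \<tau>(1) r2]) auto
      also have "\<dots> = ennreal (v (t - \<tau>) * w \<tau>) * ennreal (D * \<rho> t)"
        by (simp only: ennreal_mult[OF F(3)[OF r1] Dr] ennreal_mult[OF F(3)[OF r1] G(3)[OF \<tau>(1) r2]]) (simp only: ac_simps)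
      finally show ?thesis .
    next
      case False
      have "w \<tau> * \<rho> \<tau> \<le> w \<tau> * (D * \<rho> t)"
        using False \<tau> r2 by (intro mult_left_mono half G(3)) auto
      then have "(\<integral>\<^sup>+z. ennreal \<bar>f (t - \<tau>) x z\<bar> * ennreal \<bar>g \<tau> z y\<bar> \<partial>lborel)
         \<le> (\<integral>\<^sup>+z. ennreal \<bar>f (t - \<tau>) x z\<bar> * ennreal (w \<tau> * (D * \<rho> t)) \<partial>lborel)"
        using G(4)[OF \<tau>(1) r2, of _ y] by (intro nn_integral_mono mult_left_mono ennreal_leI) (auto intro: order_trans)
      also have "\<dots> = (\<integral>\<^sup>+z. ennreal \<bar>f (t - \<tau>) x z\<bar> \<partial>lborel) * ennreal (w \<tau> * (D * \<rho> t))"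
        by (rule nn_integral_multc) measurable
      also have "\<dots> \<le> ennreal (v (t - \<tau>)) * ennreal (w \<tau> * (D * \<rho> t))"
        by (intro mult_right_mono F(5)[OF r1]) auto
      also have "\<dots> = ennreal (v (t - \<tau>) * w \<tau>) * ennreal (D * \<rho> t)"
        by (simp only: ennreal_mult[OF G(3)[OF \<tau>(1) r2] Dr] ennreal_mult[OF F(3)[OF r1] G(3)[OF \<tau>(1) r2]] mult.assoc)
      finally show ?thesis .
    qed
  qed
  have "abs_star f g t x y \<le> (\<integral>\<^sup>+\<tau>. (indicator {0<..<t} \<tau> * ennreal (v (t - \<tau>) * w \<tau>)) * ennreal (D * \<rho> t) \<partial>lborel)"
    unfolding abs_star_def
  proof (rule nn_integral_mono)
    fix \<tau>
    show "indicator {0<..<t} \<tau> * (\<integral>\<^sup>+z. ennreal \<bar>f (t - \<tau>) x z\<bar> * ennreal \<bar>g \<tau> z y\<bar> \<partial>lborel)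
       \<le> indicator {0<..<t} \<tau> * ennreal (v (t - \<tau>) * w \<tau>) * ennreal (D * \<rho> t)"
      using inner[of \<tau>] by (cases "\<tau> \<in> {0<..<t}") auto
  qed
  also have "\<dots> = (\<integral>\<^sup>+\<tau>. indicator {0<..<t} \<tau> * ennreal (v (t - \<tau>) * w \<tau>) \<partial>lborel) * ennreal (D * \<rho> t)"
    by (rule nn_integral_multc) measurable
  also have "\<dots> \<le> ennreal (u t) * ennreal (D * \<rho> t)"
    using c t by (intro mult_right_mono) (auto simp: weights_convolve_def)
  also have "\<dots> = ennreal (D * u t * \<rho> t)"
    using c t Dr by (subst ennreal_mult[symmetric]) (auto simp: weights_convolve_def ac_simps)
  finally show ?thesis .
qed

lemma abs_star_L1:
  assumes f: "bounded_kernel v f" and g: "bounded_kernel w g" and c: "weights_convolve v w u" and t: "0 < t" "t \<le> 1"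
  shows "(\<integral>\<^sup>+y. abs_star f g t x y \<partial>lborel) \<le> ennreal (u t)"
    and "(\<integral>\<^sup>+x. abs_star f g t x y \<partial>lborel) \<le> ennreal (u t)"
proof -
  note F = bounded_kernelD[OF f] and G = bounded_kernelD[OF g]
  obtain F' where [measurable]: "F' \<in> borel_measurable (borel \<Otimes>\<^sub>M borel \<Otimes>\<^sub>M borel)" and f': "f = (\<lambda>t x y. F' (t, x, y))"
    using F(1) by (rule measurable_kernelE)
  obtain G' where [measurable]: "G' \<in> borel_measurable (borel \<Otimes>\<^sub>M borel \<Otimes>\<^sub>M borel)" and g': "g = (\<lambda>t x y. G' (t, x, y))"
    using G(1) by (rule measurable_kernelE)
  have final: "(\<integral>\<^sup>+\<tau>. indicator {0<..<t} \<tau> * H \<tau> \<partial>lborel) \<le> ennreal (u t)"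
    if "\<And>\<tau>. 0 < \<tau> \<Longrightarrow> \<tau> < t \<Longrightarrow> H \<tau> \<le> ennreal (v (t - \<tau>)) * ennreal (w \<tau>)" for H
  proof -
    have "(\<integral>\<^sup>+\<tau>. indicator {0<..<t} \<tau> * H \<tau> \<partial>lborel) \<le> (\<integral>\<^sup>+\<tau>. indicator {0<..<t} \<tau> * ennreal (v (t - \<tau>) * w \<tau>) \<partial>lborel)"
    proof (rule nn_integral_mono)
      fix \<tau>
      have "H \<tau> \<le> ennreal (v (t - \<tau>) * w \<tau>)" if "\<tau> \<in> {0<..<t}"
      proof -
        have "0 \<le> v (t - \<tau>)" "0 \<le> w \<tau>" using that t by (auto intro!: F(3) G(3))
        then show ?thesis using \<open>\<And>\<tau>. 0 < \<tau> \<Longrightarrow> \<tau> < t \<Longrightarrow> H \<tau> \<le> _\<close>[of \<tau>] that by (simp add: ennreal_mult)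
      qed
      then show "indicator {0<..<t} \<tau> * H \<tau> \<le> indicator {0<..<t} \<tau> * ennreal (v (t - \<tau>) * w \<tau>)"
        by (cases "\<tau> \<in> {0<..<t}") auto
    qed
    also have "\<dots> \<le> ennreal (u t)" using c t by (auto simp: weights_convolve_def)
    finally show ?thesis .
  qed
  have "(\<integral>\<^sup>+y. abs_star f g t x y \<partial>lborel)
    = (\<integral>\<^sup>+\<tau>. \<integral>\<^sup>+y. indicator {0<..<t} \<tau> * (\<integral>\<^sup>+z. ennreal \<bar>f (t - \<tau>) x z\<bar> * ennreal \<bar>g \<tau> z y\<bar> \<partial>lborel) \<partial>lborel \<partial>lborel)"
    unfolding abs_star_def f' g' by (rule lborel_pair.Fubini') measurable
  also have "\<dots> = (\<integral>\<^sup>+\<tau>. indicator {0<..<t} \<tau> * (\<integral>\<^sup>+y. \<integral>\<^sup>+z. ennreal \<bar>f (t - \<tau>) x z\<bar> * ennreal \<bar>g \<tau> z y\<bar> \<partial>lborel \<partial>lborel) \<partial>lborel)"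
    unfolding f' g' by (intro nn_integral_cong nn_integral_cmult) measurable
  also have "\<dots> \<le> ennreal (u t)"
  proof (rule final)
    fix \<tau> assume \<tau>: "0 < \<tau>" "\<tau> < t"
    then have r: "0 < t - \<tau>" "t - \<tau> \<le> 1" "\<tau> \<le> 1" using t by auto
    have "(\<integral>\<^sup>+y. \<integral>\<^sup>+z. ennreal \<bar>f (t - \<tau>) x z\<bar> * ennreal \<bar>g \<tau> z y\<bar> \<partial>lborel \<partial>lborel)
       = (\<integral>\<^sup>+z. \<integral>\<^sup>+y. ennreal \<bar>f (t - \<tau>) x z\<bar> * ennreal \<bar>g \<tau> z y\<bar> \<partial>lborel \<partial>lborel)"
      unfolding f' g' by (rule lborel_pair.Fubini') measurable
    also have "\<dots> = (\<integral>\<^sup>+z. ennreal \<bar>f (t - \<tau>) x z\<bar> * (\<integral>\<^sup>+y. ennreal \<bar>g \<tau> z y\<bar> \<partial>lborel) \<partial>lborel)"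
      unfolding f' g' by (intro nn_integral_cong nn_integral_cmult) measurable
    also have "\<dots> \<le> (\<integral>\<^sup>+z. ennreal \<bar>f (t - \<tau>) x z\<bar> * ennreal (w \<tau>) \<partial>lborel)"
      by (intro nn_integral_mono mult_left_mono G(5) \<tau> r) auto
    also have "\<dots> = (\<integral>\<^sup>+z. ennreal \<bar>f (t - \<tau>) x z\<bar> \<partial>lborel) * ennreal (w \<tau>)"
      unfolding f' by (rule nn_integral_multc) measurable
    also have "\<dots> \<le> ennreal (v (t - \<tau>)) * ennreal (w \<tau>)"
      by (intro mult_right_mono F(5) r) auto
    finally show "(\<integral>\<^sup>+y. \<integral>\<^sup>+z. ennreal \<bar>f (t - \<tau>) x z\<bar> * ennreal \<bar>g \<tau> z y\<bar> \<partial>lborel \<partial>lborel) \<le> ennreal (v (t - \<tau>)) * ennreal (w \<tau>)" .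
  qed
  finally show "(\<integral>\<^sup>+y. abs_star f g t x y \<partial>lborel) \<le> ennreal (u t)" .
  have "(\<integral>\<^sup>+x. abs_star f g t x y \<partial>lborel)
    = (\<integral>\<^sup>+\<tau>. \<integral>\<^sup>+x. indicator {0<..<t} \<tau> * (\<integral>\<^sup>+z. ennreal \<bar>f (t - \<tau>) x z\<bar> * ennreal \<bar>g \<tau> z y\<bar> \<partial>lborel) \<partial>lborel \<partial>lborel)"
    unfolding abs_star_def f' g' by (rule lborel_pair.Fubini') measurable
  also have "\<dots> = (\<integral>\<^sup>+\<tau>. indicator {0<..<t} \<tau> * (\<integral>\<^sup>+x. \<integral>\<^sup>+z. ennreal \<bar>f (t - \<tau>) x z\<bar> * ennreal \<bar>g \<tau> z y\<bar> \<partial>lborel \<partial>lborel) \<partial>lborel)"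
    unfolding f' g' by (intro nn_integral_cong nn_integral_cmult) measurable
  also have "\<dots> \<le> ennreal (u t)"
  proof (rule final)
    fix \<tau> assume \<tau>: "0 < \<tau>" "\<tau> < t"
    then have r: "0 < t - \<tau>" "t - \<tau> \<le> 1" "\<tau> \<le> 1" using t by auto
    have "(\<integral>\<^sup>+x. \<integral>\<^sup>+z. ennreal \<bar>f (t - \<tau>) x z\<bar> * ennreal \<bar>g \<tau> z y\<bar> \<partial>lborel \<partial>lborel)
       = (\<integral>\<^sup>+z. \<integral>\<^sup>+x. ennreal \<bar>f (t - \<tau>) x z\<bar> * ennreal \<bar>g \<tau> z y\<bar> \<partial>lborel \<partial>lborel)"
      unfolding f' g' by (rule lborel_pair.Fubini') measurable
    also have "\<dots> = (\<integral>\<^sup>+z. (\<integral>\<^sup>+x. ennreal \<bar>f (t - \<tau>) x z\<bar> \<partial>lborel) * ennreal \<bar>g \<tau> z y\<bar> \<partial>lborel)"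
      unfolding f' g' by (intro nn_integral_cong nn_integral_multc) measurable
    also have "\<dots> \<le> (\<integral>\<^sup>+z. ennreal (v (t - \<tau>)) * ennreal \<bar>g \<tau> z y\<bar> \<partial>lborel)"
      by (intro nn_integral_mono mult_right_mono F(6) r) auto
    also have "\<dots> = ennreal (v (t - \<tau>)) * (\<integral>\<^sup>+z. ennreal \<bar>g \<tau> z y\<bar> \<partial>lborel)"
      unfolding g' by (rule nn_integral_cmult) measurable
    also have "\<dots> \<le> ennreal (v (t - \<tau>)) * ennreal (w \<tau>)"
      by (intro mult_left_mono G(6) \<tau> r) auto
    finally show "(\<integral>\<^sup>+x. \<integral>\<^sup>+z. ennreal \<bar>f (t - \<tau>) x z\<bar> * ennreal \<bar>g \<tau> z y\<bar> \<partial>lborel \<partial>lborel) \<le> ennreal (v (t - \<tau>)) * ennreal (w \<tau>)" .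
  qed
  finally show "(\<integral>\<^sup>+x. abs_star f g t x y \<partial>lborel) \<le> ennreal (u t)" .
qed

lemma abs_star_finite:
  assumes "bounded_kernel v f" "bounded_kernel w g" "weights_convolve v w u" "0 < t" "t \<le> 1"
  shows "abs_star f g t x y < \<infinity>"
  using order_le_less_trans[OF abs_star_sup[OF assms]] by simp

lemma bounded_abs_star:
  assumes f: "bounded_kernel v f" and g: "bounded_kernel w g" and c: "weights_convolve v w u"
  shows "bounded_kernel (\<lambda>t. D * u t) (\<lambda>t x y. enn2real (abs_star f g t x y))"
  unfolding bounded_kernel_def
proof (intro conjI allI impI)
  note m = bounded_kernelD(1)[OF f] bounded_kernelD(1)[OF g]
  show "measurable_kernel (\<lambda>t x y. enn2real (abs_star f g t x y))"
    using measurable_abs_star[OF m] by (intro measurable_kernelI) measurable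
  show "(\<lambda>t. D * u t) \<in> borel_measurable borel"
    using c by (intro borel_measurable_times) (simp_all add: weights_convolve_def)
  fix t :: real assume t: "0 < t" "t \<le> 1"
  have u: "0 \<le> u t" using c t by (simp add: weights_convolve_def)
  then show Du: "0 \<le> D * u t" using D by simp
  have e: "ennreal \<bar>enn2real (abs_star f g t x y)\<bar> = abs_star f g t x y" for x y
    using abs_star_finite[OF f g c t, of x y] by simp
  show "\<bar>enn2real (abs_star f g t x y)\<bar> \<le> D * u t * \<rho> t" for x y
    using abs_star_sup[OF f g c t, of x y] Du rho_pos[OF t] by (simp add: enn2real_leI)
  have "ennreal (u t) \<le> ennreal (D * u t)"
    using mult_right_mono[OF D u] by (intro ennreal_leI) simp
  then show "(\<integral>\<^sup>+y. ennreal \<bar>enn2real (abs_star f g t x y)\<bar> \<partial>lborel) \<le> ennreal (D * u t)"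
    "(\<integral>\<^sup>+x. ennreal \<bar>enn2real (abs_star f g t x y)\<bar> \<partial>lborel) \<le> ennreal (D * u t)" for x y
    unfolding e using abs_star_L1[OF f g c t] by (auto intro: order_trans)
qed

lemma bounded_kernel_mono:
  assumes "bounded_kernel w g" "measurable_kernel f" "v \<in> borel_measurable borel"
    and "\<And>t x y. 0 < t \<Longrightarrow> t \<le> 1 \<Longrightarrow> \<bar>f t x y\<bar> \<le> \<bar>g t x y\<bar>" "\<And>t. 0 < t \<Longrightarrow> t \<le> 1 \<Longrightarrow> w t \<le> v t"
  shows "bounded_kernel v f"
  unfolding bounded_kernel_def
proof (intro conjI allI impI assms(2,3))
  note G = bounded_kernelD[OF assms(1)]
  fix t :: real assume t: "0 < t" "t \<le> 1"
  note le = assms(4)[OF t] and wv = assms(5)[OF t]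
  show "0 \<le> v t" using G(3)[OF t] wv by linarith
  show "\<bar>f t x y\<bar> \<le> v t * \<rho> t" for x y
    using le[of x y] G(4)[OF t, of x y] mult_right_mono[OF wv, of "\<rho> t"] rho_pos[OF t] by linarith
  show "(\<integral>\<^sup>+y. ennreal \<bar>f t x y\<bar> \<partial>lborel) \<le> ennreal (v t)" for x
    using order_trans[OF nn_integral_mono[OF ennreal_leI[OF le]] order_trans[OF G(5)[OF t] ennreal_leI[OF wv]]] .
  show "(\<integral>\<^sup>+x. ennreal \<bar>f t x y\<bar> \<partial>lborel) \<le> ennreal (v t)" for y
    using order_trans[OF nn_integral_mono[OF ennreal_leI[OF le]] order_trans[OF G(6)[OF t] ennreal_leI[OF wv]]] .
qed

lemma bounded_star:
  assumes f: "bounded_kernel v f" and g: "bounded_kernel w g" and c: "weights_convolve v w u"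
  shows "bounded_kernel (\<lambda>t. D * u t) (star f g)"
proof (rule bounded_kernel_mono[OF bounded_abs_star[OF f g c]])
  note m = bounded_kernelD(1)[OF f] bounded_kernelD(1)[OF g]
  show "measurable_kernel (star f g)" by (rule measurable_star[OF m])
  show "(\<lambda>t. D * u t) \<in> borel_measurable borel"
    using c by (intro borel_measurable_times) (simp_all add: weights_convolve_def)
  fix t x y :: real assume t: "0 < t" "t \<le> 1"
  have "enn2real (ennreal \<bar>star f g t x y\<bar>) \<le> enn2real (abs_star f g t x y)"
    using abs_star_finite[OF f g c t, of x y] abs_star_le[OF m, of t x y] by (intro enn2real_mono) auto
  then show "\<bar>star f g t x y\<bar> \<le> \<bar>enn2real (abs_star f g t x y)\<bar>" by simp
qed simp

text \<open>Both sides are integrals of one function over two copies of the plane. The assumptions on weights make it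
absolutely integrable, and a translation of the time variable matches the two parametrisations.\<close>

lemma star_assoc:
  assumes f: "bounded_kernel a f" and g: "bounded_kernel b g" and h: "bounded_kernel c h"
    and ab: "weights_convolve a b ab" and abc: "weights_convolve (\<lambda>t. D * ab t) c abc"
    and bc: "weights_convolve b c bc" and abc': "weights_convolve a (\<lambda>t. D * bc t) abc'"
    and t: "0 < t" "t \<le> 1"
  shows "star (star f g) h t x y = star f (star g h) t x y"
proof -
  note mf = bounded_kernelD(1)[OF f] and mg = bounded_kernelD(1)[OF g] and mh = bounded_kernelD(1)[OF h]
  obtain F where [measurable]: "F \<in> borel_measurable (borel \<Otimes>\<^sub>M borel \<Otimes>\<^sub>M borel)" and f': "f = (\<lambda>t x y. F (t, x, y))"
    using mf by (rule measurable_kernelE)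
  obtain G where [measurable]: "G \<in> borel_measurable (borel \<Otimes>\<^sub>M borel \<Otimes>\<^sub>M borel)" and g': "g = (\<lambda>t x y. G (t, x, y))"
    using mg by (rule measurable_kernelE)
  obtain H where [measurable]: "H \<in> borel_measurable (borel \<Otimes>\<^sub>M borel \<Otimes>\<^sub>M borel)" and h': "h = (\<lambda>t x y. H (t, x, y))"
    using mh by (rule measurable_kernelE)
  have plane: "plane = (lborel :: (real \<times> real) measure)" by (rule lborel_prod)
  have sf: "sigma_finite_measure plane" unfolding plane by (rule sigma_finite_lborel)
  define K :: "real \<times> real \<Rightarrow> real \<times> real \<Rightarrow> real" where
    "K = (\<lambda>p q. indicator {0<..<t} (fst p) * (f (t - fst p) x (snd p) * star_integrand g h (fst p) (snd p) y q))"
  have K_meas: "(\<lambda>(p, q). K p q) \<in> borel_measurable (plane \<Otimes>\<^sub>M plane)"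
    unfolding K_def star_integrand_def f' g' h' case_prod_beta' by measurable
  have inner_fin: "abs_star g h s w y < \<infinity>" if "0 < s" "s \<le> 1" for s w
    by (rule abs_star_finite[OF g h bc that])
  let ?gh = "\<lambda>t x y. enn2real (abs_star g h t x y)"
  note gh = bounded_abs_star[OF g h bc]
  have abs_inner: "(\<integral>\<^sup>+q. ennreal \<bar>K p q\<bar> \<partial>plane) \<le> indicator {0<..<t} (fst p) * (ennreal \<bar>f (t - fst p) x (snd p)\<bar> * ennreal \<bar>?gh (fst p) (snd p) y\<bar>)" for p
  proof (cases "fst p \<in> {0<..<t}")
    case True
    then have p: "0 < fst p" "fst p \<le> 1" using t by auto
    have "(\<integral>\<^sup>+q. ennreal \<bar>K p q\<bar> \<partial>plane) = (\<integral>\<^sup>+q. ennreal \<bar>f (t - fst p) x (snd p)\<bar> * ennreal \<bar>star_integrand g h (fst p) (snd p) y q\<bar> \<partial>plane)"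
      using True by (simp add: K_def abs_mult ennreal_mult)
    also have "\<dots> = ennreal \<bar>f (t - fst p) x (snd p)\<bar> * (\<integral>\<^sup>+q. ennreal \<bar>star_integrand g h (fst p) (snd p) y q\<bar> \<partial>plane)"
      by (intro nn_integral_cmult measurable_compose[OF measurable_star_integrand[OF mg mh]]) measurable
    also have "(\<integral>\<^sup>+q. ennreal \<bar>star_integrand g h (fst p) (snd p) y q\<bar> \<partial>plane) = abs_star g h (fst p) (snd p) y"
      unfolding abs_star_eq[OF mg mh] using measurable_star_integrand[OF mg mh, of "fst p" "snd p" y]
      by (subst lborel.nn_integral_fst[symmetric]) auto
    also have "\<dots> = ennreal \<bar>?gh (fst p) (snd p) y\<bar>" using inner_fin[OF p] by simp
    finally show ?thesis using True by simp
  qed (simp add: K_def)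
  have fin: "(\<integral>\<^sup>+p. \<integral>\<^sup>+q. ennreal \<bar>K p q\<bar> \<partial>plane \<partial>plane) < \<infinity>"
  proof -
    have m2: "measurable_kernel ?gh" by (rule bounded_kernelD(1)[OF gh])
    obtain E where [measurable]: "E \<in> borel_measurable (borel \<Otimes>\<^sub>M borel \<Otimes>\<^sub>M borel)" and E: "?gh = (\<lambda>t x y. E (t, x, y))"
      using m2 by (rule measurable_kernelE)
    have E': "?gh a b c = E (a, b, c)" for a b c using E by metis
    have "(\<integral>\<^sup>+p. \<integral>\<^sup>+q. ennreal \<bar>K p q\<bar> \<partial>plane \<partial>plane)
       \<le> (\<integral>\<^sup>+p. indicator {0<..<t} (fst p) * (ennreal \<bar>f (t - fst p) x (snd p)\<bar> * ennreal \<bar>?gh (fst p) (snd p) y\<bar>) \<partial>plane)"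
      by (intro nn_integral_mono abs_inner)
    also have "\<dots> = (\<integral>\<^sup>+\<tau>. \<integral>\<^sup>+z. indicator {0<..<t} \<tau> * (ennreal \<bar>f (t - \<tau>) x z\<bar> * ennreal \<bar>?gh \<tau> z y\<bar>) \<partial>lborel \<partial>lborel)"
    proof -
      have m: "(\<lambda>p. indicator {0<..<t} (fst p) * (ennreal \<bar>f (t - fst p) x (snd p)\<bar> * ennreal \<bar>?gh (fst p) (snd p) y\<bar>))
          \<in> borel_measurable plane"
        unfolding f' E' by measurable
      show ?thesis using lborel.nn_integral_fst[OF m] by simp
    qed
    also have "\<dots> = abs_star f ?gh t x y"
      unfolding E' f' unfolding abs_star_def by (intro nn_integral_cong nn_integral_cmult) measurable
    also have "\<dots> < \<infinity>" by (rule abs_star_finite[OF f gh abc' t])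
    finally show ?thesis .
  qed
  have right: "star f (star g h) t x y = (\<integral>p. \<integral>q. K p q \<partial>plane \<partial>plane)"
  proof -
    have "star f (star g h) t x y = (\<integral>p. star_integrand f (star g h) t x y p \<partial>plane)"
      by (rule star_eq_plane_integral(2)[OF mf measurable_star[OF mg mh] abs_star_finite[OF f bounded_star[OF g h bc] abc' t]])
    also have "\<dots> = (\<integral>p. \<integral>q. K p q \<partial>plane \<partial>plane)"
    proof (intro Bochner_Integration.integral_cong refl)
      fix p
      show "star_integrand f (star g h) t x y p = (\<integral>q. K p q \<partial>plane)"
      proof (cases "fst p \<in> {0<..<t}")
        case True
        then have p: "0 < fst p" "fst p \<le> 1" using t by auto
        have "(\<integral>q. K p q \<partial>plane) = f (t - fst p) x (snd p) * (\<integral>q. star_integrand g h (fst p) (snd p) y q \<partial>plane)"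
          using True unfolding K_def by (simp only: indicator_simps mult_1 integral_mult_right_zero)
        then show ?thesis
          using True star_eq_plane_integral(2)[OF mg mh inner_fin[OF p]] by (simp add: star_integrand_def case_prod_beta')
      qed (simp add: K_def star_integrand_def case_prod_beta')
    qed
    finally show ?thesis .
  qed
  have left: "star (star f g) h t x y = (\<integral>q. \<integral>p. K p q \<partial>plane \<partial>plane)"
  proof -
    have "star (star f g) h t x y = (\<integral>q. star_integrand (star f g) h t x y q \<partial>plane)"
      by (rule star_eq_plane_integral(2)[OF measurable_star[OF mf mg] mh abs_star_finite[OF bounded_star[OF f g ab] h abc t]])
    also have "\<dots> = (\<integral>q. \<integral>p. K p q \<partial>plane \<partial>plane)"
    proof (intro Bochner_Integration.integral_cong refl)
      fix q
      have Kq: "(\<lambda>p. K p q) \<in> borel_measurable plane"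
        using measurable_compose[OF measurable_Pair2'[of q plane plane] K_meas] by (simp add: plane)
      \<comment> \<open>In \<open>K\<close> the outer time is measured from \<open>0\<close>; in \<open>star f g\<close> it is measured from the inner time \<open>fst q\<close>.\<close>
      have "(\<integral>p. K p q \<partial>plane) = (\<integral>p. K (p + (fst q, 0)) q \<partial>plane)"
      proof -
        have "(\<integral>p. K p q \<partial>plane) = (\<integral>p. K p q \<partial>distr plane borel ((+) (fst q, 0)))"
          unfolding plane lborel_distr_plus ..
        also have "\<dots> = (\<integral>p. K ((fst q, 0) + p) q \<partial>plane)"
          using Kq unfolding plane by (intro integral_distr) auto
        finally show ?thesis by (simp add: add.commute)
      qed
      also have "\<dots> = (\<integral>p. (indicator {0<..<t} (fst q) * h (fst q) (snd q) y) * star_integrand f g (t - fst q) x (snd q) p \<partial>plane)"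
      proof (intro Bochner_Integration.integral_cong refl)
        fix p :: "real \<times> real"
        show "K (p + (fst q, 0)) q = (indicator {0<..<t} (fst q) * h (fst q) (snd q) y) * star_integrand f g (t - fst q) x (snd q) p"
          by (cases p; cases q) (auto simp: K_def star_integrand_def indicator_def algebra_simps)
      qed
      also have "\<dots> = indicator {0<..<t} (fst q) * h (fst q) (snd q) y * (\<integral>p. star_integrand f g (t - fst q) x (snd q) p \<partial>plane)"
        by (rule integral_mult_right_zero)
      also have "\<dots> = star_integrand (star f g) h t x y q"
      proof (cases "fst q \<in> {0<..<t}")
        case True
        then have q: "0 < t - fst q" "t - fst q \<le> 1" using t by auto
        show ?thesis
          using True star_eq_plane_integral(2)[OF mf mg abs_star_finite[OF f g ab q]] by (simp add: star_integrand_def case_prod_beta')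
      qed (simp add: star_integrand_def case_prod_beta')
      finally show "star_integrand (star f g) h t x y q = (\<integral>p. K p q \<partial>plane)" by simp
    qed
    finally show ?thesis .
  qed
  show ?thesis unfolding left right
    by (rule fubini_absolute(3)[OF sf sf K_meas fin, symmetric])
qed

end

section \<open>Exponential and singular weights in time\<close>

lemma exp_minus_le_powr:
  assumes "0 < (x::real)" "0 < a" "a \<le> 1" shows "exp (- x) \<le> x powr (- a)"
proof -
  have "x powr a \<le> exp x"
  proof (cases "x \<le> 1")
    case True
    then have "x powr a \<le> 1" using assms by (simp add: powr_le1)
    then show ?thesis using assms(1) by (meson exp_ge_zero less_eq_real_def one_le_exp_iff order_trans)
  next
    case False
    then have "x powr a \<le> x powr 1" using assms by (intro powr_mono) auto
    also have "x powr 1 = x" using assms(1) by simp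
    also have "x \<le> exp x" using exp_ge_add_one_self[of x] by linarith
    finally show ?thesis .
  qed
  then show ?thesis using assms by (simp add: exp_minus powr_minus inverse_le_iff_le)
qed

lemma nn_integral_powr_unit:
  assumes "0 < a" shows "(\<integral>\<^sup>+\<tau>. indicator {0<..<1} \<tau> * ennreal (\<tau> powr (a - 1)) \<partial>lborel) \<le> ennreal (1 / a)"
proof -
  have "((\<lambda>\<tau>. \<tau> powr (a - 1)) has_integral (1 powr (a - 1 + 1) / (a - 1 + 1))) {0..1::real}"
    using assms by (intro has_integral_powr_from_0) auto
  then have h: "((\<lambda>\<tau>. \<tau> powr (a - 1)) has_integral (1 / a)) {0..1::real}" by simp
  have "(\<integral>\<^sup>+\<tau>. indicator {0<..<1} \<tau> * ennreal (\<tau> powr (a - 1)) \<partial>lborel)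
      \<le> (\<integral>\<^sup>+\<tau>. ennreal (indicator {0..1} \<tau> * \<tau> powr (a - 1)) \<partial>lborel)"
    by (intro nn_integral_mono) (auto simp: indicator_def)
  also have "\<dots> = ennreal (1 / a)"
  proof (rule nn_integral_has_integral_lborel)
    have "(\<lambda>\<tau>. indicator {0..1} \<tau> * \<tau> powr (a - 1)) = (\<lambda>\<tau>. if \<tau> \<in> {0..1} then \<tau> powr (a - 1) else 0)"
      by (auto simp: fun_eq_iff)
    then show "((\<lambda>\<tau>. indicator {0..1} \<tau> * \<tau> powr (a - 1)) has_integral (1 / a)) UNIV"
      using h by (simp only: has_integral_restrict_UNIV)
    show "(\<lambda>\<tau>. indicator {0..1} \<tau> * \<tau> powr (a - 1)) \<in> borel_measurable borel" by measurable
    show "0 \<le> indicator {0..1} \<tau> * \<tau> powr (a - 1)" for \<tau> :: real by simp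
  qed
  finally show ?thesis .
qed

context kernel_scale
begin

text \<open>An upper bound for the integral of \<open>exp (- k \<tau>) \<tau> powr (\<delta> - 1)\<close>, and hence for the factor by which convolution
with the perturbation changes \<open>exp (k t)\<close>. It is small for large \<open>k\<close>.\<close>

definition gain :: "real \<Rightarrow> real" where "gain k = 2 / \<delta> * k powr (- \<delta> / 2)"

lemma gain_nonneg: "0 \<le> gain k" using \<delta> by (simp add: gain_def)

lemma gain_small: "0 < e \<Longrightarrow> \<exists>k>0. gain k \<le> e"
proof -
  assume e: "0 < e"
  have "(gain \<longlongrightarrow> 0) at_top"
    unfolding gain_def using \<delta> by (intro tendsto_mult_right_zero tendsto_neg_powr filterlim_ident) auto
  then have "\<forall>\<^sub>F k in at_top. gain k < e" using e by (rule order_tendstoD)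
  moreover have "\<forall>\<^sub>F k in at_top. 0 < (k::real)" by (rule eventually_gt_at_top)
  ultimately have "\<forall>\<^sub>F k in at_top. 0 < k \<and> gain k < e" by eventually_elim simp
  then obtain k where "0 < k \<and> gain k < e" using eventually_happens by force
  then show ?thesis by (auto intro: less_imp_le)
qed

text \<open>Half of the integrable singularity is traded for decay in \<open>k\<close>: \<open>exp (- k \<tau>) \<le> (k \<tau>) powr (- \<delta> / 2)\<close>.\<close>

lemma damped_integral:
  assumes k: "0 < k" and t: "t \<le> 1"
  shows "(\<integral>\<^sup>+\<tau>. indicator {0<..<t} \<tau> * ennreal (exp (- k * \<tau>) * \<tau> powr (\<delta> - 1)) \<partial>lborel) \<le> ennreal (gain k)"
proof -
  have "(\<integral>\<^sup>+\<tau>. indicator {0<..<t} \<tau> * ennreal (exp (- k * \<tau>) * \<tau> powr (\<delta> - 1)) \<partial>lborel)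
     \<le> (\<integral>\<^sup>+\<tau>. ennreal (k powr (- \<delta> / 2)) * (indicator {0<..<1} \<tau> * ennreal (\<tau> powr (\<delta> / 2 - 1))) \<partial>lborel)"
  proof (rule nn_integral_mono)
    fix \<tau> :: real
    show "indicator {0<..<t} \<tau> * ennreal (exp (- k * \<tau>) * \<tau> powr (\<delta> - 1))
       \<le> ennreal (k powr (- \<delta> / 2)) * (indicator {0<..<1} \<tau> * ennreal (\<tau> powr (\<delta> / 2 - 1)))"
    proof (cases "\<tau> \<in> {0<..<t}")
      case True
      then have \<tau>: "0 < \<tau>" "\<tau> < 1" using t by auto
      have "exp (- k * \<tau>) \<le> (k * \<tau>) powr (- (\<delta> / 2))"
        using exp_minus_le_powr[of "k * \<tau>" "\<delta> / 2"] k \<tau> \<delta> by simp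
      also have "\<dots> = k powr (- \<delta> / 2) * \<tau> powr (- \<delta> / 2)" using k \<tau> by (simp add: powr_mult)
      finally have "exp (- k * \<tau>) * \<tau> powr (\<delta> - 1) \<le> k powr (- \<delta> / 2) * \<tau> powr (- \<delta> / 2) * \<tau> powr (\<delta> - 1)"
        by (rule mult_right_mono) simp
      also have "\<dots> = k powr (- \<delta> / 2) * \<tau> powr (\<delta> / 2 - 1)"
        by (simp add: mult.assoc powr_add[symmetric])
      finally show ?thesis using True \<tau> by (simp add: ennreal_mult[symmetric] ennreal_leI)
    qed simp
  qed
  also have "\<dots> = ennreal (k powr (- \<delta> / 2)) * (\<integral>\<^sup>+\<tau>. indicator {0<..<1} \<tau> * ennreal (\<tau> powr (\<delta> / 2 - 1)) \<partial>lborel)"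
    by (rule nn_integral_cmult) measurable
  also have "\<dots> \<le> ennreal (k powr (- \<delta> / 2)) * ennreal (1 / (\<delta> / 2))"
    using \<delta> by (intro mult_left_mono nn_integral_powr_unit) auto
  also have "\<dots> = ennreal (gain k)"
    using \<delta> by (simp add: gain_def ennreal_mult[symmetric] mult.commute)
  finally show ?thesis .
qed

lemma weights_convolve_exp:
  assumes k: "0 < k" and A: "0 \<le> A" and B: "0 \<le> B"
  shows "weights_convolve (\<lambda>t. A * exp (k * t)) (\<lambda>t. B * t powr (\<delta> - 1)) (\<lambda>t. A * B * gain k * exp (k * t))"
  unfolding weights_convolve_def
proof (intro conjI allI impI)
  fix t :: real assume t: "0 < t" "t \<le> 1"
  show "0 \<le> A * B * gain k * exp (k * t)" using A B gain_nonneg by simp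
  have ABe: "0 \<le> A * B * exp (k * t)" using A B by simp
  have "(\<integral>\<^sup>+\<tau>. indicator {0<..<t} \<tau> * ennreal (A * exp (k * (t - \<tau>)) * (B * \<tau> powr (\<delta> - 1))) \<partial>lborel)
     = (\<integral>\<^sup>+\<tau>. ennreal (A * B * exp (k * t)) * (indicator {0<..<t} \<tau> * ennreal (exp (- k * \<tau>) * \<tau> powr (\<delta> - 1))) \<partial>lborel)"
  proof (rule nn_integral_cong)
    fix \<tau>
    have "A * exp (k * (t - \<tau>)) * (B * \<tau> powr (\<delta> - 1)) = A * B * exp (k * t) * (exp (- k * \<tau>) * \<tau> powr (\<delta> - 1))"
      by (simp add: right_diff_distrib exp_diff exp_minus divide_inverse)
    then have "ennreal (A * exp (k * (t - \<tau>)) * (B * \<tau> powr (\<delta> - 1))) = ennreal (A * B * exp (k * t)) * ennreal (exp (- k * \<tau>) * \<tau> powr (\<delta> - 1))"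
      using ABe by (simp only:) (rule ennreal_mult, auto)
    then show "indicator {0<..<t} \<tau> * ennreal (A * exp (k * (t - \<tau>)) * (B * \<tau> powr (\<delta> - 1)))
       = ennreal (A * B * exp (k * t)) * (indicator {0<..<t} \<tau> * ennreal (exp (- k * \<tau>) * \<tau> powr (\<delta> - 1)))"
      by (simp only: mult.left_commute)
  qed
  also have "\<dots> = ennreal (A * B * exp (k * t)) * (\<integral>\<^sup>+\<tau>. indicator {0<..<t} \<tau> * ennreal (exp (- k * \<tau>) * \<tau> powr (\<delta> - 1)) \<partial>lborel)"
    by (rule nn_integral_cmult) measurable
  also have "\<dots> \<le> ennreal (A * B * exp (k * t)) * ennreal (gain k)"
    by (intro mult_left_mono damped_integral k t) auto
  also have "\<dots> = ennreal (A * B * exp (k * t) * gain k)" by (rule ennreal_mult[OF ABe gain_nonneg, symmetric])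
  finally show "(\<integral>\<^sup>+\<tau>. indicator {0<..<t} \<tau> * ennreal (A * exp (k * (t - \<tau>)) * (B * \<tau> powr (\<delta> - 1))) \<partial>lborel)
     \<le> ennreal (A * B * gain k * exp (k * t))" by (simp only: ac_simps)
qed measurable

text \<open>The time singularity of the perturbation, multiplied by an exponential weight that makes convolution contractive.\<close>

definition singular_weight :: "real \<Rightarrow> real \<Rightarrow> real" where
  "singular_weight k t = exp (k * t) * t powr (\<delta> - 1)"

lemma measurable_singular_weight [measurable]: "singular_weight k \<in> borel_measurable borel"
  unfolding singular_weight_def[abs_def] by measurable

lemma singular_weight_nonneg: "0 \<le> singular_weight k t" by (simp add: singular_weight_def)

lemma singular_weight_0: "singular_weight 0 t = t powr (\<delta> - 1)" by (simp add: singular_weight_def)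

lemma singular_weight_ge_exp: "0 < t \<Longrightarrow> t \<le> 1 \<Longrightarrow> exp (k * t) \<le> singular_weight k t"
proof -
  assume t: "0 < t" "t \<le> 1"
  have "1 \<le> t powr (\<delta> - 1)" using powr_mono'[of "\<delta> - 1" 0 t] t \<delta> by simp
  then show ?thesis unfolding singular_weight_def by (simp add: mult_le_cancel_left1)
qed

text \<open>On each half of the time interval one of the two singular factors is comparable with \<open>t powr (\<delta> - 1)\<close>; the other
is integrated with the damping \<open>exp (- k \<tau>)\<close>.\<close>

lemma weights_convolve_singular:
  assumes k: "0 < k" and A: "0 \<le> A" and B: "0 \<le> B"
  shows "weights_convolve (\<lambda>t. A * singular_weight k t) (\<lambda>t. B * singular_weight 0 t) (\<lambda>t. A * B * (4 * gain k) * singular_weight k t)"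
  unfolding weights_convolve_def
proof (intro conjI allI impI)
  fix t :: real assume t: "0 < t" "t \<le> 1"
  show "0 \<le> A * B * (4 * gain k) * singular_weight k t" using A B gain_nonneg singular_weight_nonneg by simp
  let ?d = "\<lambda>\<tau>. exp (- k * \<tau>) * \<tau> powr (\<delta> - 1)"
  let ?C = "A * B * 2 * singular_weight k t"
  have C0: "0 \<le> ?C" using A B singular_weight_nonneg by simp
  have half: "s powr (\<delta> - 1) \<le> 2 * t powr (\<delta> - 1)" if "t / 2 \<le> s" for s
  proof -
    have "s powr (\<delta> - 1) \<le> (t / 2) powr (\<delta> - 1)"
      using that t \<delta> by (intro powr_mono2') auto
    also have "\<dots> = t powr (\<delta> - 1) * 2 powr (1 - \<delta>)"
      using t by (simp add: powr_divide powr_diff)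
    also have "\<dots> \<le> t powr (\<delta> - 1) * 2 powr 1" using \<delta> by (intro mult_left_mono powr_mono) auto
    finally show ?thesis by simp
  qed
  have pt: "A * singular_weight k (t - \<tau>) * (B * singular_weight 0 \<tau>) \<le> ?C * (?d \<tau> + ?d (t - \<tau>))" if \<tau>: "0 < \<tau>" "\<tau> < t" for \<tau>
  proof -
    have e: "exp (k * (t - \<tau>)) = exp (k * t) * exp (- k * \<tau>)" by (simp add: mult_exp_exp right_diff_distrib)
    have nn: "0 \<le> ?d \<tau>" "0 \<le> ?d (t - \<tau>)" by simp_all
    have "exp (- k * \<tau>) * ((t - \<tau>) powr (\<delta> - 1) * \<tau> powr (\<delta> - 1)) \<le> 2 * t powr (\<delta> - 1) * (?d \<tau> + ?d (t - \<tau>))"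
    proof (cases "\<tau> \<le> t / 2")
      case True
      have "(t - \<tau>) powr (\<delta> - 1) * ?d \<tau> \<le> 2 * t powr (\<delta> - 1) * ?d \<tau>"
        using True by (intro mult_right_mono half) auto
      also have "\<dots> \<le> 2 * t powr (\<delta> - 1) * (?d \<tau> + ?d (t - \<tau>))" using nn by (intro mult_left_mono) auto
      finally show ?thesis by (simp only: ac_simps)
    next
      case False
      have "exp (- k * \<tau>) \<le> exp (- k * (t - \<tau>))" using False k by simp
      then have "exp (- k * \<tau>) * ((t - \<tau>) powr (\<delta> - 1) * \<tau> powr (\<delta> - 1)) \<le> exp (- k * (t - \<tau>)) * ((t - \<tau>) powr (\<delta> - 1) * (2 * t powr (\<delta> - 1)))"
        using False by (intro mult_mono mult_left_mono half) auto
      also have "\<dots> = 2 * t powr (\<delta> - 1) * ?d (t - \<tau>)" by (simp only: ac_simps)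
      also have "\<dots> \<le> 2 * t powr (\<delta> - 1) * (?d \<tau> + ?d (t - \<tau>))" using nn by (intro mult_left_mono) auto
      finally show ?thesis .
    qed
    then have "(A * B * exp (k * t)) * (exp (- k * \<tau>) * ((t - \<tau>) powr (\<delta> - 1) * \<tau> powr (\<delta> - 1)))
       \<le> (A * B * exp (k * t)) * (2 * t powr (\<delta> - 1) * (?d \<tau> + ?d (t - \<tau>)))"
      using A B by (intro mult_left_mono) auto
    then show ?thesis unfolding singular_weight_def e by (simp only: mult_zero_left exp_zero mult_1_left ac_simps)
  qed
  have "(\<integral>\<^sup>+\<tau>. indicator {0<..<t} \<tau> * ennreal (A * singular_weight k (t - \<tau>) * (B * singular_weight 0 \<tau>)) \<partial>lborel)
     \<le> (\<integral>\<^sup>+\<tau>. ennreal ?C * (indicator {0<..<t} \<tau> * ennreal (?d \<tau>) + indicator {0<..<t} (t - \<tau>) * ennreal (?d (t - \<tau>))) \<partial>lborel)"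
  proof (rule nn_integral_mono)
    fix \<tau> :: real
    show "indicator {0<..<t} \<tau> * ennreal (A * singular_weight k (t - \<tau>) * (B * singular_weight 0 \<tau>))
      \<le> ennreal ?C * (indicator {0<..<t} \<tau> * ennreal (?d \<tau>) + indicator {0<..<t} (t - \<tau>) * ennreal (?d (t - \<tau>)))"
    proof (cases "\<tau> \<in> {0<..<t}")
      case True
      have "ennreal (A * singular_weight k (t - \<tau>) * (B * singular_weight 0 \<tau>)) \<le> ennreal (?C * (?d \<tau> + ?d (t - \<tau>)))"
        using True by (intro ennreal_leI pt) auto
      also have "\<dots> = ennreal ?C * (ennreal (?d \<tau>) + ennreal (?d (t - \<tau>)))"
        by (subst ennreal_mult[OF C0], simp, subst ennreal_plus) auto
      finally show ?thesis using True by simp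
    qed simp
  qed
  also have "\<dots> = ennreal ?C * (\<integral>\<^sup>+\<tau>. indicator {0<..<t} \<tau> * ennreal (?d \<tau>) + indicator {0<..<t} (t - \<tau>) * ennreal (?d (t - \<tau>)) \<partial>lborel)"
    by (rule nn_integral_cmult) measurable
  also have "(\<integral>\<^sup>+\<tau>. indicator {0<..<t} \<tau> * ennreal (?d \<tau>) + indicator {0<..<t} (t - \<tau>) * ennreal (?d (t - \<tau>)) \<partial>lborel)
     = (\<integral>\<^sup>+\<tau>. indicator {0<..<t} \<tau> * ennreal (?d \<tau>) \<partial>lborel) + (\<integral>\<^sup>+\<tau>. indicator {0<..<t} (t - \<tau>) * ennreal (?d (t - \<tau>)) \<partial>lborel)"
    by (rule nn_integral_add) measurable
  also have "(\<integral>\<^sup>+\<tau>. indicator {0<..<t} (t - \<tau>) * ennreal (?d (t - \<tau>)) \<partial>lborel) = (\<integral>\<^sup>+\<tau>. indicator {0<..<t} \<tau> * ennreal (?d \<tau>) \<partial>lborel)"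
    by (rule nn_integral_reflect[of "\<lambda>\<tau>. indicator {0<..<t} \<tau> * ennreal (?d \<tau>)" t]) measurable
  also have "ennreal ?C * ((\<integral>\<^sup>+\<tau>. indicator {0<..<t} \<tau> * ennreal (?d \<tau>) \<partial>lborel) + (\<integral>\<^sup>+\<tau>. indicator {0<..<t} \<tau> * ennreal (?d \<tau>) \<partial>lborel))
     \<le> ennreal ?C * (ennreal (gain k) + ennreal (gain k))"
    by (intro mult_left_mono add_mono damped_integral k t) auto
  also have "\<dots> = ennreal (?C * (gain k + gain k))"
    using gain_nonneg by (subst ennreal_mult[OF C0], simp, subst ennreal_plus) auto
  also have "?C * (gain k + gain k) = A * B * (4 * gain k) * singular_weight k t" by simp
  finally show "(\<integral>\<^sup>+\<tau>. indicator {0<..<t} \<tau> * ennreal (A * singular_weight k (t - \<tau>) * (B * singular_weight 0 \<tau>)) \<partial>lborel)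
     \<le> ennreal (A * B * (4 * gain k) * singular_weight k t)" .
qed measurable

lemma weights_convolve_mono:
  assumes c: "weights_convolve v w u" and m: "u' \<in> borel_measurable borel"
    and "\<And>t. 0 < t \<Longrightarrow> t \<le> 1 \<Longrightarrow> 0 \<le> v' t \<and> v' t \<le> v t" "\<And>t. 0 < t \<Longrightarrow> t \<le> 1 \<Longrightarrow> 0 \<le> w' t \<and> w' t \<le> w t"
    and "\<And>t. 0 < t \<Longrightarrow> t \<le> 1 \<Longrightarrow> u t \<le> u' t"
  shows "weights_convolve v' w' u'"
  unfolding weights_convolve_def
proof (intro conjI allI impI m)
  fix t :: real assume t: "0 < t" "t \<le> 1"
  have u: "0 \<le> u t" "(\<integral>\<^sup>+\<tau>. indicator {0<..<t} \<tau> * ennreal (v (t - \<tau>) * w \<tau>) \<partial>lborel) \<le> ennreal (u t)"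
    using c t by (auto simp: weights_convolve_def)
  show "0 \<le> u' t" using u(1) assms(5)[OF t] by linarith
  have "(\<integral>\<^sup>+\<tau>. indicator {0<..<t} \<tau> * ennreal (v' (t - \<tau>) * w' \<tau>) \<partial>lborel)
      \<le> (\<integral>\<^sup>+\<tau>. indicator {0<..<t} \<tau> * ennreal (v (t - \<tau>) * w \<tau>) \<partial>lborel)"
  proof (rule nn_integral_mono)
    fix \<tau>
    show "indicator {0<..<t} \<tau> * ennreal (v' (t - \<tau>) * w' \<tau>) \<le> indicator {0<..<t} \<tau> * ennreal (v (t - \<tau>) * w \<tau>)"
    proof (cases "\<tau> \<in> {0<..<t}")
      case True
      then have r: "0 < t - \<tau>" "t - \<tau> \<le> 1" "0 < \<tau>" "\<tau> \<le> 1" using t by auto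
      have "v' (t - \<tau>) * w' \<tau> \<le> v (t - \<tau>) * w \<tau>"
        using assms(3)[OF r(1,2)] assms(4)[OF r(3,4)] by (intro mult_mono) auto
      then show ?thesis by (intro mult_left_mono ennreal_leI) auto
    qed simp
  qed
  also have "\<dots> \<le> ennreal (u t)" by (rule u(2))
  also have "\<dots> \<le> ennreal (u' t)" by (rule ennreal_leI[OF assms(5)[OF t]])
  finally show "(\<integral>\<^sup>+\<tau>. indicator {0<..<t} \<tau> * ennreal (v' (t - \<tau>) * w' \<tau>) \<partial>lborel) \<le> ennreal (u' t)" .
qed

text \<open>The class in which identities between convolutions are manipulated: it is closed under sums, bounded time-dependent
factors and \<open>\<star>\<close>, and every convolution in it converges absolutely.\<close>

definition admissible :: "kernel \<Rightarrow> bool" where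
  "admissible f \<longleftrightarrow> (\<exists>A\<ge>0. bounded_kernel (\<lambda>t. A * singular_weight 0 t) f)"

lemma admissibleE:
  assumes "admissible f" obtains A where "0 \<le> A" "bounded_kernel (\<lambda>t. A * singular_weight 0 t) f"
  using assms by (auto simp: admissible_def)

lemma admissibleD: "admissible f \<Longrightarrow> measurable_kernel f"
  by (auto simp: admissible_def dest: bounded_kernelD(1))

lemma weights_convolve_admissible:
  assumes "0 \<le> A" "0 \<le> B"
  shows "weights_convolve (\<lambda>t. A * singular_weight 0 t) (\<lambda>t. B * singular_weight 0 t) (\<lambda>t. A * B * (4 * gain 1 * exp 1) * singular_weight 0 t)"
proof (rule weights_convolve_mono[OF weights_convolve_singular[OF zero_less_one assms]])
  fix t :: real assume t: "0 < t" "t \<le> 1"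
  have 1: "singular_weight 0 t \<le> singular_weight 1 t" using t by (simp add: singular_weight_def)
  show "0 \<le> A * singular_weight 0 t \<and> A * singular_weight 0 t \<le> A * singular_weight 1 t"
    using 1 assms singular_weight_nonneg by (simp add: mult_left_mono)
  show "0 \<le> B * singular_weight 0 t \<and> B * singular_weight 0 t \<le> B * singular_weight 0 t"
    using assms singular_weight_nonneg by simp
  have "singular_weight 1 t \<le> exp 1 * singular_weight 0 t"
    using t by (simp add: singular_weight_def mult_right_mono)
  then have "A * B * (4 * gain 1) * singular_weight 1 t \<le> A * B * (4 * gain 1) * (exp 1 * singular_weight 0 t)"
    using assms gain_nonneg by (intro mult_left_mono) auto
  then show "A * B * (4 * gain 1) * singular_weight 1 t \<le> A * B * (4 * gain 1 * exp 1) * singular_weight 0 t"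
    by (simp only: mult.assoc)
qed measurable

lemma admissible_finite:
  assumes "admissible f" "admissible g" "0 < t" "t \<le> 1" shows "abs_star f g t x y < \<infinity>"
  using assms(1,2) by (elim admissibleE) (rule abs_star_finite[OF _ _ weights_convolve_admissible assms(3,4)])

lemma admissible_star:
  assumes "admissible f" "admissible g" shows "admissible (star f g)"
proof -
  obtain A where A: "0 \<le> A" "bounded_kernel (\<lambda>t. A * singular_weight 0 t) f" using assms(1) by (rule admissibleE)
  obtain B where B: "0 \<le> B" "bounded_kernel (\<lambda>t. B * singular_weight 0 t) g" using assms(2) by (rule admissibleE)
  have "bounded_kernel (\<lambda>t. (D * (A * B * (4 * gain 1 * exp 1))) * singular_weight 0 t) (star f g)"
    using bounded_star[OF A(2) B(2) weights_convolve_admissible[OF A(1) B(1)]] by (simp only: mult.assoc)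
  moreover have "0 \<le> D * (A * B * (4 * gain 1 * exp 1))" using D A B gain_nonneg by simp
  ultimately show ?thesis unfolding admissible_def by blast
qed

lemma admissible_star_assoc:
  assumes "admissible f" "admissible g" "admissible h" "0 < t" "t \<le> 1"
  shows "star (star f g) h t x y = star f (star g h) t x y"
proof -
  obtain A where A: "0 \<le> A" "bounded_kernel (\<lambda>t. A * singular_weight 0 t) f" using assms(1) by (rule admissibleE)
  obtain B where B: "0 \<le> B" "bounded_kernel (\<lambda>t. B * singular_weight 0 t) g" using assms(2) by (rule admissibleE)
  obtain C where C: "0 \<le> C" "bounded_kernel (\<lambda>t. C * singular_weight 0 t) h" using assms(3) by (rule admissibleE)
  let ?g = "4 * gain 1 * exp 1"
  have AB: "0 \<le> D * (A * B * ?g)" and BC: "0 \<le> D * (B * C * ?g)"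
    using D A(1) B(1) C(1) gain_nonneg by simp_all
  show ?thesis
    by (rule star_assoc[OF A(2) B(2) C(2) weights_convolve_admissible[OF A(1) B(1)]
          weights_convolve_admissible[OF AB C(1), unfolded mult.assoc[of D]]
          weights_convolve_admissible[OF B(1) C(1)]
          weights_convolve_admissible[OF A(1) BC, unfolded mult.assoc[of D]] assms(4,5)])
qed

lemma bounded_kernel_add:
  assumes f: "bounded_kernel v f" and g: "bounded_kernel w g"
  shows "bounded_kernel (\<lambda>t. v t + w t) (\<lambda>t x y. f t x y + g t x y)"
  unfolding bounded_kernel_def
proof (intro conjI allI impI)
  note F = bounded_kernelD[OF f] and G = bounded_kernelD[OF g]
  show "measurable_kernel (\<lambda>t x y. f t x y + g t x y)" by (rule measurable_kernel_add[OF F(1) G(1)])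
  show "(\<lambda>t. v t + w t) \<in> borel_measurable borel" using F(2) G(2) by measurable
  fix t :: real assume t: "0 < t" "t \<le> 1"
  show "0 \<le> v t + w t" using F(3)[OF t] G(3)[OF t] by simp
  show "\<bar>f t x y + g t x y\<bar> \<le> (v t + w t) * \<rho> t" for x y
    using F(4)[OF t, of x y] G(4)[OF t, of x y] by (simp add: distrib_right)
  have [measurable]: "(\<lambda>z. f t x z) \<in> borel_measurable borel" "(\<lambda>z. g t x z) \<in> borel_measurable borel"
    "(\<lambda>z. f t z x) \<in> borel_measurable borel" "(\<lambda>z. g t z x) \<in> borel_measurable borel" for x
    by (rule measurable_kernel_compose[OF F(1)] measurable_kernel_compose[OF G(1)]; simp)+
  have p: "ennreal \<bar>f t x y + g t x y\<bar> \<le> ennreal \<bar>f t x y\<bar> + ennreal \<bar>g t x y\<bar>" for x y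
    using ennreal_leI[OF abs_triangle_ineq[of "f t x y" "g t x y"]] by simp
  have s: "ennreal (v t) + ennreal (w t) = ennreal (v t + w t)" using F(3)[OF t] G(3)[OF t] by simp
  show "(\<integral>\<^sup>+y. ennreal \<bar>f t x y + g t x y\<bar> \<partial>lborel) \<le> ennreal (v t + w t)" for x
  proof -
    have "(\<integral>\<^sup>+y. ennreal \<bar>f t x y + g t x y\<bar> \<partial>lborel) \<le> (\<integral>\<^sup>+y. ennreal \<bar>f t x y\<bar> \<partial>lborel) + (\<integral>\<^sup>+y. ennreal \<bar>g t x y\<bar> \<partial>lborel)"
      by (subst nn_integral_add[symmetric]) (auto intro!: nn_integral_mono p)
    also have "\<dots> \<le> ennreal (v t) + ennreal (w t)" by (intro add_mono F(5) G(5) t)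
    finally show ?thesis by (simp only: s)
  qed
  show "(\<integral>\<^sup>+x. ennreal \<bar>f t x y + g t x y\<bar> \<partial>lborel) \<le> ennreal (v t + w t)" for y
  proof -
    have "(\<integral>\<^sup>+x. ennreal \<bar>f t x y + g t x y\<bar> \<partial>lborel) \<le> (\<integral>\<^sup>+x. ennreal \<bar>f t x y\<bar> \<partial>lborel) + (\<integral>\<^sup>+x. ennreal \<bar>g t x y\<bar> \<partial>lborel)"
      by (subst nn_integral_add[symmetric]) (auto intro!: nn_integral_mono p)
    also have "\<dots> \<le> ennreal (v t) + ennreal (w t)" by (intro add_mono F(6) G(6) t)
    finally show ?thesis by (simp only: s)
  qed
qed

lemma bounded_kernel_scale:
  assumes f: "bounded_kernel w f" and [measurable]: "a \<in> borel_measurable borel" and C: "\<And>t. 0 < t \<Longrightarrow> t \<le> 1 \<Longrightarrow> \<bar>a t\<bar> \<le> C"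
  shows "bounded_kernel (\<lambda>t. C * w t) (\<lambda>t x y. a t * f t x y)"
  unfolding bounded_kernel_def
proof (intro conjI allI impI)
  note F = bounded_kernelD[OF f]
  show "measurable_kernel (\<lambda>t x y. a t * f t x y)" by (rule measurable_kernel_scale[OF F(1)]) measurable
  show "(\<lambda>t. C * w t) \<in> borel_measurable borel" using F(2) by measurable
  fix t :: real assume t: "0 < t" "t \<le> 1"
  have C0: "0 \<le> C" using C[OF t] by linarith
  show "0 \<le> C * w t" using C0 F(3)[OF t] by simp
  show "\<bar>a t * f t x y\<bar> \<le> C * w t * \<rho> t" for x y
    unfolding abs_mult mult.assoc using C[OF t] C0 F(4)[OF t] by (intro mult_mono) auto
  have [measurable]: "(\<lambda>z. f t x z) \<in> borel_measurable borel" "(\<lambda>z. f t z x) \<in> borel_measurable borel" for x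
    by (rule measurable_kernel_compose[OF F(1)]; simp)+
  have p: "ennreal \<bar>a t * f t x y\<bar> \<le> ennreal C * ennreal \<bar>f t x y\<bar>" for x y
    unfolding abs_mult using C[OF t] C0 by (subst ennreal_mult[symmetric]) (auto intro!: ennreal_leI mult_right_mono)
  have s: "ennreal C * ennreal (w t) = ennreal (C * w t)" using C0 F(3)[OF t] by (simp add: ennreal_mult)
  show "(\<integral>\<^sup>+y. ennreal \<bar>a t * f t x y\<bar> \<partial>lborel) \<le> ennreal (C * w t)" for x
  proof -
    have "(\<integral>\<^sup>+y. ennreal \<bar>a t * f t x y\<bar> \<partial>lborel) \<le> ennreal C * (\<integral>\<^sup>+y. ennreal \<bar>f t x y\<bar> \<partial>lborel)"
      by (subst nn_integral_cmult[symmetric]) (auto intro!: nn_integral_mono p)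
    also have "\<dots> \<le> ennreal C * ennreal (w t)" by (intro mult_left_mono F(5) t) auto
    finally show ?thesis by (simp only: s)
  qed
  show "(\<integral>\<^sup>+x. ennreal \<bar>a t * f t x y\<bar> \<partial>lborel) \<le> ennreal (C * w t)" for y
  proof -
    have "(\<integral>\<^sup>+x. ennreal \<bar>a t * f t x y\<bar> \<partial>lborel) \<le> ennreal C * (\<integral>\<^sup>+x. ennreal \<bar>f t x y\<bar> \<partial>lborel)"
      by (subst nn_integral_cmult[symmetric]) (auto intro!: nn_integral_mono p)
    also have "\<dots> \<le> ennreal C * ennreal (w t)" by (intro mult_left_mono F(6) t) auto
    finally show ?thesis by (simp only: s)
  qed
qed

lemma admissible_add:
  assumes "admissible f" "admissible g" shows "admissible (\<lambda>t x y. f t x y + g t x y)"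
proof -
  obtain A where A: "0 \<le> A" "bounded_kernel (\<lambda>t. A * singular_weight 0 t) f" using assms(1) by (rule admissibleE)
  obtain B where B: "0 \<le> B" "bounded_kernel (\<lambda>t. B * singular_weight 0 t) g" using assms(2) by (rule admissibleE)
  have "bounded_kernel (\<lambda>t. (A + B) * singular_weight 0 t) (\<lambda>t x y. f t x y + g t x y)"
    using bounded_kernel_add[OF A(2) B(2)] by (simp only: distrib_right)
  then show ?thesis using A(1) B(1) unfolding admissible_def by (intro exI[of _ "A + B"]) simp
qed

lemma admissible_scale:
  assumes "admissible f" "a \<in> borel_measurable borel" "\<And>t. 0 < t \<Longrightarrow> t \<le> 1 \<Longrightarrow> \<bar>a t\<bar> \<le> C"
  shows "admissible (\<lambda>t x y. a t * f t x y)"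
proof -
  obtain A where A: "0 \<le> A" "bounded_kernel (\<lambda>t. A * singular_weight 0 t) f" using assms(1) by (rule admissibleE)
  have "0 \<le> C" using assms(3)[of 1] by simp
  moreover have "bounded_kernel (\<lambda>t. (C * A) * singular_weight 0 t) (\<lambda>t x y. a t * f t x y)"
    using bounded_kernel_scale[OF A(2) assms(2,3)] by (simp only: mult.assoc)
  ultimately show ?thesis using A(1) unfolding admissible_def by (intro exI[of _ "C * A"]) simp
qed

lemma bounded_imp_admissible:
  assumes "bounded_kernel (\<lambda>t. A * exp (k * t)) f" and "0 \<le> k" and A: "0 \<le> A"
  shows "admissible f"
proof -
  have "bounded_kernel (\<lambda>t. (A * exp k) * singular_weight 0 t) f"
  proof (rule bounded_kernel_mono[OF assms(1) bounded_kernelD(1)[OF assms(1)]])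
    fix t :: real assume t: "0 < t" "t \<le> 1"
    have "exp (k * t) \<le> exp k" using t assms(2) by (simp add: mult_left_le)
    moreover have "1 \<le> singular_weight 0 t" using singular_weight_ge_exp[OF t, of 0] by simp
    ultimately have "A * (exp (k * t) * 1) \<le> A * (exp k * singular_weight 0 t)"
      using A by (intro mult_left_mono mult_mono) auto
    then show "A * exp (k * t) \<le> A * exp k * singular_weight 0 t" by simp
  qed (simp_all, measurable)
  then show ?thesis using A unfolding admissible_def by (intro exI[of _ "A * exp k"]) simp
qed

end

section \<open>Resolvent series and fixed points\<close>

text \<open>Iterates for the equation \<open>R = p + R \<star> F\<close>, started at \<open>0\<close> so that for nonnegative data they increase from below.\<close>

primrec picard :: "kernel \<Rightarrow> kernel \<Rightarrow> nat \<Rightarrow> kernel" where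
  "picard F p 0 = (\<lambda>t x y. 0)"
| "picard F p (Suc n) = (\<lambda>t x y. p t x y + star (picard F p n) F t x y)"

context kernel_scale
begin

lemma bounded_suminf:
  assumes f: "\<And>k. bounded_kernel (\<lambda>t. c k * w t) (f k)" and c: "summable c" "\<And>k. 0 \<le> c k"
    and w: "w \<in> borel_measurable borel" "\<And>t. 0 \<le> w t"
  shows "bounded_kernel (\<lambda>t. suminf c * w t) (\<lambda>t x y. \<Sum>k. f k t x y)"
    and "\<And>t x y. 0 < t \<Longrightarrow> t \<le> 1 \<Longrightarrow> summable (\<lambda>k. \<bar>f k t x y\<bar>)"
proof -
  note F = bounded_kernelD[OF f]
  have c0: "0 \<le> suminf c" using c by (intro suminf_nonneg)
  have sm: "summable (\<lambda>k. c k * w t * \<rho> t)" for t using c(1) by (intro summable_mult2)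
  show summ: "summable (\<lambda>k. \<bar>f k t x y\<bar>)" if t: "0 < t" "t \<le> 1" for t x y
    by (rule summable_comparison_test'[OF sm[of t], of 0]) (use F(4)[OF t] in auto)
  show "bounded_kernel (\<lambda>t. suminf c * w t) (\<lambda>t x y. \<Sum>k. f k t x y)"
    unfolding bounded_kernel_def
  proof (intro conjI allI impI)
    have "(\<lambda>p. f k (fst p) (fst (snd p)) (snd (snd p))) \<in> borel_measurable (borel \<Otimes>\<^sub>M borel \<Otimes>\<^sub>M borel)" for k
      by (rule measurable_kernel_compose[OF F(1)]) measurable
    then show "measurable_kernel (\<lambda>t x y. \<Sum>k. f k t x y)"
      by (intro measurable_kernelI borel_measurable_suminf)
    show "(\<lambda>t. suminf c * w t) \<in> borel_measurable borel" using w by measurable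
    fix t :: real assume t: "0 < t" "t \<le> 1"
    show "0 \<le> suminf c * w t" using c0 w by simp
    have le: "\<bar>\<Sum>k. f k t x y\<bar> \<le> (\<Sum>k. \<bar>f k t x y\<bar>)" for x y
      by (rule summable_rabs[OF summ[OF t]])
    show "\<bar>\<Sum>k. f k t x y\<bar> \<le> suminf c * w t * \<rho> t" for x y
    proof -
      have "(\<Sum>k. \<bar>f k t x y\<bar>) \<le> (\<Sum>k. c k * w t * \<rho> t)"
        by (rule suminf_le[OF _ summ[OF t] sm]) (use F(4)[OF t] in auto)
      also have "\<dots> = suminf c * w t * \<rho> t"
        using c(1) by (simp add: suminf_mult2 summable_mult2 mult.assoc)
      finally show ?thesis using le[of x y] by linarith
    qed
    have nn: "ennreal \<bar>\<Sum>k. f k t x y\<bar> \<le> (\<Sum>k. ennreal \<bar>f k t x y\<bar>)" for x y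
      using ennreal_leI[OF le[of x y]] by (simp add: suminf_ennreal2[OF _ summ[OF t]])
    have tot: "(\<Sum>k. ennreal (c k * w t)) = ennreal (suminf c * w t)"
      using c w by (subst suminf_ennreal2) (auto simp: suminf_mult2 summable_mult2)
    have [measurable]: "(\<lambda>z. f k t x z) \<in> borel_measurable borel" "(\<lambda>z. f k t z x) \<in> borel_measurable borel" for k x
      by (rule measurable_kernel_compose[OF F(1)]; simp)+
    show "(\<integral>\<^sup>+y. ennreal \<bar>\<Sum>k. f k t x y\<bar> \<partial>lborel) \<le> ennreal (suminf c * w t)" for x
    proof -
      have "(\<integral>\<^sup>+y. ennreal \<bar>\<Sum>k. f k t x y\<bar> \<partial>lborel) \<le> (\<integral>\<^sup>+y. (\<Sum>k. ennreal \<bar>f k t x y\<bar>) \<partial>lborel)"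
        by (intro nn_integral_mono nn)
      also have "\<dots> = (\<Sum>k. \<integral>\<^sup>+y. ennreal \<bar>f k t x y\<bar> \<partial>lborel)" by (rule nn_integral_suminf) measurable
      also have "\<dots> \<le> (\<Sum>k. ennreal (c k * w t))" by (intro suminf_le F(5) t) auto
      finally show ?thesis by (simp only: tot)
    qed
    show "(\<integral>\<^sup>+x. ennreal \<bar>\<Sum>k. f k t x y\<bar> \<partial>lborel) \<le> ennreal (suminf c * w t)" for y
    proof -
      have "(\<integral>\<^sup>+x. ennreal \<bar>\<Sum>k. f k t x y\<bar> \<partial>lborel) \<le> (\<integral>\<^sup>+x. (\<Sum>k. ennreal \<bar>f k t x y\<bar>) \<partial>lborel)"
        by (intro nn_integral_mono nn)
      also have "\<dots> = (\<Sum>k. \<integral>\<^sup>+x. ennreal \<bar>f k t x y\<bar> \<partial>lborel)" by (rule nn_integral_suminf) measurable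
      also have "\<dots> \<le> (\<Sum>k. ennreal (c k * w t))" by (intro suminf_le F(6) t) auto
      finally show ?thesis by (simp only: tot)
    qed
  qed
qed

lemma star_suminf_left:
  assumes f: "\<And>k. bounded_kernel (\<lambda>t. c k * w t) (f k)" and c: "summable c" "\<And>k. 0 \<le> c k"
    and w: "w \<in> borel_measurable borel" "\<And>t. 0 \<le> w t"
    and g: "bounded_kernel v g" and conv: "\<And>k. weights_convolve (\<lambda>t. c k * w t) v (\<lambda>t. c k * u t)"
    and t: "0 < t" "t \<le> 1"
  shows "star (\<lambda>t x y. \<Sum>k. f k t x y) g t x y = (\<Sum>k. star (f k) g t x y)"
proof -
  note F = bounded_kernelD[OF f] and G = bounded_kernelD[OF g]
  let ?s = "\<lambda>t x y. \<Sum>k. f k t x y"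
  let ?I = "\<lambda>k. star_integrand (f k) g t x y"
  note summ = bounded_suminf(2)[OF f c w]
  have fin: "abs_star (f k) g t x y < \<infinity>" for k by (rule abs_star_finite[OF f g conv t])
  note PI = star_eq_plane_integral[OF F(1) G(1) fin]
  have norm: "(\<integral>p. norm (?I k p) \<partial>plane) \<le> c k * (D * u t * \<rho> t)" for k
  proof -
    have "ennreal (\<integral>p. norm (?I k p) \<partial>plane) = (\<integral>\<^sup>+p. ennreal (norm (?I k p)) \<partial>plane)"
      by (rule nn_integral_eq_integral[symmetric]) (use PI(1) in auto)
    also have "\<dots> = abs_star (f k) g t x y"
      unfolding abs_star_eq[OF F(1) G(1)] using measurable_star_integrand[OF F(1) G(1), of k t x y]
      by (subst lborel.nn_integral_fst[symmetric]) auto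
    also have "\<dots> \<le> ennreal (D * (c k * u t) * \<rho> t)" by (rule abs_star_sup[OF f g conv t])
    finally have "ennreal (\<integral>p. norm (?I k p) \<partial>plane) \<le> ennreal (D * (c k * u t) * \<rho> t)" .
    moreover have "0 \<le> D * (c k * u t) * \<rho> t"
      using conv[of k] t D rho_pos[OF t] by (auto simp: weights_convolve_def)
    ultimately have "(\<integral>p. norm (?I k p) \<partial>plane) \<le> D * (c k * u t) * \<rho> t" by (simp add: ennreal_le_iff)
    then show ?thesis by (simp only: ac_simps)
  qed
  have AEs: "summable (\<lambda>k. norm (?I k p))" for p
  proof (cases "fst p \<in> {0<..<t}")
    case True
    then have r: "0 < t - fst p" "t - fst p \<le> 1" using t by auto
    have "summable (\<lambda>k. \<bar>f k (t - fst p) x (snd p)\<bar> * \<bar>g (fst p) (snd p) y\<bar>)"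
      by (intro summable_mult2 summ r)
    then show ?thesis using True by (simp add: star_integrand_def case_prod_beta' abs_mult)
  qed (simp add: star_integrand_def case_prod_beta')
  have S: "(\<lambda>k. integral\<^sup>L plane (?I k)) sums (\<integral>p. (\<Sum>k. ?I k p) \<partial>plane)"
    and Sint: "integrable plane (\<lambda>p. \<Sum>k. ?I k p)"
  proof -
    have sn: "summable (\<lambda>k. \<integral>p. norm (?I k p) \<partial>plane)"
      by (rule summable_comparison_test'[OF summable_mult2[OF c(1), of "D * u t * \<rho> t"], of 0]) (use norm in \<open>simp add: integral_nonneg_AE\<close>)
    show "(\<lambda>k. integral\<^sup>L plane (?I k)) sums (\<integral>p. (\<Sum>k. ?I k p) \<partial>plane)"
      by (rule sums_integral[OF PI(1) AE_I2[OF AEs] sn])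
    show "integrable plane (\<lambda>p. \<Sum>k. ?I k p)"
      by (rule integrable_suminf[OF PI(1) AE_I2[OF AEs] sn])
  qed
  have eq: "star_integrand ?s g t x y = (\<lambda>p. \<Sum>k. ?I k p)"
  proof
    fix p
    show "star_integrand ?s g t x y p = (\<Sum>k. ?I k p)"
    proof (cases "fst p \<in> {0<..<t}")
      case True
      then have r: "0 < t - fst p" "t - fst p \<le> 1" using t by auto
      have "(\<Sum>k. f k (t - fst p) x (snd p) * g (fst p) (snd p) y) = (\<Sum>k. f k (t - fst p) x (snd p)) * g (fst p) (snd p) y"
        by (rule suminf_mult2[symmetric, OF summable_rabs_cancel[OF summ[OF r]]])
      then show ?thesis using True by (simp add: star_integrand_def case_prod_beta')
    qed (simp add: star_integrand_def case_prod_beta')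
  qed
  have ms: "measurable_kernel ?s" by (rule bounded_kernelD(1)[OF bounded_suminf(1)[OF f c w]])
  have "abs_star ?s g t x y = (\<integral>\<^sup>+p. ennreal \<bar>star_integrand ?s g t x y p\<bar> \<partial>plane)"
    unfolding abs_star_eq[OF ms G(1)] using measurable_star_integrand[OF ms G(1), of t x y]
    by (subst lborel.nn_integral_fst[symmetric]) auto
  also have "\<dots> < \<infinity>" using Sint unfolding eq by (simp add: integrable_iff_bounded)
  finally have "star ?s g t x y = (\<integral>p. (\<Sum>k. ?I k p) \<partial>plane)"
    by (simp only: star_eq_plane_integral(2)[OF ms G(1)] eq)
  also have "\<dots> = (\<Sum>k. integral\<^sup>L plane (?I k))" by (rule sums_unique[OF S])
  also have "\<dots> = (\<Sum>k. star (f k) g t x y)" by (simp only: PI(2))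
  finally show ?thesis .
qed

text \<open>The Neumann series of \<open>F\<close>; for \<open>F = \<Phi>\<close> it is \<open>\<Psi>\<close>.\<close>

definition resolvent :: "kernel \<Rightarrow> kernel" where
  "resolvent F t x y = (\<Sum>k. star_iter F k t x y)"

text \<open>The weight \<open>k\<close> is chosen so large that convolution with \<open>F\<close> at most halves the bounds of a kernel, both for the
exponential and for the singular weight.\<close>

context
  fixes F :: kernel and N k :: real
  assumes N: "0 \<le> N" and k: "0 < k" and F: "bounded_kernel (\<lambda>t. N * singular_weight 0 t) F"
    and small: "D * (4 * N * gain k) \<le> 1 / 2"
begin

lemma perturbation_admissible: "admissible F"
  using F N unfolding admissible_def by blast

lemma singular_weight_mono: "0 < t \<Longrightarrow> singular_weight 0 t \<le> singular_weight k t"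
  using k by (simp add: singular_weight_def)

text \<open>Each convolution halves the constant, so that the series \<open>resolvent\<close> is dominated by a geometric one.\<close>

lemma star_iter_bounded: "bounded_kernel (\<lambda>t. (N * (1 / 2) ^ n) * singular_weight k t) (star_iter F n)"
proof (induction n)
  case 0
  show ?case
    by (rule bounded_kernel_mono[OF F]) (use bounded_kernelD(1)[OF F] N singular_weight_mono in \<open>auto intro: mult_left_mono\<close>)
next
  case (Suc n)
  have Nn: "0 \<le> N * (1 / 2) ^ n" using N by simp
  have B: "bounded_kernel (\<lambda>t. D * (N * (1 / 2) ^ n * N * (4 * gain k) * singular_weight k t)) (star_iter F (Suc n))"
    using bounded_star[OF Suc F weights_convolve_singular[OF k Nn N]] by simp
  show ?case
  proof (rule bounded_kernel_mono[OF B bounded_kernelD(1)[OF B]])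
    fix t :: real assume t: "0 < t" "t \<le> 1"
    have "(D * (4 * N * gain k)) * (N * (1 / 2) ^ n * singular_weight k t) \<le> 1 / 2 * (N * (1 / 2) ^ n * singular_weight k t)"
      using N singular_weight_nonneg by (intro mult_right_mono[OF small]) auto
    then show "D * (N * (1 / 2) ^ n * N * (4 * gain k) * singular_weight k t) \<le> N * (1 / 2) ^ Suc n * singular_weight k t"
      by (simp add: ac_simps)
  qed (simp_all, measurable)
qed

lemma half_series: "summable (\<lambda>n. N * (1 / 2) ^ n)" "0 \<le> N * (1 / 2) ^ n"
  using N by (auto intro: summable_mult summable_geometric)

lemma resolvent_bounded: "bounded_kernel (\<lambda>t. 2 * N * singular_weight k t) (resolvent F)"
proof -
  have "(\<Sum>n. N * (1 / 2) ^ n) = 2 * N"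
    using suminf_mult[of "\<lambda>n. (1 / 2 :: real) ^ n" N] suminf_geometric[of "1 / 2 :: real"] by (simp add: summable_geometric)
  then show ?thesis
    using bounded_suminf(1)[OF star_iter_bounded half_series _ singular_weight_nonneg] unfolding resolvent_def[abs_def] by simp
qed

lemma resolvent_equation:
  assumes t: "0 < t" "t \<le> 1"
  shows "resolvent F t x y = F t x y + star (resolvent F) F t x y"
proof -
  have conv: "weights_convolve (\<lambda>t. N * (1 / 2) ^ n * singular_weight k t) (\<lambda>t. N * singular_weight 0 t) (\<lambda>t. N * (1 / 2) ^ n * (N * (4 * gain k) * singular_weight k t))" for n
    using weights_convolve_singular[OF k half_series(2) N, of n] by (simp only: mult.assoc)
  have "star (resolvent F) F t x y = (\<Sum>n. star_iter F (Suc n) t x y)"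
    using star_suminf_left[OF star_iter_bounded half_series _ singular_weight_nonneg F conv t, of x y]
    unfolding resolvent_def[abs_def] by simp
  moreover have "summable (\<lambda>n. star_iter F n t x y)"
    by (rule summable_rabs_cancel[OF bounded_suminf(2)[OF star_iter_bounded half_series _ singular_weight_nonneg t]]) simp
  ultimately show ?thesis unfolding resolvent_def
    using suminf_split_head[of "\<lambda>n. star_iter F n t x y"] by simp
qed

lemma resolvent_admissible: "admissible (resolvent F)"
proof -
  have "bounded_kernel (\<lambda>t. (2 * N * exp k) * singular_weight 0 t) (resolvent F)"
  proof (rule bounded_kernel_mono[OF resolvent_bounded bounded_kernelD(1)[OF resolvent_bounded]])
    fix t :: real assume t: "0 < t" "t \<le> 1"
    have "singular_weight k t \<le> exp k * singular_weight 0 t"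
      using t k by (simp add: singular_weight_def mult_left_le mult_right_mono)
    then have "2 * N * singular_weight k t \<le> 2 * N * (exp k * singular_weight 0 t)" using N by (intro mult_left_mono) auto
    then show "2 * N * singular_weight k t \<le> 2 * N * exp k * singular_weight 0 t" by (simp only: mult.assoc)
  qed (simp_all, measurable)
  then show ?thesis using N unfolding admissible_def by (intro exI[of _ "2 * N * exp k"]) simp
qed

text \<open>Associativity rewrites \<open>(p \<star> resolvent F) \<star> F\<close> as \<open>p \<star> (resolvent F \<star> F)\<close>, and the equation of the
resolvent closes the circle.\<close>

lemma perturbation_equation:
  assumes p: "admissible p" and P: "P = (\<lambda>t x y. p t x y + star p (resolvent F) t x y)" and t: "0 < t" "t \<le> 1"
  shows "P t x y = p t x y + star P F t x y"
proof -
  note R = resolvent_admissible and FA = perturbation_admissible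
  note pR = admissible_star[OF p R]
  have "star P F t x y = star p F t x y + star (star p (resolvent F)) F t x y"
    unfolding P by (rule star_add_left(1)) (intro admissibleD admissible_finite p FA pR t)+
  also have "star (star p (resolvent F)) F t x y = star p (star (resolvent F) F) t x y"
    by (rule admissible_star_assoc[OF p R FA t])
  also have "star p F t x y + star p (star (resolvent F) F) t x y = star p (\<lambda>t x y. F t x y + star (resolvent F) F t x y) t x y"
    by (rule star_add_right[symmetric]) (intro admissibleD admissible_finite p FA admissible_star[OF R FA] t)+
  also have "\<dots> = star p (resolvent F) t x y"
    using t by (intro star_cong) (auto simp: resolvent_equation)
  finally show ?thesis by (simp add: P)
qed

lemma star_contraction:
  assumes f: "bounded_kernel (\<lambda>t. A * exp (k * t)) f" and A: "0 \<le> A"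
  shows "bounded_kernel (\<lambda>t. A * (D * N * gain k) * exp (k * t)) (star f F)"
proof -
  have "weights_convolve (\<lambda>t. A * exp (k * t)) (\<lambda>t. N * singular_weight 0 t) (\<lambda>t. A * N * gain k * exp (k * t))"
    using weights_convolve_exp[OF k A N] by (simp add: singular_weight_0)
  from bounded_star[OF f F this] show ?thesis by (simp only: ac_simps)
qed

lemma contraction_factor: "D * N * gain k \<le> 1 / 2"
proof -
  have "0 \<le> D * N * gain k" using D N gain_nonneg[of k] by simp
  then show ?thesis using small by simp
qed

text \<open>Each use of the equation halves the a priori constant \<open>A\<close> and adds \<open>B\<close>; in the limit the bound depends on \<open>E\<close> alone.
Applied to differences of solutions this is also the stability of the equation.\<close>

lemma fixed_point_bounded:
  assumes f: "bounded_kernel (\<lambda>t. A * exp (k * t)) f" and A: "0 \<le> A"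
    and E: "bounded_kernel (\<lambda>t. B * exp (k * t)) E" and B: "0 \<le> B"
    and eq: "\<And>t x y. 0 < t \<Longrightarrow> t \<le> 1 \<Longrightarrow> f t x y = E t x y + star f F t x y"
  shows "bounded_kernel (\<lambda>t. 2 * B * exp (k * t)) f"
proof -
  have step: "bounded_kernel (\<lambda>t. (A * (1 / 2) ^ n + 2 * B) * exp (k * t)) f" for n
  proof (induction n)
    case 0
    show ?case
      by (rule bounded_kernel_mono[OF f bounded_kernelD(1)[OF f]]) (use B in \<open>auto intro: mult_right_mono\<close>)
  next
    case (Suc n)
    let ?A = "A * (1 / 2) ^ n + 2 * B"
    have A': "0 \<le> ?A" using A B by simp
    note S = bounded_kernel_add[OF E star_contraction[OF Suc A']]
    show ?case
    proof (rule bounded_kernel_mono[OF S bounded_kernelD(1)[OF f]])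
      fix t x y :: real assume t: "0 < t" "t \<le> 1"
      show "\<bar>f t x y\<bar> \<le> \<bar>E t x y + star f F t x y\<bar>" using eq[OF t] by simp
      have "?A * (D * N * gain k) \<le> ?A * (1 / 2)" by (intro mult_left_mono contraction_factor A')
      then have "B + ?A * (D * N * gain k) \<le> A * (1 / 2) ^ Suc n + 2 * B" by simp
      from mult_right_mono[OF this, of "exp (k * t)"]
      show "B * exp (k * t) + ?A * (D * N * gain k) * exp (k * t) \<le> (A * (1 / 2) ^ Suc n + 2 * B) * exp (k * t)"
        by (simp add: distrib_right)
    qed measurable
  qed
  have lim: "(\<lambda>n. (A * (1 / 2) ^ n + 2 * B) * c) \<longlonglongrightarrow> 2 * B * c" for c :: real
  proof -
    have "(\<lambda>n. (A * (1 / 2) ^ n + 2 * B) * c) \<longlonglongrightarrow> (A * 0 + 2 * B) * c"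
      by (intro tendsto_intros LIMSEQ_power_zero) auto
    then show ?thesis by simp
  qed
  show ?thesis unfolding bounded_kernel_def
  proof (intro conjI allI impI)
    show "measurable_kernel f" by (rule bounded_kernelD(1)[OF f])
    show "(\<lambda>t. 2 * B * exp (k * t)) \<in> borel_measurable borel" by measurable
    fix t :: real assume t: "0 < t" "t \<le> 1"
    show "0 \<le> 2 * B * exp (k * t)" using B by simp
    show "\<bar>f t x y\<bar> \<le> 2 * B * exp (k * t) * \<rho> t" for x y
    proof (rule LIMSEQ_le_const)
      show "(\<lambda>n. (A * (1 / 2) ^ n + 2 * B) * exp (k * t) * \<rho> t) \<longlonglongrightarrow> 2 * B * exp (k * t) * \<rho> t"
        by (intro tendsto_mult_right lim)
      show "\<exists>M. \<forall>n\<ge>M. \<bar>f t x y\<bar> \<le> (A * (1 / 2) ^ n + 2 * B) * exp (k * t) * \<rho> t"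
        using bounded_kernelD(4)[OF step t] by blast
    qed
    show "(\<integral>\<^sup>+y. ennreal \<bar>f t x y\<bar> \<partial>lborel) \<le> ennreal (2 * B * exp (k * t))" for x
    proof (rule LIMSEQ_le_const[OF tendsto_ennrealI[OF lim]])
      show "\<exists>M. \<forall>n\<ge>M. (\<integral>\<^sup>+y. ennreal \<bar>f t x y\<bar> \<partial>lborel) \<le> ennreal ((A * (1 / 2) ^ n + 2 * B) * exp (k * t))"
        using bounded_kernelD(5)[OF step t] by blast
    qed
    show "(\<integral>\<^sup>+x. ennreal \<bar>f t x y\<bar> \<partial>lborel) \<le> ennreal (2 * B * exp (k * t))" for y
    proof (rule LIMSEQ_le_const[OF tendsto_ennrealI[OF lim]])
      show "\<exists>M. \<forall>n\<ge>M. (\<integral>\<^sup>+x. ennreal \<bar>f t x y\<bar> \<partial>lborel) \<le> ennreal ((A * (1 / 2) ^ n + 2 * B) * exp (k * t))"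
        using bounded_kernelD(6)[OF step t] by blast
    qed
  qed
qed

lemma bounded_kernel_zero: "bounded_kernel (\<lambda>t. 0) (\<lambda>t x y. 0)"
  by (simp add: bounded_kernel_def measurable_kernel_def)

lemma picard_admissible: "admissible p \<Longrightarrow> admissible (picard F p n)"
proof (induction n)
  case 0
  then show ?case using bounded_kernel_zero unfolding admissible_def by (intro exI[of _ 0]) simp
next
  case (Suc n)
  then show ?case by (simp add: admissible_add admissible_star perturbation_admissible)
qed

text \<open>The error is halved in each step, starting from \<open>R\<close> itself.\<close>

lemma picard_converges:
  assumes R: "bounded_kernel (\<lambda>t. A * exp (k * t)) R" and A: "0 \<le> A" and p: "admissible p"
    and eq: "\<And>t x y. 0 < t \<Longrightarrow> t \<le> 1 \<Longrightarrow> R t x y = p t x y + star R F t x y" and t: "0 < t" "t \<le> 1"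
  shows "(\<lambda>n. picard F p n t x y) \<longlonglongrightarrow> R t x y"
proof -
  have RA: "admissible R" by (rule bounded_imp_admissible[OF R less_imp_le[OF k] A])
  have step: "bounded_kernel (\<lambda>t. (A * (1 / 2) ^ n) * exp (k * t)) (\<lambda>t x y. R t x y - picard F p n t x y)" for n
  proof (induction n)
    case 0
    then show ?case using R by simp
  next
    case (Suc n)
    let ?X = "picard F p n"
    let ?A = "A * (1 / 2) ^ n"
    note XA = picard_admissible[OF p, of n]
    have negX: "admissible (\<lambda>t x y. (-1) * ?X t x y)" by (rule admissible_scale[OF XA, of _ 1]) auto
    have A': "0 \<le> ?A" using A by simp
    note S = star_contraction[OF Suc A']
    show ?case
    proof (rule bounded_kernel_mono[OF S])
      show "measurable_kernel (\<lambda>t x y. R t x y - picard F p (Suc n) t x y)"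
        by (intro measurable_kernel_diff admissibleD RA picard_admissible p)
      fix t x y :: real assume t: "0 < t" "t \<le> 1"
      have "star (\<lambda>t x y. R t x y - ?X t x y) F t x y = star (\<lambda>t x y. R t x y + (-1) * ?X t x y) F t x y" by simp
      also have "\<dots> = star R F t x y + star (\<lambda>t x y. (-1) * ?X t x y) F t x y"
        by (rule star_add_left(1)) (intro admissibleD admissible_finite RA negX perturbation_admissible t)+
      also have "\<dots> = R t x y - picard F p (Suc n) t x y"
        unfolding star_cmult_left using eq[OF t, of x y] by simp
      finally show "\<bar>R t x y - picard F p (Suc n) t x y\<bar> \<le> \<bar>star (\<lambda>t x y. R t x y - ?X t x y) F t x y\<bar>" by simp
      have "?A * (D * N * gain k) \<le> ?A * (1 / 2)" by (intro mult_left_mono contraction_factor A')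
      from mult_right_mono[OF this, of "exp (k * t)"]
      show "?A * (D * N * gain k) * exp (k * t) \<le> A * (1 / 2) ^ Suc n * exp (k * t)" by simp
    qed measurable
  qed
  have "(\<lambda>n. A * (1 / 2) ^ n * exp (k * t) * \<rho> t) \<longlonglongrightarrow> A * 0 * exp (k * t) * \<rho> t"
    by (intro tendsto_intros LIMSEQ_power_zero) auto
  then have "(\<lambda>n. R t x y - picard F p n t x y) \<longlonglongrightarrow> 0"
    by (intro Lim_null_comparison[of "\<lambda>n. R t x y - picard F p n t x y" "\<lambda>n. A * (1 / 2) ^ n * exp (k * t) * \<rho> t"] always_eventually allI)
       (use bounded_kernelD(4)[OF step t] in simp_all)
  from tendsto_diff[OF tendsto_const[of "R t x y"] this] show ?thesis by simp
qed

end

section \<open>Positivity and comparison\<close>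

lemma star_nonneg:
  assumes "\<And>t x y. 0 < t \<Longrightarrow> t \<le> 1 \<Longrightarrow> 0 \<le> f t x y" "\<And>t x y. 0 < t \<Longrightarrow> t \<le> 1 \<Longrightarrow> 0 \<le> g t x y" "t \<le> 1"
  shows "0 \<le> star f g t x y"
  unfolding star_def set_lebesgue_integral_def
proof (intro integral_nonneg_AE AE_I2)
  fix \<tau>
  show "0 \<le> indicator {0<..<t} \<tau> *\<^sub>R (\<integral>z. f (t - \<tau>) x z * g \<tau> z y \<partial>lborel)"
  proof (cases "\<tau> \<in> {0<..<t}")
    case True
    then have "0 \<le> (\<integral>z. f (t - \<tau>) x z * g \<tau> z y \<partial>lborel)"
      using assms by (intro integral_nonneg_AE AE_I2 mult_nonneg_nonneg) auto
    then show ?thesis by simp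
  qed simp
qed

lemma star_mono:
  assumes f: "admissible f" "admissible f'" and g: "admissible g" "admissible g'" and t: "0 < t" "t \<le> 1"
    and "\<And>t x y. 0 < t \<Longrightarrow> t \<le> 1 \<Longrightarrow> 0 \<le> f t x y" "\<And>t x y. 0 < t \<Longrightarrow> t \<le> 1 \<Longrightarrow> f t x y \<le> f' t x y"
    and "\<And>t x y. 0 < t \<Longrightarrow> t \<le> 1 \<Longrightarrow> 0 \<le> g t x y" "\<And>t x y. 0 < t \<Longrightarrow> t \<le> 1 \<Longrightarrow> g t x y \<le> g' t x y"
  shows "star f g t x y \<le> star f' g' t x y"
proof -
  note P = star_eq_plane_integral[OF admissibleD[OF f(1)] admissibleD[OF g(1)] admissible_finite[OF f(1) g(1) t]]
    and P' = star_eq_plane_integral[OF admissibleD[OF f(2)] admissibleD[OF g(2)] admissible_finite[OF f(2) g(2) t]]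
  show ?thesis unfolding P(2) P'(2)
  proof (rule integral_mono[OF P(1) P'(1)])
    fix p
    show "star_integrand f g t x y p \<le> star_integrand f' g' t x y p"
    proof (cases "fst p \<in> {0<..<t}")
      case True
      then have r: "0 < t - fst p" "t - fst p \<le> 1" "0 < fst p" "fst p \<le> 1" using t by auto
      have "f (t - fst p) x (snd p) * g (fst p) (snd p) y \<le> f' (t - fst p) x (snd p) * g' (fst p) (snd p) y"
        using assms(7-10)[OF r(1,2)] assms(7-10)[OF r(3,4)] by (intro mult_mono) (meson order_trans)+
      then show ?thesis using True by (simp add: star_integrand_def case_prod_beta')
    qed (simp add: star_integrand_def case_prod_beta')
  qed
qed

text \<open>Positivity and order are clear for Picard iterates, by induction, and pass to the limit.\<close>

lemma comparison:
  assumes k: "0 < k" and N: "0 \<le> N" "D * (4 * N * gain k) \<le> 1 / 2" and N': "0 \<le> N'" "D * (4 * N' * gain k) \<le> 1 / 2"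
    and F: "bounded_kernel (\<lambda>t. N * singular_weight 0 t) F" and F': "bounded_kernel (\<lambda>t. N' * singular_weight 0 t) F'"
    and p: "admissible p" "\<And>t x y. 0 < t \<Longrightarrow> t \<le> 1 \<Longrightarrow> 0 \<le> p t x y"
    and FF': "\<And>t x y. 0 < t \<Longrightarrow> t \<le> 1 \<Longrightarrow> 0 \<le> F t x y" "\<And>t x y. 0 < t \<Longrightarrow> t \<le> 1 \<Longrightarrow> F t x y \<le> F' t x y"
    and R: "bounded_kernel (\<lambda>t. A * exp (k * t)) R" "0 \<le> A"
      "\<And>t x y. 0 < t \<Longrightarrow> t \<le> 1 \<Longrightarrow> R t x y = p t x y + star R F t x y"
    and R': "bounded_kernel (\<lambda>t. A' * exp (k * t)) R'" "0 \<le> A'"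
      "\<And>t x y. 0 < t \<Longrightarrow> t \<le> 1 \<Longrightarrow> R' t x y = p t x y + star R' F' t x y"
    and t: "0 < t" "t \<le> 1"
  shows "0 \<le> R t x y" "R t x y \<le> R' t x y"
proof -
  note FA = perturbation_admissible[OF N(1) k F N(2)] and FA' = perturbation_admissible[OF N'(1) k F' N'(2)]
  let ?X = "picard F p" and ?X' = "picard F' p"
  have XA: "admissible (?X n)" "admissible (?X' n)" for n
    by (rule picard_admissible[OF N(1) k F N(2) p(1)] picard_admissible[OF N'(1) k F' N'(2) p(1)])+
  have mono: "0 < t \<Longrightarrow> t \<le> 1 \<Longrightarrow> 0 \<le> ?X n t x y \<and> ?X n t x y \<le> ?X' n t x y" for n t x y
  proof (induction n arbitrary: t x y)
    case (Suc n)
    have "0 \<le> star (?X n) F t x y" using Suc FF' by (intro star_nonneg) auto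
    moreover have "star (?X n) F t x y \<le> star (?X' n) F' t x y"
      using Suc FF' by (intro star_mono XA FA FA') auto
    ultimately show ?case using p(2)[OF Suc(2,3), of x y] by simp
  qed simp
  have c: "(\<lambda>n. ?X n t x y) \<longlonglongrightarrow> R t x y" "(\<lambda>n. ?X' n t x y) \<longlonglongrightarrow> R' t x y"
    by (rule picard_converges[OF N(1) k F N(2) R(1,2) p(1) R(3) t] picard_converges[OF N'(1) k F' N'(2) R'(1,2) p(1) R'(3) t]; assumption)+
  show "0 \<le> R t x y" using mono[OF t] by (intro LIMSEQ_le_const[OF c(1)]) auto
  show "R t x y \<le> R' t x y" using mono[OF t] by (intro LIMSEQ_le[OF c]) auto
qed

section \<open>Exponential tilting\<close>

lemma star_exp_scale:
  "star (\<lambda>t x y. exp (c * t) * f t x y) (\<lambda>t x y. exp (c * t) * g t x y) t x y = exp (c * t) * star f g t x y"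
proof -
  have "star (\<lambda>t x y. exp (c * t) * f t x y) (\<lambda>t x y. exp (c * t) * g t x y) t x y
     = set_lebesgue_integral lborel {0<..<t} (\<lambda>\<tau>. exp (c * t) * (\<integral>z. f (t - \<tau>) x z * g \<tau> z y \<partial>lborel))"
    unfolding star_def
  proof (rule arg_cong[where f = "set_lebesgue_integral lborel {0<..<t}"], rule ext)
    fix \<tau>
    have "exp (c * (t - \<tau>)) * f (t - \<tau>) x z * (exp (c * \<tau>) * g \<tau> z y) = exp (c * t) * (f (t - \<tau>) x z * g \<tau> z y)" for z
    proof -
      have "exp (c * (t - \<tau>)) * exp (c * \<tau>) = exp (c * t)" by (simp add: mult_exp_exp right_diff_distrib)
      then show ?thesis by (metis mult.assoc mult.left_commute)
    qed
    then show "(\<integral>z. exp (c * (t - \<tau>)) * f (t - \<tau>) x z * (exp (c * \<tau>) * g \<tau> z y) \<partial>lborel)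
        = exp (c * t) * (\<integral>z. f (t - \<tau>) x z * g \<tau> z y \<partial>lborel)"
      by (simp only: integral_mult_right_zero)
  qed
  then show ?thesis unfolding star_def by simp
qed

text \<open>The semigroup property makes the space integral independent of the intermediate time, and only an elementary
integral of \<open>exp (c (t - \<tau>))\<close> is left.\<close>

lemma star_exp_semigroup:
  assumes sg: "\<And>a b. 0 < a \<Longrightarrow> 0 < b \<Longrightarrow> a + b \<le> 1 \<Longrightarrow> (\<integral>z. f a x z * p b z y \<partial>lborel) = f (a + b) x y"
    and c: "c \<noteq> 0" and t: "0 < t" "t \<le> 1"
  shows "c * star (\<lambda>t x y. exp (c * t) * f t x y) p t x y = (exp (c * t) - 1) * f t x y"
proof -
  have "star (\<lambda>t x y. exp (c * t) * f t x y) p t x y = (\<integral>\<tau>. indicator {0<..<t} \<tau> * exp (c * (t - \<tau>)) * f t x y \<partial>lborel)"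
    unfolding star_def set_lebesgue_integral_def
  proof (intro Bochner_Integration.integral_cong refl)
    fix \<tau>
    show "indicator {0<..<t} \<tau> *\<^sub>R (\<integral>z. exp (c * (t - \<tau>)) * f (t - \<tau>) x z * p \<tau> z y \<partial>lborel)
       = indicator {0<..<t} \<tau> * exp (c * (t - \<tau>)) * f t x y"
    proof (cases "\<tau> \<in> {0<..<t}")
      case True
      then have "(\<integral>z. f (t - \<tau>) x z * p \<tau> z y \<partial>lborel) = f t x y" using sg[of "t - \<tau>" \<tau>] t by simp
      then show ?thesis using True by (simp only: mult.assoc integral_mult_right_zero) simp
    qed simp
  qed
  also have "\<dots> = (\<integral>\<tau>. indicator {0<..<t} \<tau> * exp (c * (t - \<tau>)) \<partial>lborel) * f t x y"
    by (rule integral_mult_left_zero)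
  also have "(\<integral>\<tau>. indicator {0<..<t} \<tau> * exp (c * (t - \<tau>)) \<partial>lborel) = (exp (c * t) - 1) / c"
  proof -
    have "(\<integral>\<tau>. indicator {0<..<t} \<tau> * exp (c * (t - \<tau>)) \<partial>lborel) = (\<integral>\<tau>. exp (c * (t - \<tau>)) * indicator {0..t} \<tau> \<partial>lborel)"
    proof (rule integral_cong_AE)
      show "AE \<tau> in lborel. indicator {0<..<t} \<tau> * exp (c * (t - \<tau>)) = exp (c * (t - \<tau>)) * indicator {0..t} \<tau>"
        using AE_lborel_singleton[of 0] AE_lborel_singleton[of t] by eventually_elim (auto simp: indicator_def)
    qed measurable
    also have "\<dots> = - exp (c * (t - t)) / c - (- exp (c * (t - 0)) / c)"
    proof (rule integral_FTC_Icc_real)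
      show "((\<lambda>\<tau>. - exp (c * (t - \<tau>)) / c) has_real_derivative exp (c * (t - \<tau>))) (at \<tau>)" for \<tau>
        using c by (auto intro!: derivative_eq_intros)
      show "isCont (\<lambda>\<tau>. exp (c * (t - \<tau>))) \<tau>" for \<tau> by (intro continuous_intros)
    qed (use t in auto)
    finally show ?thesis using c by (simp add: diff_divide_distrib)
  qed
  finally show ?thesis using c by simp
qed

text \<open>Multiplication by \<open>exp (c t)\<close> commutes with \<open>\<star>\<close>, so \<open>R = exp (c t) P\<close> solves the equation with data
\<open>r = exp (c t) p\<close> and \<open>E = exp (c t) F\<close>. The semigroup property gives \<open>r = p + c r \<star> p\<close> and
\<open>E = F + c E \<star> p\<close>; substituting both and using associativity leaves \<open>R = p + R \<star> (F + c p)\<close>. In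
probabilistic terms, killing at rate \<open>c\<close> is undone.\<close>

lemma exponential_tilting:
  assumes p: "admissible p" and F: "admissible F" and P: "admissible P"
    and pp: "\<And>a b x y. 0 < a \<Longrightarrow> 0 < b \<Longrightarrow> a + b \<le> 1 \<Longrightarrow> (\<integral>z. p a x z * p b z y \<partial>lborel) = p (a + b) x y"
    and Fp: "\<And>a b x y. 0 < a \<Longrightarrow> 0 < b \<Longrightarrow> a + b \<le> 1 \<Longrightarrow> (\<integral>z. F a x z * p b z y \<partial>lborel) = F (a + b) x y"
    and eq: "\<And>t x y. 0 < t \<Longrightarrow> t \<le> 1 \<Longrightarrow> P t x y = p t x y + star P F t x y"
    and c: "0 < c" and t: "0 < t" "t \<le> 1"
  shows "exp (c * t) * P t x y = p t x y + star (\<lambda>t x y. exp (c * t) * P t x y) (\<lambda>t x y. F t x y + c * p t x y) t x y"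
proof -
  have bound: "\<bar>exp (c * t)\<bar> \<le> exp c" if "0 < t" "t \<le> 1" for t using that c by (simp add: mult_left_le)
  have ma: "(\<lambda>t. exp (c * t)) \<in> borel_measurable borel" by measurable
  let ?R = "\<lambda>t x y. exp (c * t) * P t x y" and ?r = "\<lambda>t x y. exp (c * t) * p t x y" and ?E = "\<lambda>t x y. exp (c * t) * F t x y"
  have R: "admissible ?R" and r: "admissible ?r" and E: "admissible ?E"
    by (rule admissible_scale[OF P ma bound] admissible_scale[OF p ma bound] admissible_scale[OF F ma bound]; assumption)+
  have cm: "admissible (\<lambda>t x y. a * f t x y)" if "admissible f" for a f
    by (rule admissible_scale[OF that, of _ "\<bar>a\<bar>"]) auto
  have RE: "star ?R ?E t x y = ?R t x y - ?r t x y" if "0 < t" "t \<le> 1" for t x y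
    unfolding star_exp_scale using eq[OF that, of x y] by (simp add: distrib_left)
  have rp: "c * star ?r p t x y = ?r t x y - p t x y" if "0 < t" "t \<le> 1" for t x y
  proof -
    have "c * star ?r p t x y = (exp (c * t) - 1) * p t x y"
      by (rule star_exp_semigroup) (use pp c that in auto)
    then show ?thesis by (simp add: left_diff_distrib)
  qed
  have Ep: "c * star ?E p t x y = ?E t x y - F t x y" if "0 < t" "t \<le> 1" for t x y
  proof -
    have "c * star ?E p t x y = (exp (c * t) - 1) * F t x y"
      by (rule star_exp_semigroup) (use Fp c that in auto)
    then show ?thesis by (simp add: left_diff_distrib)
  qed
  have 1: "star ?R (\<lambda>t x y. F t x y + c * p t x y) t x y = star ?R F t x y + c * star ?R p t x y"
    unfolding star_cmult_right[symmetric]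
    by (rule star_add_right) (intro admissibleD admissible_finite R F cm p t)+
  have "star ?R F t x y = star ?R (\<lambda>t x y. ?E t x y + (- c) * star ?E p t x y) t x y"
    using t by (intro star_cong) (auto simp: Ep)
  also have "\<dots> = star ?R ?E t x y + (- c) * star ?R (star ?E p) t x y"
    unfolding star_cmult_right[where c = "- c", symmetric]
    by (rule star_add_right) (intro admissibleD admissible_finite R E cm admissible_star p t)+
  also have "star ?R (star ?E p) t x y = star (star ?R ?E) p t x y"
    by (rule admissible_star_assoc[OF R E p t, symmetric])
  also have "star (star ?R ?E) p t x y = star (\<lambda>t x y. ?R t x y + (-1) * ?r t x y) p t x y"
    using t by (intro star_cong) (auto simp: RE)
  also have "\<dots> = star ?R p t x y + (-1) * star ?r p t x y"
    unfolding star_cmult_left[where c = "-1", symmetric]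
    by (rule star_add_left(1)) (intro admissibleD admissible_finite R r cm p t)+
  finally have "star ?R F t x y = star ?R ?E t x y - c * star ?R p t x y + c * star ?r p t x y"
    by (simp add: algebra_simps)
  then show ?thesis unfolding 1 RE[OF t] rp[OF t] by simp
qed

end

section \<open>The perturbation kernel\<close>

text \<open>The constant \<open>c\<close> is a parameter because all estimates are linear in it, and the lower bound depends on making it small.\<close>

definition jump_rate :: "real \<Rightarrow> real \<Rightarrow> (real \<Rightarrow> real \<Rightarrow> real) \<Rightarrow> bool" where
  "jump_rate e c m \<longleftrightarrow> (\<lambda>(x, u). m x u) \<in> borel_measurable (borel \<Otimes>\<^sub>M borel) \<and> 0 \<le> c \<and>
     (\<forall>x u. 0 \<le> m x u \<and> m x u \<le> c * min 1 (\<bar>u\<bar> powr e))"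

lemma jump_rateD:
  assumes "jump_rate e c m"
  shows "(\<lambda>(x, u). m x u) \<in> borel_measurable (borel \<Otimes>\<^sub>M borel)" "0 \<le> c" "0 \<le> m x u" "m x u \<le> c * min 1 (\<bar>u\<bar> powr e)"
  using assms by (auto simp: jump_rate_def)

lemma jump_rate_restrict:
  assumes "jump_rate e c m" "A \<in> sets borel"
  shows "jump_rate e c (\<lambda>x u. m x u * indicator A u)"
  unfolding jump_rate_def
proof (intro conjI allI)
  note J = jump_rateD[OF assms(1)]
  have [measurable]: "(\<lambda>p. m (fst p) (snd p)) \<in> borel_measurable (borel \<Otimes>\<^sub>M borel)" using J(1) by (simp add: case_prod_beta')
  have [measurable]: "A \<in> sets borel" by fact
  show "(\<lambda>(x, u). m x u * indicator A u) \<in> borel_measurable (borel \<Otimes>\<^sub>M borel)" unfolding case_prod_beta' by measurable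
  show "0 \<le> c" by (rule J(2))
  fix x u
  show "0 \<le> m x u * indicator A u" using J(3) by simp
  have "0 \<le> c * min 1 (\<bar>u\<bar> powr e)" using J(3,4) order_trans by blast
  then show "m x u * indicator A u \<le> c * min 1 (\<bar>u\<bar> powr e)" using J(4)[of x u] by (auto simp: indicator_def)
qed

lemma jump_rate_halve:
  assumes "jump_rate e c m" "0 < e" shows "jump_rate (e / 2) c m"
  unfolding jump_rate_def
proof (intro conjI allI)
  note J = jump_rateD[OF assms(1)]
  show "(\<lambda>(x, u). m x u) \<in> borel_measurable (borel \<Otimes>\<^sub>M borel)" "0 \<le> c" by (fact J)+
  fix x u
  show "0 \<le> m x u" by (rule J)
  have "min 1 (\<bar>u\<bar> powr e) \<le> min 1 (\<bar>u\<bar> powr (e / 2))"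
  proof (cases "\<bar>u\<bar> \<le> 1")
    case True
    then have "\<bar>u\<bar> powr e \<le> \<bar>u\<bar> powr (e / 2)" using assms(2) by (intro powr_mono') auto
    then show ?thesis by auto
  next
    case False
    then have "1 \<le> \<bar>u\<bar> powr (e / 2)" using assms(2) by (intro ge_one_powr_ge_zero) auto
    then show ?thesis by auto
  qed
  then have "c * min 1 (\<bar>u\<bar> powr e) \<le> c * min 1 (\<bar>u\<bar> powr (e / 2))" using J(2) by (intro mult_left_mono)
  then show "m x u \<le> c * min 1 (\<bar>u\<bar> powr (e / 2))" using J(4)[of x u] by linarith
qed

text \<open>For \<open>\<bar>u\<bar> \<le> s\<close> half of the power \<open>\<bar>u\<bar> powr e\<close> is at most \<open>s powr (e / 2)\<close>; the other half still
makes the perturbation kernel integrable in time.\<close>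

lemma jump_rate_small:
  assumes "jump_rate e c m" "0 < e" and s: "0 < s" "s \<le> 1" and A: "A \<in> sets borel" "A \<subseteq> {u. \<bar>u\<bar> \<le> s}"
  shows "jump_rate (e / 2) (c * s powr (e / 2)) (\<lambda>x u. m x u * indicator A u)"
  unfolding jump_rate_def
proof (intro conjI allI)
  note J = jump_rateD[OF assms(1)] and JA = jump_rateD[OF jump_rate_restrict[OF assms(1) A(1)]]
  show "(\<lambda>(x, u). m x u * indicator A u) \<in> borel_measurable (borel \<Otimes>\<^sub>M borel)" by (rule JA)
  show "0 \<le> c * s powr (e / 2)" using J(2) by simp
  fix x u
  show "0 \<le> m x u * indicator A u" by (rule JA)
  show "m x u * indicator A u \<le> c * s powr (e / 2) * min 1 (\<bar>u\<bar> powr (e / 2))"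
  proof (cases "u \<in> A")
    case True
    then have u: "\<bar>u\<bar> \<le> s" "\<bar>u\<bar> \<le> 1" using A(2) s by auto
    have "\<bar>u\<bar> powr e = \<bar>u\<bar> powr (e / 2) * \<bar>u\<bar> powr (e / 2)" by (simp add: powr_add[symmetric])
    also have "\<dots> \<le> s powr (e / 2) * \<bar>u\<bar> powr (e / 2)" using u assms(2) by (intro mult_right_mono powr_mono2) auto
    finally have "\<bar>u\<bar> powr e \<le> s powr (e / 2) * \<bar>u\<bar> powr (e / 2)" .
    moreover have "\<bar>u\<bar> powr (e / 2) \<le> 1" using u assms(2) by (intro powr_le1) auto
    ultimately have "min 1 (\<bar>u\<bar> powr e) \<le> s powr (e / 2) * min 1 (\<bar>u\<bar> powr (e / 2))" by (simp add: min_def)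
    then have "c * min 1 (\<bar>u\<bar> powr e) \<le> c * (s powr (e / 2) * min 1 (\<bar>u\<bar> powr (e / 2)))" using J(2) by (intro mult_left_mono)
    then show ?thesis using True J(4)[of x u] by simp
  qed (use J(2) in simp)
qed

context growing_levy
begin

definition second_diff :: "real \<Rightarrow> real \<Rightarrow> real \<Rightarrow> real" where
  "second_diff t u z = levy_density \<mu> t (z + u) + levy_density \<mu> t (z - u) - 2 * levy_density \<mu> t z"

lemma Phi_eq: "Phi \<mu> m t x y = 1 / 2 * (\<integral>u. second_diff t u (y - x) * m x u \<partial>\<mu>)"
  unfolding Phi_def perturb_op_def p0_def second_diff_def
  by (intro arg_cong[where f = "(*) (1 / 2)"] Bochner_Integration.integral_cong refl arg_cong2[where f = "(*)"])
     (simp add: algebra_simps)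

text \<open>What remains of the perturbation kernel after the second difference of the density has been estimated by
\<open>min ((\<rho>\<^sub>t u)\<^sup>2) 1\<close>. Without the factor \<open>min 1 (\<bar>u\<bar> powr e)\<close> it would be \<open>q\<^sup>U(\<rho>\<^sub>t) = 1 / t\<close>, which just
fails to be integrable at \<open>0\<close>.\<close>

definition jump_moment :: "real \<Rightarrow> real \<Rightarrow> real" where
  "jump_moment e t = (\<integral>u. min ((levy_rho \<mu> t * u)\<^sup>2) 1 * min 1 (\<bar>u\<bar> powr e) \<partial>\<mu>)"

lemma integrable_jump_moment: "integrable \<mu> (\<lambda>u. min ((r * u)\<^sup>2) 1 * min 1 (\<bar>u\<bar> powr e))"
proof (rule integrable_dominated[OF integrable_qU[of r]])
  show "\<bar>min ((r * u)\<^sup>2) 1 * min 1 (\<bar>u\<bar> powr e)\<bar> \<le> min ((r * u)\<^sup>2) 1" for u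
  proof -
    have "min ((r * u)\<^sup>2) 1 * min 1 (\<bar>u\<bar> powr e) \<le> min ((r * u)\<^sup>2) 1 * 1" by (intro mult_left_mono) auto
    moreover have "0 \<le> min ((r * u)\<^sup>2) 1 * min 1 (\<bar>u\<bar> powr e)" by (intro mult_nonneg_nonneg) auto
    ultimately show ?thesis by linarith
  qed
qed measurable

lemma jump_moment_nonneg: "0 \<le> jump_moment e t"
  unfolding jump_moment_def by (intro integral_nonneg_AE AE_I2 mult_nonneg_nonneg) auto

text \<open>Split at \<open>\<bar>u\<bar> = 1 / sqrt \<rho>\<^sub>t\<close>. Below, \<open>\<bar>u\<bar> powr e\<close> is at most \<open>(1 / \<rho>\<^sub>t) powr (e / 2)\<close>. Above, the integrand is at
most \<open>min ((s u)\<^sup>2) 1\<close> with \<open>s = sqrt \<rho>\<^sub>t\<close>, and \<open>q\<^sup>U(s)\<close> is smaller than \<open>q\<^sup>U(\<rho>\<^sub>t) = 1 / t\<close> by a power of \<open>\<rho>\<^sub>t\<close>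
because of power growth. Both contributions beat \<open>1 / t\<close> by a power of \<open>\<rho>\<^sub>t\<close>, hence of \<open>t\<close>.\<close>

lemma jump_moment_bound:
  assumes e: "0 < e"
  shows "\<exists>\<delta>>0. \<delta> \<le> 1 \<and> (\<exists>C>0. \<forall>t. 0 < t \<longrightarrow> t \<le> 1 \<longrightarrow> jump_moment e t \<le> C * t powr (\<delta> - 1))"
proof -
  obtain \<alpha> c where g: "\<alpha> > 0" "c > 0"
    "\<And>\<xi> k. \<xi> \<ge> rmin \<Longrightarrow> k \<ge> 1 \<Longrightarrow> c * k powr \<alpha> * levy_qU \<mu> \<xi> \<le> levy_qU \<mu> (k * \<xi>)"
    using qU_power_growth_from[OF rmin_pos] by blast
  define M where "M = max 1 (sqrt rmin)"
  define C1 where "C1 = max (M powr \<alpha> / c) (levy_qU \<mu> 1)"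
  have C1: "C1 > 0" using g by (auto simp: C1_def M_def less_max_iff_disj)
  define \<delta> where "\<delta> = min 1 (min (e / 4) (\<alpha> / 4))"
  have \<delta>: "0 < \<delta>" "\<delta> \<le> 1" "\<delta> \<le> e / 4" "\<delta> \<le> \<alpha> / 4" using e g(1) by (auto simp: \<delta>_def)
  define C where "C = (1 / rmin) powr (e / 2) + C1 * (1 / rmin) powr (\<alpha> / 2)"
  have "jump_moment e t \<le> C * t powr (\<delta> - 1)" if t: "0 < t" "t \<le> 1" for t
  proof -
    let ?r = "levy_rho \<mu> t"
    have r: "?r > 0" "rmin \<le> ?r" using t rho_greatest(1) rho_ge_rmin by auto
    define s where "s = sqrt ?r"
    have s: "s > 0" "s * s = ?r" using r by (simp_all add: s_def)
    have pt: "min ((?r * u)\<^sup>2) 1 * min 1 (\<bar>u\<bar> powr e) \<le> (1 / ?r) powr (e / 2) * min ((?r * u)\<^sup>2) 1 + min ((s * u)\<^sup>2) 1" for u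
    proof (cases "\<bar>u\<bar> \<le> 1 / s")
      case True
      have "\<bar>u\<bar> powr e \<le> (1 / s) powr e" using True e by (intro powr_mono2) auto
      also have "\<dots> = (1 / s * (1 / s)) powr (e / 2)" using s by (subst powr_mult) (auto simp: powr_add[symmetric])
      also have "1 / s * (1 / s) = 1 / ?r" using s by simp
      finally have "min 1 (\<bar>u\<bar> powr e) \<le> (1 / ?r) powr (e / 2)" by simp
      then have "min ((?r * u)\<^sup>2) 1 * min 1 (\<bar>u\<bar> powr e) \<le> min ((?r * u)\<^sup>2) 1 * (1 / ?r) powr (e / 2)"
        by (intro mult_left_mono) auto
      moreover have "0 \<le> min ((s * u)\<^sup>2) 1" by simp
      ultimately show ?thesis by (simp only: mult.commute)
    next
      case False
      then have "1 \<le> \<bar>s * u\<bar>" using s by (simp add: abs_mult field_simps)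
      then have "min ((s * u)\<^sup>2) 1 = 1" by (metis abs_le_square_iff abs_one min_absorb2 one_power2)
      moreover have "min ((?r * u)\<^sup>2) 1 * min 1 (\<bar>u\<bar> powr e) \<le> 1 * 1" by (intro mult_mono) auto
      moreover have "0 \<le> (1 / ?r) powr (e / 2) * min ((?r * u)\<^sup>2) 1" by simp
      ultimately show ?thesis by linarith
    qed
    have "jump_moment e t \<le> (\<integral>u. (1 / ?r) powr (e / 2) * min ((?r * u)\<^sup>2) 1 + min ((s * u)\<^sup>2) 1 \<partial>\<mu>)"
      unfolding jump_moment_def
      by (rule integral_mono[OF integrable_jump_moment _ pt])
         (intro Bochner_Integration.integrable_add integrable_mult_right integrable_qU)
    also have "\<dots> = (1 / ?r) powr (e / 2) * levy_qU \<mu> ?r + levy_qU \<mu> s"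
      unfolding levy_qU_def
      by (subst Bochner_Integration.integral_add[OF integrable_mult_right[OF integrable_qU] integrable_qU]) simp
    finally have 1: "jump_moment e t \<le> (1 / ?r) powr (e / 2) * (1 / t) + levy_qU \<mu> s" using t by (simp add: rho_greatest)
    have 2: "levy_qU \<mu> s \<le> C1 * (1 / ?r) powr (\<alpha> / 2) * (1 / t)"
    proof -
      \<comment> \<open>Power growth is available only from \<open>\<rho>\<^sub>1\<close> on, and \<open>sqrt \<rho>\<^sub>t\<close> may lie below.\<close>
      define s' where "s' = max s rmin"
      have s': "s' > 0" "rmin \<le> s'" using s(1) by (auto simp: s'_def)
      have qs: "levy_qU \<mu> s \<le> levy_qU \<mu> s'" using s(1) by (intro qU_mono_abs) (auto simp: s'_def)
      show ?thesis
      proof (cases "s' \<le> ?r")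
        case True
        have "c * (?r / s') powr \<alpha> * levy_qU \<mu> s' \<le> levy_qU \<mu> (?r / s' * s')"
          using True s' by (intro g(3)) auto
        also have "?r / s' * s' = ?r" using s' by simp
        finally have "c * (?r / s') powr \<alpha> * levy_qU \<mu> s' \<le> 1 / t" using t by (simp add: rho_greatest)
        then have "levy_qU \<mu> s' \<le> 1 / t / (c * (?r / s') powr \<alpha>)"
        proof -
          assume le: "c * (?r / s') powr \<alpha> * levy_qU \<mu> s' \<le> 1 / t"
          have X: "0 < c * (?r / s') powr \<alpha>" using g(2) r s' by simp
          show ?thesis unfolding pos_le_divide_eq[OF X] using le by (simp only: mult.commute[of "levy_qU \<mu> s'"])
        qed
        also have "\<dots> = (s' / ?r) powr \<alpha> / c * (1 / t)" using r s' g(2) by (simp add: powr_divide)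
        also have "\<dots> \<le> (M powr \<alpha> * (1 / ?r) powr (\<alpha> / 2)) / c * (1 / t)"
        proof -
          have "s' / ?r \<le> M * (1 / s)"
          proof -
            have "s \<le> M * s" using s by (simp add: M_def)
            moreover have "rmin \<le> M * s"
            proof -
              have "rmin = sqrt rmin * sqrt rmin" using rmin_pos by simp
              also have "\<dots> \<le> M * s" using r rmin_pos by (intro mult_mono) (auto simp: M_def s_def)
              finally show ?thesis .
            qed
            ultimately have "s' \<le> M * s" by (simp add: s'_def)
            then show ?thesis using s by (simp add: field_simps flip: s(2))
          qed
          then have "(s' / ?r) powr \<alpha> \<le> (M * (1 / s)) powr \<alpha>" using g(1) s' r by (intro powr_mono2) auto
          also have "\<dots> = M powr \<alpha> * (1 / s) powr \<alpha>" using s by (subst powr_mult) (auto simp: M_def)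
          also have "(1 / s) powr \<alpha> = (1 / s * (1 / s)) powr (\<alpha> / 2)" using s by (subst powr_mult) (auto simp: powr_add[symmetric])
          also have "1 / s * (1 / s) = 1 / ?r" using s by simp
          finally show ?thesis using g(2) t by (intro mult_right_mono divide_right_mono) auto
        qed
        also have "\<dots> = M powr \<alpha> / c * ((1 / ?r) powr (\<alpha> / 2) * (1 / t))" by simp
        also have "\<dots> \<le> C1 * ((1 / ?r) powr (\<alpha> / 2) * (1 / t))"
          using t by (intro mult_right_mono) (auto simp: C1_def)
        finally show ?thesis using qs by simp
      next
        case False
        then have rs: "?r < s" using r by (auto simp: s'_def)
        have "?r < 1"
        proof (rule ccontr)
          assume "\<not> ?r < 1"
          then have "s \<ge> 1" by (simp add: s_def)
          then have "s * 1 \<le> s * s" by (intro mult_left_mono) auto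
          then show False using rs s by simp
        qed
        then have s1: "s \<le> 1" using r by (simp add: s_def)
        have "levy_qU \<mu> s \<le> levy_qU \<mu> 1" using s1 s(1) by (intro qU_mono_abs) auto
        also have "\<dots> \<le> C1 * (1 * 1)" by (simp add: C1_def)
        also have "\<dots> \<le> C1 * ((1 / ?r) powr (\<alpha> / 2) * (1 / t))"
          using C1 g(1) \<open>?r < 1\<close> r t by (intro mult_left_mono mult_mono ge_one_powr_ge_zero) auto
        finally show ?thesis by simp
      qed
    qed
    have dec: "(1 / ?r) powr (a / 2) * (1 / t) \<le> (1 / rmin) powr (a / 2) * t powr (\<delta> - 1)" if a: "0 < a" "\<delta> \<le> a / 4" for a
    proof -
      have "(1 / ?r) powr (a / 2) \<le> (sqrt t * (1 / rmin)) powr (a / 2)"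
        using inverse_rho_le[OF t] r a by (intro powr_mono2) auto
      also have "\<dots> = t powr (a / 4) * (1 / rmin) powr (a / 2)"
        using t rmin_pos by (subst powr_mult) (auto simp: powr_half_sqrt[symmetric] powr_powr)
      also have "\<dots> \<le> t powr \<delta> * (1 / rmin) powr (a / 2)" using a t by (intro mult_right_mono powr_mono') auto
      finally have "(1 / ?r) powr (a / 2) * (1 / t) \<le> t powr \<delta> * (1 / rmin) powr (a / 2) * (1 / t)"
        using t by (intro mult_right_mono) auto
      also have "\<dots> = (1 / rmin) powr (a / 2) * t powr (\<delta> - 1)" using t by (simp add: powr_diff)
      finally show ?thesis .
    qed
    have "C1 * (1 / ?r) powr (\<alpha> / 2) * (1 / t) \<le> C1 * ((1 / rmin) powr (\<alpha> / 2) * t powr (\<delta> - 1))"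
      unfolding mult.assoc using dec[OF g(1) \<delta>(4)] C1 by (intro mult_left_mono) auto
    then show ?thesis using 1 2 dec[OF e \<delta>(3)] by (simp add: C_def distrib_right)
  qed
  moreover have "C > 0" unfolding C_def using C1 rmin_pos by (intro add_pos_nonneg) auto
  ultimately show ?thesis using \<delta>(1,2) by blast
qed

lemma measurable_second_diff [measurable]:
  "(\<lambda>p. second_diff (fst p) (fst (snd p)) (snd (snd p))) \<in> borel_measurable (borel \<Otimes>\<^sub>M borel \<Otimes>\<^sub>M borel)"
proof -
  have c: "(\<lambda>w. levy_density \<mu> (a w) (b w)) \<in> borel_measurable M" if "a \<in> borel_measurable M" "b \<in> borel_measurable M" for a b and M :: "'x measure"
    using measurable_compose[OF measurable_Pair[OF that] measurable_levy_density2] by simp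
  show ?thesis unfolding second_diff_def
    by (intro borel_measurable_diff borel_measurable_add borel_measurable_times c) measurable
qed

lemma measurable_second_diff_compose:
  assumes [measurable]: "a \<in> borel_measurable M" "b \<in> borel_measurable M" "d \<in> borel_measurable M"
  shows "(\<lambda>w. second_diff (a w) (b w) (d w)) \<in> borel_measurable M"
  using measurable_compose[OF measurable_Pair[OF assms(1) measurable_Pair[OF assms(2,3)]] measurable_second_diff] by simp

lemma integrable_second_diff_rate:
  assumes t: "0 < t" "t \<le> 1" and m: "jump_rate e c m"
  shows "integrable \<mu> (\<lambda>u. second_diff t u z * m x u)"
proof -
  from levy_density_second_difference_sup obtain C where C: "C > 0" and
    C': "\<forall>t. 0 < t \<longrightarrow> t \<le> 1 \<longrightarrow> (\<forall>x u. \<bar>levy_density \<mu> t (x + u) + levy_density \<mu> t (x - u) - 2 * levy_density \<mu> t x\<bar>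
       \<le> C * levy_rho \<mu> t * min ((levy_rho \<mu> t * u)\<^sup>2) 1)" by (elim exE conjE)
  note J = jump_rateD[OF m]
  show ?thesis
  proof (rule integrable_dominated)
    show "integrable \<mu> (\<lambda>u. (C * levy_rho \<mu> t * c) * (min ((levy_rho \<mu> t * u)\<^sup>2) 1 * min 1 (\<bar>u\<bar> powr e)))"
      by (intro integrable_mult_right integrable_jump_moment)
    have [measurable]: "(\<lambda>u. m x u) \<in> borel_measurable borel"
      using measurable_compose[OF measurable_Pair1'[of x borel borel] J(1)] by simp
    have [measurable]: "(\<lambda>u. second_diff t u z) \<in> borel_measurable borel" by (rule measurable_second_diff_compose) auto
    show "(\<lambda>u. second_diff t u z * m x u) \<in> borel_measurable \<mu>" by measurable
    fix u
    have "\<bar>second_diff t u z\<bar> * \<bar>m x u\<bar> \<le> (C * levy_rho \<mu> t * min ((levy_rho \<mu> t * u)\<^sup>2) 1) * (c * min 1 (\<bar>u\<bar> powr e))"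
      using C' t J(3,4)[of x u] C rho_greatest(1)[OF t(1)] by (intro mult_mono) (auto simp: second_diff_def)
    then show "\<bar>second_diff t u z * m x u\<bar> \<le> (C * levy_rho \<mu> t * c) * (min ((levy_rho \<mu> t * u)\<^sup>2) 1 * min 1 (\<bar>u\<bar> powr e))"
      by (simp add: abs_mult ac_simps)
  qed
qed

lemma Phi_add:
  assumes t: "0 < t" "t \<le> 1" and m: "jump_rate e c m" and n: "jump_rate e' c' n"
  shows "Phi \<mu> (\<lambda>x u. m x u + n x u) t x y = Phi \<mu> m t x y + Phi \<mu> n t x y"
  unfolding Phi_eq distrib_left
  by (subst Bochner_Integration.integral_add[OF integrable_second_diff_rate[OF t m] integrable_second_diff_rate[OF t n]])
     (simp add: distrib_left)

lemma Phi_measurable: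
  assumes m: "jump_rate e c m" shows "measurable_kernel (Phi \<mu> m)"
proof (rule measurable_kernelI)
  interpret sigma_finite_measure \<mu> by (rule sigma_finite_mu)
  have [measurable]: "(\<lambda>p. m (fst p) (snd p)) \<in> borel_measurable (borel \<Otimes>\<^sub>M borel)" using jump_rateD(1)[OF m] by (simp add: case_prod_beta')
  have [measurable]: "(\<lambda>(p :: real \<times> real \<times> real, u). second_diff (fst p) u (snd (snd p) - fst (snd p)) * m (fst (snd p)) u)
      \<in> borel_measurable ((borel \<Otimes>\<^sub>M borel \<Otimes>\<^sub>M borel) \<Otimes>\<^sub>M borel)"
  proof -
    have 1: "(\<lambda>q :: (real \<times> real \<times> real) \<times> real. second_diff (fst (fst q)) (snd q) (snd (snd (fst q)) - fst (snd (fst q))))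
        \<in> borel_measurable ((borel \<Otimes>\<^sub>M borel \<Otimes>\<^sub>M borel) \<Otimes>\<^sub>M borel)"
      by (rule measurable_second_diff_compose) measurable
    have 2: "(\<lambda>q :: (real \<times> real \<times> real) \<times> real. m (fst (snd (fst q))) (snd q)) \<in> borel_measurable ((borel \<Otimes>\<^sub>M borel \<Otimes>\<^sub>M borel) \<Otimes>\<^sub>M borel)"
      using measurable_compose[OF measurable_Pair[of "\<lambda>q :: (real \<times> real \<times> real) \<times> real. fst (snd (fst q))" _ borel snd borel] jump_rateD(1)[OF m]]
      by (simp add: case_prod_beta')
    show ?thesis unfolding case_prod_beta' by (rule borel_measurable_times[OF 1 2])
  qed
  show "(\<lambda>p. Phi \<mu> m (fst p) (fst (snd p)) (snd (snd p))) \<in> borel_measurable (borel \<Otimes>\<^sub>M borel \<Otimes>\<^sub>M borel)"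
    unfolding Phi_eq by measurable
qed

text \<open>The bounds on the second difference of the density are integrated against the jump rate; the constant depends on neither
the rate nor its exponent.\<close>

lemma Phi_bounds:
  "\<exists>C>0. \<forall>e c m t. jump_rate e c m \<longrightarrow> 0 < t \<longrightarrow> t \<le> 1 \<longrightarrow>
     (\<forall>x y. \<bar>Phi \<mu> m t x y\<bar> \<le> C * c * jump_moment e t * levy_rho \<mu> t) \<and>
     (\<forall>x. (\<integral>\<^sup>+y. ennreal \<bar>Phi \<mu> m t x y\<bar> \<partial>lborel) \<le> ennreal (C * c * jump_moment e t)) \<and>
     (\<forall>y. (\<integral>\<^sup>+x. ennreal \<bar>Phi \<mu> m t x y\<bar> \<partial>lborel) \<le> ennreal (C * c * jump_moment e t))"
proof -
  from levy_density_second_difference_sup obtain B where B: "B > 0" and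
    B': "\<forall>t. 0 < t \<longrightarrow> t \<le> 1 \<longrightarrow> (\<forall>x u. \<bar>levy_density \<mu> t (x + u) + levy_density \<mu> t (x - u) - 2 * levy_density \<mu> t x\<bar>
       \<le> B * levy_rho \<mu> t * min ((levy_rho \<mu> t * u)\<^sup>2) 1)" by (elim exE conjE)
  from levy_density_second_difference_L1 obtain L where L: "L > 0" and
    L': "\<forall>t. 0 < t \<longrightarrow> t \<le> 1 \<longrightarrow> (\<forall>u.
    (\<integral>\<^sup>+x. ennreal \<bar>levy_density \<mu> t (x + u) + levy_density \<mu> t (x - u) - 2 * levy_density \<mu> t x\<bar> \<partial>lborel)
      \<le> ennreal (L * min ((levy_rho \<mu> t * u)\<^sup>2) 1))" by (elim exE conjE)
  define C where "C = max B L"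
  have C: "C > 0" "B \<le> C" "L \<le> C" using B by (auto simp: C_def)
  note sfm = sigma_finite_mu
  interpret sigma_finite_measure \<mu> by (rule sfm)
  interpret P: pair_sigma_finite "lborel :: real measure" \<mu> by (rule pair_sigma_finite.intro[OF sigma_finite_lborel sfm])
  have "(\<forall>x y. \<bar>Phi \<mu> m t x y\<bar> \<le> C * c * jump_moment e t * levy_rho \<mu> t) \<and>
     (\<forall>x. (\<integral>\<^sup>+y. ennreal \<bar>Phi \<mu> m t x y\<bar> \<partial>lborel) \<le> ennreal (C * c * jump_moment e t)) \<and>
     (\<forall>y. (\<integral>\<^sup>+x. ennreal \<bar>Phi \<mu> m t x y\<bar> \<partial>lborel) \<le> ennreal (C * c * jump_moment e t))"
    if m: "jump_rate e c m" and t: "0 < t" "t \<le> 1" for e c m t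
  proof -
    note J = jump_rateD[OF m]
    let ?r = "levy_rho \<mu> t"
    have r: "?r > 0" using rho_greatest t by auto
    let ?w = "\<lambda>u. min ((?r * u)\<^sup>2) 1" and ?v = "\<lambda>u. min 1 (\<bar>u\<bar> powr e)"
    have w0: "0 \<le> ?w u" "0 \<le> ?v u" for u by auto
    define H where "H z = (\<integral>\<^sup>+u. ennreal \<bar>second_diff t u z\<bar> * ennreal (c * ?v u) \<partial>\<mu>)" for z
    have [measurable]: "(\<lambda>(z, u). second_diff t u z) \<in> borel_measurable (borel \<Otimes>\<^sub>M borel)"
      unfolding case_prod_beta' by (rule measurable_second_diff_compose) measurable
    have [measurable]: "(\<lambda>q. second_diff t (snd q) (fst q)) \<in> borel_measurable (borel \<Otimes>\<^sub>M borel)"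
      by (rule measurable_second_diff_compose) measurable
    have [measurable]: "H \<in> borel_measurable borel" unfolding H_def[abs_def] by measurable
    have le: "ennreal \<bar>Phi \<mu> m t x y\<bar> \<le> H (y - x)" for x y
    proof -
      have "ennreal \<bar>Phi \<mu> m t x y\<bar> \<le> ennreal \<bar>\<integral>u. second_diff t u (y - x) * m x u \<partial>\<mu>\<bar>"
        unfolding Phi_eq by (intro ennreal_leI) (simp add: abs_mult)
      also have "\<dots> \<le> (\<integral>\<^sup>+u. ennreal \<bar>second_diff t u (y - x) * m x u\<bar> \<partial>\<mu>)" by (rule ennreal_norm_integral_le)
      also have "\<dots> \<le> H (y - x)" unfolding H_def
      proof (rule nn_integral_mono)
        fix u
        have "\<bar>second_diff t u (y - x) * m x u\<bar> \<le> \<bar>second_diff t u (y - x)\<bar> * (c * ?v u)"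
          unfolding abs_mult using J(3,4)[of x u] by (intro mult_left_mono) auto
        from ennreal_leI[OF this] show "ennreal \<bar>second_diff t u (y - x) * m x u\<bar> \<le> ennreal \<bar>second_diff t u (y - x)\<bar> * ennreal (c * ?v u)"
          using J(2) by (simp add: ennreal_mult)
      qed
      finally show ?thesis .
    qed
    have moment: "(\<integral>\<^sup>+u. ennreal (K * ?w u) * ennreal (c * ?v u) \<partial>\<mu>) = ennreal (K * c * jump_moment e t)" if K: "0 \<le> K" for K
    proof -
      have "(\<integral>\<^sup>+u. ennreal (K * ?w u) * ennreal (c * ?v u) \<partial>\<mu>) = (\<integral>\<^sup>+u. ennreal (K * c * (?w u * ?v u)) \<partial>\<mu>)"
      proof (rule nn_integral_cong)
        fix u
        have "ennreal (K * ?w u) * ennreal (c * ?v u) = ennreal (K * ?w u * (c * ?v u))"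
          using K J(2) w0 by (intro ennreal_mult[symmetric] mult_nonneg_nonneg) auto
        then show "ennreal (K * ?w u) * ennreal (c * ?v u) = ennreal (K * c * (?w u * ?v u))" by (simp only: ac_simps)
      qed
      also have "\<dots> = ennreal (\<integral>u. K * c * (?w u * ?v u) \<partial>\<mu>)"
        using K J(2) w0 by (intro nn_integral_eq_integral integrable_mult_right integrable_jump_moment AE_I2 mult_nonneg_nonneg) auto
      finally show ?thesis unfolding jump_moment_def integral_mult_right_zero .
    qed
    have Hsup: "H z \<le> ennreal (C * c * jump_moment e t * ?r)" for z
    proof -
      have "H z \<le> (\<integral>\<^sup>+u. ennreal ((C * ?r) * ?w u) * ennreal (c * ?v u) \<partial>\<mu>)" unfolding H_def
      proof (intro nn_integral_mono mult_right_mono ennreal_leI)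
        fix u
        have "\<bar>second_diff t u z\<bar> \<le> B * ?r * ?w u" using B'[rule_format, OF t, of z u] unfolding second_diff_def .
        also have "\<dots> \<le> C * ?r * ?w u" using C(2) r w0 by (intro mult_right_mono) auto
        finally show "\<bar>second_diff t u z\<bar> \<le> C * ?r * ?w u" .
      qed simp
      also have "\<dots> = ennreal ((C * ?r) * c * jump_moment e t)" using C(1) r by (intro moment) simp
      finally show ?thesis by (simp only: ac_simps)
    qed
    have HL1: "(\<integral>\<^sup>+z. H z \<partial>lborel) \<le> ennreal (C * c * jump_moment e t)"
    proof -
      have "(\<integral>\<^sup>+z. H z \<partial>lborel) = (\<integral>\<^sup>+u. \<integral>\<^sup>+z. ennreal \<bar>second_diff t u z\<bar> * ennreal (c * ?v u) \<partial>lborel \<partial>\<mu>)"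
        unfolding H_def by (rule P.Fubini'[symmetric]) measurable
      also have "\<dots> \<le> (\<integral>\<^sup>+u. ennreal (C * ?w u) * ennreal (c * ?v u) \<partial>\<mu>)"
      proof (rule nn_integral_mono)
        fix u
        have [measurable]: "(\<lambda>z. second_diff t u z) \<in> borel_measurable borel" by (rule measurable_second_diff_compose) auto
        have "(\<integral>\<^sup>+z. ennreal \<bar>second_diff t u z\<bar> * ennreal (c * ?v u) \<partial>lborel) = (\<integral>\<^sup>+z. ennreal \<bar>second_diff t u z\<bar> \<partial>lborel) * ennreal (c * ?v u)"
          by (rule nn_integral_multc) measurable
        also have "\<dots> \<le> ennreal (L * ?w u) * ennreal (c * ?v u)"
          by (rule mult_right_mono[OF L'[rule_format, OF t, of u, folded second_diff_def]]) simp
        also have "\<dots> \<le> ennreal (C * ?w u) * ennreal (c * ?v u)"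
          by (intro mult_right_mono ennreal_leI C(3) w0) simp
        finally show "(\<integral>\<^sup>+z. ennreal \<bar>second_diff t u z\<bar> * ennreal (c * ?v u) \<partial>lborel) \<le> ennreal (C * ?w u) * ennreal (c * ?v u)" .
      qed
      also have "\<dots> = ennreal (C * c * jump_moment e t)" using C(1) by (intro moment) simp
      finally show ?thesis .
    qed
    show ?thesis
    proof (intro conjI allI)
      fix x y
      have "ennreal \<bar>Phi \<mu> m t x y\<bar> \<le> ennreal (C * c * jump_moment e t * ?r)" by (rule order_trans[OF le Hsup])
      moreover have "0 \<le> C * c * jump_moment e t * ?r" using C(1) J(2) jump_moment_nonneg r by simp
      ultimately show "\<bar>Phi \<mu> m t x y\<bar> \<le> C * c * jump_moment e t * ?r" by (simp only: ennreal_le_iff)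
    next
      fix x
      have "(\<integral>\<^sup>+y. ennreal \<bar>Phi \<mu> m t x y\<bar> \<partial>lborel) \<le> (\<integral>\<^sup>+y. H (y + - x) \<partial>lborel)"
        by (intro nn_integral_mono) (use le[of x] in simp)
      also have "\<dots> = (\<integral>\<^sup>+z. H z \<partial>lborel)" by (rule nn_integral_shift) measurable
      finally show "(\<integral>\<^sup>+y. ennreal \<bar>Phi \<mu> m t x y\<bar> \<partial>lborel) \<le> ennreal (C * c * jump_moment e t)" using HL1 by (rule order_trans)
    next
      fix y
      have "(\<integral>\<^sup>+x. ennreal \<bar>Phi \<mu> m t x y\<bar> \<partial>lborel) \<le> (\<integral>\<^sup>+x. H (y - x) \<partial>lborel)"
        by (intro nn_integral_mono le)
      also have "\<dots> = (\<integral>\<^sup>+z. H z \<partial>lborel)" by (rule nn_integral_reflect) measurable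
      finally show "(\<integral>\<^sup>+x. ennreal \<bar>Phi \<mu> m t x y\<bar> \<partial>lborel) \<le> ennreal (C * c * jump_moment e t)" using HL1 by (rule order_trans)
    qed
  qed
  then show ?thesis using C(1) by blast
qed

lemma p0_semigroup:
  assumes "0 < a" "0 < b" "a + b \<le> 1"
  shows "(\<integral>z. p0 \<mu> a x z * p0 \<mu> b z y \<partial>lborel) = p0 \<mu> (a + b) x y"
proof -
  have ev: "levy_density \<mu> s (u - v) = levy_density \<mu> s (v - u)" if "0 < s" "s \<le> 1" for s u v
    using levy_density_even[OF that, of "u - v"] by simp
  have "(\<integral>z. p0 \<mu> a x z * p0 \<mu> b z y \<partial>lborel) = (\<integral>z. levy_density \<mu> a (x - z) * levy_density \<mu> b (z - y) \<partial>lborel)"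
    unfolding p0_def using assms ev[of a] ev[of b] by (intro Bochner_Integration.integral_cong) auto
  then show ?thesis
    using levy_density_semigroup[OF assms] ev[of "a + b" x y] assms by (simp add: p0_def)
qed

text \<open>The operator acts on the starting point, while the semigroup acts on the end point; Fubini exchanges the two.\<close>

lemma Phi_semigroup:
  assumes ab: "0 < a" "0 < b" "a + b \<le> 1" and m: "jump_rate e c m"
  shows "(\<integral>z. Phi \<mu> m a x z * p0 \<mu> b z y \<partial>lborel) = Phi \<mu> m (a + b) x y"
proof -
  have le: "a \<le> 1" "b \<le> 1" using ab by auto
  note J = jump_rateD[OF m]
  note [measurable] = measurable_levy_density
  have [measurable]: "(\<lambda>u. m x u) \<in> borel_measurable borel"
    using measurable_compose[OF measurable_Pair1'[of x borel borel] J(1)] by simp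
  have [measurable]: "(\<lambda>(z, u). second_diff a u (z - x)) \<in> borel_measurable (borel \<Otimes>\<^sub>M borel)"
    unfolding case_prod_beta' by (rule measurable_second_diff_compose) measurable
  have [measurable]: "(\<lambda>q. second_diff a (snd q) (fst q - x)) \<in> borel_measurable (borel \<Otimes>\<^sub>M borel)"
    by (rule measurable_second_diff_compose) measurable
  obtain B where B: "\<And>z. \<bar>levy_density \<mu> b z\<bar> \<le> B" using levy_density_sup ab(2) le(2) by metis
  have B0: "0 \<le> B" using B[of 0] by linarith
  let ?K = "\<lambda>z u. second_diff a u (z - x) * m x u * p0 \<mu> b z y"
  note sfm = sigma_finite_mu
  interpret sigma_finite_measure \<mu> by (rule sfm)
  interpret P: pair_sigma_finite "lborel :: real measure" \<mu> by (rule pair_sigma_finite.intro[OF sigma_finite_lborel sfm])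
  have K_meas: "(\<lambda>(z, u). ?K z u) \<in> borel_measurable (lborel \<Otimes>\<^sub>M \<mu>)" unfolding p0_def by measurable
  have fin: "(\<integral>\<^sup>+z. \<integral>\<^sup>+u. ennreal \<bar>?K z u\<bar> \<partial>\<mu> \<partial>lborel) < \<infinity>"
  proof -
    from levy_density_second_difference_L1 obtain L where
      L': "\<forall>t. 0 < t \<longrightarrow> t \<le> 1 \<longrightarrow> (\<forall>u.
      (\<integral>\<^sup>+x. ennreal \<bar>levy_density \<mu> t (x + u) + levy_density \<mu> t (x - u) - 2 * levy_density \<mu> t x\<bar> \<partial>lborel)
        \<le> ennreal (L * min ((levy_rho \<mu> t * u)\<^sup>2) 1))" by (elim exE conjE)
    let ?w = "\<lambda>u. min ((levy_rho \<mu> a * u)\<^sup>2) 1" and ?v = "\<lambda>u. min 1 (\<bar>u\<bar> powr e)"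
    have "(\<integral>\<^sup>+z. \<integral>\<^sup>+u. ennreal \<bar>?K z u\<bar> \<partial>\<mu> \<partial>lborel) \<le> (\<integral>\<^sup>+z. \<integral>\<^sup>+u. ennreal \<bar>second_diff a u (z - x)\<bar> * ennreal (c * ?v u * B) \<partial>\<mu> \<partial>lborel)"
    proof (intro nn_integral_mono)
      fix z u
      have "\<bar>?K z u\<bar> \<le> \<bar>second_diff a u (z - x)\<bar> * (c * ?v u) * B"
        unfolding abs_mult using J(2) J(3,4)[of x u] B[of "y - z"] B0 by (intro mult_mono) (auto simp: p0_def)
      then have "\<bar>?K z u\<bar> \<le> \<bar>second_diff a u (z - x)\<bar> * (c * ?v u * B)" by (simp only: mult.assoc)
      from ennreal_leI[OF this] show "ennreal \<bar>?K z u\<bar> \<le> ennreal \<bar>second_diff a u (z - x)\<bar> * ennreal (c * ?v u * B)"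
        by (subst (asm) ennreal_mult) (use J(2) B0 in auto)
    qed
    also have "\<dots> = (\<integral>\<^sup>+u. \<integral>\<^sup>+z. ennreal \<bar>second_diff a u (z - x)\<bar> * ennreal (c * ?v u * B) \<partial>lborel \<partial>\<mu>)"
      by (rule P.Fubini'[symmetric]) measurable
    also have "\<dots> \<le> (\<integral>\<^sup>+u. ennreal (max L 0 * ?w u) * ennreal (c * ?v u * B) \<partial>\<mu>)"
    proof (rule nn_integral_mono)
      fix u
      have [measurable]: "(\<lambda>z. second_diff a u z) \<in> borel_measurable borel" by (rule measurable_second_diff_compose) auto
      have e1: "(\<integral>\<^sup>+z. ennreal \<bar>second_diff a u (z + - x)\<bar> \<partial>lborel) = (\<integral>\<^sup>+z. ennreal \<bar>second_diff a u z\<bar> \<partial>lborel)"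
        by (rule nn_integral_shift) measurable
      have e2: "(\<integral>\<^sup>+z. ennreal \<bar>second_diff a u z\<bar> \<partial>lborel) \<le> ennreal (L * ?w u)"
        using L'[rule_format, OF ab(1) le(1), of u] unfolding second_diff_def .
      have e3: "ennreal (L * ?w u) \<le> ennreal (max L 0 * ?w u)" by (intro ennreal_leI mult_right_mono) auto
      have L1: "(\<integral>\<^sup>+z. ennreal \<bar>second_diff a u (z - x)\<bar> \<partial>lborel) \<le> ennreal (max L 0 * ?w u)"
        unfolding diff_conv_add_uminus e1 by (rule order_trans[OF e2 e3])
      have "(\<integral>\<^sup>+z. ennreal \<bar>second_diff a u (z - x)\<bar> * ennreal (c * ?v u * B) \<partial>lborel) = (\<integral>\<^sup>+z. ennreal \<bar>second_diff a u (z - x)\<bar> \<partial>lborel) * ennreal (c * ?v u * B)"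
        by (rule nn_integral_multc) measurable
      then show "(\<integral>\<^sup>+z. ennreal \<bar>second_diff a u (z - x)\<bar> * ennreal (c * ?v u * B) \<partial>lborel) \<le> ennreal (max L 0 * ?w u) * ennreal (c * ?v u * B)"
        using mult_right_mono[OF L1, of "ennreal (c * ?v u * B)"] by simp
    qed
    also have "\<dots> = (\<integral>\<^sup>+u. ennreal (max L 0 * c * B * (?w u * ?v u)) \<partial>\<mu>)"
    proof (rule nn_integral_cong)
      fix u
      have "ennreal (max L 0 * ?w u) * ennreal (c * ?v u * B) = ennreal (max L 0 * ?w u * (c * ?v u * B))"
        using J(2) B0 by (intro ennreal_mult[symmetric] mult_nonneg_nonneg) auto
      then show "ennreal (max L 0 * ?w u) * ennreal (c * ?v u * B) = ennreal (max L 0 * c * B * (?w u * ?v u))" by (simp only: ac_simps)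
    qed
    also have "\<dots> = ennreal (\<integral>u. max L 0 * c * B * (?w u * ?v u) \<partial>\<mu>)"
      using J(2) B0 by (intro nn_integral_eq_integral integrable_mult_right integrable_jump_moment AE_I2 mult_nonneg_nonneg) auto
    finally show ?thesis by (simp add: order_le_less_trans)
  qed
  have inner: "(\<integral>z. second_diff a u (z - x) * p0 \<mu> b z y \<partial>lborel) = second_diff (a + b) u (y - x)" for u
  proof -
    have i: "integrable lborel (\<lambda>z. p0 \<mu> a v z * p0 \<mu> b z y)" for v
    proof -
      have "integrable lborel (\<lambda>z. levy_density \<mu> a (z + - v))" by (rule integrable_shift[OF integrable_levy_density[OF ab(1) le(1)]])
      then have "integrable lborel (\<lambda>z. levy_density \<mu> b (y - z) * levy_density \<mu> a (z + - v))"
        by (rule integrable_bounded_mult[OF _ _ B]) measurable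
      then show ?thesis by (simp add: p0_def mult.commute)
    qed
    have "second_diff a u (z - x) * p0 \<mu> b z y = p0 \<mu> a (x - u) z * p0 \<mu> b z y + p0 \<mu> a (x + u) z * p0 \<mu> b z y - 2 * (p0 \<mu> a x z * p0 \<mu> b z y)" for z
      by (simp add: second_diff_def p0_def algebra_simps)
    then have "(\<integral>z. second_diff a u (z - x) * p0 \<mu> b z y \<partial>lborel)
       = (\<integral>z. p0 \<mu> a (x - u) z * p0 \<mu> b z y \<partial>lborel) + (\<integral>z. p0 \<mu> a (x + u) z * p0 \<mu> b z y \<partial>lborel) - 2 * (\<integral>z. p0 \<mu> a x z * p0 \<mu> b z y \<partial>lborel)"
      using i by simp
    then show ?thesis unfolding p0_semigroup[OF ab] by (simp add: second_diff_def p0_def algebra_simps)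
  qed
  have P: "(\<integral>z. Phi \<mu> m a x z * p0 \<mu> b z y \<partial>lborel) = 1 / 2 * (\<integral>z. \<integral>u. ?K z u \<partial>\<mu> \<partial>lborel)"
    unfolding Phi_eq by simp
  have K1: "(\<integral>z. \<integral>u. ?K z u \<partial>\<mu> \<partial>lborel) = (\<integral>u. \<integral>z. ?K z u \<partial>lborel \<partial>\<mu>)"
    by (rule fubini_absolute(3)[OF sigma_finite_lborel sfm K_meas fin])
  have K2: "(\<integral>u. \<integral>z. ?K z u \<partial>lborel \<partial>\<mu>) = (\<integral>u. second_diff (a + b) u (y - x) * m x u \<partial>\<mu>)"
  proof (intro Bochner_Integration.integral_cong refl)
    fix u
    have "(\<integral>z. ?K z u \<partial>lborel) = (\<integral>z. m x u * (second_diff a u (z - x) * p0 \<mu> b z y) \<partial>lborel)" by (simp add: ac_simps)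
    then show "(\<integral>z. ?K z u \<partial>lborel) = second_diff (a + b) u (y - x) * m x u" by (simp add: inner)
  qed
  show ?thesis unfolding P unfolding K1 unfolding K2 unfolding Phi_eq ..
qed

text \<open>Only the term \<open>- 2 p\<^sub>t\<close> of the second difference is negative, and a finite total rate integrates it.\<close>

lemma Phi_lower:
  assumes t: "0 < t" "t \<le> 1" and m: "jump_rate e c m" and i: "integrable \<mu> (m x)" and c: "(\<integral>u. m x u \<partial>\<mu>) \<le> C"
  shows "- (C * p0 \<mu> t x y) \<le> Phi \<mu> m t x y"
proof -
  note J = jump_rateD[OF m]
  have p: "0 \<le> levy_density \<mu> t z" for z by (rule levy_density_nonneg[OF t])
  have "(\<integral>u. - (2 * levy_density \<mu> t (y - x)) * m x u \<partial>\<mu>) \<le> (\<integral>u. second_diff t u (y - x) * m x u \<partial>\<mu>)"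
  proof (rule integral_mono)
    show "integrable \<mu> (\<lambda>u. - (2 * levy_density \<mu> t (y - x)) * m x u)" using i by (intro integrable_mult_right)
    show "integrable \<mu> (\<lambda>u. second_diff t u (y - x) * m x u)" by (rule integrable_second_diff_rate[OF t m])
    fix u
    show "- (2 * levy_density \<mu> t (y - x)) * m x u \<le> second_diff t u (y - x) * m x u"
      using p[of "y - x + u"] p[of "y - x - u"] J(3) by (intro mult_right_mono) (auto simp: second_diff_def)
  qed
  then have "- levy_density \<mu> t (y - x) * (\<integral>u. m x u \<partial>\<mu>) \<le> Phi \<mu> m t x y" unfolding Phi_eq by simp
  moreover have "levy_density \<mu> t (y - x) * (\<integral>u. m x u \<partial>\<mu>) \<le> levy_density \<mu> t (y - x) * C"
    by (rule mult_left_mono[OF c p])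
  ultimately show ?thesis by (simp add: p0_def mult.commute)
qed

lemma rate_away_integrable:
  assumes m: "jump_rate e c m" and r: "0 < r" and A: "A \<in> sets borel" "A \<subseteq> {u. r \<le> \<bar>u\<bar>}"
  shows "integrable \<mu> (\<lambda>u. m x u * indicator A u)" "(\<integral>u. m x u * indicator A u \<partial>\<mu>) \<le> c * measure \<mu> {u. r \<le> \<bar>u\<bar>}"
proof -
  note J = jump_rateD[OF m]
  let ?B = "{u. r \<le> \<bar>u\<bar>}"
  have [measurable]: "(\<lambda>u. m x u) \<in> borel_measurable borel"
    using measurable_compose[OF measurable_Pair1'[of x borel borel] J(1)] by simp
  have [measurable]: "A \<in> sets borel" by fact
  have iB: "integrable \<mu> (\<lambda>u. c * indicator ?B u)"
    using emeasure_away_finite[OF r] by (intro integrable_mult_right integrable_real_indicator) auto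
  have le: "m x u * indicator A u \<le> c * indicator ?B u" for u
  proof -
    have "c * min 1 (\<bar>u\<bar> powr e) \<le> c * 1" using J(2) by (intro mult_left_mono) auto
    then show ?thesis using J(2) J(4)[of x u] A(2) by (auto simp: indicator_def)
  qed
  show i: "integrable \<mu> (\<lambda>u. m x u * indicator A u)"
    by (rule integrable_dominated[OF iB]) (use le J(3) in \<open>auto simp: abs_mult\<close>)
  have "(\<integral>u. m x u * indicator A u \<partial>\<mu>) \<le> (\<integral>u. c * indicator ?B u \<partial>\<mu>)" by (rule integral_mono[OF i iB le])
  then show "(\<integral>u. m x u * indicator A u \<partial>\<mu>) \<le> c * measure \<mu> ?B" by simp
qed

end

section \<open>The perturbed transition density\<close>

lemma jump_rate_mono:
  assumes "jump_rate e c m" "c \<le> c'"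
  shows "jump_rate e c' m"
proof -
  have "m x u \<le> c' * min 1 (\<bar>u\<bar> powr e)" for x u
  proof -
    have "c * min 1 (\<bar>u\<bar> powr e) \<le> c' * min 1 (\<bar>u\<bar> powr e)"
      using assms(2) by (rule mult_right_mono) simp
    then show ?thesis using jump_rateD(4)[OF assms(1), of x u] by linarith
  qed
  then show ?thesis using assms unfolding jump_rate_def by simp
qed

text \<open>The factor \<open>M + 1\<close> keeps the requirement on \<open>g\<close> meaningful for \<open>M = 0\<close>.\<close>

lemma gain_condition:
  fixes D M g :: real
  assumes D: "1 \<le> D" and M: "0 \<le> M" and g: "g \<le> 1 / (8 * D * (M + 1))"
  shows "D * (4 * M * g) \<le> 1 / 2"
proof -
  have "D * (4 * M * g) \<le> D * (4 * M * (1 / (8 * D * (M + 1))))"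
    using g D M by (intro mult_left_mono) auto
  also have "\<dots> = M / (2 * (M + 1))" using D M by (simp add: divide_simps)
  also have "\<dots> \<le> 1 / 2" using M by (simp add: divide_simps)
  finally show ?thesis .
qed

text \<open>One constant \<open>N\<close> and one exponent \<open>\<delta>\<close> serve all jump rates with the same \<open>e\<close>, so that a rate, its truncations
and their differences are treated with the same weights.\<close>

locale parametrix_setting = growing_levy \<mu> + kernel_scale "levy_rho \<mu>" D \<delta>
  for \<mu> D \<delta> +
  fixes e N C0 :: real
  assumes e: "0 < e" and N: "0 \<le> N" and C0: "0 \<le> C0"
    and Phi_bounded: "\<And>c m. jump_rate e c m \<Longrightarrow> bounded_kernel (\<lambda>t. N * c * singular_weight 0 t) (Phi \<mu> m)"
    and p0_bounded: "bounded_kernel (\<lambda>t. C0) (p0 \<mu>)"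
begin

lemma p0_bounded_exp: "0 \<le> k \<Longrightarrow> bounded_kernel (\<lambda>t. C0 * exp (k * t)) (p0 \<mu>)"
  by (rule bounded_kernel_mono[OF p0_bounded bounded_kernelD(1)[OF p0_bounded]])
     (use C0 in \<open>auto simp: mult_le_cancel_left1\<close>)

lemma p0_admissible: "admissible (p0 \<mu>)"
  using bounded_imp_admissible[OF p0_bounded_exp[of 0] _ C0] by simp

lemma p0_nonneg: "0 < t \<Longrightarrow> t \<le> 1 \<Longrightarrow> 0 \<le> p0 \<mu> t x y"
  unfolding p0_def by (rule levy_density_nonneg)

lemma parametrix_resolvent: "parametrix \<mu> m = (\<lambda>t x y. p0 \<mu> t x y + star (p0 \<mu>) (resolvent (Phi \<mu> m)) t x y)"
proof -
  have "Psi \<mu> m = resolvent (Phi \<mu> m)" by (simp add: fun_eq_iff Psi_def resolvent_def)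
  then show ?thesis by (intro ext) (simp only: parametrix_def)
qed

lemma Phi_admissible: "jump_rate e c m \<Longrightarrow> admissible (Phi \<mu> m)"
  using Phi_bounded[of c m] N jump_rateD(2)[of e c m] unfolding admissible_def by (intro exI[of _ "N * c"]) auto

context
  fixes c k :: real
  assumes c: "0 \<le> c" and k: "0 < k" and small: "D * (4 * (N * c) * gain k) \<le> 1 / 2"
begin

lemma scaled_rate_nonneg: "0 \<le> N * c" using N c by simp

lemma parametrix_solution:
  assumes m: "jump_rate e c m"
  shows "\<And>t x y. 0 < t \<Longrightarrow> t \<le> 1 \<Longrightarrow> parametrix \<mu> m t x y = p0 \<mu> t x y + star (parametrix \<mu> m) (Phi \<mu> m) t x y"
    and "bounded_kernel (\<lambda>t. 2 * C0 * exp (k * t)) (parametrix \<mu> m)"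
proof -
  let ?P = "parametrix \<mu> m"
  note F = Phi_bounded[OF m]
  show eq: "\<And>t x y. 0 < t \<Longrightarrow> t \<le> 1 \<Longrightarrow> ?P t x y = p0 \<mu> t x y + star ?P (Phi \<mu> m) t x y"
    by (rule perturbation_equation[OF scaled_rate_nonneg k F small p0_admissible parametrix_resolvent])
  obtain B where B: "0 \<le> B" "bounded_kernel (\<lambda>t. B * singular_weight 0 t) (resolvent (Phi \<mu> m))"
    using resolvent_admissible[OF scaled_rate_nonneg k F small] by (rule admissibleE)
  have "weights_convolve (\<lambda>t. C0 * exp (k * t)) (\<lambda>t. B * singular_weight 0 t) (\<lambda>t. C0 * B * gain k * exp (k * t))"
    using weights_convolve_exp[OF k C0 B(1)] by (simp add: singular_weight_0)
  from bounded_kernel_add[OF p0_bounded_exp[OF less_imp_le[OF k]] bounded_star[OF p0_bounded_exp[OF less_imp_le[OF k]] B(2) this]]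
  have "bounded_kernel (\<lambda>t. (C0 + D * (C0 * B * gain k)) * exp (k * t)) ?P"
    unfolding parametrix_resolvent by (simp only: distrib_right mult.assoc)
  moreover have "0 \<le> C0 + D * (C0 * B * gain k)" using C0 B(1) D gain_nonneg[of k] by simp
  ultimately show "bounded_kernel (\<lambda>t. 2 * C0 * exp (k * t)) ?P"
    by (rule fixed_point_bounded[OF scaled_rate_nonneg k F small _ _ p0_bounded_exp[OF less_imp_le[OF k]] C0 eq])
qed

lemma parametrix_admissible: "jump_rate e c m \<Longrightarrow> admissible (parametrix \<mu> m)"
  by (rule bounded_imp_admissible[OF parametrix_solution(2) less_imp_le[OF k]]) (use C0 in auto)

lemma smaller_rate: "0 \<le> c' \<Longrightarrow> c' \<le> c \<Longrightarrow> 0 \<le> N * c' \<and> D * (4 * (N * c') * gain k) \<le> 1 / 2"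
proof -
  assume c': "0 \<le> c'" "c' \<le> c"
  have "D * (4 * (N * c') * gain k) \<le> D * (4 * (N * c) * gain k)"
    using c' N D gain_nonneg[of k] by (intro mult_left_mono mult_right_mono) auto
  then show ?thesis using small c' N by auto
qed

text \<open>The difference is \<open>P \<star> \<Phi>\<close>, in which \<open>P\<close> is bounded with a constant that does not depend on the size \<open>c'\<close> of the
rate, while \<open>\<Phi>\<close> is proportional to \<open>c'\<close>.\<close>

lemma parametrix_near_p0:
  assumes m: "jump_rate e c' m" "c' \<le> c" and t: "0 < t" "t \<le> 1"
  shows "\<bar>parametrix \<mu> m t x y - p0 \<mu> t x y\<bar> \<le> 2 * C0 * (D * (N * c') * gain k) * exp (k * t) * levy_rho \<mu> t"
proof -
  have c': "0 \<le> N * c'" "D * (4 * (N * c') * gain k) \<le> 1 / 2"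
    using smaller_rate[OF jump_rateD(2)[OF m(1)] m(2)] by auto
  note m' = jump_rate_mono[OF m]
  have "bounded_kernel (\<lambda>t. 2 * C0 * (D * (N * c') * gain k) * exp (k * t)) (star (parametrix \<mu> m) (Phi \<mu> m))"
    by (rule star_contraction[OF c'(1) k Phi_bounded[OF m(1)] c'(2) parametrix_solution(2)[OF m']]) (use C0 in simp)
  from bounded_kernelD(4)[OF this t, of x y] show ?thesis using parametrix_solution(1)[OF m' t, of x y] by simp
qed

text \<open>The difference of the solutions \<open>P\<close> and \<open>Q\<close> for the rates \<open>n + d\<close> and \<open>n\<close> solves
\<open>P - Q = P \<star> \<Phi>\<^sub>d + (P - Q) \<star> \<Phi>\<^sub>n\<close>, an equation with data proportional to \<open>c'\<close>.\<close>

lemma parametrix_continuity: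
  assumes n: "jump_rate e c n" and d: "jump_rate e c' d" "c' \<le> c" and m: "jump_rate e c (\<lambda>x u. n x u + d x u)" and t: "0 < t" "t \<le> 1"
  shows "\<bar>parametrix \<mu> (\<lambda>x u. n x u + d x u) t x y - parametrix \<mu> n t x y\<bar>
    \<le> 2 * (2 * C0 * (D * (N * c') * gain k)) * exp (k * t) * levy_rho \<mu> t"
proof -
  have c': "0 \<le> N * c'" "D * (4 * (N * c') * gain k) \<le> 1 / 2" "0 \<le> c'"
    using smaller_rate[OF jump_rateD(2)[OF d(1)] d(2)] jump_rateD(2)[OF d(1)] by auto
  let ?m = "\<lambda>x u. n x u + d x u"
  let ?P = "parametrix \<mu> ?m" and ?Q = "parametrix \<mu> n"
  have C02: "0 \<le> 2 * C0" using C0 by simp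
  have B0: "0 \<le> 2 * C0 * (D * (N * c') * gain k)" using C0 D c' N gain_nonneg[of k] by simp
  note PA = parametrix_admissible[OF m] and QA = parametrix_admissible[OF n]
  have nQ: "admissible (\<lambda>t x y. (-1) * ?Q t x y)" by (rule admissible_scale[OF QA, of _ 1]) auto
  have E: "bounded_kernel (\<lambda>t. 2 * C0 * (D * (N * c') * gain k) * exp (k * t)) (star ?P (Phi \<mu> d))"
    by (rule star_contraction[OF c'(1) k Phi_bounded[OF d(1)] c'(2) parametrix_solution(2)[OF m] C02])
  have Q': "bounded_kernel (\<lambda>t. 1 * (2 * C0 * exp (k * t))) (\<lambda>t x y. (-1) * ?Q t x y)"
    by (rule bounded_kernel_scale[OF parametrix_solution(2)[OF n]]) auto
  have "bounded_kernel (\<lambda>t. 4 * C0 * exp (k * t)) (\<lambda>t x y. ?P t x y + (-1) * ?Q t x y)"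
    using bounded_kernel_add[OF parametrix_solution(2)[OF m] Q'] by (simp add: algebra_simps)
  moreover have "0 \<le> 4 * C0" using C0 by simp
  moreover have "?P t x y + (-1) * ?Q t x y = star ?P (Phi \<mu> d) t x y + star (\<lambda>t x y. ?P t x y + (-1) * ?Q t x y) (Phi \<mu> n) t x y"
    if t: "0 < t" "t \<le> 1" for t x y
  proof -
    note nA = Phi_admissible[OF n] and dA = Phi_admissible[OF d(1)]
    have "star ?P (Phi \<mu> ?m) t x y = star ?P (\<lambda>t x y. Phi \<mu> n t x y + Phi \<mu> d t x y) t x y"
      using t by (intro star_cong Phi_add[OF _ _ n d(1)]) auto
    also have "\<dots> = star ?P (Phi \<mu> n) t x y + star ?P (Phi \<mu> d) t x y"
      by (rule star_add_right) (intro admissibleD admissible_finite PA nA dA t)+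
    finally have 1: "?P t x y = p0 \<mu> t x y + star ?P (Phi \<mu> n) t x y + star ?P (Phi \<mu> d) t x y"
      using parametrix_solution(1)[OF m t, of x y] by simp
    have 2: "star (\<lambda>t x y. ?P t x y + (-1) * ?Q t x y) (Phi \<mu> n) t x y = star ?P (Phi \<mu> n) t x y + star (\<lambda>t x y. (-1) * ?Q t x y) (Phi \<mu> n) t x y"
      by (rule star_add_left(1)) (intro admissibleD admissible_finite PA nQ nA t)+
    have 3: "star (\<lambda>t x y. (-1) * ?Q t x y) (Phi \<mu> n) t x y = (-1) * star ?Q (Phi \<mu> n) t x y"
      by (rule star_cmult_left)
    show ?thesis unfolding 2 3 using 1 parametrix_solution(1)[OF n t, of x y] by linarith
  qed
  ultimately have "bounded_kernel (\<lambda>t. 2 * (2 * C0 * (D * (N * c') * gain k)) * exp (k * t)) (\<lambda>t x y. ?P t x y + (-1) * ?Q t x y)"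
    by (rule fixed_point_bounded[OF scaled_rate_nonneg k Phi_bounded[OF n] small _ _ E B0])
  from bounded_kernelD(4)[OF this t, of x y] show ?thesis by simp
qed

text \<open>With total rates at most \<open>La\<close> and \<open>Lb\<close>, the tilted kernels \<open>\<Phi>\<^sub>a + La p\<^sup>0\<close> and
\<open>\<Phi>\<^sub>a\<^sub>+\<^sub>b + (La + Lb) p\<^sup>0\<close> are nonnegative and ordered, so their solutions are; cancelling \<open>exp (La t)\<close> gives the
second claim. The weight \<open>k2\<close> depends on \<open>La\<close> and \<open>Lb\<close>, which is harmless as it does not enter the conclusion.\<close>

lemma parametrix_comparison:
  assumes a: "jump_rate e c a" and b: "jump_rate e c b" and ab: "jump_rate e c (\<lambda>x u. a x u + b x u)"
    and A: "\<And>x. integrable \<mu> (a x)" "\<And>x. (\<integral>u. a x u \<partial>\<mu>) \<le> La" "0 < La"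
    and B: "\<And>x. integrable \<mu> (b x)" "\<And>x. (\<integral>u. b x u \<partial>\<mu>) \<le> Lb" "0 < Lb"
    and t: "0 < t" "t \<le> 1"
  shows "0 \<le> parametrix \<mu> a t x y" "parametrix \<mu> a t x y \<le> exp (Lb * t) * parametrix \<mu> (\<lambda>x u. a x u + b x u) t x y"
proof -
  let ?ab = "\<lambda>x u. a x u + b x u"
  let ?P = "parametrix \<mu> a" and ?Q = "parametrix \<mu> ?ab"
  let ?F = "\<lambda>t x y. Phi \<mu> a t x y + La * p0 \<mu> t x y" and ?G = "\<lambda>t x y. Phi \<mu> ?ab t x y + (La + Lb) * p0 \<mu> t x y"
  let ?R = "\<lambda>t x y. exp (La * t) * ?P t x y" and ?S = "\<lambda>t x y. exp ((La + Lb) * t) * ?Q t x y"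
  define N' where "N' = N * c + (La + Lb) * C0"
  have L: "0 \<le> (La + Lb) * C0" using A(3) B(3) C0 by simp
  have N': "0 \<le> N'" unfolding N'_def using scaled_rate_nonneg L by simp
  have bd: "bounded_kernel (\<lambda>t. N' * singular_weight 0 t) (\<lambda>t x y. Phi \<mu> q t x y + l * p0 \<mu> t x y)"
    if q: "jump_rate e c q" and l: "0 \<le> l" "l \<le> La + Lb" for q l
  proof -
    have p: "bounded_kernel (\<lambda>t. l * C0) (\<lambda>t x y. l * p0 \<mu> t x y)"
      by (rule bounded_kernel_scale[OF p0_bounded]) (use l in auto)
    show ?thesis
    proof (rule bounded_kernel_mono[OF bounded_kernel_add[OF Phi_bounded[OF q] p] bounded_kernelD(1)[OF bounded_kernel_add[OF Phi_bounded[OF q] p]]])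
      fix t :: real assume t: "0 < t" "t \<le> 1"
      have "l * C0 \<le> (La + Lb) * C0" using l C0 by (intro mult_right_mono) auto
      moreover have "(La + Lb) * C0 * 1 \<le> (La + Lb) * C0 * singular_weight 0 t"
        using singular_weight_ge_exp[OF t, of 0] L by (intro mult_left_mono) auto
      ultimately show "N * c * singular_weight 0 t + l * C0 \<le> N' * singular_weight 0 t"
        unfolding N'_def distrib_right[of "N * c"] by linarith
    qed (simp_all, measurable)
  qed
  obtain k2 where k2: "0 < k2" "gain k2 \<le> 1 / (8 * D * (N' + 1))"
    using gain_small[of "1 / (8 * D * (N' + 1))"] D N' by auto
  have small2: "D * (4 * N' * gain k2) \<le> 1 / 2" by (rule gain_condition[OF _ N' k2(2)]) (use D in simp)
  define A' where "A' = exp (La + Lb) * (2 * C0 * exp k)"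
  have A'0: "0 \<le> A'" using C0 by (simp add: A'_def)
  have bR: "bounded_kernel (\<lambda>t. A' * exp (k2 * t)) (\<lambda>t x y. exp (l * t) * parametrix \<mu> q t x y)"
    if q: "jump_rate e c q" and l: "0 \<le> l" "l \<le> La + Lb" for q l
  proof -
    have "\<bar>exp (l * t)\<bar> \<le> exp (La + Lb)" if "0 < t" "t \<le> 1" for t
    proof -
      have "l * t \<le> l" using l that by (simp add: mult_left_le)
      then show ?thesis using l by simp
    qed
    then have S: "bounded_kernel (\<lambda>t. exp (La + Lb) * (2 * C0 * exp (k * t))) (\<lambda>t x y. exp (l * t) * parametrix \<mu> q t x y)"
      by (intro bounded_kernel_scale[OF parametrix_solution(2)[OF q]]) measurable
    show ?thesis
    proof (rule bounded_kernel_mono[OF S bounded_kernelD(1)[OF S]])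
      fix t :: real assume t: "0 < t" "t \<le> 1"
      have "exp (k * t) \<le> exp k" using t k by (simp add: mult_left_le)
      then have 1: "exp (La + Lb) * (2 * C0 * exp (k * t)) \<le> A'" unfolding A'_def using C0 by (intro mult_left_mono) auto
      have "A' * 1 \<le> A' * exp (k2 * t)" using A'0 k2 t by (intro mult_left_mono) auto
      then show "exp (La + Lb) * (2 * C0 * exp (k * t)) \<le> A' * exp (k2 * t)" using 1 by linarith
    qed (simp_all, measurable)
  qed
  have tilt: "exp (l * t) * parametrix \<mu> q t x y = p0 \<mu> t x y + star (\<lambda>t x y. exp (l * t) * parametrix \<mu> q t x y) (\<lambda>t x y. Phi \<mu> q t x y + l * p0 \<mu> t x y) t x y"
    if q: "jump_rate e c q" and l: "0 < l" and t: "0 < t" "t \<le> 1" for q l t x y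
    by (rule exponential_tilting[OF p0_admissible Phi_admissible[OF q] parametrix_admissible[OF q] p0_semigroup Phi_semigroup[OF _ _ _ q] parametrix_solution(1)[OF q] l t])
  have Fpos: "0 \<le> ?F t x y" if "0 < t" "t \<le> 1" for t x y
    using Phi_lower[OF that a A(1,2), of x y] by simp
  have FG: "?F t x y \<le> ?G t x y" if "0 < t" "t \<le> 1" for t x y
    using Phi_lower[OF that b B(1,2), of x y] Phi_add[OF that a b, of x y] by (simp add: distrib_right)
  have l: "0 \<le> La" "La \<le> La + Lb" "0 \<le> La + Lb" "0 < La + Lb" using A(3) B(3) by auto
  note cmp = comparison[OF k2(1) N' small2 N' small2 bd[OF a l(1,2)] bd[OF ab l(3) order_refl] p0_admissible p0_nonneg Fpos FG
      bR[OF a l(1,2)] A'0 tilt[OF a A(3)] bR[OF ab l(3) order_refl] A'0 tilt[OF ab l(4)] t, of x y]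
  show "0 \<le> ?P t x y" using cmp(1) by (simp add: zero_le_mult_iff)
  have "exp (La * t) * ?P t x y \<le> exp (La * t) * (exp (Lb * t) * ?Q t x y)"
    using cmp(2) by (simp add: distrib_right exp_add mult.assoc)
  then show "?P t x y \<le> exp (Lb * t) * ?Q t x y" by simp
qed

text \<open>The jumps longer than \<open>1 / n\<close> are split at \<open>s\<close> into \<open>a\<close> and \<open>b\<close>. The solution for \<open>a\<close> is close to \<open>p\<^sup>0\<close> uniformly in
\<open>n\<close>, although the total rate of \<open>a\<close> may diverge; adding \<open>b\<close> costs the exponential of its total rate; and the part left
out, \<open>d\<close>, disappears as \<open>n\<close> tends to infinity.\<close>

lemma parametrix_lower:
  assumes m: "jump_rate (2 * e) c m" and s: "0 < s" "s \<le> 1" and t: "0 < t" "t \<le> 1"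
  shows "0 \<le> parametrix \<mu> m t x y"
    and "exp (- (c * measure \<mu> {u. s \<le> \<bar>u\<bar>} + 1)) *
       (p0 \<mu> t x y - 2 * C0 * (D * (N * (c * s powr e)) * gain k) * exp (k * t) * levy_rho \<mu> t) \<le> parametrix \<mu> m t x y"
proof -
  have e2: "0 < 2 * e" using e by simp
  have me: "jump_rate e c m" using jump_rate_halve[OF m e2] by simp
  let ?r = "\<lambda>n. 1 / real (Suc n)"
  let ?A = "\<lambda>n. {u. ?r n < \<bar>u\<bar> \<and> \<bar>u\<bar> \<le> s}" and ?B = "{u::real. s < \<bar>u\<bar>}" and ?Z = "\<lambda>n. {u. \<bar>u\<bar> \<le> ?r n \<and> \<bar>u\<bar> \<le> s}"
  let ?a = "\<lambda>n x u. m x u * indicator (?A n) u" and ?b = "\<lambda>x u. m x u * indicator ?B u" and ?d = "\<lambda>n x u. m x u * indicator (?Z n) u"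
  let ?M = "\<lambda>n x u. ?a n x u + ?b x u"
  \<comment> \<open>Adding \<open>1\<close> makes the tilting parameter positive even if no jump is longer than \<open>s\<close>.\<close>
  let ?L = "c * measure \<mu> {u. s \<le> \<bar>u\<bar>} + 1"
  let ?low = "p0 \<mu> t x y - 2 * C0 * (D * (N * (c * s powr e)) * gain k) * exp (k * t) * levy_rho \<mu> t"
  have sets: "?A n \<in> sets borel" "?B \<in> sets borel" "?Z n \<in> sets borel" for n by measurable
  have rate_a: "jump_rate e c (?a n)" and rate_b: "jump_rate e c ?b" for n
    by (rule jump_rate_restrict[OF me sets(1)] jump_rate_restrict[OF me sets(2)])+
  have M_eq: "?M n = (\<lambda>x u. m x u * indicator (?A n \<union> ?B) u)" for n
    by (auto simp: fun_eq_iff indicator_def)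
  have rate_M: "jump_rate e c (?M n)" for n unfolding M_eq by (rule jump_rate_restrict[OF me]) (use sets in auto)
  have m_eq: "(\<lambda>x u. ?M n x u + ?d n x u) = m" for n by (auto simp: fun_eq_iff indicator_def)
  have a_small: "jump_rate e (c * s powr e) (?a n)" for n
    using jump_rate_small[OF m e2 s sets(1), of n] by auto
  have d_small: "jump_rate e (c * ?r n powr e) (?d n)" for n
    using jump_rate_small[OF m e2 _ _ sets(3), of "?r n" n] by auto
  have le_c: "c * r powr e \<le> c" if "0 < r" "r \<le> 1" for r
    using that c e by (simp add: mult_left_le powr_le1)
  have La: "integrable \<mu> (?a n x)" "(\<integral>u. ?a n x u \<partial>\<mu>) \<le> c * measure \<mu> {u. ?r n \<le> \<bar>u\<bar>} + 1" for n x
  proof -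
    have "0 < ?r n" "?A n \<subseteq> {u. ?r n \<le> \<bar>u\<bar>}" by auto
    note i = rate_away_integrable[OF me this(1) sets(1) this(2), of x]
    show "integrable \<mu> (?a n x)" by (rule i(1))
    show "(\<integral>u. ?a n x u \<partial>\<mu>) \<le> c * measure \<mu> {u. ?r n \<le> \<bar>u\<bar>} + 1" using i(2) by linarith
  qed
  have Lb: "integrable \<mu> (?b x)" "(\<integral>u. ?b x u \<partial>\<mu>) \<le> ?L" for x
  proof -
    have "?B \<subseteq> {u. s \<le> \<bar>u\<bar>}" by auto
    note i = rate_away_integrable[OF me s(1) sets(2) this, of x]
    show "integrable \<mu> (?b x)" by (rule i(1))
    show "(\<integral>u. ?b x u \<partial>\<mu>) \<le> ?L" using i(2) by linarith
  qed
  have pos: "0 < c * measure \<mu> S + 1" for S using c by (simp add: add_nonneg_pos)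
  note cmp = parametrix_comparison[OF rate_a rate_b rate_M La pos Lb pos t]
  have pa: "0 \<le> parametrix \<mu> (?a n) t x y" for n by (rule cmp(1))
  have Mpos: "exp (- ?L) * parametrix \<mu> (?a n) t x y \<le> parametrix \<mu> (?M n) t x y" for n
  proof -
    have "parametrix \<mu> (?a n) t x y \<le> exp (?L * t) * parametrix \<mu> (?M n) t x y" by (rule cmp(2))
    moreover have "0 \<le> parametrix \<mu> (?M n) t x y"
    proof -
      have "0 \<le> exp (?L * t) * parametrix \<mu> (?M n) t x y" using pa[of n] cmp(2) by (rule order_trans)
      then show ?thesis by (simp add: zero_le_mult_iff)
    qed
    moreover have "exp (?L * t) \<le> exp ?L"
      using t pos[of "{u. s \<le> \<bar>u\<bar>}"] by (simp add: mult_left_le less_imp_le)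
    ultimately have "parametrix \<mu> (?a n) t x y \<le> exp ?L * parametrix \<mu> (?M n) t x y"
      by (meson mult_right_mono order_trans)
    then have "exp (- ?L) * parametrix \<mu> (?a n) t x y \<le> exp (- ?L) * (exp ?L * parametrix \<mu> (?M n) t x y)"
      by (rule mult_left_mono) simp
    then show ?thesis by (simp add: mult.assoc[symmetric] mult_exp_exp)
  qed
  have near: "?low \<le> parametrix \<mu> (?a n) t x y" for n
    using parametrix_near_p0[OF a_small le_c[OF s] t, of n x y] by linarith
  have lim: "(\<lambda>n. parametrix \<mu> (?M n) t x y) \<longlonglongrightarrow> parametrix \<mu> m t x y"
  proof -
    let ?K = "\<lambda>n. 2 * (2 * C0 * (D * (N * (c * ?r n powr e)) * gain k)) * exp (k * t) * levy_rho \<mu> t"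
    have "(\<lambda>n. ?r n powr e) \<longlonglongrightarrow> 0"
      using LIMSEQ_inverse_real_of_nat e
      by (intro tendsto_zero_powrI[where b = e]) (auto simp: inverse_eq_divide)
    then have "?K \<longlonglongrightarrow> 2 * (2 * C0 * (D * (N * (c * 0)) * gain k)) * exp (k * t) * levy_rho \<mu> t"
      by (intro tendsto_intros)
    then have K0: "?K \<longlonglongrightarrow> 0" by simp
    have "\<bar>parametrix \<mu> m t x y - parametrix \<mu> (?M n) t x y\<bar> \<le> ?K n" for n
      using parametrix_continuity[OF rate_M d_small le_c _ t, of n n x y] me unfolding m_eq by simp
    then have "(\<lambda>n. parametrix \<mu> m t x y - parametrix \<mu> (?M n) t x y) \<longlonglongrightarrow> 0"
      by (intro Lim_null_comparison[OF _ K0] always_eventually allI) simp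
    from tendsto_diff[OF tendsto_const[of "parametrix \<mu> m t x y"] this] show ?thesis by simp
  qed
  show "0 \<le> parametrix \<mu> m t x y"
  proof (rule LIMSEQ_le_const[OF lim], intro exI allI impI)
    fix n
    have "0 \<le> exp (- ?L) * parametrix \<mu> (?a n) t x y" using pa[of n] by simp
    then show "0 \<le> parametrix \<mu> (?M n) t x y" using Mpos[of n] by linarith
  qed
  show "exp (- ?L) * ?low \<le> parametrix \<mu> m t x y"
  proof (rule LIMSEQ_le_const[OF lim], intro exI allI impI)
    fix n
    have "exp (- ?L) * ?low \<le> exp (- ?L) * parametrix \<mu> (?a n) t x y" by (intro mult_left_mono near) simp
    then show "exp (- ?L) * ?low \<le> parametrix \<mu> (?M n) t x y" using Mpos[of n] by linarith
  qed
qed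

end

end

theorem proposition2p6:
  fixes \<mu> :: "real measure" and m :: "real \<Rightarrow> real \<Rightarrow> real"
  assumes levy: "symmetric_levy_measure \<mu>"
    and m_meas: "(\<lambda>(x, u). m x u) \<in> borel_measurable (borel :: (real \<times> real) measure)"
    and A1: "\<exists>\<beta>>1. \<forall>\<^sub>F \<xi> in at_infinity. levy_qU \<mu> \<xi> \<le> \<beta> * levy_qL \<mu> \<xi>"
    and A2: "\<And>x u. m x u \<ge> 0" "\<And>x u. m x (- u) = m x u"
    and A3: "\<exists>c>0. \<exists>\<epsilon>>0. (\<forall>x u. m x u \<le> c * min 1 (\<bar>u\<bar> powr \<epsilon>)) \<and>
               (\<integral>\<^sup>+u. ennreal (min (\<bar>u\<bar> powr \<epsilon>) 1) \<partial>\<mu>) = \<infinity>"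
  shows "(\<exists>c\<^sub>1>0. \<exists>c\<^sub>2>0. \<forall>t\<in>{0<..1}. \<forall>x.
            c\<^sub>1 * levy_rho \<mu> t \<le> parametrix \<mu> m t x x \<and>
            parametrix \<mu> m t x x \<le> c\<^sub>2 * levy_rho \<mu> t) \<and>
         (\<exists>d\<^sub>3>0. \<exists>d\<^sub>4>0. \<forall>t\<in>{0<..1}. \<forall>x y.
            parametrix \<mu> m t x y \<ge> levy_rho \<mu> t * f_low d\<^sub>3 d\<^sub>4 ((x - y) * levy_rho \<mu> t))"
proof -
  obtain c \<epsilon> where ce: "0 < c" "0 < \<epsilon>" "\<And>x u. m x u \<le> c * min 1 (\<bar>u\<bar> powr \<epsilon>)"
    "(\<integral>\<^sup>+u. ennreal (min (\<bar>u\<bar> powr \<epsilon>) 1) \<partial>\<mu>) = \<infinity>" using A3 by blast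
  \<comment> \<open>The other half of \<open>\<epsilon>\<close> is reserved for the smallness of the rate on short jumps.\<close>
  define e where "e = \<epsilon> / 2"
  have e: "0 < e" "\<epsilon> = 2 * e" using ce(2) by (auto simp: e_def)
  interpret symmetric_levy \<mu> by standard (rule levy)
  have "(\<integral>\<^sup>+u. ennreal (min (\<bar>u\<bar> powr \<epsilon>) 1) \<partial>\<mu>) \<le> (\<integral>\<^sup>+u. 1 \<partial>\<mu>)"
    by (intro nn_integral_mono) auto
  then have inf: "emeasure \<mu> UNIV = \<infinity>" using ce(4) by (simp add: top_unique)
  interpret growing_levy \<mu> by standard (fact A1 inf)+
  have m: "jump_rate (2 * e) c m"
    unfolding jump_rate_def using m_meas A2(1) ce(1,3) by (simp add: borel_prod e(2))
  obtain D where D: "1 \<le> D" "\<And>t. 0 < t \<Longrightarrow> t \<le> 1 \<Longrightarrow> levy_rho \<mu> (t / 2) \<le> D * levy_rho \<mu> t"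
    using rho_half by blast
  obtain \<delta> C where dC: "0 < \<delta>" "\<delta> \<le> 1" "0 < C" "\<And>t. 0 < t \<Longrightarrow> t \<le> 1 \<Longrightarrow> jump_moment e t \<le> C * t powr (\<delta> - 1)"
    using jump_moment_bound[OF e(1)] by blast
  interpret kernel_scale "levy_rho \<mu>" D \<delta>
    by standard (use D dC rho_greatest(1) rho_antimono in auto)
  from Phi_bounds obtain B where B: "0 < B" and B': "\<forall>e c m t. jump_rate e c m \<longrightarrow> 0 < t \<longrightarrow> t \<le> 1 \<longrightarrow>
     (\<forall>x y. \<bar>Phi \<mu> m t x y\<bar> \<le> B * c * jump_moment e t * levy_rho \<mu> t) \<and>
     (\<forall>x. (\<integral>\<^sup>+y. ennreal \<bar>Phi \<mu> m t x y\<bar> \<partial>lborel) \<le> ennreal (B * c * jump_moment e t)) \<and>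
     (\<forall>y. (\<integral>\<^sup>+x. ennreal \<bar>Phi \<mu> m t x y\<bar> \<partial>lborel) \<le> ennreal (B * c * jump_moment e t))"
    by (elim exE conjE)
  have Phi_b: "bounded_kernel (\<lambda>t. B * C * c * singular_weight 0 t) (Phi \<mu> m)" if "jump_rate e c m" for c m
    unfolding bounded_kernel_def
  proof (intro conjI allI impI)
    show "measurable_kernel (Phi \<mu> m)" by (rule Phi_measurable[OF that])
    show "(\<lambda>t. B * C * c * singular_weight 0 t) \<in> borel_measurable borel" by measurable
    fix t :: real assume t: "0 < t" "t \<le> 1"
    note c0 = jump_rateD(2)[OF that]
    show "0 \<le> B * C * c * singular_weight 0 t" using B dC(3) c0 singular_weight_nonneg by simp
    have J: "B * c * jump_moment e t \<le> B * C * c * singular_weight 0 t"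
    proof -
      have "B * c * jump_moment e t \<le> B * c * (C * singular_weight 0 t)"
        using dC(4)[OF t] B c0 by (intro mult_left_mono) (auto simp: singular_weight_0)
      then show ?thesis by (simp only: ac_simps)
    qed
    have P: "(\<forall>x y. \<bar>Phi \<mu> m t x y\<bar> \<le> B * c * jump_moment e t * levy_rho \<mu> t) \<and>
     (\<forall>x. (\<integral>\<^sup>+y. ennreal \<bar>Phi \<mu> m t x y\<bar> \<partial>lborel) \<le> ennreal (B * c * jump_moment e t)) \<and>
     (\<forall>y. (\<integral>\<^sup>+x. ennreal \<bar>Phi \<mu> m t x y\<bar> \<partial>lborel) \<le> ennreal (B * c * jump_moment e t))"
      by (rule B'[rule_format, OF that t])
    show "\<bar>Phi \<mu> m t x y\<bar> \<le> B * C * c * singular_weight 0 t * levy_rho \<mu> t" for x y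
      using P mult_right_mono[OF J less_imp_le[OF rho_pos[OF t]]] by (meson order_trans)
    show "(\<integral>\<^sup>+y. ennreal \<bar>Phi \<mu> m t x y\<bar> \<partial>lborel) \<le> ennreal (B * C * c * singular_weight 0 t)" for x
      using P ennreal_leI[OF J] by (meson order_trans)
    show "(\<integral>\<^sup>+x. ennreal \<bar>Phi \<mu> m t x y\<bar> \<partial>lborel) \<le> ennreal (B * C * c * singular_weight 0 t)" for y
      using P ennreal_leI[OF J] by (meson order_trans)
  qed
  obtain S where S: "0 < S" "\<And>t x. 0 < t \<Longrightarrow> t \<le> 1 \<Longrightarrow> \<bar>levy_density \<mu> t x\<bar> \<le> S * levy_rho \<mu> t"
    using levy_density_sup by blast
  obtain L where L: "0 < L" "\<And>t. 0 < t \<Longrightarrow> t \<le> 1 \<Longrightarrow> (\<integral>\<^sup>+x. ennreal \<bar>levy_density \<mu> t x\<bar> \<partial>lborel) \<le> ennreal L"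
    using levy_density_L1 by blast
  define C0 where "C0 = max S L"
  have C0: "0 < C0" "S \<le> C0" "L \<le> C0" using S(1) by (auto simp: C0_def)
  note C0_pos = C0(1)
  have p0_b: "bounded_kernel (\<lambda>t. C0) (p0 \<mu>)"
    unfolding bounded_kernel_def
  proof (intro conjI allI impI)
    show "measurable_kernel (p0 \<mu>)"
      unfolding p0_def by (intro measurable_kernelI measurable_compose[OF measurable_Pair measurable_levy_density2, simplified]) measurable
    fix t :: real assume t: "0 < t" "t \<le> 1"
    have LM: "(\<lambda>z. ennreal \<bar>levy_density \<mu> t z\<bar>) \<in> borel_measurable borel" using measurable_levy_density by measurable
    have L1: "(\<integral>\<^sup>+z. ennreal \<bar>levy_density \<mu> t z\<bar> \<partial>lborel) \<le> ennreal C0"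
      using L(2)[OF t] ennreal_leI[OF C0(3)] by (rule order_trans)
    show "\<bar>p0 \<mu> t x y\<bar> \<le> C0 * levy_rho \<mu> t" for x y
      unfolding p0_def using S(2)[OF t, of "y - x"] mult_right_mono[OF C0(2) less_imp_le[OF rho_pos[OF t]]] by linarith
    show "(\<integral>\<^sup>+y. ennreal \<bar>p0 \<mu> t x y\<bar> \<partial>lborel) \<le> ennreal C0" for x
      unfolding p0_def using nn_integral_shift[OF LM, of "- x"] L1 by simp
    show "(\<integral>\<^sup>+x. ennreal \<bar>p0 \<mu> t x y\<bar> \<partial>lborel) \<le> ennreal C0" for y
      unfolding p0_def using nn_integral_reflect[OF LM, of y] L1 by simp
  qed (use C0 in auto)
  interpret parametrix_setting \<mu> D \<delta> e "B * C" C0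
    by unfold_locales (use e B dC(3) C0 Phi_b p0_b in auto)
  let ?N = "B * C"
  obtain k where k: "0 < k" "gain k \<le> 1 / (8 * D * (?N * c + 1))"
    using gain_small[of "1 / (8 * D * (?N * c + 1))"] D(1) N ce(1) by (auto simp: add_nonneg_pos)
  have small: "D * (4 * (?N * c) * gain k) \<le> 1 / 2" using D(1) N ce(1) by (intro gain_condition[OF _ _ k(2)]) auto
  have c0: "0 \<le> c" using ce(1) by simp
  have me: "jump_rate e c m" using jump_rate_halve[OF m] e(1) by simp
  have upper: "parametrix \<mu> m t x y \<le> 2 * C0 * exp k * levy_rho \<mu> t" if t: "0 < t" "t \<le> 1" for t x y
  proof -
    have "parametrix \<mu> m t x y \<le> 2 * C0 * exp (k * t) * levy_rho \<mu> t"
      using bounded_kernelD(4)[OF parametrix_solution(2)[OF c0 k(1) small me] t, of x y] by linarith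
    also have "\<dots> \<le> 2 * C0 * exp k * levy_rho \<mu> t"
      using t k(1) C0(1) rho_pos[OF t] by (intro mult_right_mono mult_left_mono) (auto simp: mult_left_le)
    finally show ?thesis .
  qed
  obtain a b where ab: "0 < a" "0 < b"
    "\<And>t x. 0 < t \<Longrightarrow> t \<le> 1 \<Longrightarrow> a * levy_rho \<mu> t - b * (levy_rho \<mu> t)\<^sup>2 * \<bar>x\<bar> \<le> levy_density \<mu> t x"
    using levy_density_lower by blast
  define K where "K = 2 * C0 * (D * (?N * c) * gain k) * exp k"
  have K0: "0 \<le> K" unfolding K_def using C0(1) D(1) N ce(1) gain_nonneg[of k] by simp
  \<comment> \<open>Jumps up to this length perturb \<open>p\<^sup>0\<close> by at most \<open>a / 2\<close> times \<open>\<rho>\<^sub>t\<close>, half of its size on the diagonal.\<close>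
  define s where "s = min 1 ((a / (2 * (K + 1))) powr (1 / e))"
  have s: "0 < s" "s \<le> 1" using ab(1) K0 by (auto simp: s_def)
  have Ks: "K * s powr e \<le> a / 2"
  proof -
    have "s powr e \<le> ((a / (2 * (K + 1))) powr (1 / e)) powr e"
      using s e(1) by (intro powr_mono2) (auto simp: s_def)
    also have "\<dots> = a / (2 * (K + 1))" using e(1) ab(1) K0 by (simp add: powr_powr)
    finally have "K * s powr e \<le> K * (a / (2 * (K + 1)))" using K0 by (intro mult_left_mono)
    also have "\<dots> \<le> a / 2" using ab(1) K0 by (simp add: field_simps)
    finally show ?thesis .
  qed
  define E where "E = exp (- (c * measure \<mu> {u. s \<le> \<bar>u\<bar>} + 1))"
  have E: "0 < E" by (simp add: E_def)
  have lower: "levy_rho \<mu> t * f_low (E * (a / 2)) (2 * b / a) ((x - y) * levy_rho \<mu> t) \<le> parametrix \<mu> m t x y"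
    if t: "0 < t" "t \<le> 1" for t x y
  proof -
    let ?r = "levy_rho \<mu> t"
    have r: "0 < ?r" by (rule rho_pos[OF t])
    note low = parametrix_lower[OF c0 k(1) small m s t, of x y]
    have "2 * C0 * (D * (?N * (c * s powr e)) * gain k) * exp (k * t) * ?r \<le> a / 2 * ?r"
    proof (rule mult_right_mono)
      have "2 * C0 * (D * (?N * (c * s powr e)) * gain k) * exp (k * t) \<le> 2 * C0 * (D * (?N * (c * s powr e)) * gain k) * exp k"
        using t k(1) C0(1) D(1) N ce(1) gain_nonneg[of k] by (intro mult_left_mono) (auto simp: mult_left_le)
      also have "\<dots> = K * s powr e" by (simp only: K_def ac_simps)
      finally show "2 * C0 * (D * (?N * (c * s powr e)) * gain k) * exp (k * t) \<le> a / 2" using Ks by linarith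
    qed (use r in simp)
    moreover have "a * ?r - b * ?r\<^sup>2 * \<bar>y - x\<bar> \<le> p0 \<mu> t x y" unfolding p0_def by (rule ab(3)[OF t])
    ultimately have "a / 2 * ?r - b * ?r\<^sup>2 * \<bar>y - x\<bar> \<le> p0 \<mu> t x y - 2 * C0 * (D * (?N * (c * s powr e)) * gain k) * exp (k * t) * ?r"
      by simp
    then have "E * (a / 2 * ?r - b * ?r\<^sup>2 * \<bar>y - x\<bar>) \<le> E * (p0 \<mu> t x y - 2 * C0 * (D * (?N * (c * s powr e)) * gain k) * exp (k * t) * ?r)"
      using E by (intro mult_left_mono) auto
    also have "\<dots> \<le> parametrix \<mu> m t x y" using low(2) unfolding E_def .
    finally have 1: "E * (a / 2 * ?r - b * ?r\<^sup>2 * \<bar>y - x\<bar>) \<le> parametrix \<mu> m t x y" .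
    have ax: "\<bar>(x - y) * ?r\<bar> = \<bar>y - x\<bar> * ?r" using r by (simp add: abs_mult abs_minus_commute)
    have 2: "E * (a / 2 * ?r - b * ?r\<^sup>2 * \<bar>y - x\<bar>) = ?r * (E * (a / 2) * (1 - 2 * b / a * \<bar>(x - y) * ?r\<bar>))"
      unfolding ax using ab(1) by (simp add: power2_eq_square field_simps)
    show ?thesis
    proof (cases "0 \<le> 1 - 2 * b / a * \<bar>(x - y) * ?r\<bar>")
      case True
      show ?thesis using 1 unfolding f_low_def 2 max_absorb1[OF True] .
    next
      case False
      then show ?thesis using low(1) by (simp only: f_low_def max_absorb2 mult_zero_right not_le less_imp_le)
    qed
  qed
  have d: "0 < E * (a / 2)" "0 < 2 * b / a" using E ab by simp_all
  show ?thesis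
  proof (intro conjI)
    have "E * (a / 2) * levy_rho \<mu> t \<le> parametrix \<mu> m t x x \<and> parametrix \<mu> m t x x \<le> 2 * C0 * exp k * levy_rho \<mu> t"
      if "t \<in> {0<..1}" for t x
    proof
      have t: "0 < t" "t \<le> 1" using that by auto
      have "f_low (E * (a / 2)) (2 * b / a) ((x - x) * levy_rho \<mu> t) = E * (a / 2)" by (simp add: f_low_def)
      then show "E * (a / 2) * levy_rho \<mu> t \<le> parametrix \<mu> m t x x"
        using lower[OF t, of x x] by (simp only: mult.commute)
      show "parametrix \<mu> m t x x \<le> 2 * C0 * exp k * levy_rho \<mu> t" by (rule upper[OF t])
    qed
    moreover have "0 < 2 * C0 * exp k" using C0_pos by simp
    ultimately show "\<exists>c\<^sub>1>0. \<exists>c\<^sub>2>0. \<forall>t\<in>{0<..1}. \<forall>x. c\<^sub>1 * levy_rho \<mu> t \<le> parametrix \<mu> m t x x \<and> parametrix \<mu> m t x x \<le> c\<^sub>2 * levy_rho \<mu> t"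
      using d(1) by blast
    show "\<exists>d\<^sub>3>0. \<exists>d\<^sub>4>0. \<forall>t\<in>{0<..1}. \<forall>x y. parametrix \<mu> m t x y \<ge> levy_rho \<mu> t * f_low d\<^sub>3 d\<^sub>4 ((x - y) * levy_rho \<mu> t)"
      using lower d by (intro exI[of _ "E * (a / 2)"] exI[of _ "2 * b / a"] conjI) auto
  qed
qed

end
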